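(* Let $|F|\in L^2_{\mathrm{loc}}(\Omega_T)$ and assume that $u\in L^2_{\mathrm{loc}}(0,T;W^{1,2}_{\mathrm{loc}}(\Omega;\mathbb{R}^N))$ is a weak solution to $u_t-\operatorname{div}\mathcal{A}(z,\nabla u)=-\operatorname{div}F$ in $\Omega_T$. Then there exist an exponent $q=q(n,L)$, $1<q<2$, and a constant $c=c(n,N,\nu,L)$ such that $$\left(\frac1{|Q|}\iint_{Q}|\nabla u|^2\,dz\right)^{\frac12}\le c\left(\frac1{|2Q|}\iint_{2Q}|\nabla u|^q\,dz\right)^{\frac1q}+c\left(\frac1{|2Q|}\iint_{2Q}|F|^2\,dz\right)^{\frac12}$$ for every parabolic cylinder $Q$ with $2Q\Subset\Omega_T$. Moreover, there exist $c=c(n,N,\nu,L)$ and $\varepsilon_0=\varepsilon_0(n,N,\nu,L)$, $0<\varepsilon_0<1$, such that for every $0<\varepsilon<\varepsilon_0$ we have $$\left(\frac1{|Q|}\iint_{Q}|\nabla u|^{2+\varepsilon}\,dz\right)^{\frac1{2+\varepsilon}}\le c\left(\frac1{|2Q|}\iint_{2Q}|\nabla u|^{2}\,dz\right)^{\frac12}+c\left(\frac1{|2Q|}\iint_{2Q}|F|^{2+\varepsilon}\,dz\right)^{\frac1{2+\varepsilon}}$$ for every parabolic cylinder $Q$ with $2Q\Subset\Omega_T$, under the assumption that $|F|\in L^{2+\varepsilon}(2Q)$.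
   Context: $\Omega\subset\mathbb{R}^n$, $n\ge1$, is a bounded open domain, $T>0$, $\Omega_T=\Omega\times(0,T)$, $N\ge1$, $0<\nu<L<\infty$. $\mathcal{A}:\Omega_T\times\mathbb{R}^{Nn}\to\mathbb{R}^{Nn}$ is a Carathéodory vector field ($\mathcal{A}(\cdot,\xi)$ measurable for every $\xi$, $\mathcal{A}(z,\cdot)$ continuous for a.e. $z$) with $\nu|\xi|^2\le\mathcal{A}(z,\xi)\cdot\xi$ and $|\mathcal{A}(z,\xi)|\le L|\xi|$ for a.e. $z\in\Omega_T$ and every $\xi\in\mathbb{R}^{Nn}$. $F:\Omega_T\to\mathbb{R}^{Nn}$ is measurable. We write $z=(x,t)$, $dz=dx\,dt$, and $\nabla$ is the gradient in $x$. $u\in L^2_{\mathrm{loc}}(0,T;W^{1,2}_{\mathrm{loc}}(\Omega;\mathbb{R}^N))$ means that for all $\Omega'\Subset\Omega$ and $0<t_1<t_2<T$ one has $u(\cdot,t)\in W^{1,2}(\Omega';\mathbb{R}^N)$ for a.e. $t\in(t_1,t_2)$ and $\int_{t_1}^{t_2}\int_{\Omega'}(|u|^2+|\nabla u|^2)\,dx\,dt<\infty$. Such a $u$ is a weak solution if $\iint_{\Omega_T}(-u\cdot\varphi_t+\mathcal{A}(z,\nabla u)\cdot\nabla\varphi)\,dz=\iint_{\Omega_T}F\cdot\nabla\varphi\,dz$ for every $\varphi\in C_0^\infty(\Omega_T;\mathbb{R}^N)$. Parabolic cylinders: $Q=Q_\rho=B_\rho(x_0)\times(t_0-\rho^2,t_0+\rho^2)$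 and $2Q=B_{2\rho}(x_0)\times(t_0-(2\rho)^2,t_0+(2\rho)^2)$. $2Q\Subset\Omega_T$ means that the closure of $2Q$ is a compact subset of $\Omega_T$. *)

theory Defs
  imports "HOL-Analysis.Analysis"
begin

text \<open>
  Space-time points are pairs \<open>z = (x, t)\<close> with \<open>x\<close> in \<open>real ^ 'n\<close>, so \<open>n = CARD('n)\<close>.
  The number \<open>N\<close> of components is an ordinary natural number, not the cardinality of an index
  type, because an exponent depending on \<open>n\<close> and \<open>L\<close> only has to be chosen before \<open>N\<close>.
  As in \<open>Euclidean_space N\<close> of the library, an \<open>N\<close>-tuple is a sequence vanishing from index
  \<open>N\<close> on: \<open>coord_space N\<close> is \<open>\<real>\<^sup>N\<close> for entries in \<open>real\<close>, and the space of \<open>N \<times> n\<close> matrices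
  (rows \<open>\<xi> i\<close>) for entries in \<open>real ^ 'n\<close>.
\<close>

definition coord_space :: "nat \<Rightarrow> (nat \<Rightarrow> 'b::zero) set" where
  "coord_space N = {v. \<forall>i\<ge>N. v i = 0}"

definition enorm :: "nat \<Rightarrow> (nat \<Rightarrow> 'b::real_normed_vector) \<Rightarrow> real" where
  "enorm N v = L2_set (\<lambda>i. norm (v i)) {..<N}"

definition edot :: "nat \<Rightarrow> (nat \<Rightarrow> 'b::real_inner) \<Rightarrow> (nat \<Rightarrow> 'b) \<Rightarrow> real" where
  "edot N v w = (\<Sum>i<N. v i \<bullet> w i)"

definition compactly_contained :: "'a::topological_space set \<Rightarrow> 'a set \<Rightarrow> bool"
    (infix "\<Subset>" 50) where
  "U \<Subset> V \<longleftrightarrow> compact (closure U) \<and> closure U \<subseteq> V"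


subsection \<open>Lebesgue spaces and mean values\<close>

definition in_Lp ::
    "real \<Rightarrow> nat \<Rightarrow> 'a::euclidean_space set \<Rightarrow> ('a \<Rightarrow> nat \<Rightarrow> 'b::euclidean_space) \<Rightarrow> bool" where
  "in_Lp p N S f \<longleftrightarrow> f \<in> S \<rightarrow> coord_space N \<and> f \<in> borel_measurable (lebesgue_on S) \<and>
     set_integrable lebesgue S (\<lambda>x. enorm N (f x) powr p)"

definition in_Lp_loc ::
    "real \<Rightarrow> nat \<Rightarrow> 'a::euclidean_space set \<Rightarrow> ('a \<Rightarrow> nat \<Rightarrow> 'b::euclidean_space) \<Rightarrow> bool" where
  "in_Lp_loc p N S f \<longleftrightarrow> (\<forall>K. compact K \<and> K \<subseteq> S \<longrightarrow> in_Lp p N K f)"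

definition Lp_mean ::
    "real \<Rightarrow> nat \<Rightarrow> 'a::euclidean_space set \<Rightarrow> ('a \<Rightarrow> nat \<Rightarrow> 'b::euclidean_space) \<Rightarrow> real" where
  "Lp_mean p N S f =
     (1 / measure lebesgue S * (LINT x:S|lebesgue. enorm N (f x) powr p)) powr (1 / p)"


subsection \<open>Test functions\<close>

primrec C_k :: "nat \<Rightarrow> ('a::euclidean_space \<Rightarrow> real) \<Rightarrow> bool" where
  "C_k 0 f \<longleftrightarrow> continuous_on UNIV f"
| "C_k (Suc k) f \<longleftrightarrow> (\<forall>x. f differentiable (at x)) \<and>
     (\<forall>b\<in>Basis. C_k k (\<lambda>x. frechet_derivative f (at x) b))"

text \<open>Elements of \<open>C_0^\<infinity>(U)\<close> are extended by zero to the whole space.\<close>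

definition test_function :: "'a::euclidean_space set \<Rightarrow> ('a \<Rightarrow> real) \<Rightarrow> bool" where
  "test_function U \<phi> \<longleftrightarrow> (\<forall>k. C_k k \<phi>) \<and> {x. \<phi> x \<noteq> 0} \<Subset> U"

definition grad :: "(real ^ 'n \<Rightarrow> real) \<Rightarrow> real ^ 'n \<Rightarrow> real ^ 'n" where
  "grad \<phi> x = (\<chi> j. frechet_derivative \<phi> (at x) (axis j 1))"

definition spatial_grad ::
    "((real ^ 'n) \<times> real \<Rightarrow> nat \<Rightarrow> real) \<Rightarrow> (real ^ 'n) \<times> real \<Rightarrow> nat \<Rightarrow> real ^ 'n" where
  "spatial_grad \<phi> z i = grad (\<lambda>y. \<phi> (y, snd z) i) (fst z)"

definition time_deriv ::
    "((real ^ 'n) \<times> real \<Rightarrow> nat \<Rightarrow> real) \<Rightarrow> (real ^ 'n) \<times> real \<Rightarrow> nat \<Rightarrow> real" where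
  "time_deriv \<phi> z i = deriv (\<lambda>s. \<phi> (fst z, s) i) (snd z)"


subsection \<open>Sobolev functions\<close>

text \<open>
  \<open>W12 N U v G\<close> means \<open>v \<in> W\<^sup>1\<^sup>,\<^sup>2(U; \<real>\<^sup>N)\<close> with weak gradient \<open>G\<close>.  Weak gradients are only
  determined almost everywhere, so they enter as a relation.
\<close>

definition W12 ::
    "nat \<Rightarrow> (real ^ 'n) set \<Rightarrow> (real ^ 'n \<Rightarrow> nat \<Rightarrow> real) \<Rightarrow> (real ^ 'n \<Rightarrow> nat \<Rightarrow> real ^ 'n) \<Rightarrow> bool"
  where
  "W12 N U v G \<longleftrightarrow> in_Lp 2 N U v \<and> in_Lp 2 N U G \<and>
     (\<forall>\<phi>. test_function U \<phi> \<longrightarrow> (\<forall>i<N. \<forall>j.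
        (LINT x:U|lebesgue. v x i * grad \<phi> x $ j) = - (LINT x:U|lebesgue. G x i $ j * \<phi> x)))"

text \<open>
  \<open>L2loc_W12loc N \<Omega> T u Du\<close> means \<open>u \<in> L\<^sup>2_loc(0, T; W\<^sup>1\<^sup>,\<^sup>2_loc(\<Omega>; \<real>\<^sup>N))\<close> with spatial
  gradient \<open>Du\<close>.
\<close>

definition L2loc_W12loc ::
    "nat \<Rightarrow> (real ^ 'n) set \<Rightarrow> real \<Rightarrow> ((real ^ 'n) \<times> real \<Rightarrow> nat \<Rightarrow> real) \<Rightarrow>
     ((real ^ 'n) \<times> real \<Rightarrow> nat \<Rightarrow> real ^ 'n) \<Rightarrow> bool" where
  "L2loc_W12loc N \<Omega> T u Du \<longleftrightarrow>
     (\<forall>\<Omega>' t1 t2. open \<Omega>' \<and> \<Omega>' \<Subset> \<Omega> \<and> 0 < t1 \<and> t1 < t2 \<and> t2 < T \<longrightarrow>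
        (AE t in lebesgue_on {t1<..<t2}. W12 N \<Omega>' (\<lambda>x. u (x, t)) (\<lambda>x. Du (x, t))) \<and>
        in_Lp 2 N (\<Omega>' \<times> {t1<..<t2}) u \<and> in_Lp 2 N (\<Omega>' \<times> {t1<..<t2}) Du)"


subsection \<open>Parabolic systems\<close>

definition caratheodory ::
    "nat \<Rightarrow> 'a::euclidean_space set \<Rightarrow>
     ('a \<Rightarrow> (nat \<Rightarrow> 'b::euclidean_space) \<Rightarrow> (nat \<Rightarrow> 'b)) \<Rightarrow> bool" where
  "caratheodory N S A \<longleftrightarrow>
     (\<forall>z\<in>S. A z \<in> coord_space N \<rightarrow> coord_space N) \<and>
     (\<forall>\<xi>\<in>coord_space N. (\<lambda>z. A z \<xi>) \<in> borel_measurable (lebesgue_on S)) \<and>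
     (AE z in lebesgue_on S. continuous_on (coord_space N) (A z))"

definition growth_conditions ::
    "nat \<Rightarrow> real \<Rightarrow> real \<Rightarrow> 'a::euclidean_space set \<Rightarrow>
     ('a \<Rightarrow> (nat \<Rightarrow> 'b::euclidean_space) \<Rightarrow> (nat \<Rightarrow> 'b)) \<Rightarrow> bool" where
  "growth_conditions N \<nu> L S A \<longleftrightarrow>
     (AE z in lebesgue_on S. \<forall>\<xi>\<in>coord_space N.
        \<nu> * (enorm N \<xi>)\<^sup>2 \<le> edot N (A z \<xi>) \<xi> \<and> enorm N (A z \<xi>) \<le> L * enorm N \<xi>)"

definition weak_solution ::
    "nat \<Rightarrow> (real ^ 'n) set \<Rightarrow> real \<Rightarrow>
     ((real ^ 'n) \<times> real \<Rightarrow> (nat \<Rightarrow> real ^ 'n) \<Rightarrow> (nat \<Rightarrow> real ^ 'n)) \<Rightarrow>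
     ((real ^ 'n) \<times> real \<Rightarrow> nat \<Rightarrow> real ^ 'n) \<Rightarrow>
     ((real ^ 'n) \<times> real \<Rightarrow> nat \<Rightarrow> real) \<Rightarrow> ((real ^ 'n) \<times> real \<Rightarrow> nat \<Rightarrow> real ^ 'n) \<Rightarrow> bool" where
  "weak_solution N \<Omega> T A F u Du \<longleftrightarrow>
     L2loc_W12loc N \<Omega> T u Du \<and>
     (\<forall>\<phi>. (\<forall>i<N. test_function (\<Omega> \<times> {0<..<T}) (\<lambda>z. \<phi> z i)) \<longrightarrow>
        (LINT z:\<Omega> \<times> {0<..<T}|lebesgue.
           - edot N (u z) (time_deriv \<phi> z) + edot N (A z (Du z)) (spatial_grad \<phi> z)) =
        (LINT z:\<Omega> \<times> {0<..<T}|lebesgue. edot N (F z) (spatial_grad \<phi> z)))"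

definition cylinder :: "real ^ 'n \<Rightarrow> real \<Rightarrow> real \<Rightarrow> ((real ^ 'n) \<times> real) set" where
  "cylinder x0 t0 \<rho> = ball x0 \<rho> \<times> {t0 - \<rho>\<^sup>2<..<t0 + \<rho>\<^sup>2}"

end

theory Submission
  imports Defs
begin

text \<open>
  Why the theorem holds.  Put \<open>q = 2(n+2)/(n+3)\<close>, so that \<open>1 < q < 2\<close> and \<open>2/q = (n+3)/(n+2)\<close>.
  The parabolic dimension of \<open>Q_r\<close> is \<open>n+2\<close>, and \<open>q\<close> lies above the exponent \<open>2(n+2)/(n+4)\<close> at which
  the parabolic Sobolev inequality becomes critical.  This leaves room for a proof by
  mollification and summation over dyadic scales.

  Each component of the solution satisfies \<open>u_t = div G\<close> with \<open>G = A(z,Du) - F\<close>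
  (\<open>flux_solution\<close>).  The function \<open>u\<close> has no time derivative of its own, but every convolution of \<open>u\<close>
  with a smooth kernel in space and time has one, and it solves the same equation with \<open>D\<close> and \<open>G\<close>
  convolved (\<open>mollified_flux_equations\<close>).  Two facts follow.

  The first is the energy identity.  The classical identity for the convolutions passes to the limit,
  since only products of two functions converging in \<open>L2\<close> occur (\<open>flux_energy_identity\<close>).  Applied
  to \<open>u - c\<close> with a cutoff function it gives the Caccioppoli inequality.

  The second is a Sobolev-Poincare inequality, which bounds the \<open>L2\<close> distance of \<open>u\<close> from a constant by the
  \<open>L^q\<close> norm of \<open>|D| + |G|\<close> (\<open>parabolic_sobolev_poincare\<close>).
  Let \<open>u_s\<close> be the convolution at parabolic scale \<open>s\<close>.  A space derivative of \<open>u_s\<close> is the convolution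
  of \<open>D\<close>; the time derivative is one space derivative of the kernel against \<open>G\<close>.  Hence
  \<open>u_s - u_{s/2}\<close> is bounded by \<open>s^(-n-1)\<close> times the integral of \<open>|D| + |G|\<close> over a cylinder of radius
  comparable to \<open>s\<close>, and the \<open>L2\<close> norms of these bounds, measured by the \<open>L^q\<close> norm of \<open>|D| + |G|\<close>,
  form a geometric series in \<open>s\<close>.

  The two facts together give the reverse Hoelder inequality (\<open>reverse_hoelder_system\<close>), which is
  the first assertion.  The second assertion is Gehring's lemma for parabolic cylinders
  (\<open>parabolic_gehring\<close>).  Multiplied by a power of the distance to the boundary of the doubled cylinder,
  \<open>|Du|\<close> still satisfies reverse Hoelder inequalities on small cylinders and has controlled means on large
  ones.  A stopping time argument with a Vitali covering bounds the integral of its square over high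
  superlevel sets by integrals over lower ones (\<open>level_set_estimate\<close>), and a weighted sum of these bounds
  over dyadic levels gives integrability to a power slightly above two
  (\<open>higher_integrability_from_levels\<close>).

  All of this is done for square integrable Borel functions of bounded support on the whole space.  The last
  part passes from Lebesgue measurable data and slicewise Sobolev functions to such representatives
  (\<open>structured_system_of_weak_solution\<close>).
\<close>

section \<open>Smooth compactly supported kernels\<close>

lemma frechet_derivative_eqI:
 assumes "(f has_derivative f') (at x)" shows "frechet_derivative f (at x) = f'"
 using frechet_derivative_at[OF assms] by simp

text \<open>
  The definition of \<open>C_k\<close> mentions the operator \<open>frechet_derivative\<close>.  This rule lets any exhibited
  derivative serve in its place.
\<close>

lemma C_k_SucI:
 assumes "\<And>x. (f has_derivative f' x) (at x)" "\<And>b. b \<in> Basis ==> C_k k (\<lambda>x. f' x b)"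
 shows "C_k (Suc k) f"
proof -
 have "frechet_derivative f (at x) = f' x" for x
  using frechet_derivative_eqI[OF assms(1)] .
 then show ?thesis using assms by (auto simp: differentiable_def)
qed

lemma C_k_has_derivative:
 assumes "C_k (Suc k) f"
 shows "(f has_derivative frechet_derivative f (at x)) (at x)"
 using assms frechet_derivative_works by auto

lemma C_k_Suc_D: "C_k (Suc k) f ==> C_k k f"
proof (induction k arbitrary: f)
 case 0
 then show ?case
  by (simp add: continuous_on_eq_continuous_at differentiable_imp_continuous_within)
next
 case (Suc k)
 from Suc.prems have 1: "\<forall>x. f differentiable at x"
  and 2: "\<And>b. b\<in>Basis ==> C_k (Suc k) (\<lambda>x. frechet_derivative f (at x) b)"
  by (auto simp only: C_k.simps(2))
 have "\<And>b. b\<in>Basis ==> C_k k (\<lambda>x. frechet_derivative f (at x) b)"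
  using Suc.IH[OF 2] .
 then show ?case using 1 by simp
qed

lemma C_k_const: "C_k k (\<lambda>x. c)"
proof (induction k arbitrary: c)
 case (Suc k)
 show ?case by (rule C_k_SucI[where f'="\<lambda>x h. 0"]) (use Suc in auto)
qed simp

lemma C_k_add: "C_k k f ==> C_k k g ==> C_k k (\<lambda>x. f x + g x)"
proof (induction k arbitrary: f g)
 case 0 then show ?case by (auto intro: continuous_intros)
next
 case (Suc k)
 note d = C_k_has_derivative[OF Suc.prems(1)] C_k_has_derivative[OF Suc.prems(2)]
 show ?case
  by (rule C_k_SucI[where f'="\<lambda>x h. frechet_derivative f (at x) h + frechet_derivative g (at x) h"])
    (use d Suc in \<open>auto intro!: has_derivative_add Suc.IH\<close>)
qed

lemma C_k_mult: "C_k k f ==> C_k k g ==> C_k k (\<lambda>x. f x * g x)"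
proof (induction k arbitrary: f g)
 case 0 then show ?case by (auto intro: continuous_intros)
next
 case (Suc k)
 note d = C_k_has_derivative[OF Suc.prems(1)] C_k_has_derivative[OF Suc.prems(2)]
 show ?case
  by (rule C_k_SucI[where f'="\<lambda>x h. f x * frechet_derivative g (at x) h + frechet_derivative f (at x) h * g x"])
    (use d Suc.prems in \<open>auto intro!: has_derivative_mult C_k_add Suc.IH C_k_Suc_D[OF Suc.prems(1)] C_k_Suc_D[OF Suc.prems(2)]\<close>)
qed

lemma C_k_prod: "finite I ==> (\<And>i. i \<in> I ==> C_k k (f i)) ==> C_k k (\<lambda>x. \<Prod>i\<in>I. f i x)"
 by (induction I rule: finite_induct) (auto simp: C_k_const C_k_mult)

lemma C_k_reflect: "C_k k f ==> C_k k (\<lambda>w. f (z - w))"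
proof (induction k arbitrary: f)
 case 0
 then have "continuous_on UNIV f" by simp
 from continuous_on_compose2[OF this continuous_on_diff[OF continuous_on_const continuous_on_id] subset_UNIV]
 show ?case by simp
next
 case (Suc k)
 have d: "((\<lambda>w. f (z - w)) has_derivative (\<lambda>h. -1 * frechet_derivative f (at (z - w)) h)) (at w)" for w
 proof -
  have "((\<lambda>w. f (z - w)) has_derivative (\<lambda>h. frechet_derivative f (at (z - w)) (- h))) (at w)"
   by (rule has_derivative_compose[where f="\<lambda>w. z - w" and g=f, OF _ C_k_has_derivative[OF Suc.prems]])
     (auto intro!: derivative_eq_intros)
  moreover have "linear (frechet_derivative f (at (z - w)))"
   using C_k_has_derivative[OF Suc.prems] has_derivative_linear by blast
  ultimately show ?thesis by (simp add: linear_neg)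
 qed
 show ?case
 proof (rule C_k_SucI[OF d])
  fix b :: 'a assume b: "b \<in> Basis"
  have "C_k k (\<lambda>w. frechet_derivative f (at (z - w)) b)"
   by (rule Suc.IH[of "\<lambda>x. frechet_derivative f (at x) b"]) (use Suc.prems b in auto)
  then show "C_k k (\<lambda>w. - 1 * frechet_derivative f (at (z - w)) b)"
   using C_k_mult[OF C_k_const] by blast
 qed
qed

text \<open>
  The functions \<open>p(1/t) exp(-1/t)\<close>, continued by zero, form a class closed under differentiation;
  \<open>dflat\<close> is the derivative as a map on the polynomials.  Smoothness of \<open>exp(-1/t)\<close> is thus an induction
  that treats all members at once.
\<close>

definition flat :: "real poly => real => real" where
 "flat p t = (if t > 0 then poly p (1 / t) * exp (- (1 / t)) else 0)"

definition dflat :: "real poly => real poly" where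
 "dflat p = [:0, 0, 1:] * (p - pderiv p)"

lemma poly_exp_tendsto_0: "((\<lambda>x. poly p x * exp (- x)) \<longlongrightarrow> (0::real)) at_top"
proof -
 have "((\<lambda>x. \<Sum>i\<le>degree p. coeff p i * (x ^ i / exp x)) \<longlongrightarrow> (\<Sum>i\<le>degree p. coeff p i * 0)) at_top"
  by (intro tendsto_intros tendsto_power_div_exp_0)
 then show ?thesis by (simp add: poly_altdef sum_distrib_right exp_minus divide_inverse mult.assoc)
qed

text \<open>
  The exponential decays faster than any power of \<open>1/t\<close> grows.  Applied to \<open>[:0, 1:] * p\<close> the
  same limit gives the vanishing derivative at the origin.
\<close>

lemma flat_tendsto_0: "(flat p \<longlongrightarrow> 0) (at_right 0)"
proof -
 have "((\<lambda>t. poly p (inverse t) * exp (- (inverse t))) \<longlongrightarrow> (0::real)) (at_right 0)"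
  by (rule filterlim_compose[OF poly_exp_tendsto_0 filterlim_inverse_at_top_right])
 then show ?thesis
  by (rule Lim_transform_eventually)
    (auto simp: eventually_at_right_field flat_def inverse_eq_divide intro!: exI[of _ 1])
qed

lemma flat_has_derivative: "(flat p has_field_derivative flat (dflat p) t) (at t)"
proof -
 consider "t > 0" | "t < 0" | "t = 0" by linarith
 then show ?thesis
 proof cases
  case 1
  have "((\<lambda>t. poly p (1 / t) * exp (- (1 / t))) has_field_derivative flat (dflat p) t) (at t)"
   using 1 by (auto intro!: derivative_eq_intros simp: flat_def dflat_def field_simps power2_eq_square)
  then show ?thesis
   by (rule has_field_derivative_transform_within_open[of _ _ _ "{0<..}"]) (use 1 in \<open>auto simp: flat_def\<close>)
 next
  case 2
  have "((\<lambda>t. 0) has_field_derivative flat (dflat p) t) (at t)"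
   using 2 by (auto intro!: derivative_eq_intros simp: flat_def)
  then show ?thesis
   by (rule has_field_derivative_transform_within_open[of _ _ _ "{..<0}"]) (use 2 in \<open>auto simp: flat_def\<close>)
 next
  case 3
  have "((\<lambda>y. (flat p y - flat p 0) / (y - 0)) \<longlongrightarrow> 0) (at 0)"
  proof (rule filterlim_split_at)
   show "((\<lambda>y. (flat p y - flat p 0) / (y - 0)) \<longlongrightarrow> 0) (at_left 0)"
    by (rule Lim_transform_eventually[OF tendsto_const])
      (auto simp: eventually_at_left_field flat_def intro!: exI[of _ "-1"])
   show "((\<lambda>y. (flat p y - flat p 0) / (y - 0)) \<longlongrightarrow> 0) (at_right 0)"
    by (rule Lim_transform_eventually[OF flat_tendsto_0[of "[:0,1:]*p"]])
      (auto simp: eventually_at_right_field flat_def intro!: exI[of _ 1])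
  qed
  then show ?thesis unfolding has_field_derivative_iff using 3 by (simp add: flat_def)
 qed
qed

lemma C_k_flat: "C_k k (\<lambda>z::'a::euclidean_space. flat p (c + z \<bullet> a))"
proof (induction k arbitrary: p)
 case 0
 have "continuous_on UNIV (flat p)"
  using flat_has_derivative DERIV_isCont continuous_at_imp_continuous_on by blast
 from continuous_on_compose2[OF this _ subset_UNIV, of UNIV "\<lambda>z. c + z \<bullet> a"] show ?case
  by (simp add: continuous_on_add continuous_on_const continuous_on_inner continuous_on_id)
next
 case (Suc k)
 have d: "((\<lambda>z::'a. flat p (c + z \<bullet> a)) has_derivative (\<lambda>h. flat (dflat p) (c + z \<bullet> a) * (h \<bullet> a))) (at z)" for z
  by (rule has_derivative_compose[where f="\<lambda>z. c + z \<bullet> a" and g="flat p", OF _ flat_has_derivative[of p "c + z \<bullet> a", unfolded has_field_derivative_def]])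
    (auto intro!: derivative_eq_intros)
 show ?case
  by (rule C_k_SucI[OF d]) (intro C_k_mult Suc.IH C_k_const)
qed

lemma flat_1_nonneg: "0 \<le> flat 1 t" and flat_1_le_1: "flat 1 t \<le> 1"
 and flat_1_pos_iff: "flat 1 t \<noteq> 0 \<longleftrightarrow> t > 0"
 by (auto simp: flat_def)

lemma flat_1_ge: "t \<ge> 1/2 ==> exp (-2) \<le> flat 1 t"
 by (auto simp: flat_def field_simps)

lemma dflat_1_bound: "\<bar>flat (dflat 1) t\<bar> \<le> 2"
proof (cases "t > 0")
 case True
 define s where "s = 1 / t"
 have s: "s > 0" using True by (simp add: s_def)
 have "s^2 \<le> 2 * exp s" using exp_lower_Taylor_quadratic[of s] s by auto
 then have "s^2 * exp (-s) \<le> 2" using s by (simp add: exp_minus field_simps)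
 then show ?thesis using True s by (simp add: flat_def dflat_def s_def power2_eq_square abs_mult pderiv_1 flip: mult.assoc)
qed (simp add: flat_def)

text \<open>
  A product over the coordinates of \<open>exp(-1/(1+y)) exp(-1/(1-y))\<close> with \<open>y\<close> the coordinate divided by
  the half width \<open>a v\<close>.  Independent half widths are needed because space and time scale differently.
\<close>

definition bump :: "('a::euclidean_space => real) => 'a => real" where
 "bump a z = (\<Prod>v\<in>Basis. flat 1 (1 + z \<bullet> (v /\<^sub>R a v)) * flat 1 (1 + z \<bullet> - (v /\<^sub>R a v)))"

lemma C_k_bump: "C_k k (bump a)"
 unfolding bump_def by (intro C_k_prod finite_Basis C_k_mult C_k_flat)

lemma bump_nonneg: "0 \<le> bump a z"
 unfolding bump_def by (intro prod_nonneg ballI mult_nonneg_nonneg flat_1_nonneg)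

lemma bump_factor_le: "flat 1 s * flat 1 t \<le> 1"
 using mult_mono[OF flat_1_le_1[of s] flat_1_le_1[of t]] flat_1_nonneg by auto

lemma bump_le_1: "bump a z \<le> 1"
 unfolding bump_def by (intro prod_le_1) (auto simp: flat_1_nonneg bump_factor_le)

lemma bump_support:
 assumes "bump a z \<noteq> 0" "v \<in> Basis" "a v > 0" shows "\<bar>z \<bullet> v\<bar> < a v"
proof -
 have "flat 1 (1 + z \<bullet> (v /\<^sub>R a v)) \<noteq> 0" "flat 1 (1 + z \<bullet> - (v /\<^sub>R a v)) \<noteq> 0"
  using assms by (auto simp: bump_def)
 then have "1 + z \<bullet> (v /\<^sub>R a v) > 0" "1 + z \<bullet> - (v /\<^sub>R a v) > 0"
  by (simp_all only: flat_1_pos_iff)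
 then show ?thesis using assms(3) by (auto simp: field_simps abs_less_iff)
qed

lemma bump_lower_bound:
 fixes z :: "'a::euclidean_space"
 assumes "\<And>v. v \<in> Basis ==> a v > 0" "\<And>v. v \<in> Basis ==> \<bar>z \<bullet> v\<bar> \<le> a v / 2"
 shows "exp (-4) ^ DIM('a) \<le> bump a z"
proof -
 have "(\<Prod>v\<in>(Basis::'a set). exp (-4)) \<le> bump a z"
  unfolding bump_def
 proof (intro prod_mono conjI)
  fix v :: 'a assume v: "v \<in> Basis"
  have 1: "1 + z \<bullet> (v /\<^sub>R a v) \<ge> 1/2" "1 + z \<bullet> - (v /\<^sub>R a v) \<ge> 1/2"
   using assms(1)[OF v] assms(2)[OF v] by (auto simp: field_simps abs_le_iff)
  have "exp (-2) * exp (-2) \<le> flat 1 (1 + z \<bullet> (v /\<^sub>R a v)) * flat 1 (1 + z \<bullet> - (v /\<^sub>R a v))"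
   by (intro mult_mono flat_1_ge 1) (auto simp: flat_1_nonneg)
  then show "exp (-4) \<le> flat 1 (1 + z \<bullet> (v /\<^sub>R a v)) * flat 1 (1 + z \<bullet> - (v /\<^sub>R a v))"
   by (simp flip: exp_add)
 qed simp
 then show ?thesis by simp
qed

text \<open>
  Only the two factors of the coordinate direction \<open>b\<close> are differentiated, each bounded by one and
  with derivative at most \<open>2 / a b\<close>.
\<close>

lemma bump_derivative_bound:
 fixes z :: "'a::euclidean_space"
 assumes "b \<in> Basis" "a b > 0"
 shows "\<bar>frechet_derivative (bump a) (at z) b\<bar> \<le> 4 / a b"
proof -
 define w where "w v z = flat 1 (1 + z \<bullet> (v /\<^sub>R a v)) * flat 1 (1 + z \<bullet> - (v /\<^sub>R a v))" for v z :: 'a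
 define w' where "w' v h = flat 1 (1 + z \<bullet> (v /\<^sub>R a v)) * (flat (dflat 1) (1 + z \<bullet> - (v /\<^sub>R a v)) * (h \<bullet> - (v /\<^sub>R a v)))
   + (flat (dflat 1) (1 + z \<bullet> (v /\<^sub>R a v)) * (h \<bullet> (v /\<^sub>R a v))) * flat 1 (1 + z \<bullet> - (v /\<^sub>R a v))" for v h
 have d1: "((\<lambda>z. flat 1 (1 + z \<bullet> c)) has_derivative (\<lambda>h. flat (dflat 1) (1 + z \<bullet> c) * (h \<bullet> c))) (at z)" for c
  by (rule has_derivative_compose[where f="\<lambda>z. 1 + z \<bullet> c" and g="flat 1", OF _ flat_has_derivative[of 1 "1 + z \<bullet> c", unfolded has_field_derivative_def]])
    (auto intro!: derivative_eq_intros)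
 have d: "(w v has_derivative w' v) (at z)" for v
  unfolding w_def w'_def by (rule has_derivative_mult[OF d1 d1])
 have "bump a = (\<lambda>z. \<Prod>v\<in>Basis. w v z)" by (simp add: bump_def w_def fun_eq_iff)
 then have "(bump a has_derivative (\<lambda>h. \<Sum>v\<in>Basis. w' v h * (\<Prod>j\<in>Basis - {v}. w j z))) (at z)"
  using has_derivative_prod[of Basis w w' z UNIV] d by simp
 then have "frechet_derivative (bump a) (at z) b = (\<Sum>v\<in>Basis. w' v b * (\<Prod>j\<in>Basis - {v}. w j z))"
  by (simp add: frechet_derivative_eqI)
 also have "\<dots> = (\<Sum>v\<in>Basis. if v = b then w' b b * (\<Prod>j\<in>Basis - {b}. w j z) else 0)"
  using assms by (intro sum.cong) (auto simp: w'_def inner_Basis)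
 also have "\<dots> = w' b b * (\<Prod>j\<in>Basis - {b}. w j z)" using assms by simp
 finally have e: "frechet_derivative (bump a) (at z) b = w' b b * (\<Prod>j\<in>Basis - {b}. w j z)" .
 have p: "\<bar>\<Prod>j\<in>Basis - {b}. w j z\<bar> \<le> 1"
  unfolding abs_prod by (intro prod_le_1) (auto simp: w_def abs_mult flat_1_nonneg bump_factor_le)
 have m: "\<bar>flat 1 x * (flat (dflat 1) y * t)\<bar> \<le> 2 * \<bar>t\<bar>" for x y t
 proof -
  have "\<bar>flat 1 x * (flat (dflat 1) y * t)\<bar> = flat 1 x * (\<bar>flat (dflat 1) y\<bar> * \<bar>t\<bar>)"
   by (simp add: abs_mult flat_1_nonneg)
  also have "\<dots> \<le> 1 * (2 * \<bar>t\<bar>)"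
   by (intro mult_mono dflat_1_bound flat_1_le_1) (auto simp: flat_1_nonneg)
  finally show ?thesis by simp
 qed
 have "\<bar>w' b b\<bar> \<le> 2 * \<bar>b \<bullet> - (b /\<^sub>R a b)\<bar> + 2 * \<bar>b \<bullet> (b /\<^sub>R a b)\<bar>"
  unfolding w'_def using m[of "1 + z \<bullet> (b /\<^sub>R a b)" "1 + z \<bullet> - (b /\<^sub>R a b)" "b \<bullet> - (b /\<^sub>R a b)"]
   m[of "1 + z \<bullet> - (b /\<^sub>R a b)" "1 + z \<bullet> (b /\<^sub>R a b)" "b \<bullet> (b /\<^sub>R a b)"]
  by (simp only: mult.commute[of _ "flat 1 (1 + z \<bullet> - (b /\<^sub>R a b))"])
 also have "\<dots> = 4 / a b" using assms by (simp add: divide_inverse)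
 finally have "\<bar>w' b b\<bar> \<le> 4 / a b" .
 then have "\<bar>w' b b\<bar> * \<bar>\<Prod>j\<in>Basis - {b}. w j z\<bar> \<le> 4 / a b * 1"
  using p assms by (intro mult_mono) auto
 then show ?thesis using e by (simp add: abs_mult)
qed

lemma integrable_continuous_bounded_support:
 fixes f :: "'a::euclidean_space => real"
 assumes "continuous_on UNIV f" "\<And>x. f x \<noteq> 0 ==> x \<in> S" "bounded S"
 shows "integrable lborel f"
proof -
 have "integrable lborel (\<lambda>x. indicator (closure S) x *\<^sub>R f x)"
  using assms by (intro borel_integrable_compact) (auto simp: compact_closure intro: continuous_on_subset)
 moreover have "(\<lambda>x. indicator (closure S) x *\<^sub>R f x) = f"
  using assms(2) closure_subset[of S] by (force simp: indicator_def fun_eq_iff)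
 ultimately show ?thesis by simp
qed

lemma bump_integral:
 fixes a :: "'a::euclidean_space => real"
 assumes a: "\<And>v. v \<in> Basis ==> a v > 0"
 shows "integrable lborel (bump a)" "exp (-4) ^ DIM('a) * (\<Prod>v\<in>Basis. a v) \<le> integral\<^sup>L lborel (bump a)"
proof -
 define r where "r = (\<Sum>v\<in>Basis. a v *\<^sub>R v)"
 have r: "r \<bullet> v = a v" if "v \<in> Basis" for v using that by (simp add: r_def)
 have c: "continuous_on UNIV (bump a)" using C_k_bump[of 0 a] by simp
 show i: "integrable lborel (bump a)"
 proof (rule integrable_continuous_bounded_support[OF c _ bounded_cbox[of "-r" r]])
  fix x assume "bump a x \<noteq> 0"
  then have "\<bar>x \<bullet> v\<bar> < a v" if "v \<in> Basis" for v using bump_support that a by blast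
  then show "x \<in> cbox (-r) r" by (force simp: mem_box r abs_less_iff less_imp_le)
 qed
 define B where "B = cbox (- (r /\<^sub>R 2)) (r /\<^sub>R 2)"
 have m: "measure lborel B = (\<Prod>v\<in>Basis. a v)"
  unfolding B_def using a less_imp_le[OF a] by (subst content_cbox) (auto simp: r field_simps)
 have "(LBINT x. exp (-4) ^ DIM('a) * indicator B x) \<le> integral\<^sup>L lborel (bump a)"
 proof (rule integral_mono[OF _ i])
  show "integrable lborel (\<lambda>x. exp (-4) ^ DIM('a) * indicator B x :: real)"
   unfolding B_def by (intro integrable_mult_right integrable_real_indicator) (auto simp: emeasure_lborel_cbox_eq)
  fix x :: 'a
  show "exp (-4) ^ DIM('a) * indicator B x \<le> bump a x"
  proof (cases "x \<in> B")
   case True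
   then have "\<bar>x \<bullet> v\<bar> \<le> a v / 2" if "v \<in> Basis" for v
    using that by (force simp: B_def mem_box r abs_le_iff field_simps)
   from bump_lower_bound[OF a this] show ?thesis using True by simp
  qed (simp add: bump_nonneg)
 qed
 also have "(LBINT x. exp (-4) ^ DIM('a) * indicator B x) = exp (-4) ^ DIM('a) * measure lborel B"
  by simp
 finally show "exp (-4) ^ DIM('a) * (\<Prod>v\<in>Basis. a v) \<le> integral\<^sup>L lborel (bump a)" by (simp add: m)
qed

text \<open>
  The normalised bump with half width of order \<open>s\<close> in space and \<open>s\<^sup>2\<close> in time.  Its mass before
  normalisation is comparable to \<open>s^(n+2)\<close>, and each space derivative costs one further factor \<open>1/s\<close>.
\<close>

lemma parabolic_kernel_exists:
 "\<exists>C>0. \<forall>s>0. \<exists>K :: (real ^ 'n) \<times> real => real. (\<forall>k. C_k k K) \<and> (\<forall>z. 0 \<le> K z) \<and>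
   (\<forall>z. K z \<noteq> 0 --> norm (fst z) < s \<and> \<bar>snd z\<bar> < s^2) \<and> integrable lborel K \<and> integral\<^sup>L lborel K = 1 \<and>
   (\<forall>z. K z \<le> C / s ^ (CARD('n) + 2)) \<and>
   (\<forall>z j. \<bar>frechet_derivative K (at z) (axis j 1, 0)\<bar> \<le> C / s ^ (CARD('n) + 3))"
proof -
 define n where "n = CARD('n)"
 have n: "n \<ge> 1" unfolding n_def using zero_less_card_finite[where 'a='n] by linarith
 define e :: real where "e = exp (-4) ^ (n + 1)"
 have e: "e > 0" by (simp add: e_def)
 define C where "C = 4 * real n * real n ^ n / e"
 have C: "C > 0" using n e by (simp add: C_def)
 have "\<exists>K :: (real ^ 'n) \<times> real => real. (\<forall>k. C_k k K) \<and> (\<forall>z. 0 \<le> K z) \<and>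
   (\<forall>z. K z \<noteq> 0 --> norm (fst z) < s \<and> \<bar>snd z\<bar> < s^2) \<and> integrable lborel K \<and> integral\<^sup>L lborel K = 1 \<and>
   (\<forall>z. K z \<le> C / s ^ (n + 2)) \<and>
   (\<forall>z j. \<bar>frechet_derivative K (at z) (axis j 1, 0)\<bar> \<le> C / s ^ (n + 3))" if s: "s > 0" for s :: real
 proof -
  define a :: "(real ^ 'n) \<times> real => real" where "a v = (if snd v = 0 then s / n else s\<^sup>2)" for v
  have a: "a v > 0" for v using s n by (simp add: a_def)
  have inB: "(axis j 1, 0) \<in> (Basis :: ((real ^ 'n) \<times> real) set)" for j
   by (auto simp: Basis_prod_def Basis_vec_def)
  have inB2: "(0, 1) \<in> (Basis :: ((real ^ 'n) \<times> real) set)" by (auto simp: Basis_prod_def)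
  have "(\<Prod>v\<in>Basis. a v) = (\<Prod>v\<in>(\<lambda>u. (u, 0)) ` (Basis :: (real ^ 'n) set). a v) * (\<Prod>v\<in>(\<lambda>u. (0, u)) ` (Basis :: real set). a v)"
   unfolding Basis_prod_def by (rule prod.union_disjoint) auto
  also have "\<dots> = (s / n) ^ n * s^2"
   by (subst (1 2) prod.reindex) (auto simp: inj_on_def a_def n_def)
  finally have pa: "(\<Prod>v\<in>Basis. a v) = (s / n) ^ n * s^2" .
  define I where "I = integral\<^sup>L lborel (bump a)"
  have "e * ((s / n) ^ n * s^2) \<le> I"
   using bump_integral(2)[of a] a pa unfolding I_def e_def n_def by simp
  moreover have "e * ((s / n) ^ n * s^2) = e * s ^ (n + 2) / n ^ n"
   by (simp add: power_divide power_add power2_eq_square)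
  ultimately have I: "e * s ^ (n + 2) / n ^ n \<le> I" by simp
  have p: "e * s ^ (n + 2) / n ^ n > 0" using e s n by simp
  then have I0: "I > 0" using I by linarith
  have Ib: "1 / I \<le> n ^ n / (e * s ^ (n + 2))"
   using frac_le[OF _ _ p I, of 1 1] by simp
  define K where "K z = bump a z * (1 / I)" for z
  have Kk: "C_k k K" for k unfolding K_def by (intro C_k_mult C_k_bump C_k_const)
  have fd: "frechet_derivative K (at z) b = frechet_derivative (bump a) (at z) b * (1 / I)" for z b
   unfolding K_def
   by (subst frechet_derivative_eqI[OF has_derivative_mult_left[OF C_k_has_derivative[OF C_k_bump]]]) simp
  have "norm (fst z) < s \<and> \<bar>snd z\<bar> < s^2" if "K z \<noteq> 0" for z
  proof -
   have nz: "bump a z \<noteq> 0" using that by (auto simp: K_def)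
   have "\<bar>z \<bullet> (axis j 1, 0)\<bar> < a (axis j 1, 0)" for j by (rule bump_support[OF nz inB a])
   then have c: "\<bar>fst z $ j\<bar> < s / n" for j by (cases z) (simp add: a_def inner_axis)
   have "norm (fst z) \<le> (\<Sum>j\<in>UNIV. \<bar>fst z $ j\<bar>)" by (rule norm_le_l1_cart)
   also have "\<dots> < (\<Sum>j\<in>(UNIV::'n set). s / n)" by (intro sum_strict_mono c) auto
   also have "\<dots> = s" using n by (simp add: n_def)
   finally show ?thesis using bump_support[OF nz inB2 a] by (cases z) (simp add: a_def)
  qed
  moreover have "K z \<le> C / s ^ (n + 2)" for z
  proof -
   have "K z \<le> 1 * (1 / I)" unfolding K_def using I0 bump_le_1[of a z] by (intro mult_right_mono) auto
   also have "\<dots> \<le> n ^ n / (e * s ^ (n + 2))" using Ib by simp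
   also have "\<dots> = (1 / (4 * n)) * (C / s ^ (n + 2))" using n e s by (simp add: C_def)
   also have "\<dots> \<le> 1 * (C / s ^ (n + 2))" using n C s by (intro mult_right_mono) (auto simp: field_simps)
   finally show ?thesis by simp
  qed
  moreover have "\<bar>frechet_derivative K (at z) (axis j 1, 0)\<bar> \<le> C / s ^ (n + 3)" for z j
  proof -
   have "\<bar>frechet_derivative K (at z) (axis j 1, 0)\<bar> = \<bar>frechet_derivative (bump a) (at z) (axis j 1, 0)\<bar> * (1 / I)"
    unfolding fd abs_mult using I0 by simp
   also have "\<dots> \<le> (4 / a (axis j 1, 0)) * (n ^ n / (e * s ^ (n + 2)))"
    using Ib I0 less_imp_le[OF a] by (intro mult_mono bump_derivative_bound[OF inB a]) auto
   also have "\<dots> = C / s ^ (n + 3)" using n e s by (simp add: C_def a_def power_add field_simps eval_nat_numeral)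
   finally show ?thesis .
  qed
  moreover have "integrable lborel K" "integral\<^sup>L lborel K = 1"
   unfolding K_def using bump_integral(1)[of a] a I0 by (auto simp: I_def[symmetric])
  moreover have "0 \<le> K z" for z using I0 bump_nonneg[of a z] by (simp add: K_def)
  ultimately show ?thesis using Kk by blast
 qed
 then show ?thesis using C unfolding n_def by blast
qed

section \<open>Convolution and square integrable functions of bounded support\<close>

lemma abs_le_one_plus_square: "\<bar>a\<bar> \<le> 1 + (a::real)^2"
proof -
 have "0 \<le> (\<bar>a\<bar> - 1)^2" by simp
 then have "2 * \<bar>a\<bar> \<le> 1 + a^2" by (simp add: power2_diff)
 then show ?thesis by linarith
qed

lemma abs_mult_le_sum_squares: "\<bar>a * b\<bar> \<le> (a::real)^2 + b^2"
proof -
 have "0 \<le> (\<bar>a\<bar> - \<bar>b\<bar>)^2" by simp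
 then have "2 * \<bar>a * b\<bar> \<le> a^2 + b^2" by (simp add: power2_diff abs_mult)
 then show ?thesis by linarith
qed

lemma distr_reflect: "distr lborel borel (\<lambda>w. z - w) = (lborel :: 'a::euclidean_space measure)"
 using lborel_affine[of "-1" z] by (simp add: density_1)

lemma integral_reflect:
 fixes f :: "'a::euclidean_space => real"
 assumes [measurable]: "f \<in> borel_measurable borel"
 shows "(LBINT w. f (z - w)) = integral\<^sup>L lborel f"
proof -
 have "integral\<^sup>L (distr lborel borel (\<lambda>w. z - w)) f = (LBINT w. f (z - w))"
  by (rule integral_distr) auto
 then show ?thesis by (simp add: distr_reflect)
qed

lemma integrable_reflect:
 fixes f :: "'a::euclidean_space => real"
 assumes "integrable lborel f"
 shows "integrable lborel (\<lambda>w. f (z - w))"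
proof -
 have "integrable (distr lborel borel (\<lambda>w. z - w)) f" using assms by (simp add: distr_reflect)
 then show ?thesis by (subst (asm) integrable_distr_eq) (use assms in auto)
qed

lemma nn_integral_reflect:
 fixes f :: "'a::euclidean_space => ennreal"
 assumes [measurable]: "f \<in> borel_measurable borel"
 shows "(\<integral>\<^sup>+w. f (z - w) \<partial>lborel) = integral\<^sup>N lborel f"
proof -
 have "integral\<^sup>N (distr lborel borel (\<lambda>w. z - w)) f = (\<integral>\<^sup>+w. f (z - w) \<partial>lborel)"
  by (rule nn_integral_distr) auto
 then show ?thesis by (simp add: distr_reflect)
qed

lemma nn_integral_shift:
 fixes f :: "'a::euclidean_space => ennreal"
 assumes [measurable]: "f \<in> borel_measurable borel"
 shows "(\<integral>\<^sup>+w. f (w - z) \<partial>lborel) = integral\<^sup>N lborel f"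
proof -
 have "(\<integral>\<^sup>+w. f (w - z) \<partial>lborel) = (\<integral>\<^sup>+w. (\<lambda>v. f (0 - v)) (z - w) \<partial>lborel)" by simp
 also have "\<dots> = (\<integral>\<^sup>+v. f (0 - v) \<partial>lborel)" by (rule nn_integral_reflect) measurable
 also have "\<dots> = integral\<^sup>N lborel f" by (rule nn_integral_reflect) measurable
 finally show ?thesis .
qed

definition conv :: "('a::euclidean_space => real) => ('a => real) => 'a => real" where
 "conv K f z = (LBINT w. K (z - w) * f w)"

definition bounded_borel :: "('a::euclidean_space => real) => bool" where
 "bounded_borel K \<longleftrightarrow> K \<in> borel_measurable borel \<and> (\<exists>M. \<forall>z. \<bar>K z\<bar> \<le> M)"

lemma bounded_borel_measurable [measurable_dest]: "bounded_borel K ==> K \<in> borel_measurable borel"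
 by (simp add: bounded_borel_def)

lemma integrable_bounded_borel_mult:
 assumes "bounded_borel K" "integrable lborel f"
 shows "integrable lborel (\<lambda>w. K w * f w)" "integrable lborel (\<lambda>w. K (z - w) * f w)"
proof -
 obtain M where M: "\<And>z. \<bar>K z\<bar> \<le> M" using assms by (auto simp: bounded_borel_def)
 note [measurable] = bounded_borel_measurable[OF assms(1)] borel_measurable_integrable[OF assms(2)]
 have i: "integrable lborel (\<lambda>w. M * f w)" using assms(2) by simp
 have le: "\<bar>K x * f w\<bar> \<le> \<bar>M * f w\<bar>" for x w
  unfolding abs_mult using M[of x] by (intro mult_right_mono) auto
 show "integrable lborel (\<lambda>w. K w * f w)" by (rule Bochner_Integration.integrable_bound[OF i]) (use le in auto)
 show "integrable lborel (\<lambda>w. K (z - w) * f w)" by (rule Bochner_Integration.integrable_bound[OF i]) (use le in auto)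
qed

lemma borel_measurable_conv [measurable]:
 assumes [measurable]: "K \<in> borel_measurable borel" "f \<in> borel_measurable borel"
 shows "conv K f \<in> borel_measurable borel"
 unfolding conv_def[abs_def] by measurable

lemma conv_cong_AE:
 assumes "AE w in lborel. f w = g w" and [measurable]: "K \<in> borel_measurable borel" "f \<in> borel_measurable borel" "g \<in> borel_measurable borel"
 shows "conv K f z = conv K g z"
 unfolding conv_def by (rule integral_cong_AE) (use assms(1) in auto)

lemma conv_diff_right:
 assumes "bounded_borel K" "integrable lborel f" "integrable lborel g"
 shows "conv K (\<lambda>w. f w - g w) z = conv K f z - conv K g z"
 unfolding conv_def
 using integrable_bounded_borel_mult(2)[OF assms(1,2), of z] integrable_bounded_borel_mult(2)[OF assms(1,3), of z]
 by (simp add: right_diff_distrib)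

lemma conv_abs_le:
 assumes [measurable]: "K \<in> borel_measurable borel" and f: "integrable lborel f" and [measurable]: "S \<in> sets borel"
  and K: "\<And>w. K (z - w) \<noteq> 0 ==> w \<in> S" "\<And>w. \<bar>K w\<bar> \<le> M"
 shows "\<bar>conv K f z\<bar> \<le> M * (LBINT w. indicator S w * \<bar>f w\<bar>)"
proof -
 have M: "M \<ge> 0" using K(2)[of 0] by linarith
 note [measurable] = borel_measurable_integrable[OF f]
 have i: "integrable lborel (\<lambda>w. M * (indicator S w * \<bar>f w\<bar>))"
  by (rule Bochner_Integration.integrable_bound[OF integrable_mult_right[OF f, of M]]) (auto simp: indicator_def abs_mult)
 have le: "\<bar>K (z - w) * f w\<bar> \<le> M * (indicator S w * \<bar>f w\<bar>)" for w
 proof (cases "K (z - w) = 0")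
  case False
  then show ?thesis using K(1)[of w] K(2)[of "z - w"] by (auto simp: abs_mult intro: mult_right_mono)
 qed (use M in simp)
 have "\<bar>conv K f z\<bar> \<le> (LBINT w. M * (indicator S w * \<bar>f w\<bar>))"
  unfolding conv_def by (rule integral_abs_bound_integral[OF _ i le])
   (rule Bochner_Integration.integrable_bound[OF i], simp, rule AE_I2, simp only: real_norm_def, rule order_trans[OF le abs_ge_self])
 then show ?thesis by simp
qed

lemma conv_alt:
 assumes [measurable]: "K \<in> borel_measurable borel" "f \<in> borel_measurable borel"
 shows "conv K f z = (LBINT y. K y * f (z - y))"
proof -
 have "(LBINT y. (\<lambda>y. K (z - y) * f y) (z - y)) = conv K f z"
  unfolding conv_def by (rule integral_reflect) measurable
 then show ?thesis by simp
qed

text \<open>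
  Both sides are the iterated integral of \<open>K y * M x * f (z - y - x)\<close>, so this is Fubini's theorem.
\<close>

lemma conv_commute:
 fixes f :: "'a::euclidean_space => real"
 assumes K: "bounded_borel K" "integrable lborel K" and M: "bounded_borel M" "integrable lborel M"
  and f: "integrable lborel f"
 shows "conv K (conv M f) z = conv M (conv K f) z"
proof -
 note [measurable] = bounded_borel_measurable[OF K(1)] bounded_borel_measurable[OF M(1)] borel_measurable_integrable[OF f]
 have e: "conv K (conv M f) z = (LBINT y. (LBINT x. K y * M x * f (z - y - x)))"
  if [measurable]: "K \<in> borel_measurable borel" "M \<in> borel_measurable borel" for K M :: "'a => real"
  by (simp add: conv_alt[of K] conv_alt[of M] mult.assoc)
 obtain B where B: "\<And>x. \<bar>M x\<bar> \<le> B" using M by (auto simp: bounded_borel_def)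
 have B0: "B \<ge> 0" using B[of 0] by linarith
 have i1: "integrable lborel (\<lambda>x. K y * M x * f (z - y - x))" for y
  using integrable_bounded_borel_mult(1)[OF M(1) integrable_reflect[OF f, of "z - y"]] by (simp add: mult.assoc)
 have bd: "\<bar>\<integral>x. \<bar>K y * M x * f (z - y - x)\<bar> \<partial>lborel\<bar> \<le> \<bar>K y * (B * (LBINT x. \<bar>f x\<bar>))\<bar>" for y
 proof -
  have "(LBINT x. \<bar>K y * M x * f (z - y - x)\<bar>) \<le> (LBINT x. \<bar>K y\<bar> * B * \<bar>f (z - y - x)\<bar>)"
  proof (rule integral_mono)
   show "integrable lborel (\<lambda>x. \<bar>K y * M x * f (z - y - x)\<bar>)" using i1 by simp
   show "integrable lborel (\<lambda>x. \<bar>K y\<bar> * B * \<bar>f (z - y - x)\<bar>)"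
    using integrable_reflect[OF f, of "z - y"] by simp
   show "\<bar>K y * M x * f (z - y - x)\<bar> \<le> \<bar>K y\<bar> * B * \<bar>f (z - y - x)\<bar>" for x
    unfolding abs_mult by (intro mult_right_mono mult_left_mono B) auto
  qed
  also have "\<dots> = \<bar>K y\<bar> * (B * (LBINT x. \<bar>f x\<bar>))"
   using integral_reflect[of "\<lambda>x. \<bar>f x\<bar>" "z - y"] by (simp add: mult.assoc)
  finally have "(LBINT x. \<bar>K y * M x * f (z - y - x)\<bar>) \<le> \<dots>" .
  moreover have "0 \<le> (LBINT x. \<bar>K y * M x * f (z - y - x)\<bar>)" by simp
  moreover have "0 \<le> B * (LBINT x. \<bar>f x\<bar>)" using B0 by simp
  moreover have "0 \<le> (LBINT x. \<bar>f x\<bar>)" by simp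
  ultimately show ?thesis using B0 by (simp only: abs_mult abs_of_nonneg abs_idempotent)
 qed
 have "integrable (lborel \<Otimes>\<^sub>M lborel) (\<lambda>(y, x). K y * M x * f (z - y - x))"
 proof (rule lborel_pair.Fubini_integrable)
  show "(\<lambda>(y, x). K y * M x * f (z - y - x)) \<in> borel_measurable (lborel \<Otimes>\<^sub>M lborel)" by measurable
  show "integrable lborel (\<lambda>y. \<integral>x. norm (case (y, x) of (y, x) => K y * M x * f (z - y - x)) \<partial>lborel)"
  proof (rule Bochner_Integration.integrable_bound[OF integrable_mult_left[OF K(2), of "B * (LBINT x. \<bar>f x\<bar>)"]])
   show "(\<lambda>y. \<integral>x. norm (case (y, x) of (y, x) => K y * M x * f (z - y - x)) \<partial>lborel) \<in> borel_measurable lborel"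
    by measurable
  qed (use bd in \<open>auto simp: mult.assoc\<close>)
  show "AE y in lborel. integrable lborel (\<lambda>x. case (y, x) of (y, x) => K y * M x * f (z - y - x))"
   using i1 by simp
 qed
 from lborel_pair.Fubini_integral[OF this]
 have "(LBINT y. (LBINT x. K y * M x * f (z - y - x))) = (LBINT x. (LBINT y. K y * M x * f (z - y - x)))"
  by simp
 also have "\<dots> = (LBINT x. (LBINT y. M x * K y * f (z - x - y)))"
  by (intro Bochner_Integration.integral_cong refl) (simp add: mult.commute add.commute diff_diff_eq)
 finally show ?thesis by (simp add: e)
qed

text \<open>
  Convolution with such a kernel replaces a value by an average over a ball of radius \<open>r\<close>.
\<close>

definition avg_kernel :: "real => ('a::euclidean_space => real) => bool" where
 "avg_kernel r K \<longleftrightarrow> bounded_borel K \<and> (\<forall>z. 0 \<le> K z) \<and> integrable lborel K \<and> integral\<^sup>L lborel K = 1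
   \<and> (\<forall>z. K z \<noteq> 0 --> norm z < r)"

text \<open>
  Averaging preserves the total mass, by Tonelli and translation invariance.  With Jensen's inequality
  it makes convolution a contraction in \<open>L2\<close>.
\<close>

lemma nn_integral_conv:
 assumes K: "avg_kernel r K" and f: "integrable lborel f" "\<And>x. f x \<ge> 0"
 shows "(\<integral>\<^sup>+z. ennreal (conv K f z) \<partial>lborel) = (\<integral>\<^sup>+z. ennreal (f z) \<partial>lborel)"
proof -
 have bK: "bounded_borel K" and K0: "\<And>z. K z \<ge> 0" and iK: "integrable lborel K" "integral\<^sup>L lborel K = 1"
  using K by (auto simp: avg_kernel_def)
 note [measurable] = bounded_borel_measurable[OF bK] borel_measurable_integrable[OF f(1)]
 have "(\<integral>\<^sup>+z. ennreal (conv K f z) \<partial>lborel) = (\<integral>\<^sup>+z. (\<integral>\<^sup>+w. ennreal (K (z - w)) * ennreal (f w) \<partial>lborel) \<partial>lborel)"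
  unfolding conv_def using integrable_bounded_borel_mult(2)[OF bK f(1)] K0 f(2)
  by (simp add: nn_integral_eq_integral[symmetric] ennreal_mult)
 also have "\<dots> = (\<integral>\<^sup>+w. (\<integral>\<^sup>+z. ennreal (K (z - w)) * ennreal (f w) \<partial>lborel) \<partial>lborel)"
  by (rule lborel_pair.Fubini') measurable
 also have "\<dots> = (\<integral>\<^sup>+w. ennreal (f w) \<partial>lborel)"
 proof (rule nn_integral_cong)
  fix w
  have "(\<integral>\<^sup>+z. ennreal (K (z - w)) * ennreal (f w) \<partial>lborel) = (\<integral>\<^sup>+z. ennreal (K (z - w)) \<partial>lborel) * ennreal (f w)"
   by (rule nn_integral_multc) measurable
  also have "(\<integral>\<^sup>+z. ennreal (K (z - w)) \<partial>lborel) = (\<integral>\<^sup>+z. ennreal (K z) \<partial>lborel)"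
   by (rule nn_integral_shift) measurable
  also have "\<dots> = 1" using iK K0 by (subst nn_integral_eq_integral) auto
  finally show "(\<integral>\<^sup>+z. ennreal (K (z - w)) * ennreal (f w) \<partial>lborel) = ennreal (f w)" by simp
 qed
 finally show ?thesis .
qed

text \<open>
  Bounded support makes these functions integrable as well, so that every product and convolution
  below is integrable without further conditions.
\<close>

definition L2b :: "('a::euclidean_space => real) => bool" where
 "L2b f \<longleftrightarrow> f \<in> borel_measurable borel \<and> integrable lborel (\<lambda>x. (f x)^2) \<and> bounded {x. f x \<noteq> 0}"

lemma L2b_measurable [measurable_dest]: "L2b f ==> f \<in> borel_measurable borel"
 by (simp add: L2b_def)

lemma L2b_bounded_support:
 assumes "L2b f" obtains R where "R > 0" "\<And>x. f x \<noteq> 0 ==> norm x < R"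
proof -
 obtain B where "\<And>x. f x \<noteq> 0 ==> norm x \<le> B" using assms by (auto simp: L2b_def bounded_iff)
 then show ?thesis using that[of "\<bar>B\<bar> + 1"] by fastforce
qed

lemma integrable_ball_const: "integrable lborel (\<lambda>x. c * indicator (ball (a::'a::euclidean_space) R) x :: real)"
 using emeasure_bounded_finite[OF bounded_ball, of a R]
 by (intro integrable_mult_right integrable_real_indicator) auto

lemma L2b_integrable:
 assumes "L2b f" shows "integrable lborel f"
proof -
 obtain R where R: "\<And>x. f x \<noteq> 0 ==> norm x < R" using L2b_bounded_support[OF assms] by blast
 note [measurable] = L2b_measurable[OF assms]
 have 2: "integrable lborel (\<lambda>x. (f x)^2)" using assms by (simp add: L2b_def)
 show ?thesis
 proof (rule Bochner_Integration.integrable_bound[OF Bochner_Integration.integrable_add[OF integrable_ball_const[of 1 0 R] 2]])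
  show "AE x in lborel. norm (f x) \<le> norm (1 * indicator (ball 0 R) x + (f x)^2)"
  proof (rule AE_I2)
   fix x
   have "\<bar>f x\<bar> \<le> 1 + (f x)^2" by (rule abs_le_one_plus_square)
   then show "norm (f x) \<le> norm (1 * indicator (ball 0 R) x + (f x)^2)"
    using R[of x] by (cases "f x = 0") (auto simp: indicator_def)
  qed
 qed simp
qed

lemma L2b_add:
 assumes "L2b f" "L2b g" shows "L2b (\<lambda>x. f x + g x)"
proof -
 note [measurable] = L2b_measurable[OF assms(1)] L2b_measurable[OF assms(2)]
 have i: "integrable lborel (\<lambda>x. 2 * (f x)^2 + 2 * (g x)^2)" using assms by (auto simp: L2b_def)
 have "(f x + g x)^2 \<le> 2 * (f x)^2 + 2 * (g x)^2" for x
  using sum_squares_bound[of "f x" "g x"] by (simp add: power2_sum)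
 then have "integrable lborel (\<lambda>x. (f x + g x)^2)"
  by (intro Bochner_Integration.integrable_bound[OF i]) auto
 moreover have "bounded {x. f x + g x \<noteq> 0}"
  by (rule bounded_subset[of "{x. f x \<noteq> 0} \<union> {x. g x \<noteq> 0}"]) (use assms in \<open>auto simp: L2b_def\<close>)
 ultimately show ?thesis by (simp add: L2b_def)
qed

lemma L2b_bounded_mult:
 assumes "L2b f" "bounded_borel w" shows "L2b (\<lambda>x. w x * f x)"
proof -
 note [measurable] = L2b_measurable[OF assms(1)] bounded_borel_measurable[OF assms(2)]
 obtain M where M: "\<And>x. \<bar>w x\<bar> \<le> M" using assms by (auto simp: bounded_borel_def)
 have i: "integrable lborel (\<lambda>x. M^2 * (f x)^2)" using assms by (auto simp: L2b_def)
 have "(w x * f x)^2 \<le> M^2 * (f x)^2" for x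
  unfolding power_mult_distrib using M[of x] by (intro mult_right_mono abs_le_square_iff[THEN iffD1]) auto
 then have "integrable lborel (\<lambda>x. (w x * f x)^2)"
  by (intro Bochner_Integration.integrable_bound[OF i]) auto
 moreover have "bounded {x. w x * f x \<noteq> 0}"
  by (rule bounded_subset[of "{x. f x \<noteq> 0}"]) (use assms in \<open>auto simp: L2b_def\<close>)
 ultimately show ?thesis by (simp add: L2b_def)
qed

lemma bounded_borel_const: "bounded_borel (\<lambda>x. c)" by (auto simp: bounded_borel_def)

lemma L2b_diff: "L2b f ==> L2b g ==> L2b (\<lambda>x. f x - g x)"
 using L2b_add[of f "\<lambda>x. (-1) * g x"] L2b_bounded_mult[OF _ bounded_borel_const[of "-1"], of g] by simp

lemma L2b_mult_integrable:
 assumes "L2b f" "L2b g" shows "integrable lborel (\<lambda>x. f x * g x)"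
proof -
 note [measurable] = L2b_measurable[OF assms(1)] L2b_measurable[OF assms(2)]
 have i: "integrable lborel (\<lambda>x. (f x)^2 + (g x)^2)" using assms by (auto simp: L2b_def)
 have "\<bar>f x * g x\<bar> \<le> (f x)^2 + (g x)^2" for x
  by (rule abs_mult_le_sum_squares)
 then show ?thesis by (intro Bochner_Integration.integrable_bound[OF i]) auto
qed

lemma L2b_bounded:
 assumes "bounded_borel f" "bounded {x. f x \<noteq> 0}" shows "L2b f"
proof -
 note [measurable] = bounded_borel_measurable[OF assms(1)]
 obtain M where M: "\<And>x. \<bar>f x\<bar> \<le> M" using assms by (auto simp: bounded_borel_def)
 obtain R where "\<And>x. f x \<noteq> 0 ==> norm x \<le> R" using assms by (auto simp: bounded_iff)
 then have R: "\<And>x. f x \<noteq> 0 ==> norm x < R + 1" by fastforce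
 have "(f x)^2 \<le> M^2 * indicator (ball 0 (R + 1)) x" for x
  using M[of x] R[of x] by (cases "f x = 0") (auto simp: indicator_def intro: abs_le_square_iff[THEN iffD1])
 then have "integrable lborel (\<lambda>x. (f x)^2)"
  by (intro Bochner_Integration.integrable_bound[OF integrable_ball_const[of "M^2" 0 "R + 1"]]) auto
 then show ?thesis using assms by (simp add: L2b_def)
qed

text \<open>
  Jensen's inequality: the integral of \<open>K (z - w) * (f w - conv K f z)\<^sup>2\<close> is nonnegative.
\<close>

lemma conv_square_le:
 assumes K: "avg_kernel r K" and f: "L2b f"
 shows "(conv K f z)^2 \<le> conv K (\<lambda>w. (f w)^2) z"
proof -
 have bK: "bounded_borel K" and K0: "\<And>z. K z \<ge> 0" and iK: "integrable lborel K" "integral\<^sup>L lborel K = 1"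
  using K by (auto simp: avg_kernel_def)
 have iK': "integrable lborel (\<lambda>w. K (z - w))" "(LBINT w. K (z - w)) = 1"
  using integrable_reflect[OF iK(1)] integral_reflect[of K z] bounded_borel_measurable[OF bK] iK by auto
 define m where "m = conv K f z"
 have i1: "integrable lborel (\<lambda>w. K (z - w) * f w)" by (rule integrable_bounded_borel_mult(2)[OF bK L2b_integrable[OF f]])
 have i2: "integrable lborel (\<lambda>w. K (z - w) * (f w)^2)"
  by (rule integrable_bounded_borel_mult(2)[OF bK]) (use f in \<open>simp add: L2b_def\<close>)
 have "0 \<le> (LBINT w. K (z - w) * (f w - m)^2)" using K0 by (intro Bochner_Integration.integral_nonneg) auto
 also have "\<dots> = (LBINT w. K (z - w) * (f w)^2 - 2 * m * (K (z - w) * f w) + m^2 * K (z - w))"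
  by (rule Bochner_Integration.integral_cong) (auto simp: power2_eq_square algebra_simps)
 also have "\<dots> = conv K (\<lambda>w. (f w)^2) z - 2 * m * conv K f z + m^2"
  using i1 i2 iK' by (simp add: conv_def)
 finally show ?thesis by (simp add: m_def power2_eq_square)
qed

lemma conv_bounded_support:
 assumes K: "\<And>z. K z \<noteq> 0 ==> norm z < r" and f: "\<And>x. f x \<noteq> 0 ==> norm x < R" and z: "conv K f z \<noteq> 0"
 shows "norm z < r + R"
proof (rule ccontr)
 assume a: "\<not> norm z < r + R"
 have "K (z - w) * f w = 0" for w
 proof (rule ccontr)
  assume "K (z - w) * f w \<noteq> 0"
  then have "norm (z - w) < r" "norm w < R" using K f by auto
  then show False using a norm_triangle_ineq[of "z - w" w] by simp
 qed
 then have "(\<lambda>w. K (z - w) * f w) = (\<lambda>w. 0)" by blast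
 then have "conv K f z = 0" unfolding conv_def by (simp only:) simp
 then show False using z by simp
qed

lemma L2b_conv:
 assumes K: "avg_kernel r K" and f: "L2b f"
 shows "L2b (conv K f)" "(LBINT z. (conv K f z)^2) \<le> (LBINT z. (f z)^2)"
proof -
 have bK: "bounded_borel K" and K0: "\<And>z. K z \<ge> 0" and Kr: "\<And>z. K z \<noteq> 0 ==> norm z < r"
  using K by (auto simp: avg_kernel_def)
 note [measurable] = bounded_borel_measurable[OF bK] L2b_measurable[OF f]
 have f2: "integrable lborel (\<lambda>w. (f w)^2)" using f by (simp add: L2b_def)
 have c0: "0 \<le> conv K (\<lambda>w. (f w)^2) z" for z using K0 by (auto simp: conv_def)
 have nn: "(\<integral>\<^sup>+z. ennreal (conv K (\<lambda>w. (f w)^2) z) \<partial>lborel) = ennreal (LBINT z. (f z)^2)"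
  using nn_integral_conv[OF K f2] f2 by (simp add: nn_integral_eq_integral)
 have i: "integrable lborel (conv K (\<lambda>w. (f w)^2))"
  by (rule integrableI_nonneg) (use nn c0 in auto)
 have e: "(LBINT z. conv K (\<lambda>w. (f w)^2) z) = (LBINT z. (f z)^2)"
  using nn by (subst integral_eq_nn_integral) (auto simp: c0)
 have i2: "integrable lborel (\<lambda>z. (conv K f z)^2)"
  by (rule Bochner_Integration.integrable_bound[OF i]) (use conv_square_le[OF K f] c0 in auto)
 obtain R where R: "\<And>x. f x \<noteq> 0 ==> norm x < R" using L2b_bounded_support[OF f] by blast
 have "bounded {x. conv K f x \<noteq> 0}"
  using conv_bounded_support[of K r f R] Kr R by (intro boundedI[of _ "r + R"]) fastforce
 then show "L2b (conv K f)" using i2 by (simp add: L2b_def)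
 show "(LBINT z. (conv K f z)^2) \<le> (LBINT z. (f z)^2)"
  unfolding e[symmetric] by (rule integral_mono[OF i2 i conv_square_le[OF K f]])
qed

section \<open>Convergence of mollifications in the mean square\<close>

lemma uniformly_continuous_bounded_support:
 fixes g :: "'a::euclidean_space => real"
 assumes g: "continuous_on UNIV g" and R: "\<And>x. g x \<noteq> 0 ==> norm x \<le> R" and e: "e > 0"
 shows "\<exists>d>0. \<forall>x y. norm (x - y) < d --> \<bar>g x - g y\<bar> < e"
proof -
 have "uniformly_continuous_on (cball 0 (R + 1)) g"
  by (rule compact_uniformly_continuous) (use g in \<open>auto intro: continuous_on_subset\<close>)
 then obtain d where d: "d > 0" "\<And>x y. x \<in> cball 0 (R + 1) ==> y \<in> cball 0 (R + 1) ==> dist y x < d ==> dist (g y) (g x) < e"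
  unfolding uniformly_continuous_on_def using e by blast
 have "\<bar>g x - g y\<bar> < e" if xy: "norm (x - y) < min d 1" for x y
 proof (cases "x \<in> cball 0 (R + 1) \<and> y \<in> cball 0 (R + 1)")
  case True
  then show ?thesis using d(2)[of y x] xy by (auto simp: dist_norm)
 next
  case False
  have "norm x \<le> norm y + norm (x - y)" "norm y \<le> norm x + norm (x - y)"
   by (metis norm_triangle_sub) (metis norm_triangle_sub norm_minus_commute)
  then have "norm x > R" "norm y > R" using False xy by auto
  then have "g x = 0" "g y = 0" using R by fastforce+
  then show ?thesis using e by simp
 qed
 then show ?thesis using d(1) by (intro exI[of _ "min d 1"]) auto
qed

lemma square_add_le: "((a::real) + b)^2 \<le> 2 * a^2 + 2 * b^2"
 using sum_squares_bound[of a b] by (simp add: power2_sum)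

text \<open>
  Dominated convergence, in the form used for approximation in the mean square.
\<close>

lemma dominated_square_limit:
 fixes f :: "'a::euclidean_space => real"
 assumes [measurable]: "\<And>k. h k \<in> borel_measurable borel" "f \<in> borel_measurable borel"
  and w: "integrable lborel w" and lim: "AE x in lborel. (\<lambda>k. h k x) \<longlonglongrightarrow> f x"
  and bd: "\<And>k x. (f x - h k x)^2 \<le> w x"
 shows "(\<lambda>k. \<integral>x. (f x - h k x)^2 \<partial>lborel) \<longlonglongrightarrow> 0"
proof -
 have "(\<lambda>k. \<integral>x. (f x - h k x)^2 \<partial>lborel) \<longlonglongrightarrow> (\<integral>x. 0 \<partial>(lborel::'a measure))"
 proof (rule integral_dominated_convergence[where w=w])
  show "AE x in lborel. (\<lambda>k. (f x - h k x)^2) \<longlonglongrightarrow> 0"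
   using lim
  proof eventually_elim
   case (elim x)
   have "(\<lambda>k. (f x - h k x)^2) \<longlonglongrightarrow> (f x - f x)^2" by (intro tendsto_intros elim)
   then show ?case by simp
  qed
 qed (use w bd in auto)
 then show ?thesis by simp
qed

lemma L2b_approx_bounded:
 assumes f: "L2b f" and e: "e > 0"
 obtains M where "M > 0" "(LBINT x. (f x - max (-M) (min M (f x)))^2) < e"
proof -
 note [measurable] = L2b_measurable[OF f]
 have "(\<lambda>k. \<integral>x. (f x - max (- real k) (min (real k) (f x)))^2 \<partial>lborel) \<longlonglongrightarrow> 0"
 proof (rule dominated_square_limit)
  show "integrable lborel (\<lambda>x. (f x)^2)" using f by (simp add: L2b_def)
  show "AE x in lborel. (\<lambda>k. max (- real k) (min (real k) (f x))) \<longlonglongrightarrow> f x"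
  proof (rule AE_I2)
   fix x
   obtain k0 where "\<bar>f x\<bar> \<le> real k0" using real_arch_simple by blast
   then have "\<forall>k\<ge>k0. max (- real k) (min (real k) (f x)) = f x" by auto
   then show "(\<lambda>k. max (- real k) (min (real k) (f x))) \<longlonglongrightarrow> f x"
    by (intro tendsto_eventually) (auto simp: eventually_sequentially)
  qed
  show "(f x - max (- real k) (min (real k) (f x)))^2 \<le> (f x)^2" for k x
   by (rule abs_le_square_iff[THEN iffD1]) auto
 qed auto
 then have "\<forall>\<^sub>F k in sequentially. (LBINT x. (f x - max (- real k) (min (real k) (f x)))^2) < e"
  using e by (rule order_tendstoD)
 moreover have "\<forall>\<^sub>F k in sequentially. k > (0::nat)" by (rule eventually_gt_at_top)
 ultimately have "\<forall>\<^sub>F k in sequentially. k > 0 \<and> (LBINT x. (f x - max (- real k) (min (real k) (f x)))^2) < e"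
  by eventually_elim auto
 from eventually_happens'[OF sequentially_bot this] obtain k :: nat where
  "k > 0 \<and> (LBINT x. (f x - max (- real k) (min (real k) (f x)))^2) < e" by blast
 then show ?thesis by (intro that[of "real k"]) auto
qed

lemma bounded_borel_continuous:
 fixes g :: "'a::euclidean_space => real"
 assumes g: "continuous_on UNIV g" and R: "\<And>x. g x \<noteq> 0 ==> norm x \<le> R"
 shows "bounded_borel g"
proof -
 have "compact (g ` cball 0 R)" using g by (intro compact_continuous_image) (auto intro: continuous_on_subset)
 then obtain M where M: "\<And>y. y \<in> g ` cball 0 R ==> \<bar>y\<bar> \<le> M"
  using compact_imp_bounded[of "g ` cball 0 R"] unfolding bounded_iff real_norm_def by blast
 have "\<bar>g x\<bar> \<le> max M 0" for x using M[of "g x"] R[of x] by (cases "g x = 0") auto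
 then show ?thesis using g by (auto simp: bounded_borel_def borel_measurable_continuous_onI)
qed

text \<open>
  After truncation the function is bounded, and a bounded measurable function of bounded support is
  an almost everywhere limit of continuous functions, which may be cut off without increasing the
  error.
\<close>

lemma L2b_dense_continuous:
 fixes f :: "'a::euclidean_space => real"
 assumes f: "L2b f" and e: "e > 0"
 obtains g R where "continuous_on UNIV g" "\<And>x. g x \<noteq> 0 ==> norm x \<le> R" "(LBINT x. (f x - g x)^2) < e"
proof -
 note [measurable] = L2b_measurable[OF f]
 obtain M where M: "M > 0" "(LBINT x. (f x - max (-M) (min M (f x)))^2) < e / 4"
  using L2b_approx_bounded[OF f, of "e/4"] e by auto
 define clip where "clip y = max (-M) (min M y)" for y
 obtain R where R: "R > 0" "\<And>x. f x \<noteq> 0 ==> norm x < R" using L2b_bounded_support[OF f] by blast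
 have "f measurable_on UNIV" by (rule lebesgue_measurable_imp_measurable_on) (auto intro: measurable_completion)
 then obtain N g where N: "negligible N" and g: "\<And>n. continuous_on UNIV (g n)" "\<And>x. x \<notin> N ==> (\<lambda>n. g n x) \<longlonglongrightarrow> f x"
  unfolding measurable_on_def by auto
 define c where "c x = max 0 (min 1 (R + 1 - norm x))" for x :: 'a
 define h where "h n x = c x * clip (g n x)" for n x
 have hc: "continuous_on UNIV (h n)" for n
  unfolding h_def c_def clip_def by (intro continuous_intros g)
 have hs: "norm x \<le> R + 1" if "h n x \<noteq> 0" for n x
  using that by (auto simp: h_def c_def max_def min_def split: if_splits)
 have [measurable]: "h n \<in> borel_measurable borel" for n using hc borel_measurable_continuous_onI by blast
 have [measurable]: "(\<lambda>x. clip (f x)) \<in> borel_measurable borel" unfolding clip_def by measurable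
 have clipM: "\<bar>clip y\<bar> \<le> M" for y using M(1) by (auto simp: clip_def)
 have "(\<lambda>k. \<integral>x. (clip (f x) - h k x)^2 \<partial>lborel) \<longlonglongrightarrow> 0"
 proof (rule dominated_square_limit)
  show "integrable lborel (\<lambda>x. (2 * M)^2 * indicator (ball (0::'a) (R + 2)) x)" by (rule integrable_ball_const)
  have "AE x in lebesgue. x \<notin> N" using N by (metis AE_not_in negligible_iff_null_sets)
  then have "AE x in lborel. x \<notin> N" by (simp add: AE_completion_iff)
  then show "AE x in lborel. (\<lambda>k. h k x) \<longlonglongrightarrow> clip (f x)"
  proof eventually_elim
   case (elim x)
   have "(\<lambda>k. h k x) \<longlonglongrightarrow> c x * clip (f x)"
    unfolding h_def clip_def by (intro tendsto_intros g(2)[OF elim])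
   moreover have "c x * clip (f x) = clip (f x)"
    using R(2)[of x] M(1) by (cases "f x = 0") (auto simp: c_def clip_def)
   ultimately show ?case by simp
  qed
  show "(clip (f x) - h k x)^2 \<le> (2 * M)^2 * indicator (ball 0 (R + 2)) x" for k x
  proof (cases "norm x < R + 2")
   case True
   have c1: "0 \<le> c x" "c x \<le> 1" by (auto simp: c_def)
   then have "\<bar>h k x\<bar> \<le> 1 * M" unfolding h_def abs_mult by (intro mult_mono clipM) auto
   then have "\<bar>clip (f x) - h k x\<bar> \<le> \<bar>2 * M\<bar>" using clipM[of "f x"] by linarith
   then have "(clip (f x) - h k x)^2 \<le> (2 * M)^2" by (rule abs_le_square_iff[THEN iffD1])
   then show ?thesis using True by simp
  next
   case False
   have "f x = 0" using R(2)[of x] False by fastforce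
   moreover have "h k x = 0" using hs[of k x] False by fastforce
   ultimately show ?thesis using M(1) by (simp add: clip_def)
  qed
 qed auto
 then have "\<forall>\<^sub>F k in sequentially. (LBINT x. (clip (f x) - h k x)^2) < e / 4"
  using e by (intro order_tendstoD) auto
 then obtain k where k: "(LBINT x. (clip (f x) - h k x)^2) < e / 4"
  unfolding eventually_sequentially by blast
 have bs: "bounded {x. clip (f x) \<noteq> 0}"
  by (rule bounded_subset[of "ball 0 R"]) (use R(2) M(1) in \<open>force simp: clip_def\<close>)+
 have L2c: "L2b (\<lambda>x. clip (f x))"
  by (rule L2b_bounded) (use bs clipM in \<open>auto simp: bounded_borel_def\<close>)
 have L2h: "L2b (h k)"
  by (rule L2b_bounded[OF bounded_borel_continuous[OF hc hs]]) (use hs in \<open>auto simp: bounded_iff\<close>)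
 have i1: "integrable lborel (\<lambda>x. (f x - clip (f x))^2)" and i2: "integrable lborel (\<lambda>x. (clip (f x) - h k x)^2)"
  and i3: "integrable lborel (\<lambda>x. (f x - h k x)^2)"
  using L2b_diff[OF f L2c] L2b_diff[OF L2c L2h] L2b_diff[OF f L2h] by (auto simp: L2b_def)
 have "(LBINT x. (f x - h k x)^2) \<le> (LBINT x. 2 * (f x - clip (f x))^2 + 2 * (clip (f x) - h k x)^2)"
 proof (rule integral_mono[OF i3])
  show "(f x - h k x)^2 \<le> 2 * (f x - clip (f x))^2 + 2 * (clip (f x) - h k x)^2" for x
   using square_add_le[of "f x - clip (f x)" "clip (f x) - h k x"] by simp
 qed (use i1 i2 in auto)
 also have "\<dots> < e" using M(2) k i1 i2 by (simp add: clip_def)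
 finally show ?thesis using that[of "h k" "R + 1"] hc hs by blast
qed

lemma conv_close:
 assumes K: "avg_kernel r K" and v: "integrable lborel v" and M: "\<And>w. K (z - w) \<noteq> 0 ==> \<bar>v w - v z\<bar> \<le> M"
 shows "\<bar>conv K v z - v z\<bar> \<le> M"
proof -
 have bK: "bounded_borel K" and K0: "\<And>z. K z \<ge> 0" and iK: "integrable lborel K" "integral\<^sup>L lborel K = 1"
  using K by (auto simp: avg_kernel_def)
 have iK': "integrable lborel (\<lambda>w. K (z - w))" "(LBINT w. K (z - w)) = 1"
  using integrable_reflect[OF iK(1)] integral_reflect[of K z] bounded_borel_measurable[OF bK] iK by auto
 have i1: "integrable lborel (\<lambda>w. K (z - w) * v w)" by (rule integrable_bounded_borel_mult(2)[OF bK v])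
 have eq: "conv K v z - v z = (LBINT w. K (z - w) * (v w - v z))"
  using i1 iK' by (simp add: conv_def right_diff_distrib)
 have "\<bar>\<integral>w. K (z - w) * (v w - v z) \<partial>lborel\<bar> \<le> (LBINT w. K (z - w) * M)"
 proof (rule integral_abs_bound_integral)
  show "integrable lborel (\<lambda>w. K (z - w) * (v w - v z))" using i1 iK' by (simp add: right_diff_distrib)
  fix w
  show "\<bar>K (z - w) * (v w - v z)\<bar> \<le> K (z - w) * M"
  proof (cases "K (z - w) = 0")
   case False
   then show ?thesis using M[of w] K0[of "z - w"] by (auto simp: abs_mult intro: mult_left_mono)
  qed simp
 qed (use iK' in auto)
 also have "\<dots> = M" using iK' by simp
 finally show ?thesis using eq by simp
qed

lemma conv_continuous_close:
 assumes K: "avg_kernel r K" and g: "bounded_borel g" "integrable lborel g"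
  and d: "\<And>x y. norm (x - y) < d ==> \<bar>g x - g y\<bar> < e" "r \<le> d"
 shows "\<bar>conv K g z - g z\<bar> \<le> e"
proof (rule conv_close[OF K g(2)])
 fix w assume "K (z - w) \<noteq> 0"
 then have "norm (z - w) < r" using K by (simp add: avg_kernel_def)
 then show "\<bar>g w - g z\<bar> \<le> e" using d(1)[of w z] d(2) by (simp add: norm_minus_commute)
qed

text \<open>
  For a continuous function of bounded support the convergence is uniform.  The general case follows
  by density because convolution is a contraction in \<open>L2\<close>.
\<close>

lemma mollify_L2_limit:
 fixes f :: "'a::euclidean_space => real"
 assumes K: "\<And>k. avg_kernel (r k) (K k)" and r: "r \<longlonglongrightarrow> 0" and f: "L2b f"
 shows "(\<lambda>k. \<integral>x. (conv (K k) f x - f x)^2 \<partial>lborel) \<longlonglongrightarrow> 0"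
proof (rule order_tendstoI)
 fix a :: real assume "a < 0"
 moreover have "0 \<le> (LBINT x. (conv (K k) f x - f x)^2)" for k by simp
 ultimately show "\<forall>\<^sub>F k in sequentially. a < (LBINT x. (conv (K k) f x - f x)^2)"
  by (intro always_eventually allI) (rule less_le_trans)
next
 fix e :: real assume e: "0 < e"
 obtain g R where g: "continuous_on UNIV g" "\<And>x. g x \<noteq> 0 ==> norm x \<le> R" "(LBINT x. (f x - g x)^2) < e / 12"
  using L2b_dense_continuous[OF f, of "e/12"] e by auto
 have bg: "bounded_borel g" by (rule bounded_borel_continuous[OF g(1,2)])
 have Lg: "L2b g" by (rule L2b_bounded[OF bg]) (use g(2) in \<open>auto simp: bounded_iff\<close>)
 define V where "V = measure lborel (ball (0::'a) (\<bar>R\<bar> + 2))"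
 have V: "V \<ge> 0" by (simp add: V_def)
 define \<eta> where "\<eta> = sqrt (e / (12 * (V + 1)))"
 have \<eta>: "\<eta> > 0" "\<eta>^2 = e / (12 * (V + 1))" using e V by (auto simp: \<eta>_def)
 obtain d where d: "d > 0" "\<And>x y. norm (x - y) < d ==> \<bar>g x - g y\<bar> < \<eta>"
  using uniformly_continuous_bounded_support[OF g(1,2) \<eta>(1)] by blast
 have "\<forall>\<^sub>F k in sequentially. r k < min d 1" using order_tendstoD(2)[OF r, of "min d 1"] d(1) by simp
 then show "\<forall>\<^sub>F k in sequentially. (LBINT x. (conv (K k) f x - f x)^2) < e"
 proof eventually_elim
  case (elim k)
  note Kk = K[of k]
  have bK: "bounded_borel (K k)" using Kk by (simp add: avg_kernel_def)
  let ?a = "\<lambda>x. conv (K k) (\<lambda>w. f w - g w) x" and ?b = "\<lambda>x. conv (K k) g x - g x" and ?c = "\<lambda>x. g x - f x"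
  have La: "L2b ?a" by (rule L2b_conv(1)[OF Kk L2b_diff[OF f Lg]])
  have Lb: "L2b ?b" by (rule L2b_diff[OF L2b_conv(1)[OF Kk Lg] Lg])
  have Lc: "L2b ?c" by (rule L2b_diff[OF Lg f])
  have eq: "conv (K k) f x - f x = ?a x + (?b x + ?c x)" for x
   using conv_diff_right[OF bK L2b_integrable[OF f] L2b_integrable[OF Lg]] by simp
  have ia: "integrable lborel (\<lambda>x. (?a x)^2)" and ib: "integrable lborel (\<lambda>x. (?b x)^2)" and ic: "integrable lborel (\<lambda>x. (?c x)^2)"
   using La Lb Lc by (auto simp: L2b_def)
  have A: "(LBINT x. (?a x)^2) < e / 12"
   using L2b_conv(2)[OF Kk L2b_diff[OF f Lg]] g(3) by linarith
  have C: "(LBINT x. (?c x)^2) < e / 12" using g(3) by (simp add: power2_commute)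
  have "(LBINT x. (?b x)^2) \<le> (LBINT x. \<eta>^2 * indicator (ball (0::'a) (\<bar>R\<bar> + 2)) x)"
  proof (rule integral_mono[OF ib])
   show "integrable lborel (\<lambda>x. \<eta>^2 * indicator (ball (0::'a) (\<bar>R\<bar> + 2)) x)" by (rule integrable_ball_const)
   fix x :: 'a
   show "(?b x)^2 \<le> \<eta>^2 * indicator (ball 0 (\<bar>R\<bar> + 2)) x"
   proof (cases "norm x < \<bar>R\<bar> + 2")
    case True
    have "\<bar>?b x\<bar> \<le> \<bar>\<eta>\<bar>" using conv_continuous_close[OF Kk bg L2b_integrable[OF Lg] d(2), where z=x] elim \<eta>(1) by simp
    then have "(?b x)^2 \<le> \<eta>^2" by (rule abs_le_square_iff[THEN iffD1])
    then show ?thesis using True by simp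
   next
    case False
    have "conv (K k) g x = 0"
    proof (rule ccontr)
     assume "conv (K k) g x \<noteq> 0"
     moreover have "norm y < \<bar>R\<bar> + 1" if "g y \<noteq> 0" for y using g(2)[OF that] by simp
     ultimately have "norm x < r k + (\<bar>R\<bar> + 1)"
      using conv_bounded_support[of "K k" "r k" g "\<bar>R\<bar> + 1" x] Kk by (auto simp: avg_kernel_def)
     then show False using False elim by simp
    qed
    moreover have "g x = 0" using g(2)[of x] False by fastforce
    ultimately show ?thesis by simp
   qed
  qed
  also have "\<dots> = \<eta>^2 * V" by (simp add: V_def)
  also have "\<dots> \<le> e / 12" using e V by (simp add: \<eta>(2) field_simps)
  finally have B: "(LBINT x. (?b x)^2) \<le> e / 12" .
  have "(LBINT x. (conv (K k) f x - f x)^2) \<le> (LBINT x. 2 * (?a x)^2 + (4 * (?b x)^2 + 4 * (?c x)^2))"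
  proof (rule integral_mono)
   show "integrable lborel (\<lambda>x. (conv (K k) f x - f x)^2)"
    using L2b_diff[OF L2b_conv(1)[OF Kk f] f] by (simp add: L2b_def)
   show "integrable lborel (\<lambda>x. 2 * (?a x)^2 + (4 * (?b x)^2 + 4 * (?c x)^2))" using ia ib ic by simp
   show "(conv (K k) f x - f x)^2 \<le> 2 * (?a x)^2 + (4 * (?b x)^2 + 4 * (?c x)^2)" for x
    unfolding eq using square_add_le[of "?a x" "?b x + ?c x"] square_add_le[of "?b x" "?c x"] by linarith
  qed
  also have "\<dots> = 2 * (LBINT x. (?a x)^2) + (4 * (LBINT x. (?b x)^2) + 4 * (LBINT x. (?c x)^2))"
   using ia ib ic by simp
  also have "\<dots> < e" using A B C e by linarith
  finally show ?case .
 qed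
qed

section \<open>Derivatives of convolutions\<close>

lemma frechet_derivative_basis_expand:
 fixes K :: "'a::euclidean_space => real"
 assumes "C_k (Suc k) K"
 shows "frechet_derivative K (at y) v = (\<Sum>b\<in>Basis. (v \<bullet> b) * frechet_derivative K (at y) b)"
proof -
 have l: "linear (frechet_derivative K (at y))"
  using C_k_has_derivative[OF assms] has_derivative_linear by blast
 have "frechet_derivative K (at y) (\<Sum>b\<in>Basis. (v \<bullet> b) *\<^sub>R b) = (\<Sum>b\<in>Basis. (v \<bullet> b) *\<^sub>R frechet_derivative K (at y) b)"
  by (simp add: linear_sum[OF l] linear_cmul[OF l])
 then show ?thesis unfolding euclidean_representation real_scaleR_def .
qed

definition smooth_kernel :: "('a::euclidean_space => real) => bool" where
 "smooth_kernel K \<longleftrightarrow> (\<forall>k. C_k k K) \<and> bounded {z. K z \<noteq> 0}"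

lemma derivative_zero_outside_closure:
 assumes "y \<notin> closure {z. K z \<noteq> 0}"
 shows "frechet_derivative (K::'a::euclidean_space => real) (at y) v = 0"
proof -
 have "(K has_derivative (\<lambda>h. 0)) (at y)"
  by (rule has_derivative_transform_within_open[of "\<lambda>x. 0" _ _ _ "- closure {z. K z \<noteq> 0}"])
    (use assms closure_subset[of "{z. K z \<noteq> 0}"] in auto)
 then show ?thesis by (simp add: frechet_derivative_eqI)
qed

lemma smooth_kernel_derivative:
 assumes "smooth_kernel K" "b \<in> Basis" shows "smooth_kernel (\<lambda>y. frechet_derivative K (at y) b)"
proof -
 have "C_k k (\<lambda>y. frechet_derivative K (at y) b)" for k
 proof -
  have "C_k (Suc k) K" using assms(1) unfolding smooth_kernel_def by blast
  then show ?thesis using assms(2) unfolding C_k.simps(2) by blast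
 qed
 moreover have "bounded {y. frechet_derivative K (at y) b \<noteq> 0}"
  by (rule bounded_subset[of "closure {z. K z \<noteq> 0}"])
    (use assms derivative_zero_outside_closure[of _ K b] in \<open>auto simp: smooth_kernel_def\<close>)
 ultimately show ?thesis by (simp add: smooth_kernel_def)
qed

lemma smooth_kernel_continuous: "smooth_kernel K ==> continuous_on UNIV K"
 unfolding smooth_kernel_def C_k.simps(1)[symmetric] by blast

lemma smooth_kernel_support: "smooth_kernel K ==> \<exists>R. \<forall>x. K x \<noteq> 0 --> norm x \<le> R"
 by (auto simp: smooth_kernel_def bounded_iff)

lemma smooth_kernel_bounded_borel: "smooth_kernel K ==> bounded_borel K"
 using bounded_borel_continuous[OF smooth_kernel_continuous] smooth_kernel_support by blast

text \<open>
  Differentiation under the integral sign.  The first order Taylor remainder of the kernel is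
  small uniformly, by uniform continuity of its first derivatives, so the remainder of the convolution is small
  relative to the integral of \<open>|f|\<close>.
\<close>

lemma conv_has_derivative:
 fixes f :: "'a::euclidean_space => real"
 assumes K: "smooth_kernel K" and f: "integrable lborel f"
 shows "(conv K f has_derivative (\<lambda>v. \<Sum>b\<in>Basis. (v \<bullet> b) * conv (\<lambda>y. frechet_derivative K (at y) b) f z)) (at z)"
proof -
 let ?D = "\<lambda>b y. frechet_derivative K (at y) b"
 have C: "C_k (Suc 0) K" using K by (simp add: smooth_kernel_def del: C_k.simps)
 have KD: "(K has_derivative (\<lambda>v. \<Sum>b\<in>Basis. (v \<bullet> b) * ?D b y)) (at y)" for y
 proof -
  have "frechet_derivative K (at y) = (\<lambda>v. \<Sum>b\<in>Basis. (v \<bullet> b) * ?D b y)"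
   by (rule ext, rule frechet_derivative_basis_expand[OF C])
  with C_k_has_derivative[OF C] show ?thesis by (rule has_derivative_eq_rhs)
 qed
 have iK: "integrable lborel (\<lambda>w. K (x - w) * f w)" for x
  by (rule integrable_bounded_borel_mult(2)[OF smooth_kernel_bounded_borel[OF K] f])
 have iD: "integrable lborel (\<lambda>w. ?D b (x - w) * f w)" if "b \<in> Basis" for b x
  by (rule integrable_bounded_borel_mult(2)[OF smooth_kernel_bounded_borel[OF smooth_kernel_derivative[OF K that]] f])
 define I where "I = (LBINT w. \<bar>f w\<bar>)"
 have I0: "I \<ge> 0" by (simp add: I_def)
 show ?thesis
  unfolding has_derivative_within_alt
 proof (intro conjI allI impI)
  show "bounded_linear (\<lambda>v. \<Sum>b\<in>Basis. (v \<bullet> b) * conv (?D b) f z)"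
   by (intro bounded_linear_sum bounded_linear_mult_const bounded_linear_inner_left)
  fix e :: real assume e: "e > 0"
  define e' where "e' = e / (DIM('a) * (I + 1))"
  have e': "e' > 0" using e I0 by (simp add: e'_def)
  have "\<exists>d>0. \<forall>x y. norm (x - y) < d --> \<bar>?D b x - ?D b y\<bar> < e'" if b: "b \<in> Basis" for b
  proof -
   from smooth_kernel_support[OF smooth_kernel_derivative[OF K b]]
   obtain R where R: "\<forall>x. ?D b x \<noteq> 0 --> norm x \<le> R" ..
   show ?thesis
    by (rule uniformly_continuous_bounded_support[OF smooth_kernel_continuous[OF smooth_kernel_derivative[OF K b]] R[rule_format] e'])
  qed
  then obtain d where d: "\<And>b. b \<in> Basis ==> d b > 0" "\<And>b x y. b \<in> Basis ==> norm (x - y) < d b ==> \<bar>?D b x - ?D b y\<bar> < e'"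
   by metis
  define \<delta> where "\<delta> = Min (d ` (Basis::'a set))"
  have \<delta>: "\<delta> > 0" "\<And>b. b \<in> Basis ==> \<delta> \<le> d b" using d(1) by (auto simp: \<delta>_def)
  have lin: "\<bar>K (y + h) - K y - (\<Sum>b\<in>Basis. (h \<bullet> b) * ?D b y)\<bar> \<le> norm h * (DIM('a) * e')" if h: "norm h < \<delta>" for y h
  proof -
   have "norm (K (y + h) - K y - (\<Sum>b\<in>Basis. (((y + h) - y) \<bullet> b) * ?D b y)) \<le> norm ((y + h) - y) * (DIM('a) * e')"
   proof (rule differentiable_bound_linearization[where S="ball y \<delta>" and f'="\<lambda>y v. \<Sum>b\<in>Basis. (v \<bullet> b) * ?D b y"])
    show "y + t *\<^sub>R (y + h - y) \<in> ball y \<delta>" if t: "t \<in> {0..1}" for t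
    proof -
     have "norm (t *\<^sub>R h) \<le> 1 * norm h" using t by (auto intro: mult_left_le_one_le)
     then show ?thesis using h by (simp add: dist_norm)
    qed
    show "(K has_derivative (\<lambda>v. \<Sum>b\<in>Basis. (v \<bullet> b) * ?D b x)) (at x within ball y \<delta>)" for x
     by (rule has_derivative_at_withinI[OF KD])
    show "y \<in> ball y \<delta>" using \<delta> by simp
    fix x assume x: "x \<in> ball y \<delta>"
    show "onorm ((\<lambda>v. \<Sum>b\<in>Basis. (v \<bullet> b) * ?D b x) - (\<lambda>v. \<Sum>b\<in>Basis. (v \<bullet> b) * ?D b y)) \<le> DIM('a) * e'"
    proof (rule onorm_le)
     fix v :: 'a
     have "norm (((\<lambda>v. \<Sum>b\<in>Basis. (v \<bullet> b) * ?D b x) - (\<lambda>v. \<Sum>b\<in>Basis. (v \<bullet> b) * ?D b y)) v)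
      = \<bar>\<Sum>b\<in>Basis. (v \<bullet> b) * (?D b x - ?D b y)\<bar>"
      by (simp add: right_diff_distrib sum_subtractf)
     also have "\<dots> \<le> (\<Sum>b\<in>Basis. \<bar>(v \<bullet> b) * (?D b x - ?D b y)\<bar>)" by (rule sum_abs)
     also have "\<dots> \<le> (\<Sum>b\<in>(Basis::'a set). norm v * e')"
     proof (rule sum_mono)
      fix b :: 'a assume b: "b \<in> Basis"
      have "norm (x - y) < d b" using x \<delta>(2)[OF b] by (simp add: dist_norm norm_minus_commute)
      then have "\<bar>?D b x - ?D b y\<bar> \<le> e'" using d(2)[OF b, of x y] by linarith
      moreover have "\<bar>v \<bullet> b\<bar> \<le> norm v" using Basis_le_norm[OF b] by auto
      ultimately show "\<bar>(v \<bullet> b) * (?D b x - ?D b y)\<bar> \<le> norm v * e'"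
       unfolding abs_mult by (intro mult_mono) auto
     qed
     also have "\<dots> = DIM('a) * e' * norm v" by simp
     finally show "norm (((\<lambda>v. \<Sum>b\<in>Basis. (v \<bullet> b) * ?D b x) - (\<lambda>v. \<Sum>b\<in>Basis. (v \<bullet> b) * ?D b y)) v) \<le> DIM('a) * e' * norm v" .
    qed
   qed
   then show ?thesis by simp
  qed
  show "\<exists>d>0. \<forall>y\<in>UNIV. norm (y - z) < d -->
    norm (conv K f y - conv K f z - (\<Sum>b\<in>Basis. ((y - z) \<bullet> b) * conv (?D b) f z)) \<le> e * norm (y - z)"
  proof (intro exI[of _ \<delta>] conjI ballI impI)
   fix y assume y: "norm (y - z) < \<delta>"
   define h where "h = y - z"
   let ?F = "\<lambda>w. (K (z - w + h) - K (z - w) - (\<Sum>b\<in>Basis. (h \<bullet> b) * ?D b (z - w))) * f w"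
   have Feq: "?F w = K (y - w) * f w - K (z - w) * f w - (\<Sum>b\<in>Basis. (h \<bullet> b) * (?D b (z - w) * f w))" for w
   proof -
    have "z - w + h = y - w" by (simp add: h_def)
    then have "K (z - w + h) = K (y - w)" by (rule arg_cong)
    then show ?thesis by (simp only: left_diff_distrib sum_distrib_right mult.assoc)
   qed
   have iF: "integrable lborel ?F" unfolding Feq using iK iD by auto
   have "(LBINT w. ?F w) = conv K f y - conv K f z - (\<Sum>b\<in>Basis. (h \<bullet> b) * conv (?D b) f z)"
    unfolding Feq conv_def using iK iD by (simp add: Bochner_Integration.integral_sum)
   moreover have "\<bar>\<integral>w. ?F w \<partial>lborel\<bar> \<le> (LBINT w. norm h * (DIM('a) * e') * \<bar>f w\<bar>)"
   proof (rule integral_abs_bound_integral[OF iF])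
    show "\<bar>?F w\<bar> \<le> norm h * (DIM('a) * e') * \<bar>f w\<bar>" for w
     unfolding abs_mult using y by (intro mult_right_mono lin) (auto simp: h_def)
   qed (use f in simp)
   moreover have "(LBINT w. norm h * (DIM('a) * e') * \<bar>f w\<bar>) = norm h * (e * (I / (I + 1)))"
    using I0 by (simp add: I_def[symmetric] e'_def)
   moreover have "norm h * (e * (I / (I + 1))) \<le> norm h * (e * 1)"
    using I0 e by (intro mult_left_mono) auto
   ultimately show "norm (conv K f y - conv K f z - (\<Sum>b\<in>Basis. ((y - z) \<bullet> b) * conv (?D b) f z)) \<le> e * norm (y - z)"
    by (simp add: h_def mult.commute)
  qed (rule \<delta>(1))
 qed
qed

lemma conv_continuous:
 assumes "smooth_kernel K" "integrable lborel f" shows "continuous_on UNIV (conv K f)"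
 using conv_has_derivative[OF assms] has_derivative_continuous continuous_at_imp_continuous_on by blast

section \<open>Weak solutions of an equation in divergence form\<close>

lemma integral_shift:
 fixes f :: "'a::euclidean_space => real"
 assumes [measurable]: "f \<in> borel_measurable borel"
 shows "(LBINT w. f (w + z)) = integral\<^sup>L lborel f"
proof -
 have "integral\<^sup>L (distr lborel borel ((+) z)) f = (LBINT w. f (z + w))"
  by (rule integral_distr) auto
 then show ?thesis by (simp add: lborel_distr_plus add.commute)
qed

lemma integrable_shift:
 fixes f :: "'a::euclidean_space => real"
 assumes "integrable lborel f"
 shows "integrable lborel (\<lambda>w. f (w + z))"
proof -
 have "integrable (distr lborel borel ((+) z)) f" using assms by (simp add: lborel_distr_plus)
 then show ?thesis by (subst (asm) integrable_distr_eq) (use assms in \<open>auto simp: add.commute\<close>)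
qed

text \<open>
  The difference quotients of \<open>f\<close> in direction \<open>b\<close> have integral zero by translation invariance
  and converge boundedly, within a bounded set, to the derivative.
\<close>

lemma integral_derivative_zero:
 fixes f :: "'a::euclidean_space => real"
 assumes d: "\<And>z. (f has_derivative f' z) (at z)" and c: "continuous_on UNIV (\<lambda>z. f' z b)"
  and R: "\<And>z. f z \<noteq> 0 ==> norm z \<le> R"
 shows "(LBINT z. f' z b) = 0"
proof -
 have fc: "continuous_on UNIV f" by (intro continuous_at_imp_continuous_on ballI has_derivative_continuous[OF d])
 have f'0: "norm z \<le> R" if "f' z b \<noteq> 0" for z
 proof (rule ccontr)
  assume a: "\<not> norm z \<le> R"
  have o: "open {z. R < norm z}" by (intro open_Collect_less continuous_intros)
  have "(f has_derivative (\<lambda>h. 0)) (at z)"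
   by (rule has_derivative_transform_within_open[of "\<lambda>x. 0" _ _ _ "{z. R < norm z}"])
     (use a R o in \<open>force+\<close>)
  from has_derivative_unique[OF d this] have "f' z = (\<lambda>h. 0)" .
  then show False using that by simp
 qed
 have "bounded_borel (\<lambda>z. f' z b)" by (rule bounded_borel_continuous[OF c f'0])
 then obtain M where M: "\<And>z. \<bar>f' z b\<bar> \<le> M" by (auto simp: bounded_borel_def)
 have M0: "M \<ge> 0" using M[of 0] by linarith
 have fi: "integrable lborel f"
  by (rule integrable_continuous_bounded_support[OF fc, of "cball 0 R"]) (use R in auto)
 note [measurable] = borel_measurable_integrable[OF fi]
 have fsi: "integrable lborel (\<lambda>z. f (z + y))" for y by (rule integrable_shift[OF fi])
 define t where "t k = inverse (real (Suc k))" for k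
 have t: "t k > 0" "t k \<le> 1" for k by (auto simp: t_def inverse_le_1_iff)
 define q where "q k z = (f (z + t k *\<^sub>R b) - f z) / t k" for k z
 have q0: "(LBINT z. q k z) = 0" for k
  unfolding q_def using fsi[of "t k *\<^sub>R b"] fi integral_shift[of f "t k *\<^sub>R b"] by simp
 have line: "((\<lambda>s. f (z + s *\<^sub>R b)) has_field_derivative f' (z + s *\<^sub>R b) b) (at s)" for z s
 proof -
  have l: "linear (f' (z + s *\<^sub>R b))" by (rule has_derivative_linear[OF d])
  have "((\<lambda>s. f (z + s *\<^sub>R b)) has_derivative (\<lambda>h. f' (z + s *\<^sub>R b) (h *\<^sub>R b))) (at s)"
   by (rule has_derivative_compose[where f="\<lambda>s. z + s *\<^sub>R b" and g=f, OF _ d]) (auto intro!: derivative_eq_intros)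
  moreover have "(\<lambda>h. f' (z + s *\<^sub>R b) (h *\<^sub>R b)) = (*) (f' (z + s *\<^sub>R b) b)"
   by (simp add: linear_cmul[OF l] fun_eq_iff)
  ultimately show ?thesis by (simp add: has_field_derivative_def)
 qed
 have "(\<lambda>k. \<integral>z. q k z \<partial>lborel) \<longlonglongrightarrow> (LBINT z. f' z b)"
 proof (rule integral_dominated_convergence[where w="\<lambda>z. M * indicator (ball 0 (R + norm b + 1)) z"])
  show "integrable lborel (\<lambda>z::'a. M * indicator (ball 0 (R + norm b + 1)) z)" by (rule integrable_ball_const)
  show "(\<lambda>z. f' z b) \<in> borel_measurable lborel" using c by (simp add: borel_measurable_continuous_onI)
  show "q k \<in> borel_measurable lborel" for k unfolding q_def by measurable
  have tl: "t \<longlonglongrightarrow> 0" unfolding t_def by (rule LIMSEQ_inverse_real_of_nat)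
  show "AE z in lborel. (\<lambda>k. q k z) \<longlonglongrightarrow> f' z b"
  proof (rule AE_I2)
   fix z
   have "((\<lambda>h. (f (z + (0 + h) *\<^sub>R b) - f (z + 0 *\<^sub>R b)) / h) \<longlongrightarrow> f' (z + 0 *\<^sub>R b) b) (at 0)"
    using line[of z 0] unfolding DERIV_def by simp
   moreover have "filterlim t (at 0) sequentially" unfolding filterlim_at using tl t(1) by (auto simp: less_imp_neq[symmetric])
   ultimately show "(\<lambda>k. q k z) \<longlonglongrightarrow> f' z b"
    using filterlim_compose[of "\<lambda>h. (f (z + (0 + h) *\<^sub>R b) - f (z + 0 *\<^sub>R b)) / h" _ "at 0" t sequentially] by (simp add: q_def)
  qed
  fix k
  show "AE z in lborel. norm (q k z) \<le> M * indicator (ball 0 (R + norm b + 1)) z"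
  proof (rule AE_I2)
   fix z
   show "norm (q k z) \<le> M * indicator (ball 0 (R + norm b + 1)) z"
   proof (cases "norm z < R + norm b + 1")
    case True
    obtain s where "f (z + t k *\<^sub>R b) - f (z + 0 *\<^sub>R b) = (t k - 0) * f' (z + s *\<^sub>R b) b"
     using MVT2[OF t(1)[of k], of "\<lambda>s. f (z + s *\<^sub>R b)" "\<lambda>s. f' (z + s *\<^sub>R b) b"] line by blast
    then have "q k z = f' (z + s *\<^sub>R b) b" using t(1)[of k] by (simp add: q_def)
    then show ?thesis using M True by simp
   next
    case False
    have "norm (t k *\<^sub>R b) \<le> norm b" using t[of k] by (simp add: mult_left_le_one_le)
    moreover have "norm z \<le> norm (z + t k *\<^sub>R b) + norm (t k *\<^sub>R b)"
     using norm_triangle_ineq4[of "z + t k *\<^sub>R b" "t k *\<^sub>R b"] by simp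
    ultimately have "R < norm (z + t k *\<^sub>R b)" "R < norm z" using False norm_ge_zero[of b] by linarith+
    then have "f z = 0" "f (z + t k *\<^sub>R b) = 0" using R by fastforce+
    then show ?thesis using M0 by (simp add: q_def)
   qed
  qed
 qed
 then show ?thesis unfolding q0 by (simp add: LIMSEQ_const_iff)
qed

text \<open>
  If both factors converge in \<open>L2\<close>, their product converges in \<open>L1\<close>.
\<close>

lemma L2_limit_product:
 fixes a b :: "'a::euclidean_space => real"
 assumes w: "bounded_borel w" and a: "L2b a" "\<And>k. L2b (a' k)" "(\<lambda>k. \<integral>x. (a' k x - a x)^2 \<partial>lborel) \<longlonglongrightarrow> 0"
  and b: "L2b b" "\<And>k. L2b (b' k)" "(\<lambda>k. \<integral>x. (b' k x - b x)^2 \<partial>lborel) \<longlonglongrightarrow> 0"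
 shows "(\<lambda>k. \<integral>x. w x * (a' k x * b' k x) \<partial>lborel) \<longlonglongrightarrow> (LBINT x. w x * (a x * b x))"
proof (rule tendstoI)
 fix \<epsilon> :: real assume \<epsilon>: "\<epsilon> > 0"
 obtain W0 where W0: "\<And>x. \<bar>w x\<bar> \<le> W0" using w by (auto simp: bounded_borel_def)
 define W where "W = \<bar>W0\<bar> + 1"
 have W: "W > 0" "\<And>x. \<bar>w x\<bar> \<le> W" using order_trans[OF W0, of W] by (auto simp: W_def)
 define S where "S = (LBINT x. (a x)^2 + (b x)^2)"
 have S: "S \<ge> 0" by (simp add: S_def)
 define \<delta> where "\<delta> = \<epsilon> / (2 * W * (S + 1))"
 have \<delta>: "\<delta> > 0" "W * \<delta> * S < \<epsilon> / 2 + \<epsilon> / 4"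
 proof -
  show "\<delta> > 0" using \<epsilon> W S by (simp add: \<delta>_def)
  have "W * \<delta> * S = \<epsilon> / 2 * (S / (S + 1))" using W S by (simp add: \<delta>_def)
  also have "\<dots> \<le> \<epsilon> / 2 * 1" using \<epsilon> S by (intro mult_left_mono) auto
  finally show "W * \<delta> * S < \<epsilon> / 2 + \<epsilon> / 4" using \<epsilon> by simp
 qed
 define E where "E k = (LBINT x. (a' k x - a x)^2) + (LBINT x. (b' k x - b x)^2)" for k
 have "(\<lambda>k. W * (1 + 1 / \<delta>) * E k) \<longlonglongrightarrow> W * (1 + 1 / \<delta>) * (0 + 0)"
  unfolding E_def by (intro tendsto_intros a b)
 then have "\<forall>\<^sub>F k in sequentially. W * (1 + 1 / \<delta>) * E k < \<epsilon> / 4" using \<epsilon> by (intro order_tendstoD(2)[where y=0]) auto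
 then show "\<forall>\<^sub>F k in sequentially. dist (LBINT x. w x * (a' k x * b' k x)) (LBINT x. w x * (a x * b x)) < \<epsilon>"
 proof eventually_elim
  case (elim k)
  let ?e = "\<lambda>x. a' k x - a x" and ?f = "\<lambda>x. b' k x - b x"
  have i: "integrable lborel (\<lambda>x. w x * (a' k x * b' k x))" "integrable lborel (\<lambda>x. w x * (a x * b x))"
   by (intro integrable_bounded_borel_mult(1)[OF w] L2b_mult_integrable a b)+
  have ie: "integrable lborel (\<lambda>x. (?e x)^2)" "integrable lborel (\<lambda>x. (?f x)^2)" "integrable lborel (\<lambda>x. (a x)^2)" "integrable lborel (\<lambda>x. (b x)^2)"
   using L2b_diff[OF a(2) a(1), of k] L2b_diff[OF b(2) b(1), of k] a(1) b(1) by (auto simp: L2b_def)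
  have pt: "\<bar>y * z\<bar> \<le> \<delta> * y^2 + z^2 / \<delta>" for y z
  proof -
   have "\<bar>(sqrt \<delta> * y) * (z / sqrt \<delta>)\<bar> \<le> (sqrt \<delta> * y)^2 + (z / sqrt \<delta>)^2" by (rule abs_mult_le_sum_squares)
   then show ?thesis using \<delta>(1) by (simp add: power_mult_distrib power_divide)
  qed
  have "\<bar>w x * (a' k x * b' k x) - w x * (a x * b x)\<bar> \<le> W * (\<delta> * ((a x)^2 + (b x)^2) + (1 + 1 / \<delta>) * ((?e x)^2 + (?f x)^2))" for x
  proof -
   have "a' k x * b' k x - a x * b x = ?e x * ?f x + a x * ?f x + b x * ?e x" by (simp add: algebra_simps)
   then have "\<bar>a' k x * b' k x - a x * b x\<bar> \<le> \<bar>?e x * ?f x\<bar> + \<bar>a x * ?f x\<bar> + \<bar>b x * ?e x\<bar>" by linarith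
   also have "\<dots> \<le> ((?e x)^2 + (?f x)^2) + (\<delta> * (a x)^2 + (?f x)^2 / \<delta>) + (\<delta> * (b x)^2 + (?e x)^2 / \<delta>)"
    using abs_mult_le_sum_squares[of "?e x" "?f x"] pt[of "a x" "?f x"] pt[of "b x" "?e x"] by linarith
   also have "\<dots> = \<delta> * ((a x)^2 + (b x)^2) + (1 + 1 / \<delta>) * ((?e x)^2 + (?f x)^2)"
    by (simp add: distrib_left distrib_right add_divide_distrib)
   finally have "\<bar>w x\<bar> * \<bar>a' k x * b' k x - a x * b x\<bar> \<le> W * (\<delta> * ((a x)^2 + (b x)^2) + (1 + 1 / \<delta>) * ((?e x)^2 + (?f x)^2))"
    using W by (intro mult_mono) auto
   then show ?thesis by (simp add: abs_mult[symmetric] right_diff_distrib)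
  qed
  then have "\<bar>\<integral>x. w x * (a' k x * b' k x) - w x * (a x * b x) \<partial>lborel\<bar>
   \<le> (LBINT x. W * (\<delta> * ((a x)^2 + (b x)^2) + (1 + 1 / \<delta>) * ((?e x)^2 + (?f x)^2)))"
   using i ie by (intro integral_abs_bound_integral) auto
  also have "\<dots> = W * (\<delta> * S + (1 + 1 / \<delta>) * E k)" using ie by (simp add: S_def E_def)
  also have "\<dots> = W * \<delta> * S + W * (1 + 1 / \<delta>) * E k" by (rule trans[OF distrib_left]) (simp only: mult.assoc)
  also have "\<dots> < \<epsilon>" using elim \<delta>(2) by linarith
  finally show ?case using i by (simp add: dist_real_def)
 qed
qed

abbreviation dx :: "'n::finite => (real ^ 'n) \<times> real" where "dx j \<equiv> (axis j 1, 0)"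

abbreviation dt :: "(real ^ 'n) \<times> real" where "dt \<equiv> (0, 1)"

lemma dx_Basis: "dx j \<in> Basis" by (auto simp: Basis_prod_def Basis_vec_def)

lemma dt_Basis: "dt \<in> Basis" by (auto simp: Basis_prod_def)

text \<open>
  The weak form of the two statements that \<open>D\<close> is the spatial gradient of \<open>u\<close> and that \<open>u_t\<close> is
  the divergence of \<open>G\<close>, for one component \<open>u\<close>.
\<close>

definition flux_solution ::
  "((real ^ 'n) \<times> real) set => ((real ^ 'n) \<times> real => real) => ('n => (real ^ 'n) \<times> real => real) =>
   ('n => (real ^ 'n) \<times> real => real) => bool" where
 "flux_solution P u D G \<longleftrightarrow> L2b u \<and> (\<forall>j. L2b (D j)) \<and> (\<forall>j. L2b (G j)) \<and>
   (\<forall>\<psi>. test_function P \<psi> -->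
    (\<forall>j. (LBINT w. u w * frechet_derivative \<psi> (at w) (dx j)) = - (LBINT w. D j w * \<psi> w)) \<and>
    (LBINT w. u w * frechet_derivative \<psi> (at w) dt) =
     (\<Sum>j\<in>UNIV. \<integral>w. G j w * frechet_derivative \<psi> (at w) (dx j) \<partial>lborel))"

lemma reflect_derivative:
 assumes "smooth_kernel K"
 shows "frechet_derivative (\<lambda>w. K (z - w)) (at w) b = - frechet_derivative K (at (z - w)) b"
proof -
 have C: "C_k (Suc 0) K" using assms by (simp add: smooth_kernel_def del: C_k.simps)
 have l: "linear (frechet_derivative K (at (z - w)))" by (rule has_derivative_linear[OF C_k_has_derivative[OF C]])
 have "((\<lambda>w. K (z - w)) has_derivative (\<lambda>h. frechet_derivative K (at (z - w)) (- h))) (at w)"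
  by (rule has_derivative_compose[where f="\<lambda>w. z - w" and g=K, OF _ C_k_has_derivative[OF C]])
    (auto intro!: derivative_eq_intros)
 then show ?thesis by (simp add: frechet_derivative_eqI linear_neg[OF l])
qed

text \<open>
  The function \<open>w \<mapsto> K (z - w)\<close> is an admissible test function as soon as its support lies in
  \<open>P\<close>.  Reflection changes the sign of the derivative, which turns the weak formulation into these
  pointwise identities.
\<close>

lemma mollified_flux_equations:
 fixes K :: "(real ^ 'n) \<times> real => real"
 assumes sol: "flux_solution P u D G" and K: "smooth_kernel K" and P: "closure {w. K (z - w) \<noteq> 0} \<subseteq> P"
 shows "conv (\<lambda>y. frechet_derivative K (at y) (dx j)) u z = conv K (D j) z"
  and "conv (\<lambda>y. frechet_derivative K (at y) dt) u z = (\<Sum>j\<in>UNIV. conv (\<lambda>y. frechet_derivative K (at y) (dx j)) (G j) z)"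
proof -
 obtain R where R: "\<And>y. K y \<noteq> 0 ==> norm y \<le> R" using smooth_kernel_support[OF K] by auto
 have "bounded {w. K (z - w) \<noteq> 0}"
 proof (rule boundedI)
  fix w assume "w \<in> {w. K (z - w) \<noteq> 0}"
  then have "norm (z - w) \<le> R" using R by auto
  then show "norm w \<le> norm z + R" using norm_triangle_sub[of w z] by (simp add: norm_minus_commute)
 qed
 then have "test_function P (\<lambda>w. K (z - w))"
  using K P by (auto simp: test_function_def compactly_contained_def compact_closure smooth_kernel_def intro: C_k_reflect[of _ K z])
 then have
  "(LBINT w. u w * frechet_derivative (\<lambda>w. K (z - w)) (at w) (dx j)) = - (LBINT w. D j w * K (z - w))"
  "(LBINT w. u w * frechet_derivative (\<lambda>w. K (z - w)) (at w) dt) =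
     (\<Sum>j\<in>UNIV. \<integral>w. G j w * frechet_derivative (\<lambda>w. K (z - w)) (at w) (dx j) \<partial>lborel)"
  using sol unfolding flux_solution_def by blast+
 then show "conv (\<lambda>y. frechet_derivative K (at y) (dx j)) u z = conv K (D j) z"
  and "conv (\<lambda>y. frechet_derivative K (at y) dt) u z = (\<Sum>j\<in>UNIV. conv (\<lambda>y. frechet_derivative K (at y) (dx j)) (G j) z)"
  by (simp_all add: reflect_derivative[OF K] conv_def mult.commute sum_negf)
qed

section \<open>The energy identity\<close>

lemma parabolic_kernel_props:
 fixes K :: "(real ^ 'n) \<times> real => real"
 assumes "s > 0" "\<forall>k. C_k k K" "\<forall>z. 0 \<le> K z" "\<forall>z. K z \<noteq> 0 --> norm (fst z) < s \<and> \<bar>snd z\<bar> < s^2"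
  "integrable lborel K" "integral\<^sup>L lborel K = 1"
 shows "smooth_kernel K" "avg_kernel (s + s^2) K"
proof -
 have n: "norm z < s + s^2" if "K z \<noteq> 0" for z
  using assms(4)[rule_format, OF that] norm_Pair_le[of "fst z" "snd z"] by simp
 have "bounded {z. K z \<noteq> 0}" by (rule boundedI[of _ "s + s^2"]) (simp add: less_imp_le[OF n])
 then show sm: "smooth_kernel K" using assms(2) by (simp add: smooth_kernel_def)
 show "avg_kernel (s + s^2) K"
  using assms n smooth_kernel_bounded_borel[OF sm] by (simp add: avg_kernel_def)
qed

text \<open>
  A kernel of parabolic scale \<open>s\<close> lives in a ball of radius \<open>s + s\<^sup>2\<close>; scales tending to zero give the
  sequence.
\<close>

lemma mollifier_sequence:
 "\<exists>(K :: nat => (real ^ 'n) \<times> real => real) r. (\<forall>k. smooth_kernel (K k)) \<and> (\<forall>k. avg_kernel (r k) (K k)) \<and> r \<longlonglongrightarrow> 0"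
proof -
 define s where "s k = inverse (real (Suc k))" for k
 have s: "s k > 0" for k by (simp add: s_def)
 have sl: "s \<longlonglongrightarrow> 0" unfolding s_def by (rule LIMSEQ_inverse_real_of_nat)
 obtain C :: real where C: "\<forall>s>0. \<exists>K :: (real ^ 'n) \<times> real => real. (\<forall>k. C_k k K) \<and> (\<forall>z. 0 \<le> K z) \<and>
   (\<forall>z. K z \<noteq> 0 --> norm (fst z) < s \<and> \<bar>snd z\<bar> < s^2) \<and> integrable lborel K \<and> integral\<^sup>L lborel K = 1 \<and>
   (\<forall>z. K z \<le> C / s ^ (CARD('n) + 2)) \<and>
   (\<forall>z j. \<bar>frechet_derivative K (at z) (axis j 1, 0)\<bar> \<le> C / s ^ (CARD('n) + 3))"
  using parabolic_kernel_exists by blast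
 have "\<exists>K :: (real ^ 'n) \<times> real => real. smooth_kernel K \<and> avg_kernel (s k + (s k)^2) K" for k
 proof -
  obtain K :: "(real ^ 'n) \<times> real => real" where "\<forall>k. C_k k K" "\<forall>z. 0 \<le> K z"
   "\<forall>z. K z \<noteq> 0 --> norm (fst z) < s k \<and> \<bar>snd z\<bar> < (s k)^2" "integrable lborel K" "integral\<^sup>L lborel K = 1"
   using C[rule_format, OF s[of k]] by (elim exE conjE) (rule that)
  from parabolic_kernel_props[OF s this] show ?thesis by blast
 qed
 then have "\<exists>K :: nat => (real ^ 'n) \<times> real => real. \<forall>k. smooth_kernel (K k) \<and> avg_kernel (s k + (s k)^2) (K k)"
  by (intro choice allI)
 then obtain K :: "nat => (real ^ 'n) \<times> real => real" where K: "\<forall>k. smooth_kernel (K k) \<and> avg_kernel (s k + (s k)^2) (K k)" ..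
 have "(\<lambda>k. s k + (s k)^2) \<longlonglongrightarrow> 0 + 0^2" by (intro tendsto_intros sl)
 then show ?thesis by (intro exI[of _ K] exI[of _ "\<lambda>k. s k + (s k)^2"]) (use K in simp)
qed

lemma conv_partial:
 assumes "b \<in> Basis"
 shows "(\<Sum>b'\<in>Basis. (b \<bullet> b') * F b') = (F b :: real)"
proof -
 have "(\<Sum>b'\<in>Basis. (b \<bullet> b') * F b') = (\<Sum>b'\<in>Basis. if b' = b then F b else 0)"
  using assms by (intro sum.cong) (auto simp: inner_Basis)
 then show ?thesis using assms by simp
qed

text \<open>
  Formally: multiply the equation by \<open>\<zeta> u\<close> and integrate by parts.  The convolutions of \<open>u\<close> are smooth
  near the support of \<open>\<zeta>\<close> and satisfy the equation there, so the identity holds for them.  All integrands are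
  products of a bounded function and two functions that converge in \<open>L2\<close>, so the identity survives the
  limit.  The left side contains no derivative of \<open>u\<close> in time.
\<close>

lemma flux_energy_identity:
 fixes \<zeta> :: "(real ^ 'n) \<times> real => real"
 assumes sol: "flux_solution P u D G" and P: "open P"
  and d\<zeta>: "\<And>z. (\<zeta> has_derivative \<zeta>' z) (at z)" and c\<zeta>: "\<And>b. b \<in> Basis ==> continuous_on UNIV (\<lambda>z. \<zeta>' z b)"
  and C: "compact C" "C \<subseteq> P" "\<And>z. \<zeta> z \<noteq> 0 ==> z \<in> C"
 shows "(1/2) * (LBINT z. \<zeta>' z dt * (u z * u z))
  = (\<Sum>j\<in>UNIV. (LBINT z. \<zeta> z * (D j z * G j z)) + (LBINT z. \<zeta>' z (dx j) * (u z * G j z)))"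
proof -
 have Lu: "L2b u" and LD: "\<And>j. L2b (D j)" and LG: "\<And>j. L2b (G j)" using sol by (auto simp: flux_solution_def)
 have \<zeta>c: "continuous_on UNIV \<zeta>" by (intro continuous_at_imp_continuous_on ballI has_derivative_continuous[OF d\<zeta>])
 obtain R where R: "\<And>z. z \<in> C ==> norm z \<le> R" using compact_imp_bounded[OF C(1)] by (auto simp: bounded_iff)
 have \<zeta>R: "norm z \<le> R" if "\<zeta> z \<noteq> 0" for z using R C(3) that by blast
 have \<zeta>'0: "z \<in> C" if "\<zeta>' z b \<noteq> 0" for z b
 proof (rule ccontr)
  assume a: "z \<notin> C"
  have "(\<zeta> has_derivative (\<lambda>h. 0)) (at z)"
   by (rule has_derivative_transform_within_open[of "\<lambda>x. 0" _ _ _ "- C"])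
     (use a C(3) compact_imp_closed[OF C(1)] in auto)
  from has_derivative_unique[OF d\<zeta> this] show False using that by simp
 qed
 have Z1: "z \<in> C" if "\<zeta>' z b * x \<noteq> 0" for z b x
  by (rule \<zeta>'0[of z b]) (use that in simp)
 have Z2: "z \<in> C" if "\<zeta> z * x \<noteq> 0" for z x
  by (rule C(3)) (use that in simp)
 have bb\<zeta>: "bounded_borel \<zeta>" by (rule bounded_borel_continuous[OF \<zeta>c \<zeta>R])
 have bb\<zeta>': "bounded_borel (\<lambda>z. \<zeta>' z b)" if "b \<in> Basis" for b
  by (rule bounded_borel_continuous[OF c\<zeta>[OF that], of R]) (erule R[OF \<zeta>'0])
 obtain e where e0: "e > 0" "(\<Union>x\<in>C. ball x e) \<subseteq> P"
  by (rule compact_subset_open_imp_ball_epsilon_subset[OF C(1) P C(2)])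
 have e: "e > 0" "\<And>x. x \<in> C ==> ball x e \<subseteq> P" using e0 by (simp_all add: UN_subset_iff)
 obtain K :: "nat => (real ^ 'n) \<times> real => real" and r where
  K': "\<forall>k. smooth_kernel (K k)" "\<forall>k. avg_kernel (r k) (K k)" and r: "r \<longlonglongrightarrow> 0"
  using mollifier_sequence by (elim exE conjE) (rule that)
 note K = K'(1)[rule_format] K'(2)[rule_format]
 note cK = conv_has_derivative[OF K(1)] and cc = conv_continuous[OF K(1)]
 have cc': "continuous_on UNIV (conv (\<lambda>y. frechet_derivative (K k) (at y) b) f)" if "b \<in> Basis" "integrable lborel f" for k b f
  by (rule conv_continuous[OF smooth_kernel_derivative[OF K(1) that(1)] that(2)])
 have Iu: "integrable lborel u" and IG: "\<And>j. integrable lborel (G j)" using L2b_integrable Lu LG by auto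
 have cs: "integrable lborel f" if "continuous_on UNIV f" "\<And>z. f z \<noteq> 0 ==> z \<in> C" for f :: "(real ^ 'n) \<times> real => real"
  by (rule integrable_continuous_bounded_support[OF that(1,2) compact_imp_bounded[OF C(1)]])
 \<comment> \<open>The identity for the mollified functions, at scales so small that the kernels stay inside \<open>P\<close>.\<close>
 let ?pd = "\<lambda>k b y. frechet_derivative (K k) (at y) b"
 have E: "(1/2) * (LBINT z. \<zeta>' z dt * (conv (K k) u z * conv (K k) u z))
   = (\<Sum>j\<in>UNIV. (LBINT z. \<zeta> z * (conv (K k) (D j) z * conv (K k) (G j) z)) + (LBINT z. \<zeta>' z (dx j) * (conv (K k) u z * conv (K k) (G j) z)))"
  if rk: "r k < e" for k
 proof -
  let ?v = "conv (K k) u" and ?g = "\<lambda>j. conv (K k) (G j)"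
  let ?vt = "conv (?pd k dt) u" and ?vx = "\<lambda>j. conv (?pd k (dx j)) u" and ?gx = "\<lambda>j. conv (?pd k (dx j)) (G j)"
  have cl: "closure {w. K k (z - w) \<noteq> 0} \<subseteq> P" if "z \<in> C" for z
  proof -
   have "{w. K k (z - w) \<noteq> 0} \<subseteq> cball z (r k)"
   proof
    fix w assume "w \<in> {w. K k (z - w) \<noteq> 0}"
    then have "norm (z - w) < r k" using K(2)[of k] unfolding avg_kernel_def by blast
    then show "w \<in> cball z (r k)" by (simp add: dist_norm)
   qed
   then have "closure {w. K k (z - w) \<noteq> 0} \<subseteq> cball z (r k)" by (rule closure_minimal) simp
   also have "\<dots> \<subseteq> ball z e" using rk by (auto simp: subset_iff)
   finally show ?thesis using e(2)[OF that] by blast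
  qed
  note me = mollified_flux_equations[OF sol K(1) cl]
  have cont: "continuous_on UNIV ?v" "continuous_on UNIV ?vt" "\<And>j. continuous_on UNIV (?vx j)"
   "\<And>j. continuous_on UNIV (?g j)" "\<And>j. continuous_on UNIV (?gx j)"
   by (intro cc cc' Iu IG dx_Basis dt_Basis)+
  have dv: "(?v has_derivative (\<lambda>h. \<Sum>b\<in>Basis. (h \<bullet> b) * conv (?pd k b) u z)) (at z)" for z by (rule cK[OF Iu])
  have dg: "(?g j has_derivative (\<lambda>h. \<Sum>b\<in>Basis. (h \<bullet> b) * conv (?pd k b) (G j) z)) (at z)" for z j by (rule cK[OF IG])
  note ci = continuous_on_mult continuous_on_add \<zeta>c c\<zeta>[OF dx_Basis] c\<zeta>[OF dt_Basis] cont
  have T: "(LBINT z. \<zeta>' z dt * (?v z * ?v z) + \<zeta> z * (2 * (?v z * ?vt z))) = 0"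
  proof -
   let ?f' = "\<lambda>z h. \<zeta> z * (?v z * (\<Sum>b\<in>Basis. (h \<bullet> b) * conv (?pd k b) u z) + (\<Sum>b\<in>Basis. (h \<bullet> b) * conv (?pd k b) u z) * ?v z) + \<zeta>' z h * (?v z * ?v z)"
   have eq: "?f' z dt = \<zeta>' z dt * (?v z * ?v z) + \<zeta> z * (2 * (?v z * ?vt z))" for z
    unfolding conv_partial[OF dt_Basis, of "\<lambda>b. conv (?pd k b) u z"] by (simp only: distrib_left mult_2 add_ac mult_ac)
   have "(LBINT z. ?f' z dt) = 0"
   proof (rule integral_derivative_zero[where f'="?f'" and b=dt and R=R and f="\<lambda>z. \<zeta> z * (?v z * ?v z)"])
    show "((\<lambda>z. \<zeta> z * (?v z * ?v z)) has_derivative ?f' z) (at z)" for z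
     by (intro has_derivative_mult d\<zeta> dv)
    show "continuous_on UNIV (\<lambda>z. ?f' z dt)" unfolding eq by (intro ci continuous_on_const)
    show "norm z \<le> R" if "\<zeta> z * (?v z * ?v z) \<noteq> 0" for z by (rule \<zeta>R) (use that in simp)
   qed
   then show ?thesis unfolding eq .
  qed
  have X: "(LBINT z. \<zeta>' z (dx j) * (?v z * ?g j z) + \<zeta> z * (?vx j z * ?g j z) + \<zeta> z * (?v z * ?gx j z)) = 0" for j
  proof -
   let ?f' = "\<lambda>z h. \<zeta> z * (?v z * (\<Sum>b\<in>Basis. (h \<bullet> b) * conv (?pd k b) (G j) z) + (\<Sum>b\<in>Basis. (h \<bullet> b) * conv (?pd k b) u z) * ?g j z) + \<zeta>' z h * (?v z * ?g j z)"
   have eq: "?f' z (dx j) = \<zeta>' z (dx j) * (?v z * ?g j z) + \<zeta> z * (?vx j z * ?g j z) + \<zeta> z * (?v z * ?gx j z)" for z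
    unfolding conv_partial[OF dx_Basis, of _ "\<lambda>b. conv (?pd k b) u z"] conv_partial[OF dx_Basis, of _ "\<lambda>b. conv (?pd k b) (G j) z"]
    by (simp only: distrib_left add_ac mult_ac)
   have "(LBINT z. ?f' z (dx j)) = 0"
   proof (rule integral_derivative_zero[where f'="?f'" and b="dx j" and R=R and f="\<lambda>z. \<zeta> z * (?v z * ?g j z)"])
    show "((\<lambda>z. \<zeta> z * (?v z * ?g j z)) has_derivative ?f' z) (at z)" for z
     by (intro has_derivative_mult d\<zeta> dv dg)
    show "continuous_on UNIV (\<lambda>z. ?f' z (dx j))" unfolding eq by (intro ci continuous_on_const)
    show "norm z \<le> R" if "\<zeta> z * (?v z * ?g j z) \<noteq> 0" for z by (rule \<zeta>R) (use that in simp)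
   qed
   then show ?thesis unfolding eq .
  qed
  have i1: "integrable lborel (\<lambda>z. \<zeta>' z dt * (?v z * ?v z))" "integrable lborel (\<lambda>z. \<zeta> z * (?v z * ?vt z))"
   by ((rule cs, (intro ci)[1], erule Z1) | (rule cs, (intro ci)[1], erule Z2))+
  have i2: "integrable lborel (\<lambda>z. \<zeta>' z (dx j) * (?v z * ?g j z))" "integrable lborel (\<lambda>z. \<zeta> z * (?vx j z * ?g j z))"
   "integrable lborel (\<lambda>z. \<zeta> z * (?v z * ?gx j z))" for j
   by ((rule cs, (intro ci)[1], erule Z1) | (rule cs, (intro ci)[1], erule Z2))+
  have "(1/2) * (LBINT z. \<zeta>' z dt * (?v z * ?v z)) = - (LBINT z. \<zeta> z * (?v z * ?vt z))"
   using T i1 by (simp add: mult.left_commute[of _ 2])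
  also have "(LBINT z. \<zeta> z * (?v z * ?vt z)) = (LBINT z. (\<Sum>j\<in>UNIV. \<zeta> z * (?v z * ?gx j z)))"
  proof (rule Bochner_Integration.integral_cong[OF refl])
   fix z show "\<zeta> z * (?v z * ?vt z) = (\<Sum>j\<in>UNIV. \<zeta> z * (?v z * ?gx j z))"
    using me(2)[OF C(3)[of z], of ] by (cases "\<zeta> z = 0") (auto simp: sum_distrib_left)
  qed
  also have "\<dots> = (\<Sum>j\<in>UNIV. \<integral>z. \<zeta> z * (?v z * ?gx j z) \<partial>lborel)"
   by (rule Bochner_Integration.integral_sum) (rule i2)
  also have "- \<dots> = (\<Sum>j\<in>UNIV. (LBINT z. \<zeta> z * (?vx j z * ?g j z)) + (LBINT z. \<zeta>' z (dx j) * (?v z * ?g j z)))"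
   unfolding sum_negf[symmetric]
  proof (rule sum.cong[OF refl])
   fix j
   show "- (LBINT z. \<zeta> z * (?v z * ?gx j z)) = (LBINT z. \<zeta> z * (?vx j z * ?g j z)) + (LBINT z. \<zeta>' z (dx j) * (?v z * ?g j z))"
    using X[of j] i2[of j] by simp
  qed
  also have "\<dots> = (\<Sum>j\<in>UNIV. (LBINT z. \<zeta> z * (conv (K k) (D j) z * ?g j z)) + (LBINT z. \<zeta>' z (dx j) * (?v z * ?g j z)))"
  proof (intro sum.cong refl arg_cong2[where f="(+)"] Bochner_Integration.integral_cong)
   fix j z show "\<zeta> z * (?vx j z * ?g j z) = \<zeta> z * (conv (K k) (D j) z * ?g j z)"
    using me(1)[OF C(3)[of z], of j] by (cases "\<zeta> z = 0") auto
  qed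
  finally show ?thesis .
 qed
 let ?L = "\<lambda>k. (1/2) * (LBINT z. \<zeta>' z dt * (conv (K k) u z * conv (K k) u z))"
 let ?R = "\<lambda>k. \<Sum>j\<in>UNIV. (LBINT z. \<zeta> z * (conv (K k) (D j) z * conv (K k) (G j) z)) + (LBINT z. \<zeta>' z (dx j) * (conv (K k) u z * conv (K k) (G j) z))"
 have ev: "\<forall>\<^sub>F k in sequentially. ?R k = ?L k"
  using order_tendstoD(2)[OF r e(1)] by eventually_elim (erule E[symmetric])
 have lim: "(\<lambda>k. \<integral>x. (conv (K k) f x - f x)^2 \<partial>lborel) \<longlonglongrightarrow> 0" if "L2b f" for f
  by (rule mollify_L2_limit[OF K(2) r that])
 have lp: "(\<lambda>k. \<integral>z. w z * (conv (K k) f z * conv (K k) g z) \<partial>lborel) \<longlonglongrightarrow> (LBINT z. w z * (f z * g z))"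
  if "bounded_borel w" "L2b f" "L2b g" for w f g
  by (rule L2_limit_product[OF that(1,2) L2b_conv(1)[OF K(2) that(2)] lim[OF that(2)] that(3) L2b_conv(1)[OF K(2) that(3)] lim[OF that(3)]])
 have L: "?L \<longlonglongrightarrow> (1/2) * (LBINT z. \<zeta>' z dt * (u z * u z))"
  by (intro tendsto_mult tendsto_const lp bb\<zeta>' dt_Basis Lu)
 have "?R \<longlonglongrightarrow> (\<Sum>j\<in>UNIV. (LBINT z. \<zeta> z * (D j z * G j z)) + (LBINT z. \<zeta>' z (dx j) * (u z * G j z)))"
  by (intro tendsto_sum tendsto_add lp bb\<zeta>' bb\<zeta> dx_Basis Lu LD LG)
 from LIMSEQ_unique[OF L Lim_transform_eventually[OF this ev]] show ?thesis by simp
qed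

text \<open>
  Cylinders indexed by their centre in space-time.
\<close>

abbreviation Q :: "(real ^ 'n) \<times> real => real => ((real ^ 'n) \<times> real) set" where
 "Q z r \<equiv> cylinder (fst z) (snd z) r"

section \<open>Parabolic cylinders and means\<close>

lemma mem_Q: "w \<in> Q z r \<longleftrightarrow> norm (fst w - fst z) < r \<and> \<bar>snd w - snd z\<bar> < r^2"
 by (cases w) (auto simp: cylinder_def dist_norm norm_minus_commute abs_less_iff)

lemma Q_sym: "w \<in> Q z r \<longleftrightarrow> z \<in> Q w r"
 by (simp add: mem_Q norm_minus_commute abs_minus_commute)

lemma open_Q: "open (Q z r)"
 unfolding cylinder_def by (intro open_Times) auto

lemma Q_borel [measurable, simp]: "Q z r \<in> sets borel"
 by (rule borel_open[OF open_Q])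

lemma bounded_Q: "bounded (Q z r)"
 unfolding cylinder_def by (intro bounded_Times) auto

text \<open>
  The measure of a cylinder of radius one; the factor two is the length of the time interval.
\<close>

definition omega :: "'n::finite itself => real" where "omega _ = 2 * unit_ball_vol (CARD('n))"

lemma omega_pos: "omega TYPE('n::finite) > 0" by (simp add: omega_def)

lemma measure_Q:
 fixes z :: "(real ^ 'n) \<times> real"
 assumes "r > 0"
 shows "measure lborel (Q z r) = omega TYPE('n) * r ^ (CARD('n) + 2)"
  and "emeasure lborel (Q z r) = ennreal (omega TYPE('n) * r ^ (CARD('n) + 2))"
proof -
 have "emeasure lborel (Q z r) = emeasure (lborel \<Otimes>\<^sub>M lborel) (ball (fst z) r \<times> {snd z - r^2<..<snd z + r^2})"
  by (simp add: lborel_prod cylinder_def)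
 also have "\<dots> = emeasure lborel (ball (fst z) r) * emeasure lborel {snd z - r^2<..<snd z + r^2}"
  by (rule lborel.emeasure_pair_measure_Times) auto
 also have "\<dots> = ennreal (unit_ball_vol (CARD('n)) * r ^ CARD('n)) * ennreal (2 * r^2)"
  using assms by (simp add: emeasure_ball)
 also have "\<dots> = ennreal (omega TYPE('n) * r ^ (CARD('n) + 2))"
  using assms by (simp add: ennreal_mult[symmetric] omega_def power_add mult_ac power2_eq_square)
 finally show e: "emeasure lborel (Q z r) = ennreal (omega TYPE('n) * r ^ (CARD('n) + 2))" .
 then show "measure lborel (Q z r) = omega TYPE('n) * r ^ (CARD('n) + 2)"
  using assms omega_pos[where 'n='n] by (simp add: measure_def)
qed

text \<open>
  A set integral.  The indicator keeps every integral one over the whole space, so that integrability is always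
  that of the function itself.
\<close>

definition SI :: "'a::euclidean_space set => ('a => real) => real" where
 "SI S f = (LBINT w. indicator S w * f w)"

lemma integrable_indicator_mult:
 assumes "S \<in> sets borel" "integrable lborel f" shows "integrable lborel (\<lambda>w. indicator S w * f w :: real)"
 using integrable_mult_indicator[of S lborel f] assms by simp

lemma SI_nonneg: "(\<And>w. 0 \<le> f w) ==> 0 \<le> SI S f"
 unfolding SI_def by (intro Bochner_Integration.integral_nonneg) auto

lemma SI_mono_set:
 assumes "S \<in> sets borel" "T \<in> sets borel" "integrable lborel f" "\<And>w. 0 \<le> f w" "S \<subseteq> T"
 shows "SI S f \<le> SI T f"
 unfolding SI_def using assms
 by (intro integral_mono integrable_indicator_mult) (auto simp: indicator_def)

lemma SI_le_integral:
 assumes "S \<in> sets borel" "integrable lborel f" "\<And>w. 0 \<le> f w"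
 shows "SI S f \<le> integral\<^sup>L lborel f"
 unfolding SI_def using assms
 by (intro integral_mono integrable_indicator_mult) (auto simp: indicator_def)

lemma SI_mono:
 assumes "S \<in> sets borel" "integrable lborel f" "integrable lborel g" "\<And>w. w \<in> S ==> f w \<le> g w"
 shows "SI S f \<le> SI S g"
 unfolding SI_def using assms
 by (intro integral_mono integrable_indicator_mult) (auto simp: indicator_def)

text \<open>
  Convexity of the power function: its graph lies above each tangent.  Integrated with \<open>m\<close> the mean, this
  is Jensen's inequality for powers.
\<close>

lemma powr_tangent:
 fixes x m p :: real
 assumes "p \<ge> 1" "x \<ge> 0" "m > 0"
 shows "m powr p + p * m powr (p - 1) * (x - m) \<le> x powr p"
proof (cases "p = 1")
 case True
 then show ?thesis using assms by simp
next
 case False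
 then have p: "p > 1" using assms by simp
 define p' where "p' = p / (p - 1)"
 have p': "p' > 1" "1 / p + 1 / p' = 1" using p by (auto simp: p'_def field_simps)
 have "x * (m powr (p - 1)) \<le> x powr p / p + (m powr (p - 1)) powr p' / p'"
  using Youngs_inequality[of p p' x "m powr (p - 1)"] p p' assms by simp
 also have "(m powr (p - 1)) powr p' = m powr p" using p by (simp add: powr_powr p'_def)
 finally have "p * (x * m powr (p - 1)) \<le> p * (x powr p / p + m powr p / p')"
  using p by (intro mult_left_mono) auto
 also have "\<dots> = x powr p + (p - 1) * m powr p" using p by (simp add: p'_def field_simps)
 finally have "p * (x * m powr (p - 1)) \<le> x powr p + (p - 1) * m powr p" .
 moreover have "m * m powr (p - 1) = m powr p" using assms by (simp add: powr_mult_base)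
 moreover have "p * m powr (p - 1) * (x - m) = p * (x * m powr (p - 1)) - p * (m * m powr (p - 1))"
  by (simp add: algebra_simps)
 ultimately show ?thesis by (simp add: left_diff_distrib)
qed

lemma power_mean:
 fixes f :: "'a::euclidean_space => real"
 assumes p: "p \<ge> 1" and S: "S \<in> sets borel" "measure lborel S > 0"
  and f: "integrable lborel f" "integrable lborel (\<lambda>w. f w powr p)" "\<And>w. f w \<ge> 0"
 shows "(SI S f / measure lborel S) powr p \<le> SI S (\<lambda>w. f w powr p) / measure lborel S"
proof -
 define V where "V = measure lborel S"
 have V: "V > 0" using S by (simp add: V_def)
 have Sfin: "emeasure lborel S < \<infinity>"
  using S(2) by (metis infinity_ennreal_def less_top measure_eq_emeasure_eq_ennreal measure_zero_top order_less_irrefl)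
 have i0: "integrable lborel (\<lambda>w. indicator S w :: real)" using S Sfin by (intro integrable_real_indicator) auto
 note i1 = integrable_indicator_mult[OF S(1) f(1)] and i2 = integrable_indicator_mult[OF S(1) f(2)]
 define m where "m = SI S f / V"
 have m0: "m \<ge> 0" using V SI_nonneg[of f S] f(3) by (simp add: m_def)
 show ?thesis
 proof (cases "m = 0")
  case True
  have "0 \<le> SI S (\<lambda>w. f w powr p) / V" using V by (intro divide_nonneg_pos SI_nonneg) auto
  then show ?thesis using p True unfolding V_def[symmetric] m_def[symmetric] by simp
 next
  case False
  then have m: "m > 0" using m0 by simp
  have "(LBINT w. (m powr p - p * m powr (p - 1) * m) * indicator S w + p * m powr (p - 1) * (indicator S w * f w)) \<le> SI S (\<lambda>w. f w powr p)"
   unfolding SI_def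
  proof (rule integral_mono)
   fix w
   show "(m powr p - p * m powr (p - 1) * m) * indicator S w + p * m powr (p - 1) * (indicator S w * f w) \<le> indicator S w * f w powr p"
    using powr_tangent[OF p f(3)[of w] m] by (auto simp: indicator_def algebra_simps)
  qed (use i0 i1 i2 in auto)
  moreover have "(LBINT w. (m powr p - p * m powr (p - 1) * m) * indicator S w + p * m powr (p - 1) * (indicator S w * f w))
   = (m powr p - p * m powr (p - 1) * m) * V + p * m powr (p - 1) * (m * V)"
   using i0 i1 S V by (simp add: V_def[symmetric] SI_def[symmetric] m_def)
  ultimately have "m powr p * V \<le> SI S (\<lambda>w. f w powr p)" by (simp add: algebra_simps)
  then show ?thesis using V by (simp add: m_def[symmetric] V_def[symmetric] field_simps)
 qed
qed

lemma powr_le_one_plus_square: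
 assumes "0 < q" "q \<le> 2" "x \<ge> 0" shows "x powr q \<le> 1 + (x::real)^2"
proof (cases "x \<le> 1")
 case True
 then have "x powr q \<le> 1 powr q" using assms by (intro powr_mono2) auto
 then show ?thesis by (simp add: add_increasing2)
next
 case False
 then have "x powr q \<le> x powr 2" using assms by (intro powr_mono) auto
 then show ?thesis using False by (simp add: powr_numeral)
qed

lemma L2b_powr_integrable:
 assumes g: "L2b g" "\<And>w. g w \<ge> 0" and q: "0 < q" "q \<le> 2"
 shows "integrable lborel (\<lambda>w. g w powr q)"
proof -
 note [measurable] = L2b_measurable[OF g(1)]
 obtain R where R: "\<And>x. g x \<noteq> 0 ==> norm x < R" using L2b_bounded_support[OF g(1)] by blast
 have i: "integrable lborel (\<lambda>x. 1 * indicator (ball 0 R) x + (g x)^2)"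
  using integrable_ball_const[of 1 0 R] g(1) by (intro Bochner_Integration.integrable_add) (auto simp: L2b_def)
 show ?thesis
 proof (rule Bochner_Integration.integrable_bound[OF i])
  show "AE x in lborel. norm (g x powr q) \<le> norm (1 * indicator (ball 0 R) x + (g x)^2)"
  proof (rule AE_I2)
   fix x show "norm (g x powr q) \<le> norm (1 * indicator (ball 0 R) x + (g x)^2)"
   proof (cases "g x = 0")
    case False
    then show ?thesis using powr_le_one_plus_square[OF q g(2)[of x]] R[of x] by simp
   qed (use q in simp)
  qed
 qed simp
qed

lemma sum_Basis_prod:
 "(\<Sum>b\<in>(Basis :: ((real ^ 'n) \<times> real) set). F b) = (\<Sum>j\<in>UNIV. F (dx j)) + (F dt :: real)"
proof -
 have "(\<Sum>b\<in>(Basis :: ((real ^ 'n) \<times> real) set). F b) = (\<Sum>v\<in>(\<lambda>u. (u, 0)) ` (Basis :: (real ^ 'n) set). F v) + (\<Sum>v\<in>(\<lambda>u. (0, u)) ` (Basis :: real set). F v)"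
  unfolding Basis_prod_def by (rule sum.union_disjoint) auto
 also have "(\<Sum>v\<in>(\<lambda>u. (0, u)) ` (Basis :: real set). F v) = F dt" by simp
 also have "(\<lambda>u. (u, 0)) ` (Basis :: (real ^ 'n) set) = dx ` UNIV"
  by (auto simp: Basis_vec_def)
 also have "(\<Sum>v\<in>dx ` UNIV. F v) = (\<Sum>j\<in>UNIV. F (dx j))"
  by (subst sum.reindex) (auto simp: inj_on_def axis_eq_axis)
 finally show ?thesis .
qed

text \<open>
  The properties of a kernel at parabolic scale \<open>s\<close> that the estimates use; one constant \<open>C\<close> serves all
  scales.
\<close>

definition pkernel :: "real => real => ((real ^ 'n) \<times> real => real) => bool" where
 "pkernel C s K \<longleftrightarrow> smooth_kernel K \<and> avg_kernel (s + s^2) K \<and>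
   (\<forall>z. K z \<noteq> 0 --> norm (fst z) < s \<and> \<bar>snd z\<bar> < s^2) \<and>
   (\<forall>z. \<bar>K z\<bar> \<le> C / s ^ (CARD('n) + 2)) \<and>
   (\<forall>z j. \<bar>frechet_derivative K (at z) (dx j)\<bar> \<le> C / s ^ (CARD('n) + 3))"

lemma pkernel_exists: "\<exists>C>0. \<forall>s>0. \<exists>K :: (real ^ 'n) \<times> real => real. pkernel C s K"
proof -
 obtain C :: real where C0: "C > 0" and C: "\<forall>s>0. \<exists>K :: (real ^ 'n) \<times> real => real. (\<forall>k. C_k k K) \<and> (\<forall>z. 0 \<le> K z) \<and>
   (\<forall>z. K z \<noteq> 0 --> norm (fst z) < s \<and> \<bar>snd z\<bar> < s^2) \<and> integrable lborel K \<and> integral\<^sup>L lborel K = 1 \<and>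
   (\<forall>z. K z \<le> C / s ^ (CARD('n) + 2)) \<and>
   (\<forall>z j. \<bar>frechet_derivative K (at z) (axis j 1, 0)\<bar> \<le> C / s ^ (CARD('n) + 3))"
  using parabolic_kernel_exists by blast
 have "\<exists>K :: (real ^ 'n) \<times> real => real. pkernel C s K" if s: "s > 0" for s
 proof -
  obtain K :: "(real ^ 'n) \<times> real => real" where K: "\<forall>k. C_k k K" "\<forall>z. 0 \<le> K z"
   "\<forall>z. K z \<noteq> 0 --> norm (fst z) < s \<and> \<bar>snd z\<bar> < s^2" "integrable lborel K" "integral\<^sup>L lborel K = 1"
   and K2: "\<forall>z. K z \<le> C / s ^ (CARD('n) + 2)" "\<forall>z j. \<bar>frechet_derivative K (at z) (axis j 1, 0)\<bar> \<le> C / s ^ (CARD('n) + 3)"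
   using C[rule_format, OF s] by (elim exE conjE) (rule that)
  have "\<bar>K z\<bar> = K z" for z using K(2)[rule_format, of z] by simp
  then show ?thesis using parabolic_kernel_props[OF s K] K(3) K2 unfolding pkernel_def by (intro exI[of _ K]) simp
 qed
 then show ?thesis using C0 by blast
qed

lemma pkernelD:
 fixes K :: "(real ^ 'n) \<times> real => real"
 assumes "pkernel C s K"
 shows "smooth_kernel K" "avg_kernel (s + s^2) K" "K (z - w) \<noteq> 0 ==> w \<in> Q z s"
  "\<bar>K y\<bar> \<le> C / s ^ (CARD('n) + 2)" "\<bar>frechet_derivative K (at y) (dx j)\<bar> \<le> C / s ^ (CARD('n) + 3)"
  "bounded_borel K" "integrable lborel K"
proof -
 show 1: "smooth_kernel K" "avg_kernel (s + s^2) K" "\<bar>K y\<bar> \<le> C / s ^ (CARD('n) + 2)"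
  "\<bar>frechet_derivative K (at y) (dx j)\<bar> \<le> C / s ^ (CARD('n) + 3)" 
  using assms unfolding pkernel_def by blast+
 show "w \<in> Q z s" if "K (z - w) \<noteq> 0"
 proof -
  have "norm (fst (z - w)) < s \<and> \<bar>snd (z - w)\<bar> < s^2" using assms that unfolding pkernel_def by blast
  then show ?thesis by (simp add: mem_Q norm_minus_commute abs_minus_commute)
 qed
 show "bounded_borel K" "integrable lborel K" using 1(2) by (auto simp: avg_kernel_def)
qed

section \<open>Oscillation of mollifications across scales\<close>

lemma closure_Q_subset: "closure (Q z s) \<subseteq> {w. norm (fst w - fst z) \<le> s \<and> \<bar>snd w - snd z\<bar> \<le> s^2}"
 by (rule closure_minimal)
   (auto simp: mem_Q intro!: closed_Collect_conj closed_Collect_le continuous_intros)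

text \<open>
  The doubled radius absorbs the closure, so that mollification at scale \<open>s\<close> is admissible at every
  centre of a cylinder of radius \<open>2 * s\<close> inside \<open>P\<close>.
\<close>

lemma closure_support_subset:
 assumes "\<And>w. K (z - w) \<noteq> (0::real) ==> w \<in> Q z s" "s > 0"
 shows "closure {w. K (z - w) \<noteq> 0} \<subseteq> Q z (2 * s)"
proof -
 have "closure {w. K (z - w) \<noteq> 0} \<subseteq> closure (Q z s)" by (rule closure_mono) (use assms(1) in auto)
 also have "\<dots> \<subseteq> {w. norm (fst w - fst z) \<le> s \<and> \<bar>snd w - snd z\<bar> \<le> s^2}" by (rule closure_Q_subset)
 also have "\<dots> \<subseteq> Q z (2 * s)"
 proof -
  have "s^2 < (2 * s)^2" using assms(2) by (simp add: power_mult_distrib)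
  moreover have "s < 2 * s" using assms(2) by simp
  ultimately show ?thesis unfolding subset_iff mem_Q by (blast intro: le_less_trans)
 qed
 finally show ?thesis .
qed

lemma zero_outside_derivative:
 assumes "smooth_kernel K" "\<And>w. K (z - w) \<noteq> 0 ==> w \<in> Q z s" "b \<in> Basis" "s > 0"
  "frechet_derivative K (at (z - w)) b \<noteq> 0"
 shows "w \<in> closure (Q z s)"
proof (rule ccontr)
 assume a: "w \<notin> closure (Q z s)"
 have "((\<lambda>w. K (z - w)) has_derivative (\<lambda>h. 0)) (at w)"
  by (rule has_derivative_transform_within_open[of "\<lambda>x. 0" _ _ _ "- closure (Q z s)"])
    (use a assms(2) closure_subset[of "Q z s"] in auto)
 from frechet_derivative_eqI[OF this] show False
  using reflect_derivative[OF assms(1), of z w b] assms(5) by simp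
qed

text \<open>
  The function \<open>g\<close> stands for \<open>|D| + |G|\<close>; every bound below depends on the solution only through
  \<open>g\<close>.
\<close>

definition dominated_flux where
 "dominated_flux P u D G g \<longleftrightarrow> flux_solution P u D G \<and> L2b g \<and> (\<forall>w. 0 \<le> g w) \<and>
   (\<forall>j w. \<bar>D j w\<bar> \<le> g w \<and> \<bar>G j w\<bar> \<le> g w)"

lemma dominated_fluxD:
 assumes "dominated_flux P u D G g"
 shows "flux_solution P u D G" "L2b g" "0 \<le> g w" "\<bar>D j w\<bar> \<le> g w" "\<bar>G j w\<bar> \<le> g w" "L2b u" "L2b (D j)" "L2b (G j)"
  "integrable lborel g"
proof -
 show "flux_solution P u D G" "L2b g" "0 \<le> g w" "\<bar>D j w\<bar> \<le> g w" "\<bar>G j w\<bar> \<le> g w"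
  using assms unfolding dominated_flux_def by blast+
 then show "L2b u" "L2b (D j)" "L2b (G j)" "integrable lborel g"
  unfolding flux_solution_def by (blast intro: L2b_integrable)+
qed

text \<open>
  The mean value theorem on the segment from \<open>z\<close> to \<open>z'\<close>.  A space derivative of the mollification is
  the mollification of \<open>D\<close>, of size \<open>r^(-n-2)\<close> times the integral of \<open>g\<close>.  A time derivative is a sum of space
  derivatives of the kernel against \<open>G\<close>, of size \<open>r^(-n-3)\<close>.  This is how the equation replaces the missing
  regularity in time.
\<close>

lemma mollified_oscillation:
 fixes u :: "(real ^ 'n) \<times> real => real" and C :: real
 assumes dom: "dominated_flux P u D G g" and pk: "pkernel C r K" and r: "r > 0" and C: "C > 0" and a: "a > 0" and S: "S \<in> sets borel"
  and seg: "\<And>y. norm (fst y - fst z) \<le> a ==> \<bar>snd y - snd z\<bar> \<le> a^2 ==> Q y (2 * r) \<subseteq> P \<and> Q y (2 * r) \<subseteq> S"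
  and z': "norm (fst z' - fst z) \<le> a" "\<bar>snd z' - snd z\<bar> \<le> a^2"
 shows "\<bar>conv K u z' - conv K u z\<bar>
   \<le> (a * CARD('n) * C / r ^ (CARD('n) + 2) + a^2 * CARD('n) * C / r ^ (CARD('n) + 3)) * SI S g"
proof -
 note dd = dominated_fluxD[OF dom] and pd = pkernelD[OF pk]
 have SI0: "SI S g \<ge> 0" by (rule SI_nonneg) (rule dd)
 let ?F = "\<lambda>b y. conv (\<lambda>x. frechet_derivative K (at x) b) u y"
 define h where "h = z' - z"
 define y where "y \<tau> = z + \<tau> *\<^sub>R h" for \<tau>
 have der: "((\<lambda>\<tau>. conv K u (y \<tau>)) has_field_derivative (\<Sum>b\<in>Basis. (h \<bullet> b) * ?F b (y \<tau>))) (at \<tau>)" for \<tau>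
 proof -
  have "((\<lambda>\<tau>. conv K u (z + \<tau> *\<^sub>R h)) has_derivative (\<lambda>t. \<Sum>b\<in>Basis. ((t *\<^sub>R h) \<bullet> b) * ?F b (z + \<tau> *\<^sub>R h))) (at \<tau>)"
   by (rule has_derivative_compose[where f="\<lambda>\<tau>. z + \<tau> *\<^sub>R h" and g="conv K u", OF _ conv_has_derivative[OF pd(1) L2b_integrable[OF dd(6)]]])
     (auto intro!: derivative_eq_intros)
  moreover have "(\<lambda>t. \<Sum>b\<in>Basis. ((t *\<^sub>R h) \<bullet> b) * ?F b (z + \<tau> *\<^sub>R h)) = (*) (\<Sum>b\<in>Basis. (h \<bullet> b) * ?F b (z + \<tau> *\<^sub>R h))"
   by (simp add: fun_eq_iff sum_distrib_left mult_ac)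
  ultimately show ?thesis by (simp add: has_field_derivative_def y_def)
 qed
 obtain \<tau> where \<tau>: "0 < \<tau>" "\<tau> < 1" "conv K u (y 1) - conv K u (y 0) = (1 - 0) * (\<Sum>b\<in>Basis. (h \<bullet> b) * ?F b (y \<tau>))"
  using MVT2[of 0 1 "\<lambda>\<tau>. conv K u (y \<tau>)" "\<lambda>\<tau>. \<Sum>b\<in>Basis. (h \<bullet> b) * ?F b (y \<tau>)"] der by auto
 let ?y = "y \<tau>"
 have hx: "norm (fst h) \<le> a" and ht: "\<bar>snd h\<bar> \<le> a^2" using z' by (auto simp: h_def)
 have yx: "norm (fst ?y - fst z) \<le> a" 
  using \<tau> mult_mono[of \<tau> 1 "norm (fst h)" a] hx a by (simp add: y_def)
 have yt: "\<bar>snd ?y - snd z\<bar> \<le> a^2"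
  using \<tau> mult_mono[of \<tau> 1 "\<bar>snd h\<bar>" "a^2"] ht a by (simp add: y_def abs_mult)
 have QP: "Q ?y (2 * r) \<subseteq> P" and QS: "Q ?y (2 * r) \<subseteq> S" using seg[OF yx yt] by auto
 have cl: "closure {w. K (?y - w) \<noteq> 0} \<subseteq> Q ?y (2 * r)" by (rule closure_support_subset[OF pd(3) r])
 note me = mollified_flux_equations[OF dd(1) pd(1) order_trans[OF cl QP]]
 have b1: "\<bar>conv K (D j) ?y\<bar> \<le> C / r ^ (CARD('n) + 2) * SI S g" for j
 proof -
  have "\<bar>conv K (D j) ?y\<bar> \<le> C / r ^ (CARD('n) + 2) * SI S (\<lambda>w. \<bar>D j w\<bar>)"
   unfolding SI_def
  proof (rule conv_abs_le)
   show "w \<in> S" if "K (?y - w) \<noteq> 0" for w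
    using that cl QS closure_subset[of "{w. K (?y - w) \<noteq> 0}"] by auto
  qed (use pd(4) L2b_integrable[OF dd(7)] S bounded_borel_measurable[OF pd(6)] in auto)
  also have "\<dots> \<le> C / r ^ (CARD('n) + 2) * SI S g"
   using C r by (intro mult_left_mono SI_mono S dd(4,9)) (auto intro: L2b_integrable[OF dd(7)])
  finally show ?thesis .
 qed
 have b2: "\<bar>conv (\<lambda>x. frechet_derivative K (at x) (dx j)) (G j) ?y\<bar> \<le> C / r ^ (CARD('n) + 3) * SI S g" for j
 proof -
  have "\<bar>conv (\<lambda>x. frechet_derivative K (at x) (dx j)) (G j) ?y\<bar> \<le> C / r ^ (CARD('n) + 3) * SI S (\<lambda>w. \<bar>G j w\<bar>)"
   unfolding SI_def
  proof (rule conv_abs_le)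
   show "(\<lambda>x. frechet_derivative K (at x) (dx j)) \<in> borel_measurable borel"
    by (rule bounded_borel_measurable[OF smooth_kernel_bounded_borel[OF smooth_kernel_derivative[OF pd(1) dx_Basis]]])
   show "w \<in> S" if "frechet_derivative K (at (?y - w)) (dx j) \<noteq> 0" for w
   proof -
    have "w \<in> closure (Q ?y r)" by (rule zero_outside_derivative[OF pd(1) pd(3) dx_Basis r that])
    then have "norm (fst w - fst ?y) \<le> r \<and> \<bar>snd w - snd ?y\<bar> \<le> r^2" using closure_Q_subset by blast
    moreover have "r^2 < (2 * r)^2" using r by (simp add: power_mult_distrib)
    moreover have "r < 2 * r" using r by simp
    ultimately have "w \<in> Q ?y (2 * r)" unfolding mem_Q by (blast intro: le_less_trans)
    then show ?thesis using QS by blast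
   qed
  qed (use pd(5) L2b_integrable[OF dd(8)] S in auto)
  also have "\<dots> \<le> C / r ^ (CARD('n) + 3) * SI S g"
   using C r by (intro mult_left_mono SI_mono S dd(5,9)) (auto intro: L2b_integrable[OF dd(8)])
  finally show ?thesis .
 qed
 have e: "conv K u z' - conv K u z = (\<Sum>j\<in>UNIV. (fst h $ j) * conv K (D j) ?y) + snd h * (\<Sum>j\<in>UNIV. conv (\<lambda>x. frechet_derivative K (at x) (dx j)) (G j) ?y)"
 proof -
  have y01: "y 1 = z'" "y 0 = z" by (simp_all add: y_def h_def)
  show ?thesis using \<tau>(3) unfolding y01 sum_Basis_prod me by (simp add: inner_prod_def inner_axis)
 qed
 have "\<bar>conv K u z' - conv K u z\<bar> \<le> \<bar>\<Sum>j\<in>UNIV. (fst h $ j) * conv K (D j) ?y\<bar> + \<bar>snd h * (\<Sum>j\<in>UNIV. conv (\<lambda>x. frechet_derivative K (at x) (dx j)) (G j) ?y)\<bar>"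
  unfolding e by (rule abs_triangle_ineq)
 also have "\<bar>\<Sum>j\<in>UNIV. (fst h $ j) * conv K (D j) ?y\<bar> \<le> (\<Sum>j\<in>(UNIV::'n set). a * (C / r ^ (CARD('n) + 2) * SI S g))"
 proof (rule order_trans[OF sum_abs sum_mono])
  fix j show "\<bar>(fst h $ j) * conv K (D j) ?y\<bar> \<le> a * (C / r ^ (CARD('n) + 2) * SI S g)"
   unfolding abs_mult using component_le_norm_cart[of "fst h" j] hx a by (intro mult_mono b1) auto
 qed
 also have "\<bar>snd h * (\<Sum>j\<in>UNIV. conv (\<lambda>x. frechet_derivative K (at x) (dx j)) (G j) ?y)\<bar>
   \<le> a^2 * (\<Sum>j\<in>(UNIV::'n set). C / r ^ (CARD('n) + 3) * SI S g)"
  unfolding abs_mult by (intro mult_mono ht order_trans[OF sum_abs sum_mono] b2) auto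
 finally show ?thesis by (simp add: algebra_simps)
qed

text \<open>
  Since convolutions commute, \<open>K * (K' * u)\<close> differs little from \<open>K' * u\<close> and from \<open>K * u\<close>: in both cases
  a mollification of \<open>u\<close> is averaged over a set on which it hardly oscillates.
\<close>

lemma dyadic_difference:
 fixes u :: "(real ^ 'n) \<times> real => real" and C :: real
 assumes dom: "dominated_flux P u D G g" and pk: "pkernel C s K" "pkernel C (s / 2) K'" and s: "s > 0" and C: "C > 0"
  and P: "Q z (4 * s) \<subseteq> P"
 shows "\<bar>conv K u z - conv K' u z\<bar> \<le> 2 * (CARD('n) * C * 2 ^ (CARD('n) + 4) / s ^ (CARD('n) + 1)) * SI (Q z (4 * s)) g"
proof -
 note dd = dominated_fluxD[OF dom] and pd = pkernelD[OF pk(1)] and pd' = pkernelD[OF pk(2)]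
 define n where "n = CARD('n)"
 define B where "B = real n * C * 2 ^ (n + 4) / s ^ (n + 1)"
 have SI0: "SI (Q z (4 * s)) g \<ge> 0" by (rule SI_nonneg) (rule dd)
 have sub: "Q y (2 * r) \<subseteq> Q z (4 * s)" if y: "norm (fst y - fst z) \<le> s" "\<bar>snd y - snd z\<bar> \<le> s^2" and r: "r \<le> s" "r > 0" for y r
 proof
  fix w assume w: "w \<in> Q y (2 * r)"
  have "norm (fst w - fst z) < 4 * s"
   using w y r norm_triangle_ineq[of "fst w - fst y" "fst y - fst z"] s by (simp add: mem_Q)
  moreover have "(2 * r)^2 \<le> (2 * s)^2" using r by (intro power_mono) auto
  then have "\<bar>snd w - snd z\<bar> < (4 * s)^2" using w y s by (simp add: mem_Q power_mult_distrib abs_le_iff abs_less_iff)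
  ultimately show "w \<in> Q z (4 * s)" by (simp add: mem_Q)
 qed
 have o1: "\<bar>conv K u w - conv K u z\<bar> \<le> B * SI (Q z (4 * s)) g" if w: "norm (fst w - fst z) \<le> s" "\<bar>snd w - snd z\<bar> \<le> s^2" for w
 proof -
  have "\<bar>conv K u w - conv K u z\<bar> \<le> (s * n * C / s ^ (n + 2) + s^2 * n * C / s ^ (n + 3)) * SI (Q z (4 * s)) g"
   unfolding n_def by (rule mollified_oscillation[OF dom pk(1) s C s _ _ w]) (use sub s P in force)+
  also have "s * n * C / s ^ (n + 2) + s^2 * n * C / s ^ (n + 3) = 2 * (real n * C / s ^ (n + 1))"
   using s by (simp add: field_simps power_add power2_eq_square eval_nat_numeral)
  also have "2 * (real n * C / s ^ (n + 1)) * SI (Q z (4 * s)) g \<le> 2 ^ (n + 4) * (real n * C / s ^ (n + 1)) * SI (Q z (4 * s)) g"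
   using C s SI0 power_increasing[of 1 "n + 4" "2::real"] by (intro mult_right_mono) auto
  finally show ?thesis by (simp add: B_def mult_ac)
 qed
 have o2: "\<bar>conv K' u w - conv K' u z\<bar> \<le> B * SI (Q z (4 * s)) g" if w: "norm (fst w - fst z) \<le> s" "\<bar>snd w - snd z\<bar> \<le> s^2" for w
 proof -
  have "\<bar>conv K' u w - conv K' u z\<bar> \<le> (s * n * C / (s/2) ^ (n + 2) + s^2 * n * C / (s/2) ^ (n + 3)) * SI (Q z (4 * s)) g"
   unfolding n_def by (rule mollified_oscillation[OF dom pk(2) _ C s _ _ w]) (use sub[of _ "s/2"] s P in force)+
  also have "s * n * C / (s/2) ^ (n + 2) + s^2 * n * C / (s/2) ^ (n + 3) = (2 ^ (n + 2) + 2 ^ (n + 3)) * (real n * C / s ^ (n + 1))"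
   using s by (simp add: field_simps power_add power2_eq_square eval_nat_numeral)
  also have "(2 ^ (n + 2) + 2 ^ (n + 3)) * (real n * C / s ^ (n + 1)) * SI (Q z (4 * s)) g \<le> 2 ^ (n + 4) * (real n * C / s ^ (n + 1)) * SI (Q z (4 * s)) g"
   using C s SI0 by (intro mult_right_mono) (auto simp: power_add)
  finally show ?thesis by (simp add: B_def mult_ac)
 qed
 have h: "(s / 2)^2 \<le> s^2" using s by (simp add: power_divide)
 have "\<bar>conv K' (conv K u) z - conv K u z\<bar> \<le> B * SI (Q z (4 * s)) g"
 proof (rule conv_close[OF pd'(2) L2b_integrable[OF L2b_conv(1)[OF pd(2) dd(6)]] o1])
  fix w assume "K' (z - w) \<noteq> 0"
  then have "w \<in> Q z (s / 2)" by (rule pd'(3))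
  then show "norm (fst w - fst z) \<le> s" "\<bar>snd w - snd z\<bar> \<le> s^2" using s h unfolding mem_Q by linarith+
 qed
 moreover have "\<bar>conv K (conv K' u) z - conv K' u z\<bar> \<le> B * SI (Q z (4 * s)) g"
 proof (rule conv_close[OF pd(2) L2b_integrable[OF L2b_conv(1)[OF pd'(2) dd(6)]] o2])
  fix w assume "K (z - w) \<noteq> 0"
  then have "w \<in> Q z s" by (rule pd(3))
  then show "norm (fst w - fst z) \<le> s" "\<bar>snd w - snd z\<bar> \<le> s^2" by (auto simp: mem_Q)
 qed
 moreover have "conv K (conv K' u) z = conv K' (conv K u) z"
  by (rule conv_commute[OF pd(6,7) pd'(6,7) L2b_integrable[OF dd(6)]])
 ultimately have "\<bar>conv K u z - conv K' u z\<bar> \<le> 2 * (B * SI (Q z (4 * s)) g)" by linarith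
 then show ?thesis by (simp add: B_def n_def mult_ac)
qed

section \<open>The parabolic Sobolev-Poincare inequality\<close>

text \<open>
  The exponent \<open>q\<close> of the reverse Hoelder inequality and \<open>\<beta> = 2/q\<close>, so that \<open>(n+2) * \<beta> = n+3\<close>.
\<close>

definition qexp :: "'n::finite itself => real" where "qexp _ = 2 * (real CARD('n) + 2) / (real CARD('n) + 3)"

definition bexp :: "'n::finite itself => real" where "bexp _ = (real CARD('n) + 3) / (real CARD('n) + 2)"

lemma card_ge_1: "real CARD('n::finite) \<ge> 1"
 using zero_less_card_finite[where 'a='n] by linarith

lemma qexp_bounds: "1 < qexp TYPE('n::finite)" "qexp TYPE('n) < 2"
 and bexp_bounds: "1 < bexp TYPE('n)" "bexp TYPE('n) < 2"
 using card_ge_1[where 'n='n] by (auto simp: qexp_def bexp_def field_simps)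

lemma qexp_bexp: "qexp TYPE('n::finite) * bexp TYPE('n) = 2"
proof -
 have "real CARD('n) + 2 \<noteq> 0" "real CARD('n) + 3 \<noteq> 0" using card_ge_1[where 'n='n] by linarith+
 then have "2 * (real CARD('n) + 2) / (real CARD('n) + 3) * ((real CARD('n) + 3) / (real CARD('n) + 2)) = 2"
  by (simp only: times_divide_times_eq) (simp add: divide_eq_eq mult.commute)
 then show ?thesis by (simp only: qexp_def bexp_def)
qed

lemma conv_nonneg_integral:
 assumes K: "avg_kernel r K" and f: "integrable lborel f" "\<And>x. f x \<ge> 0"
 shows "integrable lborel (conv K f)" "integral\<^sup>L lborel (conv K f) = integral\<^sup>L lborel f"
proof -
 have bK: "bounded_borel K" and K0: "\<And>z. K z \<ge> 0" using K by (auto simp: avg_kernel_def)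
 note [measurable] = bounded_borel_measurable[OF bK] borel_measurable_integrable[OF f(1)]
 have c0: "0 \<le> conv K f z" for z using K0 f(2) by (auto simp: conv_def)
 have nn: "(\<integral>\<^sup>+z. ennreal (conv K f z) \<partial>lborel) = ennreal (LBINT z. f z)"
  using nn_integral_conv[OF K f] f by (simp add: nn_integral_eq_integral)
 show "integrable lborel (conv K f)"
  by (rule integrableI_nonneg) (use nn c0 in auto)
 show "integral\<^sup>L lborel (conv K f) = integral\<^sup>L lborel f"
  using nn f(2) by (subst integral_eq_nn_integral) (auto simp: c0)
qed

text \<open>
  The normalised indicator of a cylinder.  It writes integrals over moving cylinders as a convolution.
\<close>

definition boxk :: "real => (real ^ 'n) \<times> real => real" where
 "boxk r z = indicator (Q 0 r) z / (omega TYPE('n) * r ^ (CARD('n) + 2))"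

lemma boxk_avg_kernel:
 assumes r: "r > 0" shows "avg_kernel (r + r^2) (boxk r :: (real ^ 'n) \<times> real => real)"
proof -
 define V where "V = omega TYPE('n) * r ^ (CARD('n) + 2)"
 have V: "V > 0" using r omega_pos[where 'n='n] by (simp add: V_def)
 have m: "measure lborel (Q (0::(real ^ 'n) \<times> real) r) = V" "emeasure lborel (Q (0::(real ^ 'n) \<times> real) r) = ennreal V"
  using measure_Q[OF r] by (auto simp: V_def)
 have i: "integrable lborel (indicator (Q (0::(real ^ 'n) \<times> real) r) :: _ => real)"
  using m Q_borel[of "0::(real ^ 'n) \<times> real" r] by (intro integrable_real_indicator) auto
 have bk: "boxk r z = indicator (Q 0 r) z / V" for z :: "(real ^ 'n) \<times> real" by (simp add: boxk_def V_def)
 have "bounded_borel (boxk r :: (real ^ 'n) \<times> real => real)"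
  unfolding bounded_borel_def bk[abs_def] using V Q_borel[of "0::(real ^ 'n) \<times> real" r]
  by (intro conjI exI[of _ "1 / V"]) (auto simp: indicator_def)
 moreover have "norm z < r + r^2" if "boxk r z \<noteq> 0" for z :: "(real ^ 'n) \<times> real"
 proof -
  have "z \<in> Q 0 r" using that by (auto simp: bk indicator_def split: if_splits)
  then have "norm (fst z) < r \<and> \<bar>snd z\<bar> < r^2" unfolding mem_Q by simp
  then show ?thesis using norm_Pair_le[of "fst z" "snd z"] by simp
 qed
 moreover have "integrable lborel (boxk r :: (real ^ 'n) \<times> real => real)" "integral\<^sup>L lborel (boxk r :: (real ^ 'n) \<times> real => real) = 1"
  unfolding bk[abs_def] using i V m by simp_all
 ultimately show ?thesis using V by (auto simp: avg_kernel_def bk)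
qed

lemma SI_conv_boxk:
 fixes z :: "(real ^ 'n) \<times> real"
 assumes "r > 0"
 shows "SI (Q z r) f = omega TYPE('n) * r ^ (CARD('n) + 2) * conv (boxk r) f z"
proof -
 define V where "V = omega TYPE('n) * r ^ (CARD('n) + 2)"
 have V: "V > 0" using assms omega_pos[where 'n='n] by (simp add: V_def)
 have mem: "z - w \<in> Q 0 r \<longleftrightarrow> w \<in> Q z r" for w
  unfolding mem_Q by (simp add: norm_minus_commute abs_minus_commute)
 have "conv (boxk r) f z = (LBINT w. (1 / V) * (indicator (Q z r) w * f w))"
  unfolding conv_def
  by (intro Bochner_Integration.integral_cong refl)
    (simp add: boxk_def V_def indicator_def mem del: fst_zero snd_zero)
 then show ?thesis using V unfolding V_def[symmetric] by (simp add: SI_def)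
qed

text \<open>
  Hoelder's inequality gives \<open>(SI g)\<^sup>2 \<le> V^(2-\<beta>) * (SI (g^q))^\<beta>\<close> because \<open>\<beta> = 2/q\<close>.  The power
  \<open>\<beta> - 1\<close> of the integral of \<open>g^q\<close> is bounded by the integral over the whole space, which leaves an expression
  linear in \<open>SI (g^q)\<close>.
\<close>

lemma SI_square_le:
 fixes g :: "(real ^ 'n) \<times> real => real"
 defines "q \<equiv> qexp TYPE('n)" and "\<beta> \<equiv> bexp TYPE('n)"
 assumes g: "L2b g" "\<And>w. g w \<ge> 0" and r: "r > 0"
 defines "A \<equiv> \<integral>w. g w powr q \<partial>lborel" and "V \<equiv> omega TYPE('n) * r ^ (CARD('n) + 2)"
 shows "(SI (Q z r) g)^2 \<le> A powr (\<beta> - 1) * V powr (2 - \<beta>) * SI (Q z r) (\<lambda>w. g w powr q)"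
proof -
 have q: "1 < q" "q < 2" and \<beta>: "1 < \<beta>" "\<beta> < 2" and q\<beta>: "q * \<beta> = 2"
  using qexp_bounds bexp_bounds qexp_bexp by (auto simp: q_def \<beta>_def)
 have V: "V > 0" "measure lborel (Q z r) = V" using r omega_pos[where 'n='n] measure_Q(1)[OF r] by (auto simp: V_def)
 have ig: "integrable lborel (\<lambda>w. g w powr q)" by (rule L2b_powr_integrable[OF g]) (use q in auto)
 define X where "X = SI (Q z r) (\<lambda>w. g w powr q)"
 have X0: "X \<ge> 0" unfolding X_def by (rule SI_nonneg) simp
 have XA: "X \<le> A" unfolding X_def A_def by (rule SI_le_integral[OF Q_borel ig]) simp
 have S0: "SI (Q z r) g \<ge> 0" by (rule SI_nonneg) (rule g)
 have "(SI (Q z r) g / V) powr q \<le> X / V"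
  using power_mean[of q "Q z r" g] q V ig g L2b_integrable[OF g(1)] by (simp add: X_def)
 then have "((SI (Q z r) g / V) powr q) powr \<beta> \<le> (X / V) powr \<beta>"
  using \<beta> by (intro powr_mono2) auto
 then have "(SI (Q z r) g / V)^2 \<le> (X / V) powr \<beta>"
  using S0 V q\<beta> by (simp add: powr_powr powr_numeral)
 also have "\<dots> = X powr \<beta> / V powr \<beta>" using X0 V by (simp add: powr_divide)
 finally have "(SI (Q z r) g)^2 \<le> X powr \<beta> / V powr \<beta> * V^2" using V by (simp add: power_divide field_simps)
 also have "\<dots> = X powr \<beta> * V powr (2 - \<beta>)" using V by (simp add: powr_diff powr_numeral)
 also have "X powr \<beta> = X * X powr (\<beta> - 1)" using X0 powr_mult_base[of X "\<beta> - 1"] by simp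
 also have "X * X powr (\<beta> - 1) * V powr (2 - \<beta>) \<le> X * A powr (\<beta> - 1) * V powr (2 - \<beta>)"
  using X0 XA \<beta> by (intro mult_right_mono mult_left_mono powr_mono2) auto
 finally show ?thesis by (simp add: X_def mult_ac)
qed

lemma cylinder_volume_powr:
 assumes "r > 0"
 shows "(omega TYPE('n::finite) * r ^ (CARD('n) + 2)) powr (3 - bexp TYPE('n))
   = omega TYPE('n) powr (3 - bexp TYPE('n)) * r ^ (2 * CARD('n) + 3)"
proof -
 have e: "(real CARD('n) + 2) * (3 - bexp TYPE('n)) = 2 * real CARD('n) + 3"
  using card_ge_1[where 'n='n] by (simp add: bexp_def field_simps)
 have "r ^ (CARD('n) + 2) = r powr (real (CARD('n) + 2))" using assms by (rule powr_realpow[symmetric])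
 then have "(omega TYPE('n) * r ^ (CARD('n) + 2)) powr (3 - bexp TYPE('n))
  = omega TYPE('n) powr (3 - bexp TYPE('n)) * (r powr (real (CARD('n) + 2))) powr (3 - bexp TYPE('n))"
  using omega_pos[where 'n='n] by (simp only: powr_mult powr_ge_zero less_imp_le)
 also have "(r powr (real (CARD('n) + 2))) powr (3 - bexp TYPE('n)) = r powr (real (2 * CARD('n) + 3))"
  unfolding powr_powr using e by (simp add: add.commute)
 also have "\<dots> = r ^ (2 * CARD('n) + 3)" using assms by (rule powr_realpow)
 finally show ?thesis .
qed

text \<open>
  Integrating the previous bound over the centre \<open>z\<close> costs one more factor of the volume, by Tonelli.
  The resulting power of the radius, \<open>2n+3\<close>, exceeds by one the power \<open>2n+2\<close> lost in squaring
  \<open>dyadic_difference\<close>; this gain of one power of the scale makes the sum over the scales converge.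
\<close>

lemma integral_SI_square:
 fixes g :: "(real ^ 'n) \<times> real => real"
 defines "q \<equiv> qexp TYPE('n)" and "\<beta> \<equiv> bexp TYPE('n)"
 assumes g: "L2b g" "\<And>w. g w \<ge> 0" and r: "r > 0"
 defines "A \<equiv> \<integral>w. g w powr q \<partial>lborel"
 shows "integrable lborel (\<lambda>z. (SI (Q z r) g)^2)"
  "(LBINT z. (SI (Q z r) g)^2) \<le> omega TYPE('n) powr (3 - \<beta>) * r ^ (2 * CARD('n) + 3) * A powr \<beta>"
proof -
 define V where "V = omega TYPE('n) * r ^ (CARD('n) + 2)"
 have V: "V > 0" using r omega_pos[where 'n='n] by (simp add: V_def)
 have q: "1 < q" "q < 2" and \<beta>: "1 < \<beta>" "\<beta> < 2"
  using qexp_bounds bexp_bounds by (auto simp: q_def \<beta>_def)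
 have ig: "integrable lborel (\<lambda>w. g w powr q)" by (rule L2b_powr_integrable[OF g]) (use q in auto)
 have A0: "A \<ge> 0" by (simp add: A_def)
 note ci = conv_nonneg_integral[OF boxk_avg_kernel[OF r] ig powr_ge_zero]
 note [measurable] = L2b_measurable[OF g(1)] 
 have [measurable]: "boxk r \<in> borel_measurable borel"
  using boxk_avg_kernel[OF r] by (auto simp: avg_kernel_def bounded_borel_def)
 have le: "(SI (Q z r) g)^2 \<le> A powr (\<beta> - 1) * V powr (2 - \<beta>) * (V * conv (boxk r) (\<lambda>w. g w powr q) z)" for z
  using SI_square_le[OF g r, of z] SI_conv_boxk[OF r, of z "\<lambda>w. g w powr q"]
  by (simp add: A_def V_def q_def \<beta>_def)
 have i: "integrable lborel (\<lambda>z. A powr (\<beta> - 1) * V powr (2 - \<beta>) * (V * conv (boxk r) (\<lambda>w. g w powr q) z))"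
  using ci by simp
 show i2: "integrable lborel (\<lambda>z. (SI (Q z r) g)^2)"
 proof (rule Bochner_Integration.integrable_bound[OF i])
  show "(\<lambda>z. (SI (Q z r) g)^2) \<in> borel_measurable lborel"
   unfolding SI_conv_boxk[OF r] by measurable
  show "AE z in lborel. norm ((SI (Q z r) g)^2) \<le> norm (A powr (\<beta> - 1) * V powr (2 - \<beta>) * (V * conv (boxk r) (\<lambda>w. g w powr q) z))"
   by (rule AE_I2) (use order_trans[OF le abs_ge_self] in simp)
 qed
 have "(LBINT z. (SI (Q z r) g)^2) \<le> (LBINT z. A powr (\<beta> - 1) * V powr (2 - \<beta>) * (V * conv (boxk r) (\<lambda>w. g w powr q) z))"
  by (rule integral_mono[OF i2 i le])
 also have "\<dots> = A powr (\<beta> - 1) * V powr (2 - \<beta>) * (V * A)" using ci by (simp add: A_def)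
 also have "\<dots> = (A * A powr (\<beta> - 1)) * (V * V powr (2 - \<beta>))" by (simp add: mult_ac)
 also have "A * A powr (\<beta> - 1) = A powr \<beta>" using A0 powr_mult_base[of A "\<beta> - 1"] by simp
 also have "V * V powr (2 - \<beta>) = V powr (3 - \<beta>)" using V powr_mult_base[of V "2 - \<beta>"] by simp
 also have "V powr (3 - \<beta>) = omega TYPE('n) powr (3 - \<beta>) * r ^ (2 * CARD('n) + 3)"
  unfolding V_def \<beta>_def by (rule cylinder_volume_powr[OF r])
 finally show "(LBINT z. (SI (Q z r) g)^2) \<le> omega TYPE('n) powr (3 - \<beta>) * r ^ (2 * CARD('n) + 3) * A powr \<beta>"
  by (simp add: mult_ac)
qed

text \<open>
  Cauchy-Schwarz with geometric weights: the factor \<open>(4/3)^k\<close> is affordable because the squares of the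
  dyadic differences decay like \<open>2^(-k)\<close>.
\<close>

lemma sum_square_weighted:
 fixes y :: "nat => real"
 shows "(\<Sum>k<m. y k)^2 \<le> 4 * (\<Sum>k<m. (4/3) ^ k * (y k)^2)"
proof (induction m arbitrary: y)
 case (Suc m)
 have two: "(a + b)^2 \<le> 4 * a^2 + (4/3) * b^2" for a b :: real
 proof -
  have "0 \<le> (3 * a - b)^2" by simp
  then show ?thesis by (simp add: power2_eq_square algebra_simps)
 qed
 have "(\<Sum>k<Suc m. y k)^2 = (y 0 + (\<Sum>k<m. y (Suc k)))^2" by (simp only: sum.lessThan_Suc_shift)
 also have "\<dots> \<le> 4 * (y 0)^2 + (4/3) * (\<Sum>k<m. y (Suc k))^2" by (rule two)
 also have "\<dots> \<le> 4 * (y 0)^2 + (4/3) * (4 * (\<Sum>k<m. (4/3) ^ k * (y (Suc k))^2))"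
  using Suc.IH[of "\<lambda>k. y (Suc k)"] by simp
 also have "\<dots> = 4 * (\<Sum>k<Suc m. (4/3) ^ k * (y k)^2)"
  by (simp add: sum.lessThan_Suc_shift sum_distrib_left mult_ac del: sum.lessThan_Suc)
 finally show ?case .
qed simp

lemma sum_two_thirds: "(\<Sum>k<m. (2/3::real) ^ k) \<le> 3"
 by (subst sum_gp_strict) simp

text \<open>
  Let \<open>u_k\<close> be the mollification at scale \<open>2^(-k) \<rho>/8\<close>.  The constant is \<open>c = u_0(z0)\<close>.  Then \<open>u - c\<close> is
  the sum of the differences \<open>u_(k+1) - u_k\<close>, bounded by \<open>dyadic_difference\<close> and summed by
  \<open>integral_SI_square\<close>, and of \<open>u_0 - c\<close>, which is bounded by the oscillation at the single scale \<open>\<rho>/8\<close>.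
\<close>

lemma parabolic_sobolev_poincare:
 "\<exists>C>0. \<forall>(z0 :: (real ^ 'n) \<times> real) \<rho> u D G g. 0 < \<rho> --> dominated_flux (Q z0 (2 * \<rho>)) u D G g -->
   (\<exists>c. integrable lborel (\<lambda>w. indicator (Q z0 (3/2 * \<rho>)) w * (u w - c)^2) \<and>
     SI (Q z0 (3/2 * \<rho>)) (\<lambda>w. (u w - c)^2) \<le> C * \<rho> * (LBINT w. g w powr qexp TYPE('n)) powr bexp TYPE('n))"
proof -
 define n where "n = CARD('n)"
 define \<beta> where "\<beta> = bexp TYPE('n)"
 define \<omega> where "\<omega> = omega TYPE('n)"
 have \<omega>: "\<omega> > 0" using omega_pos[where 'n='n] by (simp add: \<omega>_def)
 obtain Ck :: real where Ck: "Ck > 0" and kex: "\<forall>s>0. \<exists>K :: (real ^ 'n) \<times> real => real. pkernel Ck s K"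
  using pkernel_exists by (elim exE conjE) (rule that)
 define B where "B = 2 * (real n * Ck * 2 ^ (n + 4))"
 define W where "W = \<omega> powr (3 - \<beta>) * 4 ^ (2 * n + 3)"
 define C1 where "C1 = B^2 * W"
 define H where "H = (3/2) * n * Ck * 8 ^ (n + 2) + (3/2)^2 * n * Ck * 8 ^ (n + 3)"
 define C2 where "C2 = H^2 * (\<omega> powr (3 - \<beta>) * 8 ^ (2 * n + 3))"
 have C1: "C1 \<ge> 0" using \<omega> by (simp add: C1_def W_def)
 have C2: "C2 \<ge> 0" using \<omega> by (simp add: C2_def)
 define Cf where "Cf = 3 * (12 * C1) + 3 * C2 + 1"
 have main: "\<exists>c. integrable lborel (\<lambda>w. indicator (Q z0 (3/2 * \<rho>)) w * (u w - c)^2) \<and>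
     SI (Q z0 (3/2 * \<rho>)) (\<lambda>w. (u w - c)^2) \<le> Cf * \<rho> * (LBINT w. g w powr qexp TYPE('n)) powr \<beta>"
  if \<rho>: "0 < \<rho>" and dom: "dominated_flux (Q z0 (2 * \<rho>)) u D G g" for z0 :: "(real ^ 'n) \<times> real" and \<rho> u D G g
 proof -
  note dd = dominated_fluxD[OF dom]
  define A where "A = (LBINT w. g w powr qexp TYPE('n)) powr \<beta>"
  have A0: "A \<ge> 0" by (simp add: A_def)
  define E where "E = Q z0 (3/2 * \<rho>)"
  have E: "E \<in> sets borel" by (simp add: E_def)
  \<comment> \<open>At scales up to \<open>\<rho>/8\<close> the cylinders of radius \<open>4 * a\<close> around points of \<open>E\<close> stay in the large one.\<close>
  define R where "R = \<rho> / 8"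
  have R: "R > 0" using \<rho> by (simp add: R_def)
  define s where "s k = R / 2 ^ k" for k
  have s: "s k > 0" "s k \<le> R" for k using R by (auto simp: s_def field_simps)
  have "\<exists>K :: nat => (real ^ 'n) \<times> real => real. \<forall>k. pkernel Ck (s k) (K k)"
   by (rule choice) (use kex s in blast)
  then obtain K :: "nat => (real ^ 'n) \<times> real => real" where "\<forall>k. pkernel Ck (s k) (K k)" ..
  then have K: "pkernel Ck (s k) (K k)" for k by blast
  define v where "v k = conv (K k) u" for k
  have Lv: "L2b (v k)" for k unfolding v_def by (rule L2b_conv(1)[OF pkernelD(2)[OF K] dd(6)])
  have SIsq: "integrable lborel (\<lambda>z. (SI (Q z r) g)^2)"
   "(LBINT z. (SI (Q z r) g)^2) \<le> \<omega> powr (3 - \<beta>) * r ^ (2 * n + 3) * A" if "r > 0" for r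
   using integral_SI_square[OF dd(2,3) that] by (simp_all only: A_def \<beta>_def \<omega>_def n_def)
  have sub: "Q z (4 * a) \<subseteq> Q z0 (2 * \<rho>)" if z: "z \<in> E" and a: "0 < a" "a \<le> R" for z a
  proof
   fix w assume w: "w \<in> Q z (4 * a)"
   have "norm (fst w - fst z0) < 2 * \<rho>"
    using w z a norm_triangle_ineq[of "fst w - fst z" "fst z - fst z0"] by (simp add: mem_Q E_def R_def)
   moreover have a2: "(4 * a)^2 \<le> (\<rho> / 2)^2" using a by (intro power_mono) (auto simp: R_def)
   have "(4 * a)^2 + (3/2 * \<rho>)^2 \<le> (2 * \<rho>)^2"
   proof -
    have "(\<rho> / 2)^2 = \<rho>^2 / 4" "(3/2 * \<rho>)^2 = 9/4 * \<rho>^2" "(2 * \<rho>)^2 = 4 * \<rho>^2"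
     by (simp_all add: power_mult_distrib power_divide)
    then show ?thesis using a2 zero_le_power2[of \<rho>] by linarith
   qed
   then have "\<bar>snd w - snd z0\<bar> < (2 * \<rho>)^2"
    using w z unfolding E_def mem_Q by linarith
   ultimately show "w \<in> Q z0 (2 * \<rho>)" by (simp add: mem_Q)
  qed
  have step: "SI E (\<lambda>w. (v (Suc k) w - v k w)^2) \<le> C1 * s k * A" for k
  proof -
   define J where "J z = SI (Q z (4 * s k)) g" for z
   have s4: "4 * s k > 0" using s by simp
   have iJ: "integrable lborel (\<lambda>z. (J z)^2)" unfolding J_def by (rule SIsq(1)[OF s4])
   have "SI E (\<lambda>w. (v (Suc k) w - v k w)^2) \<le> SI E (\<lambda>w. (B / s k ^ (n + 1))^2 * (J w)^2)"
   proof (rule SI_mono[OF E])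
    show "integrable lborel (\<lambda>w. (v (Suc k) w - v k w)^2)" using L2b_diff[OF Lv Lv] by (simp add: L2b_def)
    show "integrable lborel (\<lambda>w. (B / s k ^ (n + 1))^2 * (J w)^2)" using iJ by simp
    fix w assume w: "w \<in> E"
    have sS: "s (Suc k) = s k / 2" by (simp add: s_def)
    have "\<bar>v k w - v (Suc k) w\<bar> \<le> (B / s k ^ (n + 1)) * J w"
     using dyadic_difference[OF dom K[of k] K[of "Suc k", unfolded sS] s(1) Ck sub[OF w s]]
     by (simp add: v_def B_def J_def n_def)
    then have "\<bar>v (Suc k) w - v k w\<bar> \<le> \<bar>(B / s k ^ (n + 1)) * J w\<bar>" by linarith
    then show "(v (Suc k) w - v k w)^2 \<le> (B / s k ^ (n + 1))^2 * (J w)^2"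
     unfolding power_mult_distrib[symmetric] by (rule abs_le_square_iff[THEN iffD1])
   qed
   also have "\<dots> \<le> (LBINT w. (B / s k ^ (n + 1))^2 * (J w)^2)"
    by (rule SI_le_integral[OF E]) (use iJ in auto)
   also have "\<dots> = (B / s k ^ (n + 1))^2 * (LBINT w. (J w)^2)" by simp
   also have "\<dots> \<le> (B / s k ^ (n + 1))^2 * (\<omega> powr (3 - \<beta>) * (4 * s k) ^ (2 * n + 3) * A)"
    unfolding J_def by (rule mult_left_mono[OF SIsq(2)[OF s4]]) simp
   also have "\<dots> = C1 * (s k ^ (2 * n + 3) / (s k ^ (n + 1))^2) * A"
    by (simp add: C1_def W_def power_mult_distrib power_divide)
   also have "s k ^ (2 * n + 3) / (s k ^ (n + 1))^2 = s k"
   proof -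
    have "s k ^ (2 * n + 3) = s k * (s k ^ (n + 1))^2"
     by (simp add: power_mult[symmetric] power_add[symmetric] power_Suc[symmetric] del: power_Suc) (simp add: mult.commute numeral_3_eq_3)
    then show ?thesis using s(1)[of k] by simp
   qed
   finally show ?thesis .
  qed
  define c where "c = v 0 z0"
  have base: "\<bar>v 0 w - c\<bar> \<le> H / \<rho> ^ (n + 1) * SI (Q z0 (2 * \<rho>)) g" if w: "w \<in> E" for w
  proof -
   have sg: "Q y (2 * R) \<subseteq> Q z0 (2 * \<rho>)" if "norm (fst y - fst z0) \<le> 3/2 * \<rho>" "\<bar>snd y - snd z0\<bar> \<le> (3/2 * \<rho>)^2" for y
   proof
    fix w assume w: "w \<in> Q y (2 * R)"
    have "norm (fst w - fst z0) < 2 * \<rho>"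
     using w that \<rho> norm_triangle_ineq[of "fst w - fst y" "fst y - fst z0"] by (simp add: mem_Q R_def)
    moreover have "\<bar>snd w - snd z0\<bar> < (2 * \<rho>)^2"
    proof -
     have "(2 * R)^2 + (3/2 * \<rho>)^2 \<le> (2 * \<rho>)^2" using \<rho> by (simp add: R_def power_mult_distrib power_divide)
     then show ?thesis using w that(2) unfolding mem_Q by linarith
    qed
    ultimately show "w \<in> Q z0 (2 * \<rho>)" by (simp add: mem_Q)
   qed
   have K0: "pkernel Ck R (K 0)" using K[of 0] by (simp add: s_def)
   have "\<bar>conv (K 0) u w - conv (K 0) u z0\<bar> \<le> ((3/2 * \<rho>) * CARD('n) * Ck / R ^ (CARD('n) + 2) + (3/2 * \<rho>)^2 * CARD('n) * Ck / R ^ (CARD('n) + 3)) * SI (Q z0 (2 * \<rho>)) g"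
    by (rule mollified_oscillation[OF dom K0 R Ck]) (use \<rho> sg w in \<open>auto simp: E_def mem_Q\<close>)
   also have "(3/2 * \<rho>) * CARD('n) * Ck / R ^ (CARD('n) + 2) + (3/2 * \<rho>)^2 * CARD('n) * Ck / R ^ (CARD('n) + 3) = H / \<rho> ^ (n + 1)"
    using \<rho> by (simp add: H_def n_def R_def power_divide field_simps power_add power2_eq_square eval_nat_numeral)
   finally show ?thesis by (simp add: v_def c_def)
  qed
  have E2: "emeasure lborel E < \<infinity>" unfolding E_def by (rule emeasure_bounded_finite[OF bounded_Q])
  have iE: "integrable lborel (\<lambda>w. indicator E w :: real)" using E E2 by (intro integrable_real_indicator) auto
  have iEc: "integrable lborel (\<lambda>w. indicator E w * (f w - c)^2)" if f: "L2b f" for f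
  proof -
   have "(\<lambda>w. indicator E w * (f w - c)^2) = (\<lambda>w. indicator E w * (f w)^2 - 2 * c * (indicator E w * f w) + c^2 * indicator E w)"
    by (auto simp: fun_eq_iff power2_eq_square algebra_simps)
   then show ?thesis using integrable_indicator_mult[OF E, of "\<lambda>w. (f w)^2"] integrable_indicator_mult[OF E L2b_integrable[OF f]] iE f
    by (simp add: L2b_def)
  qed
  have b0: "SI E (\<lambda>w. (v 0 w - c)^2) \<le> C2 * \<rho> * A"
  proof -
   define S where "S = SI (Q z0 (2 * \<rho>)) g"
   have S0: "S \<ge> 0" unfolding S_def by (rule SI_nonneg) (rule dd)
   have r2: "2 * \<rho> > 0" using \<rho> by simp
   have "SI E (\<lambda>w. (v 0 w - c)^2) \<le> (LBINT w. (H / \<rho> ^ (n + 1))^2 * (SI (Q w (4 * \<rho>)) g)^2)"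
    unfolding SI_def[of E]
   proof (rule integral_mono[OF iEc[OF Lv]])
    show "integrable lborel (\<lambda>w. (H / \<rho> ^ (n + 1))^2 * (SI (Q w (4 * \<rho>)) g)^2)"
     using SIsq(1)[of "4 * \<rho>"] \<rho> by simp
    fix w
    show "indicator E w * (v 0 w - c)^2 \<le> (H / \<rho> ^ (n + 1))^2 * (SI (Q w (4 * \<rho>)) g)^2"
    proof (cases "w \<in> E")
     case True
     have "Q z0 (2 * \<rho>) \<subseteq> Q w (4 * \<rho>)"
     proof
      fix y assume y: "y \<in> Q z0 (2 * \<rho>)"
      have "norm (fst y - fst w) < 4 * \<rho>"
       using y True \<rho> norm_triangle_ineq4[of "fst y - fst z0" "fst w - fst z0"] by (simp add: mem_Q E_def)
      moreover have "\<bar>snd y - snd w\<bar> < (4 * \<rho>)^2"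
      proof -
       have "(2 * \<rho>)^2 + (3/2 * \<rho>)^2 \<le> (4 * \<rho>)^2" using \<rho> by (simp add: power_mult_distrib power_divide)
       then show ?thesis using y True unfolding E_def mem_Q by linarith
      qed
      ultimately show "y \<in> Q w (4 * \<rho>)" by (simp add: mem_Q)
     qed
     then have "S \<le> SI (Q w (4 * \<rho>)) g" unfolding S_def by (intro SI_mono_set dd) auto
     moreover have H0: "0 \<le> H / \<rho> ^ (n + 1)" using Ck \<rho> by (simp add: H_def)
     ultimately have "H / \<rho> ^ (n + 1) * S \<le> H / \<rho> ^ (n + 1) * SI (Q w (4 * \<rho>)) g" by (intro mult_left_mono)
     then have "\<bar>v 0 w - c\<bar> \<le> \<bar>H / \<rho> ^ (n + 1) * SI (Q w (4 * \<rho>)) g\<bar>"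
      using base[OF True] unfolding S_def by linarith
     then have "(v 0 w - c)^2 \<le> (H / \<rho> ^ (n + 1) * SI (Q w (4 * \<rho>)) g)^2" by (rule abs_le_square_iff[THEN iffD1])
     then show ?thesis using True by (simp only: power_mult_distrib) simp
    qed simp
   qed
   also have "\<dots> = (H / \<rho> ^ (n + 1))^2 * (LBINT w. (SI (Q w (4 * \<rho>)) g)^2)" by simp
   also have "\<dots> \<le> (H / \<rho> ^ (n + 1))^2 * (\<omega> powr (3 - \<beta>) * (4 * \<rho>) ^ (2 * n + 3) * A)"
    by (rule mult_left_mono[OF SIsq(2)]) (use \<rho> in auto)
   also have "\<dots> = H^2 * (\<omega> powr (3 - \<beta>) * 4 ^ (2 * n + 3)) * (\<rho> ^ (2 * n + 3) / (\<rho> ^ (n + 1))^2) * A"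
    by (simp add: power_mult_distrib power_divide)
   also have "\<rho> ^ (2 * n + 3) / (\<rho> ^ (n + 1))^2 = \<rho>"
   proof -
    have "\<rho> ^ (2 * n + 3) = \<rho> * (\<rho> ^ (n + 1))^2"
     by (simp add: power_mult[symmetric] power_add[symmetric] power_Suc[symmetric] del: power_Suc) (simp add: mult.commute numeral_3_eq_3)
    then show ?thesis using \<rho> by simp
   qed
   also have "H^2 * (\<omega> powr (3 - \<beta>) * 4 ^ (2 * n + 3)) * \<rho> * A \<le> C2 * \<rho> * A"
    unfolding C2_def using \<rho> A0 \<omega> by (intro mult_right_mono mult_left_mono power_mono) auto
   finally show ?thesis .
  qed
  have bound: "SI E (\<lambda>w. (u w - c)^2) \<le> 3 * (LBINT w. (v m w - u w)^2) + (3 * (12 * C1) + 3 * C2) * \<rho> * A" for m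
  proof -
   let ?d = "\<lambda>k w. v (Suc k) w - v k w"
   have Ld: "L2b (?d k)" for k by (rule L2b_diff[OF Lv Lv])
   have id: "integrable lborel (\<lambda>w. indicator E w * (?d k w)^2)" for k
    by (rule integrable_indicator_mult[OF E]) (use Ld in \<open>simp add: L2b_def\<close>)
   have iu: "integrable lborel (\<lambda>w. (v m w - u w)^2)" using L2b_diff[OF Lv dd(6)] by (simp add: L2b_def)
   have "SI E (\<lambda>w. (u w - c)^2) \<le> (LBINT w. 3 * (v m w - u w)^2 + 3 * (indicator E w * (v 0 w - c)^2) + 12 * (\<Sum>k<m. (4/3) ^ k * (indicator E w * (?d k w)^2)))"
    unfolding SI_def
   proof (rule integral_mono[OF iEc[OF dd(6)]])
    show "integrable lborel (\<lambda>w. 3 * (v m w - u w)^2 + 3 * (indicator E w * (v 0 w - c)^2) + 12 * (\<Sum>k<m. (4/3) ^ k * (indicator E w * (?d k w)^2)))"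
     using iu iEc[OF Lv] id by (intro Bochner_Integration.integrable_add integrable_mult_right Bochner_Integration.integrable_sum) auto
    fix w
    have three: "(x + y + z)^2 \<le> 3 * x^2 + 3 * y^2 + 3 * z^2" for x y z :: real
     using zero_le_power2[of "x - y"] zero_le_power2[of "x - z"] zero_le_power2[of "y - z"]
     by (simp add: power2_eq_square algebra_simps)
    show "indicator E w * (u w - c)^2 \<le> 3 * (v m w - u w)^2 + 3 * (indicator E w * (v 0 w - c)^2) + 12 * (\<Sum>k<m. (4/3) ^ k * (indicator E w * (?d k w)^2))"
    proof (cases "w \<in> E")
     case True
     have "(\<Sum>k<m. ?d k w) = v m w - v 0 w" by (rule sum_lessThan_telescope)
     then have "u w - c = (u w - v m w) + (v 0 w - c) + (\<Sum>k<m. ?d k w)" by simp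
     then have "(u w - c)^2 \<le> 3 * (u w - v m w)^2 + 3 * (v 0 w - c)^2 + 3 * (\<Sum>k<m. ?d k w)^2"
      using three by metis
     then show ?thesis using True sum_square_weighted[of "\<lambda>k. ?d k w" m] by (simp add: power2_commute[of "u w"])
    qed simp
   qed
   also have "\<dots> = 3 * (LBINT w. (v m w - u w)^2) + 3 * SI E (\<lambda>w. (v 0 w - c)^2) + 12 * (\<Sum>k<m. (4/3) ^ k * SI E (\<lambda>w. (?d k w)^2))"
    unfolding SI_def using iu iEc[OF Lv] id by (simp add: Bochner_Integration.integral_sum)
   also have "(\<Sum>k<m. (4/3) ^ k * SI E (\<lambda>w. (?d k w)^2)) \<le> (\<Sum>k<m. (4/3) ^ k * (C1 * s k * A))"
    by (intro sum_mono mult_left_mono step) auto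
   also have "(\<Sum>k<m. (4/3) ^ k * (C1 * s k * A)) = C1 * R * A * (\<Sum>k<m. (2/3) ^ k)"
    unfolding sum_distrib_left by (intro sum.cong) (auto simp: s_def power_divide power_mult_distrib[symmetric] field_simps)
   also have "C1 * R * A * (\<Sum>k<m. (2/3) ^ k) \<le> C1 * \<rho> * A * 3"
    using C1 A0 \<rho> by (intro mult_mono sum_two_thirds mult_nonneg_nonneg sum_nonneg) (auto simp: R_def)
   finally show ?thesis using b0 by (simp add: algebra_simps)
  qed
  have "s \<longlonglongrightarrow> 0" unfolding s_def[abs_def] by (intro LIMSEQ_divide_realpow_zero) simp
  then have "(\<lambda>k. s k + (s k)^2) \<longlonglongrightarrow> 0 + 0^2" by (intro tendsto_intros)
  then have "(\<lambda>k. s k + (s k)^2) \<longlonglongrightarrow> 0" by simp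
  from mollify_L2_limit[OF pkernelD(2)[OF K] this dd(6)]
  have lim: "(\<lambda>m. \<integral>w. (v m w - u w)^2 \<partial>lborel) \<longlonglongrightarrow> 0" unfolding v_def .
  have "(\<lambda>m. 3 * (LBINT w. (v m w - u w)^2) + (3 * (12 * C1) + 3 * C2) * \<rho> * A) \<longlonglongrightarrow> 3 * 0 + (3 * (12 * C1) + 3 * C2) * \<rho> * A"
   by (intro tendsto_intros lim)
  from LIMSEQ_le_const[OF this] bound
  have "SI E (\<lambda>w. (u w - c)^2) \<le> 3 * 0 + (3 * (12 * C1) + 3 * C2) * \<rho> * A" by blast
  also have "\<dots> \<le> Cf * \<rho> * A" using \<rho> A0 by (simp add: Cf_def algebra_simps)
  finally show ?thesis using iEc[OF dd(6)] unfolding E_def A_def by blast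
 qed
 have "Cf > 0" using C1 C2 by (simp add: Cf_def)
 with main show ?thesis unfolding \<beta>_def by blast
qed

section \<open>Cutoff functions and subtraction of constants\<close>

lemma square_pos_part_derivative: "((\<lambda>y. (max 0 y)^2) has_field_derivative 2 * max 0 y) (at (y::real))"
proof -
 consider "y > 0" | "y < 0" | "y = 0" by linarith
 then show ?thesis
 proof cases
  case 1
  have "((\<lambda>y. y^2) has_field_derivative 2 * max 0 y) (at y)"
   using 1 by (auto intro!: derivative_eq_intros)
  then show ?thesis
   by (rule has_field_derivative_transform_within_open[of _ _ _ "{0<..}"]) (use 1 in auto)
 next
  case 2
  have "((\<lambda>y. 0) has_field_derivative 2 * max 0 y) (at y)" using 2 by simp
  then show ?thesis
   by (rule has_field_derivative_transform_within_open[of _ _ _ "{..<0}"]) (use 2 in auto)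
 next
  case 3
  have "((\<lambda>h. ((max 0 h)^2 - (max 0 0)^2) / (h - 0)) \<longlongrightarrow> (0::real)) (at 0)"
  proof (rule Lim_null_comparison)
   show "\<forall>\<^sub>F h in at 0. norm (((max 0 h)^2 - (max 0 0)^2) / (h - 0)) \<le> \<bar>h\<bar>"
    by (intro always_eventually allI) (auto simp: max_def power2_eq_square)
   show "((\<lambda>h. \<bar>h\<bar>) \<longlongrightarrow> (0::real)) (at 0)" by (rule tendsto_eq_intros | simp)+
  qed
  then show ?thesis unfolding has_field_derivative_iff using 3 by simp
 qed
qed

text \<open>
  Take the product of \<open>(1 - |x|\<^sup>2/r\<^sup>2)\<^sub>+\<^sup>2\<close> and \<open>(1 - t\<^sup>2/r^4)\<^sub>+\<^sup>2\<close>.  Squares of positive parts are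
  continuously differentiable and satisfy \<open>|\<nabla>\<zeta>|\<^sup>2 \<le> const * \<zeta> / r\<^sup>2\<close>, which allows the gradient of the
  cutoff to be absorbed without taking a root of the cutoff.
\<close>

lemma parabolic_cutoff_exists:
 fixes z0 :: "(real ^ 'n) \<times> real"
 assumes r: "r > 0"
 shows "\<exists>\<zeta> \<zeta>'. (\<forall>z. (\<zeta> has_derivative \<zeta>' z) (at z)) \<and> (\<forall>b. continuous_on UNIV (\<lambda>z. \<zeta>' z b)) \<and>
  (\<forall>z. 0 \<le> \<zeta> z \<and> \<zeta> z \<le> 1) \<and> (\<forall>z. z \<notin> Q z0 r --> \<zeta> z = 0 \<and> (\<forall>b. \<zeta>' z b = 0)) \<and>
  (\<forall>z j. (\<zeta>' z (dx j))^2 \<le> 16 / r^2 * \<zeta> z) \<and> (\<forall>z. \<bar>\<zeta>' z dt\<bar> \<le> 4 / r^2) \<and>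
  (\<forall>z\<in>Q z0 (2/3 * r). 1/10 \<le> \<zeta> z)"
proof -
 define a where "a z = 1 - (fst z - fst z0) \<bullet> (fst z - fst z0) / r^2" for z :: "(real ^ 'n) \<times> real"
 define b where "b z = 1 - (snd z - snd z0)^2 / r ^ 4" for z :: "(real ^ 'n) \<times> real"
 define a' where "a' z h = - (2 * ((fst z - fst z0) \<bullet> fst h) / r^2)" for z h :: "(real ^ 'n) \<times> real"
 define b' where "b' z h = - (2 * (snd z - snd z0) * snd h / r ^ 4)" for z h :: "(real ^ 'n) \<times> real"
 have da: "(a has_derivative a' z) (at z)" for z
  unfolding a_def[abs_def] a'_def[abs_def] using r
  by (auto intro!: derivative_eq_intros simp: fun_eq_iff inner_commute field_simps)
 have db: "(b has_derivative b' z) (at z)" for z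
  unfolding b_def[abs_def] b'_def[abs_def] using r
  by (auto intro!: derivative_eq_intros simp: fun_eq_iff power2_eq_square field_simps)
 define \<zeta> where "\<zeta> z = (max 0 (a z))^2 * (max 0 (b z))^2" for z
 define \<zeta>' where "\<zeta>' z h = (max 0 (a z))^2 * (2 * max 0 (b z) * b' z h) + 2 * max 0 (a z) * a' z h * (max 0 (b z))^2" for z h
 have comp: "((\<lambda>z. (max 0 (f z))^2) has_derivative (\<lambda>h. 2 * max 0 (f z) * f' h)) (at z)"
  if "(f has_derivative f') (at z)" for f :: "(real ^ 'n) \<times> real => real" and f' z
  using has_derivative_compose[where f=f and g="\<lambda>y. (max 0 y)^2", OF that square_pos_part_derivative[of "f z", unfolded has_field_derivative_def]] .
 have d: "(\<zeta> has_derivative \<zeta>' z) (at z)" for z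
  unfolding \<zeta>_def[abs_def] \<zeta>'_def[abs_def] by (intro has_derivative_mult comp da db)
 have ca: "continuous_on UNIV a" and cb: "continuous_on UNIV b"
  using has_derivative_continuous[OF da] has_derivative_continuous[OF db] by (simp_all add: continuous_at_imp_continuous_on)
 have ca': "continuous_on UNIV (\<lambda>z. a' z h)" and cb': "continuous_on UNIV (\<lambda>z. b' z h)" for h
  unfolding a'_def b'_def using r by (intro continuous_intros; simp)+
 have c: "continuous_on UNIV (\<lambda>z. \<zeta>' z h)" for h
  unfolding \<zeta>'_def by (intro continuous_intros ca cb ca' cb')
 have a1: "a z \<le> 1" and b1: "b z \<le> 1" for z using r by (auto simp: a_def b_def)
 have ma: "0 \<le> max 0 (a z)" "max 0 (a z) \<le> 1" and mb: "0 \<le> max 0 (b z)" "max 0 (b z) \<le> 1" for z using a1 b1 by auto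
 have sq1: "0 \<le> (max 0 (a z))^2" "(max 0 (a z))^2 \<le> 1" "0 \<le> (max 0 (b z))^2" "(max 0 (b z))^2 \<le> 1" for z
  using power_le_one[OF ma, of z 2] power_le_one[OF mb, of z 2] by auto
 have apos: "a z > 0 \<longleftrightarrow> norm (fst z - fst z0) < r" for z
 proof -
  have "a z > 0 \<longleftrightarrow> (norm (fst z - fst z0))^2 < r^2" using r by (simp add: a_def power2_norm_eq_inner)
  also have "\<dots> \<longleftrightarrow> norm (fst z - fst z0) < r" using r power_mono_iff[of r "norm (fst z - fst z0)" 2] by (simp add: not_le[symmetric])
  finally show ?thesis .
 qed
 have bpos: "b z > 0 \<longleftrightarrow> \<bar>snd z - snd z0\<bar> < r^2" for z
 proof -
  have "b z > 0 \<longleftrightarrow> \<bar>snd z - snd z0\<bar>\<^sup>2 < (r^2)^2" using r by (simp add: b_def flip: power_mult)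
  also have "\<dots> \<longleftrightarrow> \<bar>snd z - snd z0\<bar> < r^2" using power_mono_iff[of "r^2" "\<bar>snd z - snd z0\<bar>" 2] by (simp only: not_le[symmetric]) simp
  finally show ?thesis .
 qed
 have out: "\<zeta> z = 0 \<and> (\<forall>h. \<zeta>' z h = 0)" if "z \<notin> Q z0 r" for z
  using that apos[of z] bpos[of z] by (auto simp: mem_Q \<zeta>_def \<zeta>'_def max_def)
 have rng: "0 \<le> \<zeta> z \<and> \<zeta> z \<le> 1" for z
  unfolding \<zeta>_def using sq1[of z] by (auto intro: mult_le_one)
 have grad: "(\<zeta>' z (dx j))^2 \<le> 16 / r^2 * \<zeta> z" for z j
 proof (cases "a z > 0")
  case True
  have "\<bar>(fst z - fst z0) $ j\<bar> \<le> r" using component_le_norm_cart[of "fst z - fst z0" j] apos[of z] True by linarith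
  then have "(a' z (dx j))^2 \<le> 4 / r^2"
  proof -
   assume k: "\<bar>(fst z - fst z0) $ j\<bar> \<le> r"
   have "(a' z (dx j))^2 = 4 * ((fst z - fst z0) $ j)^2 / (r^2 * r^2)"
   proof -
    have sq: "(- (2 * x / r^2))^2 = 4 * x^2 / (r^2 * r^2)" for x :: real
     by (simp add: power2_eq_square mult_ac)
    have "a' z (dx j) = - (2 * ((fst z - fst z0) $ j) / r^2)" by (simp add: a'_def inner_axis)
    then show ?thesis by (simp only: sq)
   qed
   also have "\<dots> \<le> 4 * r^2 / (r^2 * r^2)" using k r abs_le_square_iff[of "(fst z - fst z0) $ j" r] by (intro divide_right_mono mult_left_mono) auto
   also have "\<dots> = 4 / r^2" using r by (simp only: power2_eq_square) (simp add: field_simps)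
   finally show ?thesis .
  qed
  then have "4 * (max 0 (a z))^2 * (max 0 (b z))^2 * ((a' z (dx j))^2 * (max 0 (b z))^2) \<le> 4 * (max 0 (a z))^2 * (max 0 (b z))^2 * (4 / r^2 * 1)"
   using sq1[of z] r by (intro mult_left_mono mult_mono) auto
  moreover have "(\<zeta>' z (dx j))^2 = 4 * (max 0 (a z))^2 * (max 0 (b z))^2 * ((a' z (dx j))^2 * (max 0 (b z))^2)"
   by (simp add: \<zeta>'_def b'_def power2_eq_square algebra_simps)
  ultimately show ?thesis by (simp add: \<zeta>_def)
 next
  case False
  then have "max 0 (a z) = 0" by auto
  then have "\<zeta>' z (dx j) = 0" "\<zeta> z = 0" by (simp_all add: \<zeta>'_def \<zeta>_def)
  then show ?thesis by simp
 qed
 have time: "\<bar>\<zeta>' z dt\<bar> \<le> 4 / r^2" for z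
 proof (cases "b z > 0")
  case True
  have k: "\<bar>snd z - snd z0\<bar> \<le> r^2" using bpos[of z] True by simp
  have "\<bar>b' z dt\<bar> = 2 * \<bar>snd z - snd z0\<bar> / r ^ 4"
  proof -
   have "\<bar>- (2 * x * 1 / r ^ 4)\<bar> = 2 * \<bar>x\<bar> / r ^ 4" for x :: real using r by (simp add: abs_mult)
   then show ?thesis by (simp only: b'_def snd_conv)
  qed
  also have "\<dots> \<le> 2 * r^2 / r ^ 4" using k r by (intro divide_right_mono mult_left_mono) auto
  also have "\<dots> = 2 / r^2" using r by (simp add: power2_eq_square eval_nat_numeral)
  finally have b2: "\<bar>b' z dt\<bar> \<le> 2 / r^2" .
  have "\<bar>\<zeta>' z dt\<bar> = (max 0 (a z))^2 * (2 * max 0 (b z) * \<bar>b' z dt\<bar>)"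
   using mb[of z] by (simp add: \<zeta>'_def a'_def abs_mult)
  also have "\<dots> \<le> 1 * (2 * 1 * (2 / r^2))"
   using sq1[of z] mb[of z] b2 r by (intro mult_mono) auto
  finally show ?thesis by simp
 next
  case False
  then have "max 0 (b z) = 0" by auto
  then show ?thesis using r by (simp add: \<zeta>'_def)
 qed
 have low: "1/10 \<le> \<zeta> z" if z: "z \<in> Q z0 (2/3 * r)" for z
 proof -
  have "(norm (fst z - fst z0))^2 \<le> (2/3 * r)^2" using z by (intro power_mono) (auto simp: mem_Q)
  then have "(norm (fst z - fst z0))^2 \<le> 4/9 * r^2" by (simp add: power_mult_distrib power_divide)
  then have "a z \<ge> 5/9" using r by (simp add: a_def power2_norm_eq_inner[symmetric] field_simps)
  then have 1: "(5/9)^2 \<le> (max 0 (a z))^2" by (intro power_mono) auto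
  have "\<bar>snd z - snd z0\<bar> \<le> (2/3 * r)^2" using z by (auto simp: mem_Q)
  then have "\<bar>snd z - snd z0\<bar>\<^sup>2 \<le> ((2/3 * r)^2)^2" by (intro power_mono) auto
  then have "(snd z - snd z0)^2 \<le> 16/81 * r ^ 4" by (simp add: power_mult_distrib power_divide flip: power_mult)
  then have "b z \<ge> 65/81" using r by (simp add: b_def field_simps)
  then have 2: "(65/81)^2 \<le> (max 0 (b z))^2" by (intro power_mono) auto
  have "(5/9)^2 * (65/81)^2 \<le> \<zeta> z" unfolding \<zeta>_def by (intro mult_mono 1 2) auto
  then show ?thesis by (simp add: power_divide)
 qed
 show ?thesis
  using d c rng out grad time low by (intro exI[of _ \<zeta>] exI[of _ \<zeta>']) simp
qed

text \<open>
  A constant is orthogonal to derivatives of test functions.  The indicator keeps the support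
  bounded.
\<close>

lemma flux_solution_shift:
 fixes P :: "((real ^ 'n) \<times> real) set"
 assumes sol: "flux_solution P u D G" and P: "P \<in> sets borel" "bounded P"
 shows "flux_solution P (\<lambda>w. indicator P w * (u w - c)) D G"
proof -
 have Lu: "L2b u" using sol by (simp add: flux_solution_def)
 have bP: "bounded_borel (indicator P :: _ => real)"
  using P by (auto simp: bounded_borel_def indicator_def intro!: exI[of _ 1])
 have LP: "L2b (indicator P :: _ => real)"
  by (rule L2b_bounded[OF bP]) (rule bounded_subset[OF P(2)], auto simp: indicator_def split: if_splits)
 have "L2b (\<lambda>w. indicator P w * u w - c * indicator P w)"
  by (intro L2b_diff L2b_bounded_mult bP Lu bounded_borel_const LP)
 then have L: "L2b (\<lambda>w. indicator P w * (u w - c))" by (simp add: right_diff_distrib mult.commute)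
 have key: "(LBINT w. indicator P w * (u w - c) * frechet_derivative \<psi> (at w) b) = (LBINT w. u w * frechet_derivative \<psi> (at w) b)"
  if \<psi>: "test_function P \<psi>" and b: "b \<in> Basis" for \<psi> b
 proof -
  have cl: "compact (closure {x. \<psi> x \<noteq> 0})" "closure {x. \<psi> x \<noteq> 0} \<subseteq> P" and C: "\<And>k. C_k k \<psi>"
   using \<psi> by (auto simp: test_function_def compactly_contained_def)
  have sk: "smooth_kernel \<psi>" unfolding smooth_kernel_def using C
   by (auto intro: bounded_subset[OF compact_imp_bounded[OF cl(1)] closure_subset])
  let ?d = "\<lambda>w. frechet_derivative \<psi> (at w) b"
  have d0: "w \<in> P" if "?d w \<noteq> 0" for w using derivative_zero_outside_closure[of w \<psi> b] cl(2) that by auto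
  have sd: "smooth_kernel ?d" by (rule smooth_kernel_derivative[OF sk b])
  obtain R where R: "\<forall>x. \<psi> x \<noteq> 0 --> norm x \<le> R" using smooth_kernel_support[OF sk] ..
  have z: "(LBINT w. ?d w) = 0"
   by (rule integral_derivative_zero[where f=\<psi> and f'="\<lambda>w. frechet_derivative \<psi> (at w)" and R=R])
     (use C_k_has_derivative[OF C] smooth_kernel_continuous[OF sd] R in auto)
  have id: "integrable lborel ?d" "integrable lborel (\<lambda>w. u w * ?d w)"
  proof -
   have bd: "bounded {w. ?d w \<noteq> 0}" using sd by (simp add: smooth_kernel_def)
   show "integrable lborel ?d"
    by (rule integrable_continuous_bounded_support[OF smooth_kernel_continuous[OF sd] _ bd]) simp
   show "integrable lborel (\<lambda>w. u w * ?d w)"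
    using integrable_bounded_borel_mult(1)[OF smooth_kernel_bounded_borel[OF sd] L2b_integrable[OF Lu]] by (simp add: mult.commute)
  qed
  have "(\<lambda>w. indicator P w * (u w - c) * ?d w) = (\<lambda>w. u w * ?d w - c * ?d w)"
   using d0 by (auto simp: fun_eq_iff indicator_def algebra_simps)
  then show ?thesis using id z by simp
 qed
 show ?thesis
  using sol L key[OF _ dx_Basis] key[OF _ dt_Basis] unfolding flux_solution_def by simp
qed

section \<open>The Caccioppoli inequality\<close>

definition mean :: "'a::euclidean_space set => ('a => real) => real" where
 "mean S f = SI S f / measure lborel S"

definition sqsum :: "nat => (nat => 'n::finite => 'a => real) => 'a => real" where
 "sqsum N D w = (\<Sum>i<N. \<Sum>j\<in>UNIV. (D i j w)^2)"

lemma sqsum_nonneg: "0 \<le> sqsum N D w"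
 unfolding sqsum_def by (intro sum_nonneg) auto

lemma abs_le_sqrt_sqsum: "i < N ==> \<bar>D i j w\<bar> \<le> sqrt (sqsum N D w)"
proof -
 assume i: "i < N"
 have "(D i j w)^2 \<le> (\<Sum>j\<in>UNIV. (D i j w)^2)" by (rule member_le_sum) auto
 also have "\<dots> \<le> sqsum N D w" unfolding sqsum_def
  by (rule member_le_sum[of i "{..<N}" "\<lambda>i. \<Sum>j\<in>UNIV. (D i j w)^2"]) (use i in \<open>auto intro!: sum_nonneg\<close>)
 finally show ?thesis using real_sqrt_le_mono by fastforce
qed

lemma L2b_sqrt_sqsum:
 assumes "\<And>i j. i < N ==> L2b (D i j)"
 shows "L2b (\<lambda>w. sqrt (sqsum N D w))" "integrable lborel (sqsum N D)"
proof -
 have m: "sqsum N D \<in> borel_measurable borel"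
  unfolding sqsum_def[abs_def] by (intro borel_measurable_sum borel_measurable_power L2b_measurable assms) auto
 show i: "integrable lborel (sqsum N D)"
  unfolding sqsum_def[abs_def] by (intro Bochner_Integration.integrable_sum) (use assms in \<open>auto simp: L2b_def\<close>)
 have "bounded (\<Union>i<N. \<Union>j\<in>UNIV. {w. D i j w \<noteq> 0})"
  by (intro bounded_UN ballI finite) (use assms in \<open>auto simp: L2b_def\<close>)
 then have "bounded {w. sqrt (sqsum N D w) \<noteq> 0}"
 proof (rule bounded_subset)
  show "{w. sqrt (sqsum N D w) \<noteq> 0} \<subseteq> (\<Union>i<N. \<Union>j\<in>UNIV. {w. D i j w \<noteq> 0})"
  proof (rule subsetI, rule ccontr)
   fix w assume w: "w \<in> {w. sqrt (sqsum N D w) \<noteq> 0}" "w \<notin> (\<Union>i<N. \<Union>j\<in>UNIV. {w. D i j w \<noteq> 0})"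
   then have "D i j w = 0" if "i < N" for i j using that by simp
   then have "sqsum N D w = 0" by (simp add: sqsum_def)
   then show False using w(1) by simp
  qed
 qed
 then show "L2b (\<lambda>w. sqrt (sqsum N D w))"
  using i m by (simp add: L2b_def sqsum_nonneg)
qed

text \<open>
  Young's inequality, with the factor \<open>\<zeta>\<close> recovered from the bound on the cutoff gradient \<open>p\<close>.
\<close>

lemma young_gradient:
 fixes p e X \<alpha> r \<zeta> :: real
 assumes "p^2 \<le> 16 / r^2 * \<zeta>" "\<alpha> > 0" "r > 0"
 shows "\<bar>p * (e * X)\<bar> \<le> \<alpha> * (\<zeta> * X^2) + 4 / \<alpha> / r^2 * e^2"
proof -
 define t where "t = \<alpha> * r^2 / 8"
 have t: "t > 0" using assms by (simp add: t_def)
 have "0 \<le> (t * \<bar>p * X\<bar> - \<bar>e\<bar>)^2" by simp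
 then have "2 * t * (\<bar>p * X\<bar> * \<bar>e\<bar>) \<le> t^2 * (p * X)^2 + e^2"
  by (simp add: power2_diff power_mult_distrib)
 then have "2 * t * (\<bar>p * X\<bar> * \<bar>e\<bar>) / (2 * t) \<le> (t^2 * (p * X)^2 + e^2) / (2 * t)"
  using t by (intro divide_right_mono) auto
 then have "\<bar>p * X\<bar> * \<bar>e\<bar> \<le> t / 2 * (p^2 * X^2) + e^2 / (2 * t)"
  using t by (simp add: power2_eq_square add_divide_distrib mult_ac)
 also have "t / 2 * (p^2 * X^2) \<le> t / 2 * (16 / r^2 * \<zeta> * X^2)"
  using assms t by (intro mult_left_mono mult_right_mono) auto
 also have "t / 2 * (16 / r^2 * \<zeta> * X^2) = \<alpha> * (\<zeta> * X^2)" using assms by (simp add: t_def)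
 also have "e^2 / (2 * t) = 4 / \<alpha> / r^2 * e^2" using assms by (simp add: t_def)
 finally show ?thesis by (simp add: abs_mult mult_ac)
qed

lemma young_weighted:
 fixes D F \<nu> :: real
 assumes "\<nu> > 0"
 shows "\<bar>D * F\<bar> \<le> \<nu> / 4 * D^2 + F^2 / \<nu>"
proof -
 have "0 \<le> (\<nu> / 2 * \<bar>D\<bar> - \<bar>F\<bar>)^2" by simp
 then have "\<nu> * \<bar>D * F\<bar> \<le> \<nu>^2 / 4 * D^2 + F^2"
  by (simp add: power2_diff power_mult_distrib power_divide abs_mult mult_ac)
 then have "\<nu> * \<bar>D * F\<bar> / \<nu> \<le> (\<nu>^2 / 4 * D^2 + F^2) / \<nu>" using assms by (intro divide_right_mono) auto
 then show ?thesis using assms by (simp add: power2_eq_square add_divide_distrib mult_ac)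
qed

lemma powr_add_le:
 assumes "0 < p" "p \<le> 2" "x \<ge> 0" "y \<ge> 0"
 shows "(x + y) powr p \<le> 4 * (x powr p + (y::real) powr p)"
proof -
 have "(x + y) powr p \<le> (2 * max x y) powr p" using assms by (intro powr_mono2) auto
 also have "\<dots> = 2 powr p * (max x y) powr p" by (rule powr_mult)
 also have "\<dots> \<le> 4 * (x powr p + y powr p)"
 proof (rule mult_mono)
  have "2 powr p \<le> (2::real) powr 2" using assms by (intro powr_mono) auto
  then show "2 powr p \<le> (4::real)" by simp
  show "(max x y) powr p \<le> x powr p + y powr p" by (cases "x \<le> y") (auto simp: max_def)
 qed auto
 finally show ?thesis .
qed

text \<open>
  The integrands of the energy identity, summed over all components: ellipticity bounds the main term
  from below, and Young's inequality splits the others so that half of it remains.  Only the sums over all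
  components appear, since ellipticity holds for the full matrix and not row by row.
\<close>

lemma caccioppoli_pointwise:
 fixes D A F :: "nat => 'n::finite => real" and e :: "nat => real" and p :: "'n => real" and \<nu> L r \<zeta> \<tau> :: real
 assumes \<nu>: "\<nu> > 0" and L: "L > 0" and r: "r > 0" and \<zeta>: "0 \<le> \<zeta>" "\<zeta> \<le> 1"
  and p: "\<And>j. (p j)^2 \<le> 16 / r^2 * \<zeta>" and \<tau>: "\<bar>\<tau>\<bar> \<le> 4 / r^2"
  and s1: "\<nu> * (\<Sum>i<N. \<Sum>j\<in>UNIV. (D i j)^2) \<le> (\<Sum>i<N. \<Sum>j\<in>UNIV. A i j * D i j)"
  and s2: "(\<Sum>i<N. \<Sum>j\<in>UNIV. (A i j)^2) \<le> L^2 * (\<Sum>i<N. \<Sum>j\<in>UNIV. (D i j)^2)"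
 shows "\<nu> / 2 * (\<zeta> * (\<Sum>i<N. \<Sum>j\<in>UNIV. (D i j)^2)) \<le>
   (\<Sum>i<N. (\<Sum>j\<in>UNIV. \<zeta> * (D i j * (A i j - F i j)) + p j * (e i * (A i j - F i j))) - 1/2 * (\<tau> * (e i * e i)))
   + (16 * CARD('n) * L^2 / \<nu> + 4 * CARD('n) + 2) / r^2 * (\<Sum>i<N. (e i)^2)
   + (1 / \<nu> + 1) * (\<Sum>i<N. \<Sum>j\<in>UNIV. (F i j)^2)"
proof -
 define \<alpha> where "\<alpha> = \<nu> / (4 * L^2)"
 have \<alpha>: "\<alpha> > 0" using \<nu> L by (simp add: \<alpha>_def)
 define k where "k = (4 / \<alpha> + 4) / r^2"
 have pt: "\<zeta> * (A i j * D i j) - \<nu> / 4 * (\<zeta> * (D i j)^2) - (1 / \<nu> + 1) * (F i j)^2 - \<alpha> * (\<zeta> * (A i j)^2) - k * (e i)^2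
   \<le> \<zeta> * (D i j * (A i j - F i j)) + p j * (e i * (A i j - F i j))" for i j
 proof -
  have 1: "\<bar>p j * (e i * A i j)\<bar> \<le> \<alpha> * (\<zeta> * (A i j)^2) + 4 / \<alpha> / r^2 * (e i)^2" by (rule young_gradient[OF p \<alpha> r])
  have 2: "\<bar>p j * (e i * F i j)\<bar> \<le> 1 * (\<zeta> * (F i j)^2) + 4 / 1 / r^2 * (e i)^2" by (rule young_gradient[OF p _ r]) simp
  have 3: "\<zeta> * \<bar>D i j * F i j\<bar> \<le> \<zeta> * (\<nu> / 4 * (D i j)^2 + (F i j)^2 / \<nu>)" by (rule mult_left_mono[OF young_weighted[OF \<nu>] \<zeta>(1)])
  have 4: "\<zeta> * (F i j)^2 \<le> (F i j)^2" using \<zeta> by (simp add: mult_left_le_one_le)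
  then have 5: "\<zeta> * ((F i j)^2 / \<nu>) \<le> (F i j)^2 / \<nu>" using divide_right_mono[OF 4, of \<nu>] \<nu> by simp
  have 6: "\<zeta> * (D i j * F i j) \<le> \<zeta> * \<bar>D i j * F i j\<bar>" using \<zeta>(1) by (intro mult_left_mono) auto
  have "\<zeta> * (D i j * (A i j - F i j)) + p j * (e i * (A i j - F i j))
   = \<zeta> * (A i j * D i j) - \<zeta> * (D i j * F i j) + p j * (e i * A i j) - p j * (e i * F i j)"
   by (simp add: algebra_simps)
  moreover have "\<zeta> * (\<nu> / 4 * (D i j)^2 + (F i j)^2 / \<nu>) = \<nu> / 4 * (\<zeta> * (D i j)^2) + \<zeta> * ((F i j)^2 / \<nu>)"
   by (simp add: algebra_simps)
  moreover have "k * (e i)^2 = 4 / \<alpha> / r^2 * (e i)^2 + 4 / r^2 * (e i)^2"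
   by (simp add: k_def add_divide_distrib distrib_right)
  moreover have "(1 / \<nu> + 1) * (F i j)^2 = (F i j)^2 / \<nu> + (F i j)^2" by (simp add: distrib_right)
  ultimately show ?thesis using 1 2 3 4 5 6 by linarith
 qed
 let ?D = "\<Sum>i<N. \<Sum>j\<in>UNIV. (D i j)^2" and ?A = "\<Sum>i<N. \<Sum>j\<in>UNIV. (A i j)^2" and ?F = "\<Sum>i<N. \<Sum>j\<in>UNIV. (F i j)^2"
 let ?X = "\<lambda>i j. \<zeta> * (D i j * (A i j - F i j)) + p j * (e i * (A i j - F i j))"
 have "(\<Sum>i<N. \<Sum>j\<in>UNIV. \<zeta> * (A i j * D i j) - \<nu> / 4 * (\<zeta> * (D i j)^2) - (1 / \<nu> + 1) * (F i j)^2 - \<alpha> * (\<zeta> * (A i j)^2) - k * (e i)^2)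
  \<le> (\<Sum>i<N. \<Sum>j\<in>UNIV. ?X i j)" by (intro sum_mono pt)
 also have "(\<Sum>i<N. \<Sum>j\<in>UNIV. \<zeta> * (A i j * D i j) - \<nu> / 4 * (\<zeta> * (D i j)^2) - (1 / \<nu> + 1) * (F i j)^2 - \<alpha> * (\<zeta> * (A i j)^2) - k * (e i)^2)
  = \<zeta> * (\<Sum>i<N. \<Sum>j\<in>UNIV. A i j * D i j) - \<nu> / 4 * (\<zeta> * ?D) - (1 / \<nu> + 1) * ?F - \<alpha> * (\<zeta> * ?A) - CARD('n) * k * (\<Sum>i<N. (e i)^2)"
  by (simp add: sum_subtractf sum_distrib_left mult.assoc)
 finally have main: "\<zeta> * (\<Sum>i<N. \<Sum>j\<in>UNIV. A i j * D i j) - \<nu> / 4 * (\<zeta> * ?D) - (1 / \<nu> + 1) * ?F - \<alpha> * (\<zeta> * ?A) - CARD('n) * k * (\<Sum>i<N. (e i)^2)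
  \<le> (\<Sum>i<N. \<Sum>j\<in>UNIV. ?X i j)" .
 have a1: "\<zeta> * (\<nu> * ?D) \<le> \<zeta> * (\<Sum>i<N. \<Sum>j\<in>UNIV. A i j * D i j)" by (rule mult_left_mono[OF s1 \<zeta>(1)])
 have a2: "\<alpha> * (\<zeta> * ?A) \<le> \<alpha> * (\<zeta> * (L^2 * ?D))" using \<alpha> by (intro mult_left_mono s2 \<zeta>(1)) auto
 have a3: "\<alpha> * (\<zeta> * (L^2 * ?D)) = \<nu> / 4 * (\<zeta> * ?D)" using L by (simp add: \<alpha>_def)
 have a4: "(\<Sum>i<N. 1/2 * (\<tau> * (e i * e i))) \<le> (\<Sum>i<N. 2 / r^2 * (e i)^2)"
 proof (rule sum_mono)
  fix i
  have "\<tau> * (e i)^2 \<le> 4 / r^2 * (e i)^2" using \<tau> by (intro mult_right_mono) auto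
  then show "1/2 * (\<tau> * (e i * e i)) \<le> 2 / r^2 * (e i)^2" by (simp add: power2_eq_square)
 qed
 let ?E = "\<Sum>i<N. (e i)^2" and ?T = "\<Sum>i<N. 1/2 * (\<tau> * (e i * e i))" and ?S = "\<Sum>i<N. 2 / r^2 * (e i)^2"
 let ?AD = "\<Sum>i<N. \<Sum>j\<in>UNIV. A i j * D i j" and ?XX = "\<Sum>i<N. \<Sum>j\<in>UNIV. ?X i j"
 have a5: "(16 * CARD('n) * L^2 / \<nu> + 4 * CARD('n) + 2) / r^2 * ?E = CARD('n) * k * ?E + ?S"
 proof -
  have "CARD('n) * k = (16 * CARD('n) * L^2 / \<nu> + 4 * CARD('n)) / r^2" using \<nu> L by (simp add: k_def \<alpha>_def field_simps)
  moreover have "(\<Sum>i<N. 2 / r^2 * (e i)^2) = 2 / r^2 * (\<Sum>i<N. (e i)^2)" by (simp only: sum_distrib_left)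
  ultimately show ?thesis by (simp only: add_divide_distrib distrib_right)
 qed
 have a6: "(\<Sum>i<N. (\<Sum>j\<in>UNIV. ?X i j) - 1/2 * (\<tau> * (e i * e i))) = ?XX - ?T"
  by (rule sum_subtractf)
 define b where "b = \<nu> * (\<zeta> * ?D)"
 have b: "\<zeta> * (\<nu> * ?D) = b" "\<nu> / 2 * (\<zeta> * ?D) = b / 2" "\<nu> / 4 * (\<zeta> * ?D) = b / 4"
  unfolding b_def by simp_all
 have m1: "\<zeta> * ?AD - b / 4 - (1 / \<nu> + 1) * ?F - \<alpha> * (\<zeta> * ?A) - CARD('n) * k * ?E \<le> ?XX"
  using main unfolding b(3) .
 have m2: "b \<le> \<zeta> * ?AD" using a1 unfolding b(1) .
 have m3: "\<alpha> * (\<zeta> * ?A) \<le> b / 4" using a2 unfolding a3 b(3) .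
 have fin: "b' / 2 \<le> X - T + (k' + s) + f" if "a - b' / 4 - f - c - k' \<le> X" "b' \<le> a" "c \<le> b' / 4" "T \<le> s"
  for a b' c f k' X T s :: real using that by linarith
 have "b / 2 \<le> ?XX - ?T + (CARD('n) * k * ?E + ?S) + (1 / \<nu> + 1) * ?F"
  by (rule fin[OF m1 m2 m3 a4])
 then show ?thesis by (simp only: a5 a6 b(2))
qed

lemma mean_nonneg: "(\<And>w. 0 \<le> f w) ==> 0 \<le> mean S f"
 unfolding mean_def by (intro divide_nonneg_nonneg SI_nonneg) auto

text \<open>
  A system \<open>u_t - div A = - div F\<close> with gradient \<open>D\<close>, for which the structure conditions between \<open>A\<close>
  and \<open>D\<close> hold at every point.  The dependence of \<open>A\<close> on the gradient is forgotten.
\<close>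

definition structured_system ::
  "nat => real => real => ((real ^ 'n) \<times> real) set => (nat => (real ^ 'n) \<times> real => real) =>
   (nat => 'n => (real ^ 'n) \<times> real => real) => (nat => 'n => (real ^ 'n) \<times> real => real) =>
   (nat => 'n => (real ^ 'n) \<times> real => real) => bool" where
 "structured_system N \<nu> L P u D A F \<longleftrightarrow>
   (\<forall>i<N. flux_solution P (u i) (D i) (\<lambda>j w. A i j w - F i j w)) \<and>
   (\<forall>i<N. \<forall>j. L2b (D i j) \<and> L2b (A i j) \<and> L2b (F i j)) \<and>
   (\<forall>i<N. \<forall>j w. w \<notin> P --> D i j w = 0 \<and> F i j w = 0) \<and>
   (\<forall>w. \<nu> * sqsum N D w \<le> (\<Sum>i<N. \<Sum>j\<in>UNIV. A i j w * D i j w) \<and> sqsum N A w \<le> L^2 * sqsum N D w)"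

lemma structured_systemD:
 assumes "structured_system N \<nu> L P u D A F"
 shows "i < N ==> flux_solution P (u i) (D i) (\<lambda>j w. A i j w - F i j w)"
  "i < N ==> L2b (D i j)" "i < N ==> L2b (A i j)" "i < N ==> L2b (F i j)"
  "i < N ==> w \<notin> P ==> D i j w = 0" "i < N ==> w \<notin> P ==> F i j w = 0"
  "\<nu> * sqsum N D w \<le> (\<Sum>i<N. \<Sum>j\<in>UNIV. A i j w * D i j w)" "sqsum N A w \<le> L^2 * sqsum N D w"
 using assms unfolding structured_system_def by blast+

text \<open>
  The pointwise inequality, integrated.  Its first sum on the right is the integrand of the energy identity
  for \<open>u - c\<close> and integrates to zero; on the small cylinder the cutoff is at least \<open>1/10\<close>.
\<close>

lemma caccioppoli_inequality:
 fixes z0 :: "(real ^ 'n) \<times> real" and L :: real and c :: "nat => real"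
 assumes S: "structured_system N \<nu> L (Q z0 (2 * \<rho>)) u D A F" and \<rho>: "\<rho> > 0" and \<nu>: "\<nu> > 0" and L: "L > 0"
  and iu: "\<And>i. i < N ==> integrable lborel (\<lambda>w. indicator (Q z0 (3/2 * \<rho>)) w * (u i w - c i)^2)"
 shows "\<nu> / 20 * SI (Q z0 \<rho>) (sqsum N D) \<le>
   (16 * CARD('n) * L^2 / \<nu> + 4 * CARD('n) + 2) / (3/2 * \<rho>)^2 * (\<Sum>i<N. SI (Q z0 (3/2 * \<rho>)) (\<lambda>w. (u i w - c i)^2))
   + (1 / \<nu> + 1) * SI (Q z0 (2 * \<rho>)) (sqsum N F)"
proof -
 define P where "P = Q z0 (2 * \<rho>)"
 \<comment> \<open>The cutoff lives where \<open>u - c\<close> is controlled and is at least \<open>1/10\<close> on \<open>Q z0 (2/3 * r) = Q z0 \<rho>\<close>.\<close>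
 define r where "r = 3/2 * \<rho>"
 define E where "E = Q z0 r"
 have r: "r > 0" using \<rho> by (simp add: r_def)
 note sd = structured_systemD[OF S, folded P_def]
 note sol = sd(1) and LD = sd(2) and LA = sd(3) and LF = sd(4) and F0 = sd(6) and st = sd(7,8)
 have oP: "open P" and bP: "P \<in> sets borel" "bounded P" by (simp_all add: P_def open_Q bounded_Q)
 have bE: "E \<in> sets borel" by (simp add: E_def)
 define e where "e i w = indicator P w * (u i w - c i)" for i w
 have sole: "flux_solution P (e i) (D i) (\<lambda>j w. A i j w - F i j w)" if "i < N" for i
  unfolding e_def[abs_def] by (rule flux_solution_shift[OF sol[OF that] bP])
 have Le: "L2b (e i)" and LG: "L2b (\<lambda>w. A i j w - F i j w)" if "i < N" for i j
  using sole[OF that] by (auto simp: flux_solution_def)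
 obtain \<zeta> \<zeta>' where "(\<forall>z. (\<zeta> has_derivative \<zeta>' z) (at z)) \<and> (\<forall>b. continuous_on UNIV (\<lambda>z. \<zeta>' z b)) \<and>
  (\<forall>z. 0 \<le> \<zeta> z \<and> \<zeta> z \<le> 1) \<and> (\<forall>z. z \<notin> Q z0 r --> \<zeta> z = 0 \<and> (\<forall>b. \<zeta>' z b = 0)) \<and>
  (\<forall>z j. (\<zeta>' z (dx j))^2 \<le> 16 / r^2 * \<zeta> z) \<and> (\<forall>z. \<bar>\<zeta>' z dt\<bar> \<le> 4 / r^2) \<and>
  (\<forall>z\<in>Q z0 (2/3 * r). 1/10 \<le> \<zeta> z)"
  using parabolic_cutoff_exists[OF r, of z0] by (elim exE) (rule that)
 then have \<zeta>d: "\<And>z. (\<zeta> has_derivative \<zeta>' z) (at z)" and \<zeta>c: "\<And>b. continuous_on UNIV (\<lambda>z. \<zeta>' z b)"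
  and \<zeta>01: "\<And>z. 0 \<le> \<zeta> z" "\<And>z. \<zeta> z \<le> 1" and \<zeta>out: "\<And>z. z \<notin> E ==> \<zeta> z = 0" "\<And>z b. z \<notin> E ==> \<zeta>' z b = 0"
  and \<zeta>x: "\<And>z j. (\<zeta>' z (dx j))^2 \<le> 16 / r^2 * \<zeta> z" and \<zeta>t: "\<And>z. \<bar>\<zeta>' z dt\<bar> \<le> 4 / r^2"
  and \<zeta>low: "\<And>z. z \<in> Q z0 (2/3 * r) ==> 1/10 \<le> \<zeta> z"
  unfolding E_def by blast+
 have clE: "closure E \<subseteq> P"
 proof -
  have "r < 2 * \<rho>" "r^2 < (2 * \<rho>)^2" using \<rho> by (auto simp: r_def power_mult_distrib power_divide)
  then show ?thesis using closure_Q_subset[of z0 r] unfolding E_def P_def subset_iff mem_Q by (auto intro: le_less_trans)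
 qed
 have EP: "E \<subseteq> P" using clE closure_subset by blast
 have comp: "compact (closure E)" using bounded_Q by (simp add: E_def compact_closure)
 have \<zeta>supp: "z \<in> closure E" if "\<zeta> z \<noteq> 0" for z using \<zeta>out(1)[of z] that closure_subset[of E] by auto
 have en: "(1/2) * (LBINT z. \<zeta>' z dt * (e i z * e i z))
  = (\<Sum>j\<in>UNIV. (LBINT z. \<zeta> z * (D i j z * (A i j z - F i j z))) + (LBINT z. \<zeta>' z (dx j) * (e i z * (A i j z - F i j z))))"
  if "i < N" for i
  by (rule flux_energy_identity[OF sole[OF that] oP \<zeta>d \<zeta>c comp clE \<zeta>supp])
 obtain R where R: "\<And>z. z \<in> closure E ==> norm z \<le> R" using compact_imp_bounded[OF comp] by (auto simp: bounded_iff)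
 have bb: "bounded_borel \<zeta>" 
 proof (rule bounded_borel_continuous)
  show "continuous_on UNIV \<zeta>" by (intro continuous_at_imp_continuous_on ballI has_derivative_continuous[OF \<zeta>d])
  show "norm z \<le> R" if "\<zeta> z \<noteq> 0" for z by (rule R[OF \<zeta>supp[OF that]])
 qed
 have bb': "bounded_borel (\<lambda>z. \<zeta>' z b)" for b
 proof (rule bounded_borel_continuous[OF \<zeta>c])
  show "norm z \<le> R" if "\<zeta>' z b \<noteq> 0" for z
   using \<zeta>out(2)[of z b] that closure_subset[of E] by (intro R) auto
 qed
 have i1: "integrable lborel (\<lambda>z. \<zeta>' z dt * (e i z * e i z))"
  and i2: "integrable lborel (\<lambda>z. \<zeta> z * (D i j z * (A i j z - F i j z)))"
  and i3: "integrable lborel (\<lambda>z. \<zeta>' z (dx j) * (e i z * (A i j z - F i j z)))" if "i < N" for i j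
  by (intro integrable_bounded_borel_mult(1) bb bb' L2b_mult_integrable Le LD LG that)+
 define \<Psi> where "\<Psi> w = (\<Sum>i<N. (\<Sum>j\<in>UNIV. \<zeta> w * (D i j w * (A i j w - F i j w)) + \<zeta>' w (dx j) * (e i w * (A i j w - F i j w)))
   - 1/2 * (\<zeta>' w dt * (e i w * e i w)))" for w
 have iij: "integrable lborel (\<lambda>w. (\<Sum>j\<in>UNIV. \<zeta> w * (D i j w * (A i j w - F i j w)) + \<zeta>' w (dx j) * (e i w * (A i j w - F i j w)))
   - 1/2 * (\<zeta>' w dt * (e i w * e i w)))" if "i < N" for i
  using i1[OF that] i2[OF that] i3[OF that]
  by (intro Bochner_Integration.integrable_diff Bochner_Integration.integrable_sum Bochner_Integration.integrable_add integrable_mult_right)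
 have i\<Psi>: "integrable lborel \<Psi>" unfolding \<Psi>_def[abs_def] by (intro Bochner_Integration.integrable_sum iij) auto
 have \<Psi>0: "integral\<^sup>L lborel \<Psi> = 0"
 proof -
  have "integral\<^sup>L lborel \<Psi> = (\<Sum>i<N. \<integral>w. (\<Sum>j\<in>UNIV. \<zeta> w * (D i j w * (A i j w - F i j w)) + \<zeta>' w (dx j) * (e i w * (A i j w - F i j w)))
   - 1/2 * (\<zeta>' w dt * (e i w * e i w)) \<partial>lborel)"
   unfolding \<Psi>_def[abs_def] by (intro Bochner_Integration.integral_sum iij) auto
  also have "\<dots> = (\<Sum>i<N. 0)"
  proof (intro sum.cong refl)
   fix i assume "i \<in> {..<N}"
   then have i: "i < N" by simp
   have "(LBINT w. (\<Sum>j\<in>UNIV. \<zeta> w * (D i j w * (A i j w - F i j w)) + \<zeta>' w (dx j) * (e i w * (A i j w - F i j w)))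
    - 1/2 * (\<zeta>' w dt * (e i w * e i w)))
    = (LBINT w. (\<Sum>j\<in>UNIV. \<zeta> w * (D i j w * (A i j w - F i j w)) + \<zeta>' w (dx j) * (e i w * (A i j w - F i j w))))
     - (LBINT w. 1/2 * (\<zeta>' w dt * (e i w * e i w)))"
    by (intro Bochner_Integration.integral_diff Bochner_Integration.integrable_sum Bochner_Integration.integrable_add integrable_mult_right i1 i2 i3 i)
   also have "(LBINT w. (\<Sum>j\<in>UNIV. \<zeta> w * (D i j w * (A i j w - F i j w)) + \<zeta>' w (dx j) * (e i w * (A i j w - F i j w))))
    = (\<Sum>j\<in>UNIV. (LBINT w. \<zeta> w * (D i j w * (A i j w - F i j w)) + \<zeta>' w (dx j) * (e i w * (A i j w - F i j w))))"
    by (intro Bochner_Integration.integral_sum Bochner_Integration.integrable_add i2 i3 i)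
   also have "\<dots> = (\<Sum>j\<in>UNIV. (LBINT z. \<zeta> z * (D i j z * (A i j z - F i j z))) + (LBINT z. \<zeta>' z (dx j) * (e i z * (A i j z - F i j z))))"
    by (intro sum.cong refl Bochner_Integration.integral_add i2 i3 i)
   finally show "(LBINT w. (\<Sum>j\<in>UNIV. \<zeta> w * (D i j w * (A i j w - F i j w)) + \<zeta>' w (dx j) * (e i w * (A i j w - F i j w)))
    - 1/2 * (\<zeta>' w dt * (e i w * e i w))) = 0"
    using en[OF i] by simp
  qed
  finally show ?thesis by simp
 qed
 define k1 where "k1 = (16 * CARD('n) * L^2 / \<nu> + 4 * CARD('n) + 2) / r^2"
 have k1: "k1 \<ge> 0" using \<nu> by (simp add: k1_def)
 have ptw: "\<nu> / 2 * (\<zeta> w * sqsum N D w) \<le> \<Psi> w + k1 * (\<Sum>i<N. indicator E w * (u i w - c i)^2) + (1 / \<nu> + 1) * sqsum N F w" for w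
 proof (cases "w \<in> E")
  case True
  have eE: "e i w = u i w - c i" for i using True EP by (auto simp: e_def)
  have "\<nu> / 2 * (\<zeta> w * sqsum N D w) \<le> \<Psi> w + k1 * (\<Sum>i<N. (e i w)^2) + (1 / \<nu> + 1) * sqsum N F w"
   unfolding \<Psi>_def k1_def sqsum_def
   by (rule caccioppoli_pointwise[OF \<nu> L r \<zeta>01 \<zeta>x \<zeta>t st[unfolded sqsum_def]])
  then show ?thesis using True by (simp add: eE)
 next
  case False
  then have "\<Psi> w = 0" by (simp add: \<Psi>_def \<zeta>out)
  then show ?thesis using False \<nu> sqsum_nonneg[of N F w] by (simp add: \<zeta>out)
 qed
 have iD: "integrable lborel (sqsum N D)" and iF: "integrable lborel (sqsum N F)"
  using L2b_sqrt_sqsum(2) LD LF by metis+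
 have i\<zeta>D: "integrable lborel (\<lambda>w. \<zeta> w * sqsum N D w)" by (rule integrable_bounded_borel_mult(1)[OF bb iD])
 have iEu: "integrable lborel (\<lambda>w. indicator E w * (u i w - c i)^2)" if "i < N" for i
  using iu[OF that] by (simp add: E_def r_def)
 have "\<nu> / 2 * (LBINT w. \<zeta> w * sqsum N D w) = (LBINT w. \<nu> / 2 * (\<zeta> w * sqsum N D w))" by simp
 also have "\<dots> \<le> (LBINT w. \<Psi> w + k1 * (\<Sum>i<N. indicator E w * (u i w - c i)^2) + (1 / \<nu> + 1) * sqsum N F w)"
  by (intro integral_mono ptw Bochner_Integration.integrable_add integrable_mult_right i\<zeta>D i\<Psi> iF Bochner_Integration.integrable_sum iEu) auto
 also have "\<dots> = integral\<^sup>L lborel \<Psi> + k1 * (\<Sum>i<N. SI E (\<lambda>w. (u i w - c i)^2)) + (1 / \<nu> + 1) * integral\<^sup>L lborel (sqsum N F)"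
 proof -
  have iS: "integrable lborel (\<lambda>w. k1 * (\<Sum>i<N. indicator E w * (u i w - c i)^2))"
   by (intro integrable_mult_right Bochner_Integration.integrable_sum iEu) simp
  have "(LBINT w. (\<Sum>i<N. indicator E w * (u i w - c i)^2)) = (\<Sum>i<N. SI E (\<lambda>w. (u i w - c i)^2))"
   unfolding SI_def by (rule Bochner_Integration.integral_sum) (use iEu in auto)
  then show ?thesis
   by (simp only: Bochner_Integration.integral_add[OF Bochner_Integration.integrable_add[OF i\<Psi> iS] integrable_mult_right[OF iF]]
    Bochner_Integration.integral_add[OF i\<Psi> iS] integral_mult_right_zero)
 qed
 also have "integral\<^sup>L lborel (sqsum N F) = SI P (sqsum N F)"
  unfolding SI_def
  by (intro Bochner_Integration.integral_cong refl) (auto simp: indicator_def sqsum_def F0)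
 finally have up: "\<nu> / 2 * (LBINT w. \<zeta> w * sqsum N D w) \<le> k1 * (\<Sum>i<N. SI E (\<lambda>w. (u i w - c i)^2)) + (1 / \<nu> + 1) * SI P (sqsum N F)"
  by (simp add: \<Psi>0)
 have "1/10 * SI (Q z0 \<rho>) (sqsum N D) = (LBINT w. 1/10 * (indicator (Q z0 \<rho>) w * sqsum N D w))" by (simp add: SI_def)
 also have "\<dots> \<le> (LBINT w. \<zeta> w * sqsum N D w)"
 proof (rule integral_mono[OF _ i\<zeta>D])
  show "integrable lborel (\<lambda>w. 1/10 * (indicator (Q z0 \<rho>) w * sqsum N D w))"
   by (intro integrable_mult_right integrable_indicator_mult iD) simp
  fix w
  show "1/10 * (indicator (Q z0 \<rho>) w * sqsum N D w) \<le> \<zeta> w * sqsum N D w"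
  proof (cases "w \<in> Q z0 \<rho>")
   case True
   then have "1/10 \<le> \<zeta> w" using \<zeta>low[of w] by (simp add: r_def)
   then have "1/10 * sqsum N D w \<le> \<zeta> w * sqsum N D w" by (rule mult_right_mono[OF _ sqsum_nonneg])
   then show ?thesis using True by simp
  qed (simp add: \<zeta>01 sqsum_nonneg)
 qed
 finally have low: "1/10 * SI (Q z0 \<rho>) (sqsum N D) \<le> (LBINT w. \<zeta> w * sqsum N D w)" .
 have "\<nu> / 2 * (1/10 * SI (Q z0 \<rho>) (sqsum N D)) \<le> \<nu> / 2 * (LBINT w. \<zeta> w * sqsum N D w)"
  using \<nu> by (intro mult_left_mono low) auto
 from order_trans[OF this up]
 have "\<nu> / 20 * SI (Q z0 \<rho>) (sqsum N D) \<le> k1 * (\<Sum>i<N. SI E (\<lambda>w. (u i w - c i)^2)) + (1 / \<nu> + 1) * SI P (sqsum N F)" by simp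
 then show ?thesis unfolding k1_def E_def P_def r_def .
qed

section \<open>The reverse Hoelder inequality\<close>

text \<open>
  The \<open>L^q\<close> mean of the data term is estimated by its \<open>L2\<close> mean, so that \<open>F\<close> enters with exponent two.
\<close>

lemma mean_powr_decompose:
 fixes z :: "(real ^ 'n) \<times> real"
 defines "q \<equiv> qexp TYPE('n)" and "\<beta> \<equiv> bexp TYPE('n)"
 assumes r: "r > 0" and d: "L2b d" "\<And>w. 0 \<le> d w" and f: "L2b f" "\<And>w. 0 \<le> f w" and k: "k \<ge> 1"
 shows "(mean (Q z r) (\<lambda>w. (k * d w + f w) powr q)) powr \<beta>
  \<le> 64 * k ^ 2 * ((mean (Q z r) (\<lambda>w. d w powr q)) powr \<beta> + mean (Q z r) (\<lambda>w. (f w)^2))"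
proof -
 have q: "1 < q" "q < 2" and \<beta>: "1 < \<beta>" "\<beta> < 2" and q\<beta>: "q * \<beta> = 2"
  using qexp_bounds bexp_bounds qexp_bexp by (auto simp: q_def \<beta>_def)
 define V where "V = measure lborel (Q z r)"
 have V: "V > 0" using r omega_pos[where 'n='n] measure_Q(1)[OF r, of z] by (simp add: V_def)
 have id: "integrable lborel (\<lambda>w. d w powr q)" and jf: "integrable lborel (\<lambda>w. f w powr q)"
  by (rule L2b_powr_integrable; use d f q in auto)+
 have Lk: "L2b (\<lambda>w. k * d w + f w)" by (intro L2b_add L2b_bounded_mult d f bounded_borel_const)
 have ik: "integrable lborel (\<lambda>w. (k * d w + f w) powr q)"
  by (rule L2b_powr_integrable[OF Lk]) (use d f q k in auto)
 let ?X = "mean (Q z r) (\<lambda>w. d w powr q)" and ?Y = "mean (Q z r) (\<lambda>w. f w powr q)"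
 have X0: "?X \<ge> 0" and Y0: "?Y \<ge> 0" by (auto intro: mean_nonneg)
 have kq: "k powr q \<ge> 0" by simp
 have "mean (Q z r) (\<lambda>w. (k * d w + f w) powr q) \<le> mean (Q z r) (\<lambda>w. 4 * (k powr q * d w powr q + f w powr q))"
  unfolding mean_def
 proof (intro divide_right_mono SI_mono Q_borel ik)
  show "integrable lborel (\<lambda>w. 4 * (k powr q * d w powr q + f w powr q))" using id jf by simp
  show "(k * d w + f w) powr q \<le> 4 * (k powr q * d w powr q + f w powr q)" for w
   using powr_add_le[of q "k * d w" "f w"] q d(2) f(2) k by (simp add: powr_mult)
 qed (use V in \<open>simp add: V_def\<close>)
 also have "\<dots> = 4 * (k powr q * ?X + ?Y)"
  using integrable_indicator_mult[OF Q_borel id, of z r] integrable_indicator_mult[OF Q_borel jf, of z r]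
  by (simp add: mean_def SI_def add_divide_distrib distrib_left mult.left_commute[of "indicator _ _"])
 finally have "(mean (Q z r) (\<lambda>w. (k * d w + f w) powr q)) powr \<beta> \<le> (4 * (k powr q * ?X + ?Y)) powr \<beta>"
  using \<beta> by (intro powr_mono2 mean_nonneg) auto
 also have "\<dots> = 4 powr \<beta> * (k powr q * ?X + ?Y) powr \<beta>" by (rule powr_mult)
 also have "\<dots> \<le> 16 * (4 * ((k powr q * ?X) powr \<beta> + ?Y powr \<beta>))"
 proof (rule mult_mono)
  have "4 powr \<beta> \<le> (4::real) powr 2" using \<beta> by (intro powr_mono) auto
  then show "4 powr \<beta> \<le> (16::real)" by simp
  show "(k powr q * ?X + ?Y) powr \<beta> \<le> 4 * ((k powr q * ?X) powr \<beta> + ?Y powr \<beta>)"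
   by (rule powr_add_le) (use \<beta> X0 Y0 in auto)
 qed auto
 also have "(k powr q * ?X) powr \<beta> = k^2 * ?X powr \<beta>"
  using q\<beta> k by (simp add: powr_mult powr_powr powr_numeral)
 also have "?Y powr \<beta> \<le> mean (Q z r) (\<lambda>w. (f w)^2)"
 proof -
  have "(SI (Q z r) (\<lambda>w. f w powr q) / measure lborel (Q z r)) powr \<beta> \<le> SI (Q z r) (\<lambda>w. (f w powr q) powr \<beta>) / measure lborel (Q z r)"
   by (rule power_mean) (use \<beta> V jf q\<beta> f in \<open>auto simp: V_def powr_powr powr_numeral L2b_def\<close>)
  then show ?thesis using q\<beta> f(2) by (simp add: mean_def powr_powr powr_numeral)
 qed
 also have "16 * (4 * (k^2 * ?X powr \<beta> + mean (Q z r) (\<lambda>w. (f w)^2))) \<le> 64 * k^2 * (?X powr \<beta> + mean (Q z r) (\<lambda>w. (f w)^2))"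
 proof -
  have "1 * mean (Q z r) (\<lambda>w. (f w)^2) \<le> k^2 * mean (Q z r) (\<lambda>w. (f w)^2)"
   using k by (intro mult_right_mono mean_nonneg one_le_power) auto
  then show ?thesis by (simp add: distrib_left)
 qed
 finally show ?thesis by simp
qed

text \<open>
  Insert the Sobolev-Poincare inequality, with \<open>g = (1+L)|D| + |F|\<close>, into the Caccioppoli inequality.
  The powers of \<open>\<rho>\<close> cancel on passing to means, because \<open>(n+2) * \<beta> = n+3\<close>.
\<close>

lemma reverse_hoelder_system:
 assumes \<nu>: "\<nu> > 0" and L: "L > 0"
 shows "\<exists>C>0. \<forall>(z0 :: (real ^ 'n) \<times> real) \<rho> u D A F. 0 < \<rho> --> structured_system N \<nu> L (Q z0 (2 * \<rho>)) u D A F -->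
   mean (Q z0 \<rho>) (sqsum N D) \<le> C * ((mean (Q z0 (2 * \<rho>)) (\<lambda>w. sqrt (sqsum N D w) powr qexp TYPE('n))) powr bexp TYPE('n)
    + mean (Q z0 (2 * \<rho>)) (sqsum N F))"
proof -
 define n where "n = CARD('n)"
 define q where "q = qexp TYPE('n)"
 define \<beta> where "\<beta> = bexp TYPE('n)"
 define \<omega> where "\<omega> = omega TYPE('n)"
 have \<omega>: "\<omega> > 0" using omega_pos[where 'n='n] by (simp add: \<omega>_def)
 have q: "1 < q" "q < 2" and \<beta>: "1 < \<beta>" "\<beta> < 2" and q\<beta>: "q * \<beta> = 2"
  using qexp_bounds bexp_bounds qexp_bexp by (auto simp: q_def \<beta>_def)
 have e\<beta>: "(real n + 2) * \<beta> = real n + 3"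
  using card_ge_1[where 'n='n] by (simp add: \<beta>_def bexp_def n_def)
 obtain Cp :: real where Cp: "Cp > 0" and pw: "\<forall>(z0 :: (real ^ 'n) \<times> real) \<rho> u D G g. 0 < \<rho> --> dominated_flux (Q z0 (2 * \<rho>)) u D G g -->
   (\<exists>c. integrable lborel (\<lambda>w. indicator (Q z0 (3/2 * \<rho>)) w * (u w - c)^2) \<and>
     SI (Q z0 (3/2 * \<rho>)) (\<lambda>w. (u w - c)^2) \<le> Cp * \<rho> * (LBINT w. g w powr qexp TYPE('n)) powr bexp TYPE('n))"
  using parabolic_sobolev_poincare by (elim exE conjE) (rule that)
 define K1 where "K1 = 16 * CARD('n) * L^2 / \<nu> + 4 * CARD('n) + 2"
 have K1: "K1 \<ge> 0" using \<nu> by (simp add: K1_def)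
 define B1 where "B1 = 20 / \<nu> * (K1 * (real N * Cp)) * (\<omega> powr (\<beta> - 1) * 2 ^ (n + 3)) * (64 * (1 + L)^2)"
 define B2 where "B2 = 20 / \<nu> * (1 / \<nu> + 1) * 2 ^ (n + 2)"
 have B: "B1 \<ge> 0" "B2 \<ge> 0" using \<nu> K1 Cp by (auto simp: B1_def B2_def)
 have "mean (Q z0 \<rho>) (sqsum N D) \<le> (B1 + B2 + 1) * ((mean (Q z0 (2 * \<rho>)) (\<lambda>w. sqrt (sqsum N D w) powr q)) powr \<beta>
    + mean (Q z0 (2 * \<rho>)) (sqsum N F))"
  if \<rho>: "0 < \<rho>" and S: "structured_system N \<nu> L (Q z0 (2 * \<rho>)) u D A F" for z0 :: "(real ^ 'n) \<times> real" and \<rho> u D A F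
 proof -
  define P where "P = Q z0 (2 * \<rho>)"
  note sd = structured_systemD[OF S, folded P_def]
  note sol = sd(1) and LD = sd(2) and LF = sd(4) and D0 = sd(5) and F0 = sd(6) and st = sd(8)
  define d where "d w = sqrt (sqsum N D w)" for w
  define f where "f w = sqrt (sqsum N F w)" for w
  define g where "g w = (1 + L) * d w + f w" for w
  have Ld: "L2b d" and Lf: "L2b f" unfolding d_def[abs_def] f_def[abs_def] by (rule L2b_sqrt_sqsum(1); use LD LF in simp)+
  have d0: "0 \<le> d w" and f0: "0 \<le> f w" for w by (simp_all add: d_def f_def sqsum_nonneg)
  have Lg: "L2b g" unfolding g_def[abs_def] by (intro L2b_add L2b_bounded_mult Ld Lf bounded_borel_const)
  have gd: "d w \<le> g w" for w using d0[of w] f0[of w] L by (simp add: g_def algebra_simps)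
  have g0: "0 \<le> g w" for w using d0[of w] gd[of w] by linarith
  have dom: "dominated_flux P (u i) (D i) (\<lambda>j w. A i j w - F i j w) g" if i: "i < N" for i
   unfolding dominated_flux_def
  proof (intro conjI allI sol[OF i] Lg g0)
   fix j w
   show "\<bar>D i j w\<bar> \<le> g w" using abs_le_sqrt_sqsum[OF i, of D j w] gd[of w] unfolding d_def by linarith
   have "\<bar>A i j w\<bar> \<le> sqrt (sqsum N A w)" by (rule abs_le_sqrt_sqsum[OF i])
   also have "\<dots> \<le> sqrt (L^2 * sqsum N D w)" by (rule real_sqrt_le_mono[OF st])
   also have "\<dots> = L * d w" using L by (simp add: real_sqrt_mult d_def)
   finally have "\<bar>A i j w\<bar> \<le> L * d w" .
   moreover have "\<bar>F i j w\<bar> \<le> f w" unfolding f_def by (rule abs_le_sqrt_sqsum[OF i])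
   moreover have "g w = d w + L * d w + f w" by (simp add: g_def distrib_right)
   ultimately show "\<bar>A i j w - F i j w\<bar> \<le> g w" using d0[of w] by linarith
  qed
  define Ag where "Ag = (LBINT w. g w powr q) powr \<beta>"
  have Ag0: "Ag \<ge> 0" by (simp add: Ag_def)
  have "\<exists>c. \<forall>i<N. integrable lborel (\<lambda>w. indicator (Q z0 (3/2 * \<rho>)) w * (u i w - c i)^2) \<and>
     SI (Q z0 (3/2 * \<rho>)) (\<lambda>w. (u i w - c i)^2) \<le> Cp * \<rho> * Ag"
  proof -
   have "\<forall>i. \<exists>c. i < N --> integrable lborel (\<lambda>w. indicator (Q z0 (3/2 * \<rho>)) w * (u i w - c)^2) \<and>
     SI (Q z0 (3/2 * \<rho>)) (\<lambda>w. (u i w - c)^2) \<le> Cp * \<rho> * Ag"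
    using pw[rule_format, OF \<rho> dom[unfolded P_def]] unfolding Ag_def q_def \<beta>_def by auto
   from choice[OF this] show ?thesis .
  qed
  then obtain c where c: "\<And>i. i < N ==> integrable lborel (\<lambda>w. indicator (Q z0 (3/2 * \<rho>)) w * (u i w - c i)^2)"
   "\<And>i. i < N ==> SI (Q z0 (3/2 * \<rho>)) (\<lambda>w. (u i w - c i)^2) \<le> Cp * \<rho> * Ag" by auto
  define SD where "SD = SI (Q z0 \<rho>) (sqsum N D)"
  define SF where "SF = SI P (sqsum N F)"
  have SF0: "SF \<ge> 0" unfolding SF_def by (rule SI_nonneg) (rule sqsum_nonneg)
  have "\<nu> / 20 * SD \<le> K1 / (3/2 * \<rho>)^2 * (\<Sum>i<N. SI (Q z0 (3/2 * \<rho>)) (\<lambda>w. (u i w - c i)^2)) + (1 / \<nu> + 1) * SF"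
   unfolding SD_def SF_def K1_def P_def by (rule caccioppoli_inequality[OF S \<rho> \<nu> L c(1)])
  also have "\<dots> \<le> K1 / (3/2 * \<rho>)^2 * (\<Sum>i<N. Cp * \<rho> * Ag) + (1 / \<nu> + 1) * SF"
   using K1 by (intro add_right_mono mult_left_mono sum_mono c(2)) auto
  also have "K1 / (3/2 * \<rho>)^2 * (\<Sum>i<N. Cp * \<rho> * Ag) \<le> K1 / \<rho>^2 * (\<Sum>i<N. Cp * \<rho> * Ag)"
   using K1 \<rho> Cp Ag0 by (intro mult_right_mono divide_left_mono) (auto simp: power_mult_distrib power_divide)
  also have "K1 / \<rho>^2 * (\<Sum>i<N. Cp * \<rho> * Ag) = K1 * (real N * Cp) * Ag / \<rho>"
   using \<rho> by (simp add: power2_eq_square)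
  finally have "\<nu> / 20 * SD \<le> K1 * (real N * Cp) * Ag / \<rho> + (1 / \<nu> + 1) * SF" by simp
  then have "20 / \<nu> * (\<nu> / 20 * SD) \<le> 20 / \<nu> * (K1 * (real N * Cp) * Ag / \<rho> + (1 / \<nu> + 1) * SF)"
   using \<nu> by (intro mult_left_mono) auto
  then have bound: "SD \<le> 20 / \<nu> * (K1 * (real N * Cp)) * (Ag / \<rho>) + 20 / \<nu> * (1 / \<nu> + 1) * SF"
  proof -
   assume a: "20 / \<nu> * (\<nu> / 20 * SD) \<le> 20 / \<nu> * (K1 * (real N * Cp) * Ag / \<rho> + (1 / \<nu> + 1) * SF)"
   have "k * (K * Ag / \<rho> + m * SF) = k * K * (Ag / \<rho>) + k * m * SF" for k K m :: real by (simp add: algebra_simps)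
   moreover have "20 / \<nu> * (\<nu> / 20 * SD) = SD" using \<nu> by simp
   ultimately show ?thesis using a by (simp only:)
  qed
  define V1 where "V1 = \<omega> * \<rho> ^ (n + 2)"
  define V2 where "V2 = \<omega> * (2 * \<rho>) ^ (n + 2)"
  have V: "V1 > 0" "V2 > 0" "V2 = 2 ^ (n + 2) * V1" using \<omega> \<rho> by (auto simp: V1_def V2_def power_mult_distrib)
  have m1: "measure lborel (Q z0 \<rho>) = V1" using measure_Q(1)[OF \<rho>, of z0] by (simp add: V1_def \<omega>_def n_def)
  have m2: "measure lborel P = V2" using measure_Q(1)[of "2 * \<rho>" z0] \<rho> unfolding P_def V2_def \<omega>_def n_def by simp
  define mg where "mg = mean P (\<lambda>w. g w powr q)"
  have g_out: "g w = 0" if "w \<notin> P" for w using that by (simp add: g_def d_def f_def sqsum_def D0 F0)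
  have "(LBINT w. g w powr q) = SI P (\<lambda>w. g w powr q)"
   unfolding SI_def by (intro Bochner_Integration.integral_cong refl) (use g_out q in \<open>auto simp: indicator_def\<close>)
  also have "\<dots> = V2 * mg" using V by (simp add: mg_def mean_def m2)
  finally have "Ag = V2 powr \<beta> * mg powr \<beta>" by (simp add: Ag_def powr_mult)
  also have "V2 powr \<beta> = \<omega> powr \<beta> * (2 * \<rho>) ^ (n + 3)"
  proof -
   have "V2 powr \<beta> = \<omega> powr \<beta> * ((2 * \<rho>) powr real (n + 2)) powr \<beta>"
   proof -
    have r2: "(2 * \<rho>) ^ (n + 2) = (2 * \<rho>) powr real (n + 2)" by (rule powr_realpow[symmetric]) (use \<rho> in simp)
    show ?thesis unfolding V2_def r2 by (rule powr_mult)
   qed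
   also have "((2 * \<rho>) powr real (n + 2)) powr \<beta> = (2 * \<rho>) powr real (n + 3)"
    using e\<beta> by (simp add: powr_powr add.commute)
   also have "\<dots> = (2 * \<rho>) ^ (n + 3)" using \<rho> by (intro powr_realpow) auto
   finally show ?thesis .
  qed
  finally have Age: "Ag / \<rho> / V1 = (\<omega> powr (\<beta> - 1) * 2 ^ (n + 3)) * mg powr \<beta>"
  proof -
   assume a: "Ag = \<omega> powr \<beta> * (2 * \<rho>) ^ (n + 3) * mg powr \<beta>"
   have "(2 * \<rho>) ^ (n + 3) = 2 ^ (n + 3) * (\<rho> * \<rho> ^ (n + 2))" by (simp add: power_mult_distrib eval_nat_numeral)
   moreover have "\<omega> powr \<beta> = \<omega> * \<omega> powr (\<beta> - 1)" using \<omega> powr_mult_base[of \<omega> "\<beta> - 1"] by simp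
   ultimately have "Ag = (\<rho> * V1) * ((\<omega> powr (\<beta> - 1) * 2 ^ (n + 3)) * mg powr \<beta>)" unfolding a V1_def by (simp only: mult_ac)
   then show ?thesis using V \<rho> by (simp add: divide_divide_eq_left)
  qed
  have mgb: "mg powr \<beta> \<le> 64 * (1 + L)^2 * ((mean P (\<lambda>w. d w powr q)) powr \<beta> + mean P (\<lambda>w. (f w)^2))"
   unfolding mg_def g_def P_def q_def \<beta>_def
   by (rule mean_powr_decompose) (use \<rho> Ld Lf d0 f0 L in auto)
  let ?X = "(mean P (\<lambda>w. d w powr q)) powr \<beta>" and ?Y = "mean P (sqsum N F)"
  have fY: "mean P (\<lambda>w. (f w)^2) = ?Y" by (simp add: f_def sqsum_nonneg)
  have X0: "?X \<ge> 0" by simp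
  have Y0: "?Y \<ge> 0" by (rule mean_nonneg) (rule sqsum_nonneg)
  have SFV: "SF / V1 = 2 ^ (n + 2) * ?Y" using V by (simp add: SF_def mean_def m2)
  have "mean (Q z0 \<rho>) (sqsum N D) = SD / V1" by (simp add: mean_def SD_def m1)
  also have "\<dots> \<le> (20 / \<nu> * (K1 * (real N * Cp)) * (Ag / \<rho>) + 20 / \<nu> * (1 / \<nu> + 1) * SF) / V1"
   using bound V by (intro divide_right_mono) auto
  also have "\<dots> = 20 / \<nu> * (K1 * (real N * Cp)) * (Ag / \<rho> / V1) + 20 / \<nu> * (1 / \<nu> + 1) * (SF / V1)"
   by (simp add: add_divide_distrib)
  also have "\<dots> = 20 / \<nu> * (K1 * (real N * Cp)) * ((\<omega> powr (\<beta> - 1) * 2 ^ (n + 3)) * mg powr \<beta>) + B2 * ?Y"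
   unfolding Age SFV B2_def by (simp only: mult.assoc)
  also have "\<dots> \<le> 20 / \<nu> * (K1 * (real N * Cp)) * ((\<omega> powr (\<beta> - 1) * 2 ^ (n + 3)) * (64 * (1 + L)^2 * (?X + ?Y))) + B2 * ?Y"
   using \<nu> K1 Cp mgb unfolding fY by (intro add_right_mono mult_left_mono) auto
  also have "\<dots> = B1 * (?X + ?Y) + B2 * ?Y" by (simp only: B1_def mult.assoc)
  also have "\<dots> \<le> (B1 + B2 + 1) * (?X + ?Y)" using B X0 Y0 by (simp add: distrib_right distrib_left)
  finally show ?thesis by (simp add: P_def d_def)
 qed
 moreover have "B1 + B2 + 1 > 0" using B by simp
 ultimately show ?thesis unfolding q_def \<beta>_def by (intro exI[of _ "B1 + B2 + 1"]) simp
qed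

section \<open>Vitali covering, Lebesgue points and stopping radii\<close>

lemma Q_subset_triple:
 assumes "Q z r \<inter> Q z' r' \<noteq> {}" "0 < r" "r \<le> r'"
 shows "Q z r \<subseteq> Q z' (3 * r')"
proof
 fix x assume x: "x \<in> Q z r"
 obtain y where y: "y \<in> Q z r" "y \<in> Q z' r'" using assms(1) by auto
 have "norm (fst x - fst z') \<le> norm (fst x - fst z) + norm (fst z - fst y) + norm (fst y - fst z')"
  using norm_triangle_ineq[of "fst x - fst z" "fst z - fst y"] norm_triangle_ineq[of "fst x - fst y" "fst y - fst z'"] by simp
 moreover have "norm (fst z - fst y) < r" using y(1) by (simp add: mem_Q norm_minus_commute)
 ultimately have 1: "norm (fst x - fst z') < 3 * r'" using x y assms by (simp add: mem_Q)
 have "r^2 \<le> r'^2" using assms by (intro power_mono) auto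
 moreover have "(3 * r')^2 = 9 * r'^2" by (simp add: power_mult_distrib)
 ultimately have "\<bar>snd x - snd z'\<bar> < (3 * r')^2"
  using x y zero_le_power2[of r'] unfolding mem_Q by linarith
 with 1 show "x \<in> Q z' (3 * r')" by (simp add: mem_Q)
qed

text \<open>
  Choose a cylinder of maximal radius, discard those that meet it, and repeat.  Two intersecting cylinders
  satisfy a triangle inequality in each of the two factors, so that the factor three suffices as for
  balls.
\<close>

lemma parabolic_vitali_finite:
 assumes "finite I" "\<And>i. i \<in> I ==> 0 < r i"
 shows "\<exists>J\<subseteq>I. (\<forall>i\<in>J. \<forall>j\<in>J. i \<noteq> j --> Q (z i) (r i) \<inter> Q (z j) (r j) = {}) \<and>
   (\<Union>i\<in>I. Q (z i) (r i)) \<subseteq> (\<Union>j\<in>J. Q (z j) (3 * r j))"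
 using assms
proof (induction I rule: finite_psubset_induct)
 case (psubset I)
 show ?case
 proof (cases "I = {}")
  case False
  define m where "m = Max (r ` I)"
  have "m \<in> r ` I" unfolding m_def using psubset.hyps False by (intro Max_in) auto
  then obtain i where i: "i \<in> I" "r i = m" by auto
  have le: "r j \<le> r i" if "j \<in> I" for j using that psubset.hyps i(2) by (simp add: m_def)
  define I' where "I' = {j \<in> I. Q (z j) (r j) \<inter> Q (z i) (r i) = {}}"
  have ri: "0 < r i" using psubset.prems i by blast
  have "z i \<in> Q (z i) (r i)" using ri by (simp add: mem_Q)
  then have "i \<notin> I'" by (auto simp: I'_def)
  then have "I' \<subset> I" using i by (auto simp: I'_def)
  then obtain J where J: "J \<subseteq> I'" "\<forall>i\<in>J. \<forall>j\<in>J. i \<noteq> j --> Q (z i) (r i) \<inter> Q (z j) (r j) = {}"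
   "(\<Union>i\<in>I'. Q (z i) (r i)) \<subseteq> (\<Union>j\<in>J. Q (z j) (3 * r j))"
   using psubset.IH[of I'] psubset.prems by (auto simp: I'_def)
  have "(\<Union>i\<in>I. Q (z i) (r i)) \<subseteq> (\<Union>j\<in>insert i J. Q (z j) (3 * r j))"
  proof
   fix x assume "x \<in> (\<Union>i\<in>I. Q (z i) (r i))"
   then obtain j where j: "j \<in> I" "x \<in> Q (z j) (r j)" by auto
   show "x \<in> (\<Union>j\<in>insert i J. Q (z j) (3 * r j))"
   proof (cases "j \<in> I'")
    case True
    then show ?thesis using j J(3) by auto
   next
    case False
    then have "Q (z j) (r j) \<inter> Q (z i) (r i) \<noteq> {}" using j by (auto simp: I'_def)
    from Q_subset_triple[OF this psubset.prems[OF j(1)] le[OF j(1)]] show ?thesis using j by auto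
   qed
  qed
  moreover have "\<forall>a\<in>insert i J. \<forall>b\<in>insert i J. a \<noteq> b --> Q (z a) (r a) \<inter> Q (z b) (r b) = {}"
   using J(1,2) unfolding I'_def by blast
  moreover have "insert i J \<subseteq> I" using J(1) i by (auto simp: I'_def)
  ultimately show ?thesis by blast
 qed auto
qed

lemma SI_Union_le:
 assumes "finite J" "\<And>j. j \<in> J ==> S j \<in> sets borel" "integrable lborel f" "\<And>w. 0 \<le> f w"
 shows "SI (\<Union>j\<in>J. S j) f \<le> (\<Sum>j\<in>J. SI (S j) f)"
proof -
 have "(\<Sum>j\<in>J. SI (S j) f) = (LBINT w. (\<Sum>j\<in>J. indicator (S j) w * f w))"
  unfolding SI_def by (rule Bochner_Integration.integral_sum[symmetric]) (rule integrable_indicator_mult[OF assms(2,3)])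
 moreover have "SI (\<Union>j\<in>J. S j) f \<le> (LBINT w. (\<Sum>j\<in>J. indicator (S j) w * f w))"
  unfolding SI_def
 proof (rule integral_mono)
  show "integrable lborel (\<lambda>w. indicator (\<Union>j\<in>J. S j) w * f w)"
   by (rule integrable_indicator_mult) (use assms in auto)
  show "integrable lborel (\<lambda>w. \<Sum>j\<in>J. indicator (S j) w * f w)"
   by (intro Bochner_Integration.integrable_sum integrable_indicator_mult assms)
  fix w
  show "indicator (\<Union>j\<in>J. S j) w * f w \<le> (\<Sum>j\<in>J. indicator (S j) w * f w)"
  proof (cases "w \<in> (\<Union>j\<in>J. S j)")
   case True
   then obtain j where j: "j \<in> J" "w \<in> S j" by auto
   have "indicator (S j) w * f w \<le> (\<Sum>j\<in>J. indicator (S j) w * f w)"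
    by (rule member_le_sum[of j J "\<lambda>j. indicator (S j) w * f w"]) (use j assms in auto)
   then show ?thesis using True j by simp
  next
   case False
   then show ?thesis using assms(4) by (simp add: sum_nonneg)
  qed
 qed
 ultimately show ?thesis by simp
qed

lemma SI_disjoint_sum_le:
 assumes "finite J" "\<And>j. j \<in> J ==> S j \<in> sets borel" "integrable lborel f" "\<And>w. 0 \<le> f w"
  and d: "\<And>i j. i \<in> J ==> j \<in> J ==> i \<noteq> j ==> S i \<inter> S j = {}"
 shows "(\<Sum>j\<in>J. SI (S j) f) \<le> integral\<^sup>L lborel f"
proof -
 have "(\<Sum>j\<in>J. SI (S j) f) = (LBINT w. (\<Sum>j\<in>J. indicator (S j) w * f w))"
  unfolding SI_def by (rule Bochner_Integration.integral_sum[symmetric]) (rule integrable_indicator_mult[OF assms(2,3)])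
 also have "\<dots> \<le> integral\<^sup>L lborel f"
 proof (rule integral_mono)
  show "integrable lborel (\<lambda>w. \<Sum>j\<in>J. indicator (S j) w * f w)"
   by (intro Bochner_Integration.integrable_sum integrable_indicator_mult assms)
  fix w
  show "(\<Sum>j\<in>J. indicator (S j) w * f w) \<le> f w"
  proof (cases "\<exists>i\<in>J. w \<in> S i")
   case True
   then obtain i where i: "i \<in> J" "w \<in> S i" by auto
   have "(\<Sum>j\<in>J. indicator (S j) w * f w) = (\<Sum>j\<in>J. if j = i then f w else 0)"
    using d[OF i(1)] i(2) by (intro sum.cong) (auto simp: indicator_def)
   also have "\<dots> = f w" using i assms(1) by (simp add: sum.delta)
   finally show ?thesis by (simp only: order_refl)
  next
   case False
   then have "(\<Sum>j\<in>J. indicator (S j) w * f w) = 0" by (intro sum.neutral) auto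
   then show ?thesis using assms(4) by simp
  qed
 qed (use assms in auto)
 finally show ?thesis .
qed

lemma mean_square_le:
 fixes z :: "(real ^ 'n) \<times> real"
 assumes h: "L2b h" "\<And>w. 0 \<le> h w" and r: "r > 0"
 shows "(mean (Q z r) h)^2 \<le> mean (Q z r) (\<lambda>w. (h w)^2)"
proof -
 have V: "measure lborel (Q z r) > 0" using measure_Q(1)[OF r, of z] r omega_pos[where 'n='n] by simp
 have "(SI (Q z r) h / measure lborel (Q z r)) powr 2 \<le> SI (Q z r) (\<lambda>w. h w powr 2) / measure lborel (Q z r)"
  by (rule power_mean) (use V h L2b_integrable[OF h(1)] in \<open>auto simp: L2b_def powr_numeral\<close>)
 moreover have "SI (Q z r) h / measure lborel (Q z r) \<ge> 0" using V h by (intro divide_nonneg_pos SI_nonneg) auto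
 ultimately show ?thesis using h(2) by (simp add: mean_def powr_numeral)
qed

text \<open>
  Mollifications converge almost everywhere along a sequence of scales, and each is at most a constant
  times a mean over a cylinder.  Where \<open>h\<close> is large, means over arbitrarily small cylinders are therefore
  large.
\<close>

lemma lebesgue_point_means:
 fixes h :: "(real ^ 'n) \<times> real => real"
 shows "\<exists>c>0. \<forall>h :: (real ^ 'n) \<times> real => real. L2b h --> (\<forall>w. 0 \<le> h w) -->
   (AE z in lborel. \<forall>t s0. 0 \<le> t --> c * t < h z --> 0 < s0 --> (\<exists>s. 0 < s \<and> s < s0 \<and> t^2 < mean (Q z s) (\<lambda>w. (h w)^2)))"
proof -
 obtain Ck :: real where Ck: "Ck > 0" and kex: "\<forall>s>0. \<exists>K :: (real ^ 'n) \<times> real => real. pkernel Ck s K"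
  using pkernel_exists by (elim exE conjE) (rule that)
 define c where "c = Ck * omega TYPE('n)"
 have c: "c > 0" using Ck omega_pos[where 'n='n] by (simp add: c_def)
 define s where "s k = inverse (real (Suc k))" for k
 have s0: "s k > 0" for k by (simp add: s_def)
 have sl: "s \<longlonglongrightarrow> 0" unfolding s_def by (rule LIMSEQ_inverse_real_of_nat)
 have "\<exists>K :: nat => (real ^ 'n) \<times> real => real. \<forall>k. pkernel Ck (s k) (K k)"
  by (rule choice) (use kex s0 in blast)
 then obtain K :: "nat => (real ^ 'n) \<times> real => real" where "\<forall>k. pkernel Ck (s k) (K k)" ..
 then have K: "pkernel Ck (s k) (K k)" for k by blast
 have "AE z in lborel. \<forall>t s0. 0 \<le> t --> c * t < h z --> 0 < s0 --> (\<exists>s. 0 < s \<and> s < s0 \<and> t^2 < mean (Q z s) (\<lambda>w. (h w)^2))"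
  if h: "L2b h" "\<And>w. 0 \<le> h w" for h :: "(real ^ 'n) \<times> real => real"
 proof -
  have "(\<lambda>k. s k + (s k)^2) \<longlonglongrightarrow> 0 + 0^2" by (intro tendsto_intros sl)
  then have "(\<lambda>k. s k + (s k)^2) \<longlonglongrightarrow> 0" by simp
  from mollify_L2_limit[OF pkernelD(2)[OF K] this h(1)]
  have lim: "(\<lambda>k. \<integral>x. norm ((conv (K k) h x - h x)^2) \<partial>lborel) \<longlonglongrightarrow> 0" by simp
  have int: "integrable lborel (\<lambda>x. (conv (K k) h x - h x)^2)" for k
   using L2b_diff[OF L2b_conv(1)[OF pkernelD(2)[OF K] h(1)] h(1)] by (simp add: L2b_def)
  obtain \<sigma> where \<sigma>: "strict_mono \<sigma>" "AE x in lborel. (\<lambda>k. (conv (K (\<sigma> k)) h x - h x)^2) \<longlonglongrightarrow> 0"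
   using tendsto_L1_AE_subseq[OF int lim] by blast
  from \<sigma>(2) show ?thesis
  proof eventually_elim
   case (elim z)
   show ?case
   proof (intro allI impI)
    fix t e :: real assume t: "0 \<le> t" "c * t < h z" and e: "0 < e"
    define \<eta> where "\<eta> = h z - c * t"
    have "\<forall>\<^sub>F k in sequentially. (conv (K (\<sigma> k)) h z - h z)^2 < \<eta>^2"
     using t by (intro order_tendstoD(2)[OF elim]) (simp add: \<eta>_def)
    moreover have "\<forall>\<^sub>F k in sequentially. s (\<sigma> k) < e"
     using order_tendstoD(2)[OF LIMSEQ_subseq_LIMSEQ[OF sl \<sigma>(1)] e] by (simp add: o_def)
    ultimately have "\<forall>\<^sub>F k in sequentially. (conv (K (\<sigma> k)) h z - h z)^2 < \<eta>^2 \<and> s (\<sigma> k) < e" by eventually_elim simp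
    from eventually_happens'[OF sequentially_bot this]
    obtain k where k: "(conv (K (\<sigma> k)) h z - h z)^2 < \<eta>^2" "s (\<sigma> k) < e" by blast
    have "\<bar>conv (K (\<sigma> k)) h z - h z\<bar> < \<bar>\<eta>\<bar>" using k(1) abs_le_square_iff[of \<eta> "conv (K (\<sigma> k)) h z - h z"] by linarith
    then have gt: "c * t < conv (K (\<sigma> k)) h z" using t by (simp add: \<eta>_def)
    let ?s = "s (\<sigma> k)"
    note sp = s0[of "\<sigma> k"]
    have "conv (K (\<sigma> k)) h z \<le> \<bar>conv (K (\<sigma> k)) h z\<bar>" by simp
    also have "\<dots> \<le> Ck / ?s ^ (CARD('n) + 2) * (LBINT w. indicator (Q z ?s) w * \<bar>h w\<bar>)"
     by (rule conv_abs_le[OF bounded_borel_measurable[OF pkernelD(6)[OF K]] L2b_integrable[OF h(1)] Q_borel pkernelD(3)[OF K] pkernelD(4)[OF K]])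
    also have "\<dots> = Ck / ?s ^ (CARD('n) + 2) * SI (Q z ?s) h" using h(2) by (simp add: SI_def)
    also have "\<dots> = c * mean (Q z ?s) h"
     using sp omega_pos[where 'n='n] by (simp add: mean_def measure_Q(1)[OF sp] c_def)
    finally have "c * t < c * mean (Q z ?s) h" using gt by linarith
    then have "t < mean (Q z ?s) h" using c by simp
    then have "t^2 < (mean (Q z ?s) h)^2" using t by (intro power_strict_mono) auto
    then have "t^2 < mean (Q z ?s) (\<lambda>w. (h w)^2)" using mean_square_le[OF h sp, of z] by linarith
    then show "\<exists>s. 0 < s \<and> s < e \<and> t^2 < mean (Q z s) (\<lambda>w. (h w)^2)" using sp k(2) by blast
   qed
  qed
 qed
 then show ?thesis using c by blast
qed

text \<open>
  The volume grows by at most \<open>2^(n+2)\<close> when the radius at most doubles.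
\<close>

lemma mean_enlarge:
 fixes z :: "(real ^ 'n) \<times> real"
 assumes f: "integrable lborel f" "\<And>w. 0 \<le> f w" and r: "0 < r" "r \<le> r'" "r' \<le> 2 * r"
 shows "mean (Q z r) f \<le> 2 ^ (CARD('n) + 2) * mean (Q z r') f"
proof -
 have r': "r' > 0" using r by simp
 have om: "omega TYPE('n) > 0" by (rule omega_pos)
 have sub: "Q z r \<subseteq> Q z r'"
 proof -
  have "r^2 \<le> r'^2" using r by (intro power_mono) auto
  then show ?thesis using r unfolding subset_iff mem_Q by (auto intro: less_le_trans)
 qed
 have S: "SI (Q z r) f \<le> SI (Q z r') f" by (rule SI_mono_set[OF Q_borel Q_borel f sub])
 have S0: "0 \<le> SI (Q z r') f" by (rule SI_nonneg[OF f(2)])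
 have "r' ^ (CARD('n) + 2) \<le> (2 * r) ^ (CARD('n) + 2)" using r by (intro power_mono) auto
 then have p: "r' ^ (CARD('n) + 2) \<le> 2 ^ (CARD('n) + 2) * r ^ (CARD('n) + 2)" by (simp only: power_mult_distrib)
 have "mean (Q z r) f \<le> SI (Q z r') f / (omega TYPE('n) * r ^ (CARD('n) + 2))"
  unfolding mean_def measure_Q(1)[OF r(1)] using om r S by (intro divide_right_mono) auto
 also have "\<dots> \<le> SI (Q z r') f * (2 ^ (CARD('n) + 2) / (omega TYPE('n) * r' ^ (CARD('n) + 2)))"
 proof -
  have "1 / (omega TYPE('n) * r ^ (CARD('n) + 2)) \<le> 2 ^ (CARD('n) + 2) / (omega TYPE('n) * r' ^ (CARD('n) + 2))"
   using p om r r' by (simp add: divide_simps mult.commute mult.left_commute)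
  from mult_left_mono[OF this S0] show ?thesis by simp
 qed
 also have "\<dots> = 2 ^ (CARD('n) + 2) * mean (Q z r') f" by (simp add: mean_def measure_Q(1)[OF r'])
 finally show ?thesis .
qed

text \<open>
  Take the first of the radii \<open>\<delta>, \<delta>/2, \<delta>/4, ...\<close> at which the mean exceeds \<open>m\<close>.  At the doubled radius
  and at eight times the radius the mean is still at most \<open>m\<close>: either the radius was tested before, or it
  lies in the range of the hypothesis.
\<close>

lemma stopping_radius:
 fixes z :: "(real ^ 'n) \<times> real" and h :: "(real ^ 'n) \<times> real => real"
 assumes f: "integrable lborel f" "\<And>w. 0 \<le> f w" and \<delta>: "\<delta> > 0"
  and H2: "\<And>r. \<delta> \<le> r ==> r \<le> 8 * \<delta> ==> mean (Q z r) f \<le> m"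
  and good: "\<And>s0. 0 < s0 ==> \<exists>s. 0 < s \<and> s < s0 \<and> 2 ^ (CARD('n) + 2) * m < mean (Q z s) f"
 shows "\<exists>r. 0 < r \<and> r \<le> \<delta> \<and> m < mean (Q z r) f \<and> mean (Q z (2 * r)) f \<le> m \<and> mean (Q z (8 * r)) f \<le> m"
proof -
 define R where "R j = \<delta> / 2 ^ j" for j :: nat
 have R: "R j > 0" for j using \<delta> by (simp add: R_def)
 have RS: "R j = 2 * R (Suc j)" for j by (simp add: R_def)
 have ex: "\<exists>j. m < mean (Q z (R j)) f"
 proof -
  obtain s where s: "0 < s" "s < \<delta>" "2 ^ (CARD('n) + 2) * m < mean (Q z s) f" using good[OF \<delta>] by blast
  have "R \<longlonglongrightarrow> 0" unfolding R_def[abs_def] by (intro LIMSEQ_divide_realpow_zero) simp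
  then have "\<forall>\<^sub>F j in sequentially. R j < s" using s(1) by (rule order_tendstoD(2))
  then have "\<exists>j. R j < s" using eventually_happens'[OF sequentially_bot] by blast
  then have L: "R (LEAST j. R j < s) < s" by (rule LeastI_ex)
  have "(LEAST j. R j < s) \<noteq> 0" using L s by (metis R_def div_by_1 less_asym power_0)
  then obtain j where j: "(LEAST j. R j < s) = Suc j" using not0_implies_Suc by blast
  have "\<not> R j < s" using not_less_Least[of j "\<lambda>j. R j < s"] j by simp
  then have "s \<le> R j" "R j \<le> 2 * s" using L j RS[of j] by auto
  from mean_enlarge[OF f s(1) this] s(3) have "2 ^ (CARD('n) + 2) * m < 2 ^ (CARD('n) + 2) * mean (Q z (R j)) f" by (rule less_le_trans[rotated])
  then show ?thesis by (intro exI[of _ j]) simp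
 qed
 define j where "j = (LEAST j. m < mean (Q z (R j)) f)"
 have j: "m < mean (Q z (R j)) f" unfolding j_def using ex by (rule LeastI_ex)
 have jm: "mean (Q z (R i)) f \<le> m" if "i < j" for i
  using not_less_Least[of i "\<lambda>j. m < mean (Q z (R j)) f"] that by (simp add: j_def)
 have R0: "R 0 = \<delta>" by (simp add: R_def)
 have "j \<noteq> 0"
 proof
  assume "j = 0"
  then have "m < mean (Q z \<delta>) f" using j R0 by simp
  then show False using H2[of \<delta>] \<delta> by simp
 qed
 then obtain i where i: "j = Suc i" using not0_implies_Suc by blast
 have le: "R j \<le> \<delta>" using \<delta> by (simp add: R_def field_simps)
 have 2: "mean (Q z (2 * R j)) f \<le> m" using jm[of i] RS[of i] i by simp
 have 8: "mean (Q z (8 * R j)) f \<le> m"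
 proof -
  consider "j = 1" | "j = 2" | k where "j = Suc (Suc (Suc k))"
   using i by (metis One_nat_def Suc_1 not0_implies_Suc)
  then show ?thesis
  proof cases
   case 1
   then have e: "8 * R j = 4 * \<delta>" by (simp add: R_def)
   have "mean (Q z (4 * \<delta>)) f \<le> m" using H2[of "4 * \<delta>"] \<delta> by simp
   then show ?thesis by (simp only: e)
  next
   case 2
   then have e: "8 * R j = 2 * \<delta>" by (simp add: R_def)
   have "mean (Q z (2 * \<delta>)) f \<le> m" using H2[of "2 * \<delta>"] \<delta> by simp
   then show ?thesis by (simp only: e)
  next
   case (3 k)
   then have "8 * R j = R k" by (simp add: R_def)
   then show ?thesis using jm[of k] 3 by simp
  qed
 qed
 show ?thesis using R[of j] le j 2 8 by blast
qed

section \<open>The level set estimate\<close>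

text \<open>
  The \<open>p\<close>-th power of \<open>f\<close> above the height \<open>t\<close>, and zero elsewhere.
\<close>

definition trunc_pow :: "real => real => ('a => real) => 'a => real" where
 "trunc_pow p t f w = (if t < f w then f w powr p else 0)"

lemma trunc_pow_nonneg: "0 \<le> trunc_pow p t f w"
 by (simp add: trunc_pow_def)

lemma trunc_pow_integrable:
 assumes g: "L2b g" "\<And>w. g w \<ge> 0" and q: "0 < q" "q \<le> 2"
 shows "integrable lborel (trunc_pow q t g)"
proof -
 note [measurable] = L2b_measurable[OF g(1)]
 show ?thesis
  by (rule Bochner_Integration.integrable_bound[OF L2b_powr_integrable[OF g q]])
    (auto simp: trunc_pow_def[abs_def])
qed

lemma mean_mono:
 assumes "S \<in> sets borel" "integrable lborel f" "integrable lborel g" "\<And>w. w \<in> S ==> f w \<le> g w"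
 shows "mean S f \<le> mean S g"
 unfolding mean_def by (intro divide_right_mono SI_mono assms) auto

lemma mean_add_const:
 fixes z :: "(real ^ 'n) \<times> real"
 assumes r: "r > 0" and f: "integrable lborel f"
 shows "mean (Q z r) (\<lambda>w. indicator (Q z r) w * c + f w) = c + mean (Q z r) f"
proof -
 define V where "V = measure lborel (Q z r)"
 have V: "V > 0" using r omega_pos[where 'n='n] measure_Q(1)[OF r, of z] by (simp add: V_def)
 have i: "integrable lborel (indicator (Q z r) :: _ => real)"
  using measure_Q(2)[OF r, of z] by (intro integrable_real_indicator) auto
 have "SI (Q z r) (\<lambda>w. indicator (Q z r) w * c + f w) = (LBINT w. c * indicator (Q z r) w + indicator (Q z r) w * f w)"
  unfolding SI_def by (intro Bochner_Integration.integral_cong refl) (auto simp: indicator_def)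
 also have "\<dots> = c * V + SI (Q z r) f"
  using i integrable_indicator_mult[OF Q_borel f, of z r] by (simp add: SI_def V_def)
 finally show ?thesis using V by (simp add: mean_def V_def[symmetric] add_divide_distrib)
qed

text \<open>
  In the reverse Hoelder inequality, the parts of \<open>h\<close> and \<open>f\<close> below the height \<open>\<eta> * lam\<close> contribute at most
  half of \<open>lam\<^sup>2\<close> by the choice of \<open>\<eta>\<close>, and are absorbed.  The power \<open>\<beta>\<close> of the rest is linearised: the \<open>L^q\<close>
  mean of \<open>h\<close> is at most \<open>lam^q\<close> on the doubled cylinder, so its power \<open>\<beta> - 1\<close> is at most
  \<open>lam^(2-q)\<close>.
\<close>

lemma stopped_cylinder_estimate:
 fixes z :: "(real ^ 'n) \<times> real" and C lam :: real
 defines "q \<equiv> qexp TYPE('n)" and "\<beta> \<equiv> bexp TYPE('n)"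
 assumes h: "L2b h" "\<And>w. 0 \<le> h w" and f: "L2b f" "\<And>w. 0 \<le> f w" and C: "C > 0" and lam: "lam > 0" and r: "r > 0"
  and RH: "mean (Q z r) (\<lambda>w. (h w)^2) \<le> C * ((mean (Q z (2 * r)) (\<lambda>w. h w powr q)) powr \<beta> + mean (Q z (2 * r)) (\<lambda>w. (f w)^2))"
  and s1: "lam^2 < mean (Q z r) (\<lambda>w. (h w)^2)" and s2: "mean (Q z (2 * r)) (\<lambda>w. (h w)^2) \<le> lam^2"
  and \<eta>: "\<eta> > 0" "10 * C * \<eta>^2 = 1"
 shows "measure lborel (Q z r) * lam^2 \<le> 8 * C * (lam powr (2 - q) * SI (Q z (2 * r)) (trunc_pow q (\<eta> * lam) h) + SI (Q z (2 * r)) (trunc_pow 2 (\<eta> * lam) f))"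
proof -
 have q: "1 < q" "q < 2" and \<beta>: "1 < \<beta>" "\<beta> < 2" and q\<beta>: "q * \<beta> = 2"
  using qexp_bounds bexp_bounds qexp_bexp by (auto simp: q_def \<beta>_def)
 let ?S = "Q z (2 * r)"
 have r2: "2 * r > 0" using r by simp
 define V where "V = measure lborel ?S"
 have V: "V > 0" using r2 omega_pos[where 'n='n] measure_Q(1)[OF r2, of z] by (simp add: V_def)
 have V1: "0 < measure lborel (Q z r)" "measure lborel (Q z r) \<le> V"
 proof -
  show "0 < measure lborel (Q z r)" using r omega_pos[where 'n='n] measure_Q(1)[OF r, of z] by simp
  have "r ^ (CARD('n) + 2) \<le> (2 * r) ^ (CARD('n) + 2)" using r by (intro power_mono) auto
  then show "measure lborel (Q z r) \<le> V" unfolding V_def measure_Q(1)[OF r] measure_Q(1)[OF r2]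
   using omega_pos[where 'n='n] by (intro mult_left_mono) auto
 qed
 have ih: "integrable lborel (\<lambda>w. h w powr q)" by (rule L2b_powr_integrable[OF h]) (use q in auto)
 have ih2: "integrable lborel (\<lambda>w. (h w)^2)" and if2: "integrable lborel (\<lambda>w. (f w)^2)" using h f by (auto simp: L2b_def)
 have it: "integrable lborel (trunc_pow q (\<eta> * lam) h)" by (rule trunc_pow_integrable[OF h]) (use q in auto)
 have itf: "integrable lborel (trunc_pow 2 (\<eta> * lam) f)" by (rule trunc_pow_integrable[OF f]) auto
 have ind: "integrable lborel (\<lambda>w. indicator ?S w * c + g w)" if "integrable lborel g" for c :: real and g :: "(real ^ 'n) \<times> real => real"
  using measure_Q(2)[OF r2, of z] that by (intro Bochner_Integration.integrable_add integrable_mult_left integrable_real_indicator) auto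
 have el: "\<eta> * lam > 0" using \<eta> lam by simp
 define X where "X = mean ?S (\<lambda>w. h w powr q)"
 define X1 where "X1 = mean ?S (trunc_pow q (\<eta> * lam) h)"
 define Y1 where "Y1 = mean ?S (trunc_pow 2 (\<eta> * lam) f)"
 have X10: "X1 \<ge> 0" unfolding X1_def by (rule mean_nonneg) (rule trunc_pow_nonneg)
 have XX1: "X \<le> (\<eta> * lam) powr q + X1"
  unfolding X_def X1_def mean_add_const[OF r2 it, symmetric]
 proof (rule mean_mono[OF Q_borel ih ind[OF it]])
  fix w assume w: "w \<in> ?S"
  have "h w powr q \<le> (\<eta> * lam) powr q" if "h w \<le> \<eta> * lam" using that h(2) q by (intro powr_mono2) auto
  then show "h w powr q \<le> indicator ?S w * (\<eta> * lam) powr q + trunc_pow q (\<eta> * lam) h w"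
   using w by (auto simp: trunc_pow_def)
 qed
 have Yb: "mean ?S (\<lambda>w. (f w)^2) \<le> (\<eta> * lam)^2 + Y1"
  unfolding Y1_def mean_add_const[OF r2 itf, symmetric]
 proof (rule mean_mono[OF Q_borel if2 ind[OF itf]])
  fix w assume w: "w \<in> ?S"
  have "(f w)^2 \<le> (\<eta> * lam)^2" if "f w \<le> \<eta> * lam" using that f(2) by (intro power_mono) auto
  then show "(f w)^2 \<le> indicator ?S w * (\<eta> * lam)^2 + trunc_pow 2 (\<eta> * lam) f w"
   using w f(2)[of w] by (auto simp: trunc_pow_def powr_numeral)
 qed
 have X1X: "X1 \<le> X" unfolding X_def X1_def
  by (rule mean_mono[OF Q_borel it ih]) (simp add: trunc_pow_def)
 have X0: "X \<ge> 0" using X10 X1X by linarith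
 have "X powr \<beta> \<le> mean ?S (\<lambda>w. (h w)^2)"
 proof -
  have "(SI ?S (\<lambda>w. h w powr q) / measure lborel ?S) powr \<beta> \<le> SI ?S (\<lambda>w. (h w powr q) powr \<beta>) / measure lborel ?S"
   by (rule power_mean) (use \<beta> V ih ih2 q\<beta> h in \<open>auto simp: V_def powr_powr powr_numeral\<close>)
  then show ?thesis using q\<beta> h(2) by (simp add: mean_def X_def powr_powr powr_numeral)
 qed
 then have Xl: "X powr \<beta> \<le> lam^2" using s2 by linarith
 have "X powr (\<beta> - 1) \<le> lam powr (2 - q)"
 proof -
  have "(X powr \<beta>) powr ((\<beta> - 1) / \<beta>) \<le> (lam^2) powr ((\<beta> - 1) / \<beta>)" using Xl \<beta> by (intro powr_mono2) auto
  moreover have "(X powr \<beta>) powr ((\<beta> - 1) / \<beta>) = X powr (\<beta> - 1)" using \<beta> by (simp add: powr_powr)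
  moreover have "(lam^2) powr ((\<beta> - 1) / \<beta>) = lam powr (2 - q)"
  proof -
   have "2 * ((\<beta> - 1) / \<beta>) = 2 - q" using \<beta> q\<beta> by (simp add: field_simps)
   moreover have "lam^2 = lam powr 2" using lam by (simp add: powr_numeral)
   ultimately show ?thesis by (simp only: powr_powr)
  qed
  ultimately show ?thesis by simp
 qed
 moreover have "X1 powr (\<beta> - 1) \<le> X powr (\<beta> - 1)" using X10 X1X \<beta> by (intro powr_mono2) auto
 ultimately have X1p: "X1 powr \<beta> \<le> X1 * lam powr (2 - q)"
  using X10 powr_mult_base[of X1 "\<beta> - 1"] mult_left_mono[of "X1 powr (\<beta> - 1)" "lam powr (2 - q)" X1] by simp
 have "X powr \<beta> \<le> ((\<eta> * lam) powr q + X1) powr \<beta>" using XX1 X0 \<beta> by (intro powr_mono2) auto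
 also have "\<dots> \<le> 4 * (((\<eta> * lam) powr q) powr \<beta> + X1 powr \<beta>)" by (rule powr_add_le) (use \<beta> X10 in auto)
 also have "((\<eta> * lam) powr q) powr \<beta> = (\<eta> * lam)^2" using q\<beta> el by (simp add: powr_powr powr_numeral)
 also have "4 * ((\<eta> * lam)^2 + X1 powr \<beta>) \<le> 4 * ((\<eta> * lam)^2 + X1 * lam powr (2 - q))"
  by (intro mult_left_mono add_left_mono X1p) simp
 also have "\<dots> = 4 * (\<eta> * lam)^2 + 4 * (X1 * lam powr (2 - q))" by (rule distrib_left)
 finally have "X powr \<beta> \<le> 4 * (\<eta> * lam)^2 + 4 * (X1 * lam powr (2 - q))" .
 then have "X powr \<beta> + mean ?S (\<lambda>w. (f w)^2) \<le> 5 * (\<eta> * lam)^2 + (4 * (X1 * lam powr (2 - q)) + Y1)" using Yb by linarith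
 then have "C * (X powr \<beta> + mean ?S (\<lambda>w. (f w)^2)) \<le> C * (5 * (\<eta> * lam)^2 + (4 * (X1 * lam powr (2 - q)) + Y1))"
  using C by (intro mult_left_mono) auto
 then have "lam^2 \<le> C * (5 * (\<eta> * lam)^2) + C * (4 * (X1 * lam powr (2 - q)) + Y1)"
  using s1 RH unfolding X_def by (simp only: distrib_left)
 moreover have "C * (5 * (\<eta> * lam)^2) = lam^2 / 2"
 proof -
  have "C * (5 * (\<eta> * lam)^2) = (10 * C * \<eta>^2) * lam^2 / 2" by (simp add: power_mult_distrib)
  then show ?thesis by (simp only: \<eta>(2))
 qed
 moreover have "C * (4 * (X1 * lam powr (2 - q)) + Y1) \<le> C * (4 * (X1 * lam powr (2 - q) + Y1))"
  unfolding Y1_def using C by (intro mult_left_mono) (auto intro!: mean_nonneg trunc_pow_nonneg)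
 ultimately have "lam^2 \<le> lam^2 / 2 + C * (4 * (X1 * lam powr (2 - q) + Y1))" by linarith
 moreover have "8 * C * (lam powr (2 - q) * X1 + Y1) = 2 * (C * (4 * (X1 * lam powr (2 - q) + Y1)))" by (simp add: mult_ac)
 ultimately have "lam^2 \<le> 8 * C * (lam powr (2 - q) * X1 + Y1)" by linarith
 then have "V * lam^2 \<le> V * (8 * C * (lam powr (2 - q) * X1 + Y1))" using V by (intro mult_left_mono) auto
 also have "\<dots> = 8 * C * (lam powr (2 - q) * (V * X1) + V * Y1)" by (simp add: algebra_simps)
 also have "V * X1 = SI ?S (trunc_pow q (\<eta> * lam) h)" using V by (simp add: X1_def mean_def V_def)
 also have "V * Y1 = SI ?S (trunc_pow 2 (\<eta> * lam) f)" using V by (simp add: Y1_def mean_def V_def)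
 finally show ?thesis using V1 mult_right_mono[of "measure lborel (Q z r)" V "lam^2"] by simp
qed

text \<open>
  Every point where \<open>h\<close> is large has a stopping cylinder.  A countable subfamily of the doubled cylinders covers
  these points by Lindelof's theorem; a finite part of it has a Vitali subfamily of disjoint cylinders.  On
  their enlargements the mean of \<open>h\<^sup>2\<close> is at most \<open>lam\<^sup>2\<close>, while the disjoint cylinders satisfy
  \<open>stopped_cylinder_estimate\<close>.
\<close>

lemma level_set_estimate:
 assumes C: "C > 0"
 shows "\<exists>\<kappa>>0. \<exists>\<eta>>0. \<exists>C'>0. \<forall>(h :: (real ^ 'n) \<times> real => real) f P \<delta> lam.
  L2b h --> (\<forall>w. 0 \<le> h w) --> L2b f --> (\<forall>w. 0 \<le> f w) --> (\<forall>w. w \<notin> P --> h w = 0) --> (\<forall>z\<in>P. \<delta> z > 0) --> lam > 0 -->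
  (\<forall>z\<in>P. \<forall>r. 0 < r --> r \<le> \<delta> z --> mean (Q z r) (\<lambda>w. (h w)^2) \<le>
    C * ((mean (Q z (2 * r)) (\<lambda>w. h w powr qexp TYPE('n))) powr bexp TYPE('n) + mean (Q z (2 * r)) (\<lambda>w. (f w)^2))) -->
  (\<forall>z\<in>P. \<forall>r. \<delta> z \<le> r --> r \<le> 8 * \<delta> z --> mean (Q z r) (\<lambda>w. (h w)^2) \<le> lam^2) -->
  integral\<^sup>L lborel (trunc_pow 2 (\<kappa> * lam) h) \<le>
   C' * (lam powr (2 - qexp TYPE('n)) * integral\<^sup>L lborel (trunc_pow (qexp TYPE('n)) (\<eta> * lam) h) + integral\<^sup>L lborel (trunc_pow 2 (\<eta> * lam) f))"
proof -
 define q where "q = qexp TYPE('n)"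
 define n where "n = CARD('n)"
 have q: "1 < q" "q < 2" using qexp_bounds by (auto simp: q_def)
 obtain c :: real where c: "c > 0" and leb: "\<forall>h :: (real ^ 'n) \<times> real => real. L2b h --> (\<forall>w. 0 \<le> h w) -->
   (AE z in lborel. \<forall>t s0. 0 \<le> t --> c * t < h z --> 0 < s0 --> (\<exists>s. 0 < s \<and> s < s0 \<and> t^2 < mean (Q z s) (\<lambda>w. (h w)^2)))"
  using lebesgue_point_means by (elim exE conjE) (rule that)
 \<comment> \<open>\<open>stopping_radius\<close> asks for means above \<open>2^(n+2) * lam^2 = (B * lam)^2\<close> at small radii.\<close>
 define B where "B = sqrt (2 ^ (n + 2))"
 have B: "B > 0" "B^2 = 2 ^ (n + 2)" by (auto simp: B_def)
 define \<kappa> where "\<kappa> = c * B"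
 \<comment> \<open>The heights below \<open>\<eta> * lam\<close> contribute at most \<open>5 * C * (\<eta> * lam)^2 = lam^2 / 2\<close>.\<close>
 define \<eta> where "\<eta> = 1 / sqrt (10 * C)"
 have \<eta>: "\<eta> > 0" "10 * C * \<eta>^2 = 1" using C by (auto simp: \<eta>_def power_divide)
 define C' where "C' = 8 ^ (n + 2) * (8 * C)"
 have main: "integral\<^sup>L lborel (trunc_pow 2 (\<kappa> * lam) h) \<le>
   C' * (lam powr (2 - q) * integral\<^sup>L lborel (trunc_pow q (\<eta> * lam) h) + integral\<^sup>L lborel (trunc_pow 2 (\<eta> * lam) f))"
  if h: "L2b h" "\<forall>w. 0 \<le> h w" and f: "L2b f" "\<forall>w. 0 \<le> f w" and out: "\<forall>w. w \<notin> P --> h w = 0" and \<delta>: "\<forall>z\<in>P. \<delta> z > 0" and lam: "lam > 0"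
   and RH: "\<forall>z\<in>P. \<forall>r. 0 < r --> r \<le> \<delta> z --> mean (Q z r) (\<lambda>w. (h w)^2) \<le>
    C * ((mean (Q z (2 * r)) (\<lambda>w. h w powr q)) powr bexp TYPE('n) + mean (Q z (2 * r)) (\<lambda>w. (f w)^2))"
   and H2: "\<forall>z\<in>P. \<forall>r. \<delta> z \<le> r --> r \<le> 8 * \<delta> z --> mean (Q z r) (\<lambda>w. (h w)^2) \<le> lam^2"
  for h f :: "(real ^ 'n) \<times> real => real" and P \<delta> lam
 proof -
  have h0: "0 \<le> h w" and f0: "0 \<le> f w" for w using h(2) f(2) by blast+
  have ih2: "integrable lborel (\<lambda>w. (h w)^2)" using h by (simp add: L2b_def)
  have h20: "0 \<le> (h w)^2" for w by simp
  have it: "integrable lborel (trunc_pow q (\<eta> * lam) h)" by (rule trunc_pow_integrable[OF h(1) h0]) (use q in auto)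
  have itf: "integrable lborel (trunc_pow 2 (\<eta> * lam) f)" by (rule trunc_pow_integrable[OF f(1) f0]) auto
  have it2: "integrable lborel (trunc_pow 2 (\<kappa> * lam) h)" by (rule trunc_pow_integrable[OF h(1) h0]) auto
  define T where "T w = lam powr (2 - q) * trunc_pow q (\<eta> * lam) h w + trunc_pow 2 (\<eta> * lam) f w" for w
  have iT: "integrable lborel T" unfolding T_def[abs_def] using it itf by simp
  have T0: "0 \<le> T w" for w unfolding T_def by (intro add_nonneg_nonneg mult_nonneg_nonneg trunc_pow_nonneg) auto
  have SIT: "SI S T = lam powr (2 - q) * SI S (trunc_pow q (\<eta> * lam) h) + SI S (trunc_pow 2 (\<eta> * lam) f)" if "S \<in> sets borel" for S
   unfolding SI_def T_def using integrable_indicator_mult[OF that it] integrable_indicator_mult[OF that itf]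
   by (simp add: distrib_left mult.left_commute[of "indicator _ _"])
  define RR where "RR = C' * integral\<^sup>L lborel T"
  define good where "good z \<longleftrightarrow> z \<in> P \<and> (\<forall>s0. 0 < s0 --> (\<exists>s. 0 < s \<and> s < s0 \<and> 2 ^ (CARD('n) + 2) * lam^2 < mean (Q z s) (\<lambda>w. (h w)^2)))" for z
  have "\<exists>\<rho>. \<forall>z. good z --> 0 < \<rho> z \<and> \<rho> z \<le> \<delta> z \<and> lam^2 < mean (Q z (\<rho> z)) (\<lambda>w. (h w)^2) \<and> mean (Q z (2 * \<rho> z)) (\<lambda>w. (h w)^2) \<le> lam^2 \<and> mean (Q z (8 * \<rho> z)) (\<lambda>w. (h w)^2) \<le> lam^2"
  proof (rule choice, rule allI)
   fix z
   show "\<exists>r. good z --> 0 < r \<and> r \<le> \<delta> z \<and> lam^2 < mean (Q z r) (\<lambda>w. (h w)^2) \<and> mean (Q z (2 * r)) (\<lambda>w. (h w)^2) \<le> lam^2 \<and> mean (Q z (8 * r)) (\<lambda>w. (h w)^2) \<le> lam^2"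
   proof (cases "good z")
    case True
    then have zP: "z \<in> P" and gd: "\<And>s0. 0 < s0 ==> \<exists>s. 0 < s \<and> s < s0 \<and> 2 ^ (CARD('n) + 2) * lam^2 < mean (Q z s) (\<lambda>w. (h w)^2)" by (auto simp: good_def)
    from stopping_radius[OF ih2 h20 \<delta>[rule_format, OF zP] H2[rule_format, OF zP] gd] show ?thesis by blast
   qed simp
  qed
  then obtain \<rho> where "\<forall>z. good z --> 0 < \<rho> z \<and> \<rho> z \<le> \<delta> z \<and> lam^2 < mean (Q z (\<rho> z)) (\<lambda>w. (h w)^2) \<and> mean (Q z (2 * \<rho> z)) (\<lambda>w. (h w)^2) \<le> lam^2 \<and> mean (Q z (8 * \<rho> z)) (\<lambda>w. (h w)^2) \<le> lam^2" ..
  then have \<rho>: "0 < \<rho> z" "\<rho> z \<le> \<delta> z" "lam^2 < mean (Q z (\<rho> z)) (\<lambda>w. (h w)^2)" "mean (Q z (2 * \<rho> z)) (\<lambda>w. (h w)^2) \<le> lam^2" "mean (Q z (8 * \<rho> z)) (\<lambda>w. (h w)^2) \<le> lam^2" if "good z" for z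
   using that by blast+
  have cyl: "SI (Q z (8 * \<rho> z)) (\<lambda>w. (h w)^2) \<le> C' * SI (Q z (2 * \<rho> z)) T" if g: "good z" for z
  proof -
   note r = \<rho>[OF g]
   have zP: "z \<in> P" using g by (simp add: good_def)
   have r8: "8 * \<rho> z > 0" using r by simp
   have "measure lborel (Q z (\<rho> z)) * lam^2 \<le> 8 * C * SI (Q z (2 * \<rho> z)) T"
    unfolding SIT[OF Q_borel] q_def
    by (rule stopped_cylinder_estimate[OF h(1) h0 f(1) f0 C lam r(1) RH[rule_format, OF zP r(1,2), unfolded q_def] r(3,4) \<eta>])
   then have le: "8 ^ (n + 2) * (measure lborel (Q z (\<rho> z)) * lam^2) \<le> 8 ^ (n + 2) * (8 * C * SI (Q z (2 * \<rho> z)) T)"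
    by (intro mult_left_mono) auto
   have V8: "measure lborel (Q z (8 * \<rho> z)) = 8 ^ (n + 2) * measure lborel (Q z (\<rho> z))"
    unfolding measure_Q(1)[OF r8] measure_Q(1)[OF r(1)] n_def by (simp add: power_mult_distrib)
   have V0: "measure lborel (Q z (8 * \<rho> z)) > 0" unfolding measure_Q(1)[OF r8] using omega_pos[where 'n='n] r8 by simp
   have "SI (Q z (8 * \<rho> z)) (\<lambda>w. (h w)^2) \<le> lam^2 * measure lborel (Q z (8 * \<rho> z))"
    using r(5) V0 unfolding mean_def by (simp add: divide_le_eq)
   also have "\<dots> = 8 ^ (n + 2) * (measure lborel (Q z (\<rho> z)) * lam^2)" unfolding V8 by (simp only: mult_ac)
   also note le
   finally show ?thesis unfolding C'_def by (simp only: mult.assoc)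
  qed
  have C'0: "C' > 0" using C by (simp add: C'_def)
  have fin: "SI (\<Union>z\<in>I. Q z (2 * \<rho> z)) (\<lambda>w. (h w)^2) \<le> RR" if I: "finite I" "\<And>z. z \<in> I ==> good z" for I
  proof -
   obtain J where J: "J \<subseteq> I" "\<forall>i\<in>J. \<forall>j\<in>J. i \<noteq> j --> Q i (2 * \<rho> i) \<inter> Q j (2 * \<rho> j) = {}"
    "(\<Union>i\<in>I. Q i (2 * \<rho> i)) \<subseteq> (\<Union>j\<in>J. Q j (3 * (2 * \<rho> j)))"
    using parabolic_vitali_finite[OF I(1), of "\<lambda>z. 2 * \<rho> z" "\<lambda>z. z"] \<rho>(1) I(2) by auto
   have fJ: "finite J" using J(1) I(1) by (rule finite_subset)
   have gJ: "good j" if "j \<in> J" for j using that J(1) I(2) by blast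
   have sub: "(\<Union>i\<in>I. Q i (2 * \<rho> i)) \<subseteq> (\<Union>j\<in>J. Q j (8 * \<rho> j))"
   proof -
    have "Q j (3 * (2 * \<rho> j)) \<subseteq> Q j (8 * \<rho> j)" if "j \<in> J" for j
    proof -
     have "3 * (2 * \<rho> j) \<le> 8 * \<rho> j" using \<rho>(1)[OF gJ[OF that]] by simp
     moreover have "(3 * (2 * \<rho> j))^2 \<le> (8 * \<rho> j)^2" using \<rho>(1)[OF gJ[OF that]] by (intro power_mono) auto
     ultimately show ?thesis unfolding subset_iff mem_Q by (auto intro: less_le_trans)
    qed
    then show ?thesis using J(3) by blast
   qed
   have "SI (\<Union>z\<in>I. Q z (2 * \<rho> z)) (\<lambda>w. (h w)^2) \<le> SI (\<Union>j\<in>J. Q j (8 * \<rho> j)) (\<lambda>w. (h w)^2)"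
    by (rule SI_mono_set[OF _ _ ih2 h20 sub]; intro borel_open open_UN ballI open_Q)
   also have "\<dots> \<le> (\<Sum>j\<in>J. SI (Q j (8 * \<rho> j)) (\<lambda>w. (h w)^2))"
    by (rule SI_Union_le[OF fJ Q_borel ih2 h20])
   also have "\<dots> \<le> (\<Sum>j\<in>J. C' * SI (Q j (2 * \<rho> j)) T)" by (intro sum_mono cyl gJ)
   also have "\<dots> = C' * (\<Sum>j\<in>J. SI (Q j (2 * \<rho> j)) T)" by (simp add: sum_distrib_left)
   also have "\<dots> \<le> C' * integral\<^sup>L lborel T"
    using C'0 J(2) by (intro mult_left_mono SI_disjoint_sum_le[OF fJ Q_borel iT T0]) auto
   finally show ?thesis by (simp add: RR_def)
  qed
  define O' where "O' = (\<Union>z\<in>{z. good z}. Q z (2 * \<rho> z))"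
  have RR0: "RR \<ge> 0" unfolding RR_def using C'0 T0 by (intro mult_nonneg_nonneg Bochner_Integration.integral_nonneg) auto
  have SIO: "SI O' (\<lambda>w. (h w)^2) \<le> RR"
  proof -
   obtain F' where F': "F' \<subseteq> (\<lambda>z. Q z (2 * \<rho> z)) ` {z. good z}" "countable F'" "\<Union>F' = \<Union>((\<lambda>z. Q z (2 * \<rho> z)) ` {z. good z})"
   proof (rule Lindelof[of "(\<lambda>z. Q z (2 * \<rho> z)) ` {z. good z}"])
    show "open S" if "S \<in> (\<lambda>z. Q z (2 * \<rho> z)) ` {z. good z}" for S
     using that by (elim imageE) (simp only: open_Q)
   qed
   obtain G where G: "G \<subseteq> {z. good z}" "countable G" "F' = (\<lambda>z. Q z (2 * \<rho> z)) ` G"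
    using countable_subset_image[of F' "\<lambda>z. Q z (2 * \<rho> z)" "{z. good z}"] F'(1,2) by auto
   have OG: "O' = (\<Union>z\<in>G. Q z (2 * \<rho> z))" using F'(3) G(3) by (simp add: O'_def)
   show ?thesis
   proof (cases "G = {}")
    case True
    then show ?thesis using RR0 by (simp add: OG SI_def)
   next
    case False
    define e where "e = from_nat_into G"
    have e: "range e = G" unfolding e_def using False G(2) by (rule range_from_nat_into)
    define U where "U m = (\<Union>z\<in>e ` {..<m}. Q z (2 * \<rho> z))" for m :: nat
    have U: "U m \<in> sets borel" for m unfolding U_def by (intro borel_open open_UN ballI open_Q)
    have OB: "O' \<in> sets borel" unfolding O'_def by (intro borel_open open_UN ballI open_Q)
    have "(\<lambda>m. SI (U m) (\<lambda>w. (h w)^2)) \<longlonglongrightarrow> SI O' (\<lambda>w. (h w)^2)"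
     unfolding SI_def
    proof (rule integral_dominated_convergence[where w="\<lambda>w. (h w)^2"])
     show "AE w in lborel. (\<lambda>m. indicator (U m) w * (h w)^2) \<longlonglongrightarrow> indicator O' w * (h w)^2"
     proof (rule AE_I2, rule tendsto_eventually)
      fix w
      show "\<forall>\<^sub>F m in sequentially. indicator (U m) w * (h w)^2 = indicator O' w * (h w)^2"
      proof (cases "w \<in> O'")
       case True
       then obtain k where k: "w \<in> Q (e k) (2 * \<rho> (e k))" using e by (auto simp: OG)
       have "w \<in> U m" if "m > k" for m using k that by (auto simp: U_def)
       then show ?thesis using True by (intro eventually_mono[OF eventually_gt_at_top[of k]]) simp
      next
       case False
       have "w \<notin> U m" for m using False e by (auto simp: U_def OG)
       then show ?thesis using False by simp
      qed
     qed
     show "AE w in lborel. norm (indicator (U m) w * (h w)^2) \<le> (h w)^2" for m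
      by (rule AE_I2) (simp add: indicator_def)
    qed (use ih2 borel_measurable_integrable[OF integrable_indicator_mult[OF OB ih2]] borel_measurable_integrable[OF integrable_indicator_mult[OF U ih2]] in auto)
    moreover have "SI (U m) (\<lambda>w. (h w)^2) \<le> RR" for m
     unfolding U_def by (rule fin) (use e G(1) in auto)
    ultimately show ?thesis by (intro LIMSEQ_le_const2) auto
   qed
  qed
  have ae: "AE z in lborel. \<kappa> * lam < h z --> z \<in> O'"
   using leb[rule_format, OF h(1) h0]
  proof eventually_elim
   case (elim z)
   show ?case
   proof
    assume a: "\<kappa> * lam < h z"
    have kl: "0 < \<kappa> * lam" using c B lam by (simp add: \<kappa>_def)
    then have zP: "z \<in> P" using out a by fastforce
    have "(B * lam)^2 = 2 ^ (CARD('n) + 2) * lam^2" by (simp only: power_mult_distrib B(2) n_def)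
    moreover have "c * (B * lam) < h z" "0 \<le> B * lam" using a B lam by (auto simp: \<kappa>_def mult.assoc)
    ultimately have "\<exists>s. 0 < s \<and> s < s0 \<and> 2 ^ (CARD('n) + 2) * lam^2 < mean (Q z s) (\<lambda>w. (h w)^2)" if "0 < s0" for s0
     using elim[rule_format, of "B * lam" s0] that by simp
    then have g: "good z" unfolding good_def using zP by blast
    then have "z \<in> Q z (2 * \<rho> z)" using \<rho>(1)[OF g] by (simp add: mem_Q)
    then show "z \<in> O'" unfolding O'_def using g by blast
   qed
  qed
  have OB: "O' \<in> sets borel" unfolding O'_def by (intro borel_open open_UN ballI open_Q)
  have "integral\<^sup>L lborel (trunc_pow 2 (\<kappa> * lam) h) \<le> SI O' (\<lambda>w. (h w)^2)"
   unfolding SI_def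
  proof (rule integral_mono_AE[OF it2 integrable_indicator_mult[OF OB ih2]])
   show "AE w in lborel. trunc_pow 2 (\<kappa> * lam) h w \<le> indicator O' w * (h w)^2"
    using ae
   proof eventually_elim
    case (elim w)
    then show ?case using h0[of w] by (cases "h w = 0") (auto simp: trunc_pow_def powr_numeral)
   qed
  qed
  also have "\<dots> \<le> RR" by (rule SIO)
  also have "RR = C' * (lam powr (2 - q) * integral\<^sup>L lborel (trunc_pow q (\<eta> * lam) h) + integral\<^sup>L lborel (trunc_pow 2 (\<eta> * lam) f))"
   unfolding RR_def T_def using it itf by simp
  finally show ?thesis .
 qed
 have pos: "\<kappa> > 0" "C' > 0" using c B C by (simp_all add: \<kappa>_def C'_def)
 show ?thesis
 proof (rule exI[of _ \<kappa>], rule conjI[OF pos(1)], rule exI[of _ \<eta>], rule conjI[OF \<eta>(1)],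
   rule exI[of _ C'], rule conjI[OF pos(2)], intro allI impI)
  fix h f :: "(real ^ 'n) \<times> real => real" and P \<delta> lam
  assume a: "L2b h" "\<forall>w. 0 \<le> h w" "L2b f" "\<forall>w. 0 \<le> f w" "\<forall>w. w \<notin> P --> h w = 0" "\<forall>z\<in>P. \<delta> z > 0" "lam > 0"
   and b: "\<forall>z\<in>P. \<forall>r. 0 < r --> r \<le> \<delta> z --> mean (Q z r) (\<lambda>w. (h w)^2) \<le>
    C * ((mean (Q z (2 * r)) (\<lambda>w. h w powr qexp TYPE('n))) powr bexp TYPE('n) + mean (Q z (2 * r)) (\<lambda>w. (f w)^2))"
   and c: "\<forall>z\<in>P. \<forall>r. \<delta> z \<le> r --> r \<le> 8 * \<delta> z --> mean (Q z r) (\<lambda>w. (h w)^2) \<le> lam^2"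
  show "integral\<^sup>L lborel (trunc_pow 2 (\<kappa> * lam) h) \<le>
   C' * (lam powr (2 - qexp TYPE('n)) * integral\<^sup>L lborel (trunc_pow (qexp TYPE('n)) (\<eta> * lam) h) + integral\<^sup>L lborel (trunc_pow 2 (\<eta> * lam) f))"
   unfolding q_def[symmetric]
  proof (rule main[where P=P and \<delta>=\<delta>, OF a])
   show "\<forall>z\<in>P. \<forall>r. 0 < r --> r \<le> \<delta> z --> mean (Q z r) (\<lambda>w. (h w)^2) \<le>
    C * ((mean (Q z (2 * r)) (\<lambda>w. h w powr q)) powr bexp TYPE('n) + mean (Q z (2 * r)) (\<lambda>w. (f w)^2))"
    using b unfolding q_def .
  qed (rule c)
 qed
qed

section \<open>Higher integrability by summation over levels\<close>

lemma power_powr_swap: "(2 ^ k) powr \<epsilon> = (2 powr \<epsilon> :: real) ^ k"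
 by (induction k) (simp_all add: powr_mult)

lemma geometric_powers:
 fixes a :: real
 shows "(a - 1) * (\<Sum>j<k. a ^ j) = a ^ k - 1"
 by (induction k) (simp_all add: algebra_simps)

text \<open>
  If the index set is not empty, its terms are among those up to its largest element.
\<close>

lemma sum_le_Max_prefix:
 fixes a :: "nat => real"
 assumes "\<And>j. 0 \<le> a j" "\<exists>j<m. P j"
 shows "\<exists>J. J < m \<and> P J \<and> (\<Sum>j<m. if P j then a j else 0) \<le> (\<Sum>j<Suc J. a j)"
proof -
 define J where "J = Max {j. j < m \<and> P j}"
 have J: "J \<in> {j. j < m \<and> P j}" unfolding J_def using assms(2) by (intro Max_in) auto
 have le: "j \<le> J" if "j < m" "P j" for j unfolding J_def using that by (intro Max_ge) auto
 have "(\<Sum>j<m. if P j then a j else 0) = (\<Sum>j\<in>{j. j < m \<and> P j}. a j)"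
  by (subst sum.inter_filter[symmetric]) (auto intro: sum.cong)
 also have "\<dots> \<le> (\<Sum>j<Suc J. a j)"
  by (rule sum_mono2) (use le assms(1) in \<open>auto simp: less_Suc_eq_le\<close>)
 finally show ?thesis using J by (intro exI[of _ J]) simp
qed

text \<open>
  The sum counts the dyadic levels \<open>t * 2^j\<close> below \<open>x\<close> with the weight \<open>a^j\<close>.  For \<open>a = 2^\<epsilon>\<close> it is
  comparable to \<open>((x/t)^\<epsilon> - 1) / (a - 1)\<close>, a discrete form of the layer cake
  formula.  Finitely many levels keep everything finite before absorption.
\<close>

definition levels :: "real => real => nat => real => real" where
 "levels a t m x = (\<Sum>j<m. if t * 2 ^ j < x then a ^ j else 0)"

lemma levels_prefix_le:
 assumes "a > 1" "t * 2 ^ i < x" "i < m" "t > 0"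
 shows "a ^ Suc i \<le> (a - 1) * levels a t m x + 1"
proof -
 have "(\<Sum>j<Suc i. a ^ j) = (\<Sum>j<Suc i. if t * 2 ^ j < x then a ^ j else 0)"
 proof (rule sum.cong[OF refl])
  fix j assume "j \<in> {..<Suc i}"
  then have "(2::real) ^ j \<le> 2 ^ i" by (intro power_increasing) auto
  then have "t * 2 ^ j \<le> t * 2 ^ i" using assms by (intro mult_left_mono) auto
  then have "t * 2 ^ j < x" using assms(2) by (rule le_less_trans)
  then show "a ^ j = (if t * 2 ^ j < x then a ^ j else 0)" by simp
 qed
 also have "\<dots> \<le> levels a t m x"
  unfolding levels_def by (rule sum_mono2) (use assms in auto)
 finally have "(a - 1) * (\<Sum>j<Suc i. a ^ j) \<le> (a - 1) * levels a t m x" using assms by (intro mult_left_mono) auto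
 then show ?thesis unfolding geometric_powers by simp
qed

lemma levels_nonneg: "a > 1 ==> 0 \<le> levels a t m x"
 unfolding levels_def by (intro sum_nonneg) auto

lemma levels_lower:
 assumes a: "1 < a" "a = 2 powr \<epsilon>" and \<epsilon>: "\<epsilon> > 0" and t: "t > 0" and x: "x \<ge> 0"
 shows "min ((x / t) powr \<epsilon>) (a ^ m) \<le> (a - 1) * levels a t m x + 1"
proof (cases "\<exists>k<m. \<not> t * 2 ^ k < x")
 case False
 show ?thesis
 proof (cases m)
  case 0
  then show ?thesis by (simp add: levels_def)
 next
  case (Suc i)
  then show ?thesis using levels_prefix_le[OF a(1), of t i x m] False t by simp
 qed
next
 case True
 define k where "k = (LEAST k. \<not> t * 2 ^ k < x)"
 have ex: "\<exists>k. \<not> t * 2 ^ k < x" using True by blast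
 have k: "\<not> t * 2 ^ k < x" unfolding k_def by (rule LeastI_ex[OF ex])
 have km: "k < m" 
 proof -
  obtain k' where "k' < m" "\<not> t * 2 ^ k' < x" using True by blast
  moreover from this(2) have "k \<le> k'" unfolding k_def by (rule Least_le)
  ultimately show ?thesis by linarith
 qed
 have "(x / t) powr \<epsilon> \<le> (2 ^ k) powr \<epsilon>" using k t x \<epsilon> by (intro powr_mono2) (auto simp: field_simps)
 also have "(2 ^ k) powr \<epsilon> = a ^ k" by (simp only: a(2) power_powr_swap)
 also have "a ^ k \<le> (a - 1) * levels a t m x + 1"
 proof (cases k)
  case 0
  then show ?thesis using levels_nonneg[OF a(1), of t m x] a by simp
 next
  case (Suc i)
  then have "t * 2 ^ i < x" using not_less_Least[of i "\<lambda>k. \<not> t * 2 ^ k < x"] unfolding k_def by auto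
  from levels_prefix_le[OF a(1) this _ t] show ?thesis using Suc km by simp
 qed
 finally show ?thesis by simp
qed

text \<open>
  Changing the threshold from \<open>\<eta>\<close> to \<open>\<kappa>\<close> shifts the levels by at most \<open>l\<close> places.
\<close>

lemma power_le_levels:
 assumes a: "1 < a" "a \<le> 2" and t: "t > 0" "\<kappa> > 0" "\<eta> > 0" and l: "\<kappa> \<le> \<eta> * 2 ^ l"
  and J: "J < m" "\<eta> * t * 2 ^ J < x"
 shows "a ^ J \<le> 2 ^ l * ((a - 1) * levels a (\<kappa> * t) m x + 1)"
proof -
 have al: "a ^ l \<le> 2 ^ l" using a by (intro power_mono) auto
 have S0: "0 \<le> (a - 1) * levels a (\<kappa> * t) m x" using a levels_nonneg[OF a(1)] by (intro mult_nonneg_nonneg) auto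
 show ?thesis
 proof (cases "J < l")
  case True
  have "a ^ J \<le> a ^ l" using True a by (intro power_increasing) auto
  also have "\<dots> \<le> 2 ^ l * 1" using al by simp
  also have "\<dots> \<le> 2 ^ l * ((a - 1) * levels a (\<kappa> * t) m x + 1)" using S0 by (intro mult_left_mono) auto
  finally show ?thesis .
 next
  case False
  define i where "i = J - l"
  have Ji: "J = l + i" using False by (simp add: i_def)
  have "\<kappa> * t * 2 ^ i \<le> (\<eta> * 2 ^ l) * t * 2 ^ i" using l t by (intro mult_right_mono) auto
  also have "\<dots> = \<eta> * t * 2 ^ J" by (simp add: Ji power_add)
  finally have "\<kappa> * t * 2 ^ i < x" using J by linarith
  moreover have "i < m" using J Ji by simp
  ultimately have "a ^ Suc i \<le> (a - 1) * levels a (\<kappa> * t) m x + 1" using t by (intro levels_prefix_le a) auto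
  moreover have "a ^ i \<le> a ^ Suc i" using a by (intro power_increasing) auto
  ultimately have "a ^ i \<le> (a - 1) * levels a (\<kappa> * t) m x + 1" by linarith
  then have "a ^ l * a ^ i \<le> 2 ^ l * ((a - 1) * levels a (\<kappa> * t) m x + 1)" using al a by (intro mult_mono) auto
  then show ?thesis by (simp add: Ji power_add)
 qed
qed

text \<open>
  The weights \<open>lam^(2-q)\<close> grow geometrically, so that the sum over the levels below \<open>x\<close> is dominated by the
  last one and produces \<open>x\<^sup>2\<close> times the weight of that level.
\<close>

lemma weighted_levels_q:
 assumes q: "0 < q" "q < 2" and a: "1 < a" "a \<le> 2" and t: "t > 0" "\<kappa> > 0" "\<eta> > 0" and l: "\<kappa> \<le> \<eta> * 2 ^ l"
  and x: "x \<ge> 0"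
 shows "(\<Sum>j<m. a ^ j * ((t * 2 ^ j) powr (2 - q) * (if \<eta> * (t * 2 ^ j) < x then x powr q else 0)))
  \<le> (\<eta> powr (q - 2) / (1 - 2 powr (q - 2)) * 2 ^ l) * (x^2 * ((a - 1) * levels a (\<kappa> * t) m x + 1))"
proof (cases "\<exists>j<m. \<eta> * (t * 2 ^ j) < x")
 case False
 then have "(\<Sum>j<m. a ^ j * ((t * 2 ^ j) powr (2 - q) * (if \<eta> * (t * 2 ^ j) < x then x powr q else 0))) = 0"
  by (intro sum.neutral) auto
 moreover have "2 powr (q - 2) < (1::real)" using q by (simp add: powr_less_one)
 ultimately show ?thesis using a levels_nonneg[OF a(1), of "\<kappa> * t" m x] by simp
next
 case True
 define \<theta> :: real where "\<theta> = 2 powr (q - 2)"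
 have \<theta>: "0 < \<theta>" "\<theta> < 1" using q by (auto simp: \<theta>_def powr_less_one)
 define F where "F j = a ^ j * ((t * 2 ^ j) powr (2 - q) * x powr q)" for j :: nat
 have F0: "0 \<le> F j" for j using a by (simp add: F_def)
 obtain J where J: "J < m" "\<eta> * (t * 2 ^ J) < x" "(\<Sum>j<m. if \<eta> * (t * 2 ^ j) < x then F j else 0) \<le> (\<Sum>j<Suc J. F j)"
  using sum_le_Max_prefix[where a=F, OF F0 True] by (elim exE conjE) (rule that)
 have xpos: "x > 0" by (rule less_trans[OF _ J(2)]) (use t in simp)
 have "(\<Sum>j<m. a ^ j * ((t * 2 ^ j) powr (2 - q) * (if \<eta> * (t * 2 ^ j) < x then x powr q else 0)))
   = (\<Sum>j<m. if \<eta> * (t * 2 ^ j) < x then F j else 0)" by (intro sum.cong) (auto simp: F_def)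
 also have "\<dots> \<le> (\<Sum>j<Suc J. F j)" by (rule J(3))
 also have "\<dots> \<le> (\<Sum>j<Suc J. a ^ J * (\<eta> powr (q - 2) * x^2) * \<theta> ^ (J - j))"
 proof (rule sum_mono)
  fix j assume "j \<in> {..<Suc J}"
  then have jJ: "j \<le> J" by simp
  define i where "i = J - j"
  have Jj: "J = i + j" using jJ by (simp add: i_def)
  have aj: "a ^ j \<le> a ^ J" using jJ a by (intro power_increasing) auto
  have eq: "t * 2 ^ j = t * 2 ^ J * (1 / 2 ^ i)" by (simp add: Jj power_add)
  have "(t * 2 ^ j) powr (2 - q) = (t * 2 ^ J) powr (2 - q) * (1 / 2 ^ i) powr (2 - q)"
   unfolding eq by (rule powr_mult)
  also have "(1 / 2 ^ i) powr (2 - q) = \<theta> ^ i"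
  proof -
   have "(1 / 2 ^ i :: real) = 2 powr (- real i)" by (simp add: powr_minus_divide powr_realpow)
   then have "(1 / 2 ^ i :: real) powr (2 - q) = 2 powr (real i * (q - 2))" by (simp add: powr_powr algebra_simps)
   also have "\<dots> = \<theta> powr real i" by (simp add: \<theta>_def powr_powr mult.commute)
   also have "\<dots> = \<theta> ^ i" using \<theta>(1) by (rule powr_realpow)
   finally show ?thesis .
  qed
  also have "(t * 2 ^ J) powr (2 - q) \<le> (x / \<eta>) powr (2 - q)"
   using J(2) t q by (intro powr_mono2) (auto simp: field_simps)
  also have "(x / \<eta>) powr (2 - q) = x powr (2 - q) * \<eta> powr (q - 2)"
  proof -
   have "\<eta> powr (q - 2) = 1 / \<eta> powr (2 - q)" using powr_minus_divide[of \<eta> "2 - q"] by simp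
   then show ?thesis using xpos t by (simp add: powr_divide)
  qed
  finally have "(t * 2 ^ j) powr (2 - q) \<le> x powr (2 - q) * \<eta> powr (q - 2) * \<theta> ^ i" using \<theta> by (simp add: mult_right_mono)
  then have "F j \<le> a ^ J * ((x powr (2 - q) * \<eta> powr (q - 2) * \<theta> ^ i) * x powr q)"
   unfolding F_def using aj a by (intro mult_mono mult_right_mono) auto
  also have "\<dots> = a ^ J * (\<eta> powr (q - 2) * (x powr (2 - q) * x powr q)) * \<theta> ^ i" by (simp only: mult_ac)
  also have "x powr (2 - q) * x powr q = x^2" using xpos by (simp add: powr_add[symmetric] powr_numeral)
  finally show "F j \<le> a ^ J * (\<eta> powr (q - 2) * x^2) * \<theta> ^ (J - j)" by (simp only: i_def)
 qed
 also have "\<dots> = a ^ J * (\<eta> powr (q - 2) * x^2) * (\<Sum>j<Suc J. \<theta> ^ (J - j))" by (simp only: sum_distrib_left)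
 also have "(\<Sum>j<Suc J. \<theta> ^ (J - j)) = (\<Sum>j<Suc J. \<theta> ^ j)"
  using sum.nat_diff_reindex[of "\<lambda>j. \<theta> ^ j" "Suc J"] by simp
 also have "\<dots> \<le> 1 / (1 - \<theta>)"
 proof -
  have "(1 - \<theta>) * (\<Sum>j<Suc J. \<theta> ^ j) = 1 - \<theta> ^ Suc J" using geometric_powers[of \<theta> "Suc J"] by (simp only: left_diff_distrib)
  then have "(1 - \<theta>) * (\<Sum>j<Suc J. \<theta> ^ j) \<le> 1" using \<theta> by simp
  then show ?thesis using \<theta> by (simp add: field_simps del: sum.lessThan_Suc)
 qed
 also have "a ^ J * (\<eta> powr (q - 2) * x^2) * (1 / (1 - \<theta>)) \<le> (2 ^ l * ((a - 1) * levels a (\<kappa> * t) m x + 1)) * (\<eta> powr (q - 2) * x^2) * (1 / (1 - \<theta>))"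
  using J \<theta> by (intro mult_right_mono power_le_levels[OF a t l J(1)]) (auto simp: mult.assoc)
 also have "\<dots> = (\<eta> powr (q - 2) / (1 - \<theta>) * 2 ^ l) * (x^2 * ((a - 1) * levels a (\<kappa> * t) m x + 1))" by simp
 finally show ?thesis using a t \<theta> unfolding \<theta>_def by (simp add: mult_left_mono)
qed

lemma weighted_levels_2:
 fixes a t \<eta> x \<epsilon> :: real
 assumes a: "1 < a" "a \<le> 2" "a = 2 powr \<epsilon>" and \<epsilon>: "\<epsilon> > 0" and t: "t > 0" "\<eta> > 0" and x: "x \<ge> 0"
 shows "(a - 1) * (\<Sum>j<m. a ^ j * (if \<eta> * (t * 2 ^ j) < x then x powr 2 else 0)) \<le> 2 * (\<eta> * t) powr (- \<epsilon>) * x powr (2 + \<epsilon>)"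
proof (cases "\<exists>j<m. \<eta> * (t * 2 ^ j) < x")
 case False
 then have "(\<Sum>j<m. a ^ j * (if \<eta> * (t * 2 ^ j) < x then x powr 2 else 0)) = 0" by (intro sum.neutral) auto
 then show ?thesis by simp
next
 case True
 define F where "F j = a ^ j * x powr 2" for j :: nat
 have F0: "0 \<le> F j" for j using a by (simp add: F_def)
 obtain J where J: "J < m" "\<eta> * (t * 2 ^ J) < x" "(\<Sum>j<m. if \<eta> * (t * 2 ^ j) < x then F j else 0) \<le> (\<Sum>j<Suc J. F j)"
  using sum_le_Max_prefix[where a=F, OF F0 True] by (elim exE conjE) (rule that)
 have et: "\<eta> * t > 0" using t by simp
 have "(\<Sum>j<m. a ^ j * (if \<eta> * (t * 2 ^ j) < x then x powr 2 else 0)) = (\<Sum>j<m. if \<eta> * (t * 2 ^ j) < x then F j else 0)"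
  by (intro sum.cong) (auto simp: F_def)
 also have "\<dots> \<le> (\<Sum>j<Suc J. a ^ j) * x powr 2" using J(3) by (simp only: F_def sum_distrib_right)
 finally have "(a - 1) * (\<Sum>j<m. a ^ j * (if \<eta> * (t * 2 ^ j) < x then x powr 2 else 0)) \<le> (a - 1) * ((\<Sum>j<Suc J. a ^ j) * x powr 2)"
  using a by (intro mult_left_mono) auto
 also have "\<dots> = (a ^ Suc J - 1) * x powr 2" unfolding mult.assoc[symmetric] geometric_powers ..
 also have "\<dots> \<le> (2 * a ^ J) * x powr 2"
 proof (rule mult_right_mono)
  have "a * a ^ J \<le> 2 * a ^ J" using a by (intro mult_right_mono) auto
  then show "a ^ Suc J - 1 \<le> 2 * a ^ J" by simp
 qed simp
 also have "\<dots> \<le> (2 * (x / (\<eta> * t)) powr \<epsilon>) * x powr 2"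
 proof -
  have "a ^ J = (2 ^ J) powr \<epsilon>" by (simp only: a(3) power_powr_swap)
  also have "\<dots> \<le> (x / (\<eta> * t)) powr \<epsilon>" using J(2) et \<epsilon> by (intro powr_mono2) (auto simp: field_simps)
  finally show ?thesis by (intro mult_right_mono) auto
 qed
 also have "(x / (\<eta> * t)) powr \<epsilon> = (\<eta> * t) powr (- \<epsilon>) * x powr \<epsilon>" using x et by (simp add: powr_divide powr_minus_divide)
 finally show ?thesis by (simp add: powr_add mult_ac)
qed

lemma powr_le_one_plus: "0 < \<epsilon> ==> \<epsilon> \<le> 1 ==> x > 0 ==> x powr \<epsilon> \<le> 1 + (x::real)"
proof -
 assume a: "0 < \<epsilon>" "\<epsilon> \<le> 1" "x > 0"
 show ?thesis
 proof (cases "x \<le> 1")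
  case True
  then have "x powr \<epsilon> \<le> 1 powr \<epsilon>" using a by (intro powr_mono2) auto
  then show ?thesis using a by simp
 next
  case False
  then have "x powr \<epsilon> \<le> x powr 1" using a by (intro powr_mono) auto
  then show ?thesis using a by simp
 qed
qed

text \<open>
  The bound \<open>2^\<epsilon> - 1 \<le> \<epsilon>\<close> is Bernoulli's inequality for the exponent \<open>1/\<epsilon>\<close>.  It makes the coefficient
  of the term to be absorbed proportional to \<open>\<epsilon>\<close>.
\<close>

lemma two_powr_bound:
 assumes "0 < \<epsilon>" "\<epsilon> \<le> 1" shows "1 < 2 powr \<epsilon>" "2 powr \<epsilon> \<le> 2" "2 powr \<epsilon> - 1 \<le> (\<epsilon>::real)"
proof -
 show "1 < 2 powr \<epsilon>" using assms by simp
 have "2 powr \<epsilon> \<le> 2 powr (1::real)" using assms by (intro powr_mono) auto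
 then show "2 powr \<epsilon> \<le> 2" by simp
 have "1 powr (1 / \<epsilon>) + 1 / \<epsilon> * 1 powr (1 / \<epsilon> - 1) * ((1 + \<epsilon>) - 1) \<le> (1 + \<epsilon>) powr (1 / \<epsilon>)"
  by (rule powr_tangent) (use assms in auto)
 then have "2 \<le> (1 + \<epsilon>) powr (1 / \<epsilon>)" using assms by simp
 then have "2 powr \<epsilon> \<le> ((1 + \<epsilon>) powr (1 / \<epsilon>)) powr \<epsilon>" using assms by (intro powr_mono2) auto
 then show "2 powr \<epsilon> - 1 \<le> \<epsilon>" using assms by (simp add: powr_powr)
qed

text \<open>
  Multiply the estimate at level \<open>t * 2^j\<close> by \<open>a^j\<close> with \<open>a = 2^\<epsilon>\<close> and add over \<open>j < m\<close>.  After
  multiplication by \<open>a - 1\<close> the left side is about the integral of \<open>h\<^sup>2 * min ((h/t)^\<epsilon>) (a^m)\<close>, and the first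
  term on the right is the same integral times a constant multiple of \<open>\<epsilon>\<close>.  It is finite and can be
  absorbed if \<open>\<epsilon>\<close> is small; then \<open>m\<close> tends to infinity.
\<close>

lemma higher_integrability_from_levels:
 assumes q: "0 < q" "q < 2" and pos: "\<kappa> > 0" "\<eta> > 0" "C' > 0"
 shows "\<exists>\<epsilon>0 C2. 0 < \<epsilon>0 \<and> \<epsilon>0 < 1 \<and> C2 > 0 \<and> (\<forall>\<epsilon> (h :: 'a::euclidean_space => real) (f :: 'a => real) t.
  0 < \<epsilon> --> \<epsilon> < \<epsilon>0 --> L2b h --> (\<forall>w. 0 \<le> h w) --> L2b f --> (\<forall>w. 0 \<le> f w) --> t > 0 -->
  (\<forall>lam\<ge>t. integral\<^sup>L lborel (trunc_pow 2 (\<kappa> * lam) h) \<le>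
   C' * (lam powr (2 - q) * integral\<^sup>L lborel (trunc_pow q (\<eta> * lam) h) + integral\<^sup>L lborel (trunc_pow 2 (\<eta> * lam) f))) -->
  integrable lborel (\<lambda>w. f w powr (2 + \<epsilon>)) -->
  integrable lborel (\<lambda>w. h w powr (2 + \<epsilon>)) \<and>
  (LBINT w. h w powr (2 + \<epsilon>)) \<le> C2 * (t powr \<epsilon> * (LBINT w. (h w)^2) + (LBINT w. f w powr (2 + \<epsilon>))))"
proof -
 obtain l :: nat where l: "\<kappa> \<le> \<eta> * 2 ^ l"
 proof -
  obtain l :: nat where "\<kappa> / \<eta> < 2 ^ l" using real_arch_pow[of 2 "\<kappa> / \<eta>"] by auto
  then show ?thesis using pos by (intro that[of l]) (simp add: field_simps)
 qed
 define c1 where "c1 = \<eta> powr (q - 2) / (1 - 2 powr (q - 2)) * 2 ^ l"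
 have "2 powr (q - 2) < (1::real)" using q by (simp add: powr_less_one)
 then have c1: "c1 > 0" using pos by (simp add: c1_def)
 \<comment> \<open>Since \<open>a - 1 \<le> \<epsilon>\<close>, the second entry makes the absorbed coefficient at most one half.\<close>
 define \<epsilon>0 where "\<epsilon>0 = min (1/2) (1 / (2 * C' * c1))"
 have \<epsilon>0: "0 < \<epsilon>0" "\<epsilon>0 < 1" using pos c1 by (auto simp: \<epsilon>0_def)
 define C2 where "C2 = 2 * (1 + \<kappa>) + 4 * C' * (1 + \<kappa> / \<eta>)"
 have C2: "C2 > 0" unfolding C2_def using pos by (intro add_pos_pos mult_pos_pos) auto
 have main: "integrable lborel (\<lambda>w. h w powr (2 + \<epsilon>)) \<and>
  (LBINT w. h w powr (2 + \<epsilon>)) \<le> C2 * (t powr \<epsilon> * (LBINT w. (h w)^2) + (LBINT w. f w powr (2 + \<epsilon>)))"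
  if \<epsilon>: "0 < \<epsilon>" "\<epsilon> < \<epsilon>0" and h: "L2b h" "\<And>w. 0 \<le> h w" and f: "L2b f" "\<And>w. 0 \<le> f w" and t: "t > 0"
   and est: "\<And>lam. lam \<ge> t ==> integral\<^sup>L lborel (trunc_pow 2 (\<kappa> * lam) h) \<le>
   C' * (lam powr (2 - q) * integral\<^sup>L lborel (trunc_pow q (\<eta> * lam) h) + integral\<^sup>L lborel (trunc_pow 2 (\<eta> * lam) f))"
   and fi: "integrable lborel (\<lambda>w. f w powr (2 + \<epsilon>))"
  for \<epsilon> t :: real and h f :: "'a => real"
 proof -
  define a where "a = 2 powr \<epsilon>"
  have e1: "\<epsilon> \<le> 1" using \<epsilon> \<epsilon>0 by linarith
  have a: "1 < a" "a \<le> 2" "a - 1 \<le> \<epsilon>" using two_powr_bound[OF \<epsilon>(1) e1] by (auto simp: a_def)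
  have small: "C' * ((a - 1) * c1) \<le> 1/2"
  proof -
   have "a - 1 \<le> 1 / (2 * C' * c1)" using a(3) \<epsilon>(2) by (simp add: \<epsilon>0_def)
   then have "(C' * c1) * (a - 1) \<le> (C' * c1) * (1 / (2 * C' * c1))" using pos c1 by (intro mult_left_mono) auto
   then show ?thesis using pos c1 by (simp add: mult_ac)
  qed
  note [measurable] = L2b_measurable[OF h(1)] L2b_measurable[OF f(1)]
  define H2 where "H2 = (LBINT w. (h w)^2)"
  define FF where "FF = (LBINT w. f w powr (2 + \<epsilon>))"
  have ih2: "integrable lborel (\<lambda>w. (h w)^2)" using h by (simp add: L2b_def)
  have itq: "integrable lborel (trunc_pow q s h)" for s by (rule trunc_pow_integrable[OF h]) (use q in auto)
  have it2: "integrable lborel (trunc_pow 2 s h)" for s by (rule trunc_pow_integrable[OF h]) auto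
  have itf: "integrable lborel (trunc_pow 2 s f)" for s by (rule trunc_pow_integrable[OF f]) auto
  define RR where "RR = 2 * H2 + 4 * C' * ((\<eta> * t) powr (- \<epsilon>) * FF)"
  have bound: "(LBINT w. (h w)^2 * min ((h w / (\<kappa> * t)) powr \<epsilon>) (a ^ m)) \<le> RR" (is ?B)
   and ibm: "integrable lborel (\<lambda>w. (h w)^2 * min ((h w / (\<kappa> * t)) powr \<epsilon>) (a ^ m))" (is ?I) for m
  proof -
   let ?S = "\<lambda>x. (a - 1) * levels a (\<kappa> * t) m x + 1"
   have kt: "\<kappa> * t > 0" using pos t by simp
   have pt: "(h w)^2 * ?S (h w) = (h w)^2 + (a - 1) * (\<Sum>j<m. a ^ j * trunc_pow 2 (\<kappa> * (t * 2 ^ j)) h w)" for w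
   proof -
    have "(h w)^2 * levels a (\<kappa> * t) m (h w) = (\<Sum>j<m. a ^ j * trunc_pow 2 (\<kappa> * (t * 2 ^ j)) h w)"
     unfolding levels_def sum_distrib_left
     by (intro sum.cong refl) (use h(2)[of w] in \<open>auto simp: trunc_pow_def powr_numeral mult.assoc\<close>)
    then show ?thesis by (simp add: distrib_left mult.left_commute[of "(h w)^2"])
   qed
   have iX: "integrable lborel (\<lambda>w. (h w)^2 * ?S (h w))"
    unfolding pt using ih2 it2 by (intro Bochner_Integration.integrable_add integrable_mult_right Bochner_Integration.integrable_sum)
   define X where "X = (LBINT w. (h w)^2 * ?S (h w))"
   have mb: "(\<lambda>w. (h w)^2 * min ((h w / (\<kappa> * t)) powr \<epsilon>) (a ^ m)) \<in> borel_measurable lborel" by measurable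
   have ptl: "(h w)^2 * min ((h w / (\<kappa> * t)) powr \<epsilon>) (a ^ m) \<le> (h w)^2 * ?S (h w)" for w
    by (intro mult_left_mono levels_lower[OF a(1) a_def \<epsilon>(1) kt h(2)]) auto
   have nn: "0 \<le> (h w)^2 * min ((h w / (\<kappa> * t)) powr \<epsilon>) (a ^ m)" for w using a by auto
   show I: ?I
    by (rule Bochner_Integration.integrable_bound[OF iX mb], rule AE_I2) (use ptl nn in \<open>simp add: order_trans[OF ptl abs_ge_self]\<close>)
   have Xeq: "X = H2 + (a - 1) * (\<Sum>j<m. a ^ j * integral\<^sup>L lborel (trunc_pow 2 (\<kappa> * (t * 2 ^ j)) h))"
   proof -
    have s: "integrable lborel (\<lambda>w. \<Sum>j<m. a ^ j * trunc_pow 2 (\<kappa> * (t * 2 ^ j)) h w)"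
     by (intro integrable_mult_right Bochner_Integration.integrable_sum it2)
    have "(LBINT w. (\<Sum>j<m. a ^ j * trunc_pow 2 (\<kappa> * (t * 2 ^ j)) h w)) = (\<Sum>j<m. a ^ j * integral\<^sup>L lborel (trunc_pow 2 (\<kappa> * (t * 2 ^ j)) h))"
     using it2 by (subst Bochner_Integration.integral_sum) auto
    then show ?thesis unfolding X_def pt H2_def
     using Bochner_Integration.integral_add[OF ih2 integrable_mult_right[OF s, of "a - 1"]] by simp
   qed
   have "(\<Sum>j<m. a ^ j * integral\<^sup>L lborel (trunc_pow 2 (\<kappa> * (t * 2 ^ j)) h)) \<le>
    (\<Sum>j<m. a ^ j * (C' * ((t * 2 ^ j) powr (2 - q) * integral\<^sup>L lborel (trunc_pow q (\<eta> * (t * 2 ^ j)) h) + integral\<^sup>L lborel (trunc_pow 2 (\<eta> * (t * 2 ^ j)) f))))"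
   proof (intro sum_mono mult_left_mono est)
    fix j :: nat show "t \<le> t * 2 ^ j" using t by simp
    show "0 \<le> a ^ j" using a by simp
   qed
   also have "\<dots> = C' * ((LBINT w. (\<Sum>j<m. a ^ j * ((t * 2 ^ j) powr (2 - q) * trunc_pow q (\<eta> * (t * 2 ^ j)) h w)))
     + (LBINT w. (\<Sum>j<m. a ^ j * trunc_pow 2 (\<eta> * (t * 2 ^ j)) f w)))"
   proof -
    have "(LBINT w. (\<Sum>j<m. a ^ j * ((t * 2 ^ j) powr (2 - q) * trunc_pow q (\<eta> * (t * 2 ^ j)) h w)))
     = (\<Sum>j<m. a ^ j * ((t * 2 ^ j) powr (2 - q) * integral\<^sup>L lborel (trunc_pow q (\<eta> * (t * 2 ^ j)) h)))"
     using itq by (subst Bochner_Integration.integral_sum) auto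
    moreover have "(LBINT w. (\<Sum>j<m. a ^ j * trunc_pow 2 (\<eta> * (t * 2 ^ j)) f w))
     = (\<Sum>j<m. a ^ j * integral\<^sup>L lborel (trunc_pow 2 (\<eta> * (t * 2 ^ j)) f))"
     using itf by (subst Bochner_Integration.integral_sum) auto
    moreover have "(\<Sum>j<m. a ^ j * (C' * (A j + B j))) = C' * ((\<Sum>j<m. a ^ j * A j) + (\<Sum>j<m. a ^ j * B j))" for A B :: "nat => real"
    proof -
     have "a ^ j * (C' * (A j + B j)) = C' * (a ^ j * A j + a ^ j * B j)" for j by (simp add: algebra_simps)
     then show ?thesis by (simp only: sum_distrib_left[symmetric] sum.distrib)
    qed
    ultimately show ?thesis by (simp only:)
   qed
   finally have Sle: "(\<Sum>j<m. a ^ j * integral\<^sup>L lborel (trunc_pow 2 (\<kappa> * (t * 2 ^ j)) h)) \<le> C' * ((LBINT w. (\<Sum>j<m. a ^ j * ((t * 2 ^ j) powr (2 - q) * trunc_pow q (\<eta> * (t * 2 ^ j)) h w)))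
     + (LBINT w. (\<Sum>j<m. a ^ j * trunc_pow 2 (\<eta> * (t * 2 ^ j)) f w)))" .
   have Xle: "X \<le> H2 + (a - 1) * (C' * ((LBINT w. (\<Sum>j<m. a ^ j * ((t * 2 ^ j) powr (2 - q) * trunc_pow q (\<eta> * (t * 2 ^ j)) h w)))
     + (LBINT w. (\<Sum>j<m. a ^ j * trunc_pow 2 (\<eta> * (t * 2 ^ j)) f w))))"
    unfolding Xeq by (intro add_left_mono mult_left_mono Sle) (use a in simp)
   have p1: "(LBINT w. (\<Sum>j<m. a ^ j * ((t * 2 ^ j) powr (2 - q) * trunc_pow q (\<eta> * (t * 2 ^ j)) h w))) \<le> (LBINT w. c1 * ((h w)^2 * ?S (h w)))"
   proof (rule integral_mono)
    show "integrable lborel (\<lambda>w. \<Sum>j<m. a ^ j * ((t * 2 ^ j) powr (2 - q) * trunc_pow q (\<eta> * (t * 2 ^ j)) h w))"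
     by (intro integrable_mult_right Bochner_Integration.integrable_sum itq)
    show "integrable lborel (\<lambda>w. c1 * ((h w)^2 * ?S (h w)))" using iX by (rule integrable_mult_right)
    show "(\<Sum>j<m. a ^ j * ((t * 2 ^ j) powr (2 - q) * trunc_pow q (\<eta> * (t * 2 ^ j)) h w)) \<le> c1 * ((h w)^2 * ?S (h w))" for w
     unfolding trunc_pow_def c1_def by (rule weighted_levels_q[OF q a(1,2) t pos(1,2) l h(2)])
   qed
   have p2: "(a - 1) * (LBINT w. (\<Sum>j<m. a ^ j * trunc_pow 2 (\<eta> * (t * 2 ^ j)) f w)) \<le> 2 * ((\<eta> * t) powr (- \<epsilon>) * FF)"
   proof -
    have "(a - 1) * (LBINT w. (\<Sum>j<m. a ^ j * trunc_pow 2 (\<eta> * (t * 2 ^ j)) f w)) = (LBINT w. (a - 1) * (\<Sum>j<m. a ^ j * trunc_pow 2 (\<eta> * (t * 2 ^ j)) f w))" by simp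
    also have "\<dots> \<le> (LBINT w. 2 * (\<eta> * t) powr (- \<epsilon>) * f w powr (2 + \<epsilon>))"
    proof (rule integral_mono)
     show "integrable lborel (\<lambda>w. (a - 1) * (\<Sum>j<m. a ^ j * trunc_pow 2 (\<eta> * (t * 2 ^ j)) f w))"
      by (intro integrable_mult_right Bochner_Integration.integrable_sum itf)
     show "(a - 1) * (\<Sum>j<m. a ^ j * trunc_pow 2 (\<eta> * (t * 2 ^ j)) f w) \<le> 2 * (\<eta> * t) powr (- \<epsilon>) * f w powr (2 + \<epsilon>)" for w
      unfolding trunc_pow_def by (rule weighted_levels_2[OF a(1,2) a_def \<epsilon>(1) t pos(2) f(2)])
    qed (use fi in simp)
    also have "\<dots> = 2 * ((\<eta> * t) powr (- \<epsilon>) * FF)" by (simp add: FF_def)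
    finally show ?thesis .
   qed
   define U where "U = (LBINT w. (\<Sum>j<m. a ^ j * ((t * 2 ^ j) powr (2 - q) * trunc_pow q (\<eta> * (t * 2 ^ j)) h w)))"
   define U2 where "U2 = (LBINT w. (\<Sum>j<m. a ^ j * trunc_pow 2 (\<eta> * (t * 2 ^ j)) f w))"
   have X0: "X \<ge> 0" unfolding X_def
    by (intro Bochner_Integration.integral_nonneg) (use order_trans[OF nn ptl] in auto)
   have "X \<le> H2 + C' * ((a - 1) * U) + C' * ((a - 1) * U2)"
    using Xle unfolding U_def[symmetric] U2_def[symmetric] by (simp add: algebra_simps)
   moreover have "C' * ((a - 1) * U) \<le> C' * ((a - 1) * (c1 * X))"
    using p1 a pos unfolding U_def[symmetric] X_def by (intro mult_left_mono) auto
   moreover have "C' * ((a - 1) * (c1 * X)) = (C' * ((a - 1) * c1)) * X" by simp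
   moreover have "(C' * ((a - 1) * c1)) * X \<le> 1/2 * X" by (rule mult_right_mono[OF small X0])
   moreover have "C' * ((a - 1) * U2) \<le> C' * (2 * ((\<eta> * t) powr (- \<epsilon>) * FF))"
    using p2 pos unfolding U2_def by (intro mult_left_mono) auto
   ultimately have "X \<le> 2 * H2 + 2 * (C' * (2 * ((\<eta> * t) powr (- \<epsilon>) * FF)))" by linarith
   then have "X \<le> RR" by (simp add: RR_def)
   moreover have "(LBINT w. (h w)^2 * min ((h w / (\<kappa> * t)) powr \<epsilon>) (a ^ m)) \<le> X"
    unfolding X_def by (rule integral_mono[OF I iX ptl])
   ultimately show ?B by linarith
  qed
  let ?u = "\<lambda>m w. (h w)^2 * min ((h w / (\<kappa> * t)) powr \<epsilon>) (a ^ m)"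
  let ?v = "\<lambda>w. (h w)^2 * (h w / (\<kappa> * t)) powr \<epsilon>"
  have mono: "mono (\<lambda>m. ?u m w)" for w
   by (rule monoI, intro mult_left_mono min.mono order_refl power_increasing) (use a in auto)
  have inc: "incseq (\<lambda>m. integral\<^sup>L lborel (?u m))"
   by (rule incseq_SucI, rule integral_mono[OF ibm ibm], rule monoD[OF mono]) simp
  obtain Lm where Lm: "(\<lambda>m. integral\<^sup>L lborel (?u m)) \<longlonglongrightarrow> Lm"
   using incseq_convergent[OF inc] bound by blast
  have lim: "(\<lambda>m. ?u m w) \<longlonglongrightarrow> ?v w" for w
  proof (rule tendsto_eventually)
   obtain k where k: "(h w / (\<kappa> * t)) powr \<epsilon> < a ^ k" using real_arch_pow[OF a(1)] by blast
   show "\<forall>\<^sub>F m in sequentially. ?u m w = ?v w"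
   proof (rule eventually_mono[OF eventually_ge_at_top[of k]])
    fix m assume "k \<le> m"
    then have "a ^ k \<le> a ^ m" using a by (intro power_increasing) auto
    then show "?u m w = ?v w" using k by (simp add: min_def)
   qed
  qed
  have vm: "?v \<in> borel_measurable lborel" by measurable
  have iv: "integrable lborel ?v" and Lv: "integral\<^sup>L lborel ?v = Lm"
   using integrable_monotone_convergence[OF ibm _ _ Lm vm] integral_monotone_convergence[OF ibm _ _ Lm vm] mono lim by auto
  have vR: "integral\<^sup>L lborel ?v \<le> RR" unfolding Lv by (rule LIMSEQ_le_const2[OF Lm]) (use bound in auto)
  have kt: "\<kappa> * t > 0" using pos t by simp
  have eq: "h w powr (2 + \<epsilon>) = (\<kappa> * t) powr \<epsilon> * ?v w" for w
   using h(2)[of w] kt by (cases "h w = 0") (auto simp: powr_add powr_divide powr_numeral)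
  have 1: "integrable lborel (\<lambda>w. h w powr (2 + \<epsilon>))" unfolding eq using iv by simp
  have "(LBINT w. h w powr (2 + \<epsilon>)) = (\<kappa> * t) powr \<epsilon> * integral\<^sup>L lborel ?v" unfolding eq by simp
  also have "\<dots> \<le> (\<kappa> * t) powr \<epsilon> * RR" by (rule mult_left_mono[OF vR]) simp
  also have "\<dots> = 2 * \<kappa> powr \<epsilon> * (t powr \<epsilon> * H2) + 4 * C' * (\<kappa> / \<eta>) powr \<epsilon> * FF"
  proof -
   have "(\<kappa> * t) powr \<epsilon> * (\<eta> * t) powr (- \<epsilon>) = (\<kappa> / \<eta>) powr \<epsilon>"
    using pos t by (simp add: powr_mult powr_divide powr_minus_divide)
   moreover have "(\<kappa> * t) powr \<epsilon> = \<kappa> powr \<epsilon> * t powr \<epsilon>" by (rule powr_mult)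
   ultimately have "(\<kappa> * t) powr \<epsilon> * (2 * H2) = 2 * \<kappa> powr \<epsilon> * (t powr \<epsilon> * H2)"
    "(\<kappa> * t) powr \<epsilon> * (4 * C' * ((\<eta> * t) powr (- \<epsilon>) * FF)) = 4 * C' * (\<kappa> / \<eta>) powr \<epsilon> * FF"
    by (simp, metis mult.assoc mult.left_commute)
   then show ?thesis unfolding RR_def by (simp only: distrib_left)
  qed
  also have "\<dots> \<le> 2 * (1 + \<kappa>) * (t powr \<epsilon> * H2) + 4 * C' * (1 + \<kappa> / \<eta>) * FF"
  proof (rule add_mono)
   have H20: "0 \<le> t powr \<epsilon> * H2" by (simp add: H2_def)
   have FF0: "0 \<le> FF" by (simp add: FF_def)
   show "2 * \<kappa> powr \<epsilon> * (t powr \<epsilon> * H2) \<le> 2 * (1 + \<kappa>) * (t powr \<epsilon> * H2)"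
    using powr_le_one_plus[OF \<epsilon>(1) e1 pos(1)] H20 by (intro mult_right_mono) auto
   show "4 * C' * (\<kappa> / \<eta>) powr \<epsilon> * FF \<le> 4 * C' * (1 + \<kappa> / \<eta>) * FF"
    using powr_le_one_plus[OF \<epsilon>(1) e1, of "\<kappa> / \<eta>"] pos FF0 by (intro mult_right_mono mult_left_mono) auto
  qed
  also have "\<dots> \<le> C2 * (t powr \<epsilon> * H2) + C2 * FF"
  proof (intro add_mono mult_right_mono)
   have "0 \<le> \<kappa> / \<eta>" using pos by simp
   then show "2 * (1 + \<kappa>) \<le> C2" "4 * C' * (1 + \<kappa> / \<eta>) \<le> C2" using pos by (auto simp: C2_def)
  qed (auto simp: H2_def FF_def)
  finally show ?thesis using 1 by (simp add: H2_def FF_def distrib_left)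
 qed
 show ?thesis
 proof (rule exI[of _ \<epsilon>0], rule exI[of _ C2], rule conjI[OF \<epsilon>0(1)], rule conjI[OF \<epsilon>0(2)], rule conjI[OF C2], intro allI impI)
  fix \<epsilon> t :: real and h f :: "'a => real"
  assume a: "0 < \<epsilon>" "\<epsilon> < \<epsilon>0" "L2b h" and h: "\<forall>w. 0 \<le> h w" and f: "L2b f" "\<forall>w. 0 \<le> f w" and t: "t > 0"
   and e: "\<forall>lam\<ge>t. integral\<^sup>L lborel (trunc_pow 2 (\<kappa> * lam) h) \<le>
   C' * (lam powr (2 - q) * integral\<^sup>L lborel (trunc_pow q (\<eta> * lam) h) + integral\<^sup>L lborel (trunc_pow 2 (\<eta> * lam) f))"
   and i: "integrable lborel (\<lambda>w. f w powr (2 + \<epsilon>))"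
  show "integrable lborel (\<lambda>w. h w powr (2 + \<epsilon>)) \<and>
  (LBINT w. h w powr (2 + \<epsilon>)) \<le> C2 * (t powr \<epsilon> * (LBINT w. (h w)^2) + (LBINT w. f w powr (2 + \<epsilon>)))"
   by (rule main[OF a h[rule_format] f(1) f(2)[rule_format] t e[rule_format] i])
 qed
qed

section \<open>Gehring's lemma on parabolic cylinders\<close>

text \<open>
  The parabolic distance of \<open>z\<close> to the boundary of the cylinder, up to constants: a cylinder of this radius
  around \<open>z\<close> is contained in the given one.
\<close>

definition pdist :: "(real ^ 'n) \<times> real => real => (real ^ 'n) \<times> real => real" where
 "pdist z0 r z = min (r - norm (fst z - fst z0)) (sqrt (r^2 - \<bar>snd z - snd z0\<bar>))"

lemma pdist_bounds:
 assumes "z \<in> Q z0 r" "r > 0" shows "0 < pdist z0 r z" "pdist z0 r z \<le> r"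
 using assms by (auto simp: pdist_def mem_Q intro!: min.coboundedI1)

lemma pdist_half:
 assumes "\<rho> > 0" "z \<in> Q z0 \<rho>" shows "\<rho> \<le> pdist z0 (2 * \<rho>) z"
proof -
 have "\<rho>^2 \<le> (2 * \<rho>)^2 - \<bar>snd z - snd z0\<bar>"
  using assms zero_le_power2[of \<rho>] unfolding mem_Q power_mult_distrib by simp linarith
 then have "sqrt (\<rho>^2) \<le> sqrt ((2 * \<rho>)^2 - \<bar>snd z - snd z0\<bar>)" by (rule real_sqrt_le_mono)
 then show ?thesis using assms by (simp add: pdist_def mem_Q)
qed

lemma pdist_lipschitz:
 assumes "w \<in> Q z r" "r > 0" "\<bar>snd z - snd z0\<bar> \<le> R^2" "\<bar>snd w - snd z0\<bar> \<le> R^2"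
 shows "pdist z0 R w \<le> pdist z0 R z + r"
proof -
 have "norm (fst z - fst z0) \<le> norm (fst z - fst w) + norm (fst w - fst z0)"
  using norm_triangle_ineq[of "fst z - fst w" "fst w - fst z0"] by simp
 moreover have "norm (fst z - fst w) < r" using assms(1) by (simp add: mem_Q norm_minus_commute)
 ultimately have 1: "R - norm (fst w - fst z0) \<le> R - norm (fst z - fst z0) + r" by linarith
 have "\<bar>snd w - snd z\<bar> < r^2" using assms(1) by (simp add: mem_Q)
 then have "sqrt (R^2 - \<bar>snd w - snd z0\<bar>) \<le> sqrt ((R^2 - \<bar>snd z - snd z0\<bar>) + r^2)"
  by (intro real_sqrt_le_mono) linarith
 also have "\<dots> \<le> sqrt (R^2 - \<bar>snd z - snd z0\<bar>) + sqrt (r^2)"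
  by (rule sqrt_add_le_add_sqrt) (use assms in auto)
 finally have 2: "sqrt (R^2 - \<bar>snd w - snd z0\<bar>) \<le> sqrt (R^2 - \<bar>snd z - snd z0\<bar>) + r" using assms(2) by simp
 show ?thesis using 1 2 unfolding pdist_def by linarith
qed

lemma Q_pdist_subset:
 assumes z: "z \<in> Q z0 R" and R: "R > 0" and r: "r \<le> pdist z0 R z" "r > 0"
 shows "Q z r \<subseteq> Q z0 R"
proof
 fix w assume w: "w \<in> Q z r"
 have "norm (fst w - fst z0) \<le> norm (fst w - fst z) + norm (fst z - fst z0)"
  using norm_triangle_ineq[of "fst w - fst z" "fst z - fst z0"] by simp
 then have 1: "norm (fst w - fst z0) < R" using w r by (simp add: mem_Q pdist_def)
 have "r^2 \<le> (sqrt (R^2 - \<bar>snd z - snd z0\<bar>))^2" using r by (intro power_mono) (auto simp: pdist_def)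
 also have "\<dots> = R^2 - \<bar>snd z - snd z0\<bar>" using z by (simp add: mem_Q)
 finally have "\<bar>snd w - snd z0\<bar> < R^2" using w unfolding mem_Q by linarith
 with 1 show "w \<in> Q z0 R" by (simp add: mem_Q)
qed

lemma pdist_comparable:
 assumes z: "z \<in> Q z0 R" and R: "R > 0" and r: "r > 0" "2 * r \<le> pdist z0 R z" and w: "w \<in> Q z r"
 shows "w \<in> Q z0 R" "pdist z0 R z \<le> 2 * pdist z0 R w" "pdist z0 R w \<le> 2 * pdist z0 R z"
proof -
 have "Q z r \<subseteq> Q z0 R" by (rule Q_pdist_subset[OF z R]) (use r in auto)
 then show wP: "w \<in> Q z0 R" using w by blast
 have t: "\<bar>snd z - snd z0\<bar> \<le> R^2" "\<bar>snd w - snd z0\<bar> \<le> R^2" using z wP by (auto simp: mem_Q)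
 have 1: "pdist z0 R w \<le> pdist z0 R z + r" by (rule pdist_lipschitz[OF w r(1) t])
 have "z \<in> Q w r" using w Q_sym by blast
 from pdist_lipschitz[OF this r(1) t(2,1)] have 2: "pdist z0 R z \<le> pdist z0 R w + r" .
 show "pdist z0 R z \<le> 2 * pdist z0 R w" "pdist z0 R w \<le> 2 * pdist z0 R z" using 1 2 r by linarith+
qed

lemma sqrt_powr: "x > 0 ==> sqrt x powr (2 + \<epsilon>) = x powr (1 + \<epsilon> / 2)"
 by (simp add: powr_half_sqrt[symmetric] powr_powr add_divide_distrib)

text \<open>
  With \<open>m = n+2\<close> and \<open>d\<close> the distance to the boundary of \<open>Q z0 (2 * \<rho>)\<close>, pass to \<open>h = d^(m/2) g\<close>.  On a
  cylinder of radius below \<open>d/16\<close> the weight is constant up to a factor, so \<open>h\<close> inherits the reverse Hoelder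
  inequality.  On a cylinder of radius comparable to \<open>d\<close>, the weight cancels the volume, and the mean of
  \<open>h\<^sup>2\<close> is at most a constant times the integral of \<open>g\<^sup>2\<close>.  Hence all levels above one fixed level are
  admissible in \<open>level_set_estimate\<close>, up to the boundary.
  On \<open>Q z0 \<rho>\<close> the distance is at least \<open>\<rho>\<close>, so there the weight can be removed.
\<close>

lemma parabolic_gehring:
 fixes C :: real
 assumes C: "C > 0"
 shows "\<exists>\<epsilon>0 c. 0 < \<epsilon>0 \<and> \<epsilon>0 < 1 \<and> c > 0 \<and> (\<forall>(z0 :: (real ^ 'n) \<times> real) \<rho> g f \<epsilon>.
  0 < \<rho> --> 0 < \<epsilon> --> \<epsilon> < \<epsilon>0 --> L2b g --> (\<forall>w. 0 \<le> g w) --> L2b f --> (\<forall>w. 0 \<le> f w) -->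
  (\<forall>w. w \<notin> Q z0 (2 * \<rho>) --> g w = 0) --> (\<forall>w. w \<notin> Q z0 (2 * \<rho>) --> f w = 0) -->
  (\<forall>z r. 0 < r --> Q z (2 * r) \<subseteq> Q z0 (2 * \<rho>) --> mean (Q z r) (\<lambda>w. (g w)^2) \<le>
    C * ((mean (Q z (2 * r)) (\<lambda>w. g w powr qexp TYPE('n))) powr bexp TYPE('n) + mean (Q z (2 * r)) (\<lambda>w. (f w)^2))) -->
  integrable lborel (\<lambda>w. f w powr (2 + \<epsilon>)) -->
  integrable lborel (\<lambda>w. indicator (Q z0 \<rho>) w * g w powr (2 + \<epsilon>)) \<and>
  mean (Q z0 \<rho>) (\<lambda>w. g w powr (2 + \<epsilon>)) \<le>
   c * ((mean (Q z0 (2 * \<rho>)) (\<lambda>w. (g w)^2)) powr (1 + \<epsilon> / 2) + mean (Q z0 (2 * \<rho>)) (\<lambda>w. f w powr (2 + \<epsilon>))))"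
proof -
 define m where "m = CARD('n) + 2"
 define q where "q = qexp TYPE('n)"
 define \<beta> where "\<beta> = bexp TYPE('n)"
 define \<omega> where "\<omega> = omega TYPE('n)"
 have \<omega>: "\<omega> > 0" using omega_pos[where 'n='n] by (simp add: \<omega>_def)
 have q: "1 < q" "q < 2" and \<beta>: "1 < \<beta>" "\<beta> < 2" and q\<beta>: "q * \<beta> = 2"
  using qexp_bounds bexp_bounds qexp_bexp by (auto simp: q_def \<beta>_def)
 have C4: "C * 4 ^ m > 0" using C by simp
 obtain \<kappa> \<eta> C' :: real where pos: "\<kappa> > 0" "\<eta> > 0" "C' > 0" and lev: "\<forall>(h :: (real ^ 'n) \<times> real => real) f P \<delta> lam.
  L2b h --> (\<forall>w. 0 \<le> h w) --> L2b f --> (\<forall>w. 0 \<le> f w) --> (\<forall>w. w \<notin> P --> h w = 0) --> (\<forall>z\<in>P. \<delta> z > 0) --> lam > 0 -->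
  (\<forall>z\<in>P. \<forall>r. 0 < r --> r \<le> \<delta> z --> mean (Q z r) (\<lambda>w. (h w)^2) \<le>
    (C * 4 ^ m) * ((mean (Q z (2 * r)) (\<lambda>w. h w powr qexp TYPE('n))) powr bexp TYPE('n) + mean (Q z (2 * r)) (\<lambda>w. (f w)^2))) -->
  (\<forall>z\<in>P. \<forall>r. \<delta> z \<le> r --> r \<le> 8 * \<delta> z --> mean (Q z r) (\<lambda>w. (h w)^2) \<le> lam^2) -->
  integral\<^sup>L lborel (trunc_pow 2 (\<kappa> * lam) h) \<le>
   C' * (lam powr (2 - qexp TYPE('n)) * integral\<^sup>L lborel (trunc_pow (qexp TYPE('n)) (\<eta> * lam) h) + integral\<^sup>L lborel (trunc_pow 2 (\<eta> * lam) f))"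
  using level_set_estimate[OF C4, where 'n='n] by (elim exE conjE) (rule that)
 have q02: "0 < q" using q by simp
 obtain \<epsilon>0 C2 :: real where \<epsilon>0: "0 < \<epsilon>0" "\<epsilon>0 < 1" and C2: "C2 > 0" and hi: "\<forall>\<epsilon> (h :: (real ^ 'n) \<times> real => real) (f :: (real ^ 'n) \<times> real => real) t.
  0 < \<epsilon> --> \<epsilon> < \<epsilon>0 --> L2b h --> (\<forall>w. 0 \<le> h w) --> L2b f --> (\<forall>w. 0 \<le> f w) --> t > 0 -->
  (\<forall>lam\<ge>t. integral\<^sup>L lborel (trunc_pow 2 (\<kappa> * lam) h) \<le>
   C' * (lam powr (2 - q) * integral\<^sup>L lborel (trunc_pow q (\<eta> * lam) h) + integral\<^sup>L lborel (trunc_pow 2 (\<eta> * lam) f))) -->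
  integrable lborel (\<lambda>w. f w powr (2 + \<epsilon>)) -->
  integrable lborel (\<lambda>w. h w powr (2 + \<epsilon>)) \<and>
  (LBINT w. h w powr (2 + \<epsilon>)) \<le> C2 * (t powr \<epsilon> * (LBINT w. (h w)^2) + (LBINT w. f w powr (2 + \<epsilon>)))"
  using higher_integrability_from_levels[OF q02 q(2) pos, where 'a="(real ^ 'n) \<times> real"] by (elim exE conjE) (rule that)
 \<comment> \<open>If \<open>r \<ge> d/16\<close> then \<open>(2 * d)^m / (\<omega> * r^m) \<le> T0\<close>: the weight over the volume.\<close>
 define T0 where "T0 = 32 ^ m / \<omega>"
 have T0: "T0 > 0" using \<omega> by (simp add: T0_def)
 define c1 where "c1 = C2 * (1 + T0) * 2 ^ m * (1 + 2 ^ m * \<omega>)^2 / \<omega>"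
 define c2 where "c2 = C2 * (2 ^ m)^2 * 2 ^ m"
 define c where "c = c1 + c2"
 have "1 + 2 ^ m * \<omega> > 0" using \<omega> by (intro add_pos_pos mult_pos_pos) auto
 then have c12: "c1 > 0" "c2 > 0" using C2 T0 \<omega> by (auto simp: c1_def c2_def intro!: divide_pos_pos mult_pos_pos add_pos_pos zero_less_power)
 have c: "c > 0" using c12 by (simp add: c_def)
 have main: "integrable lborel (\<lambda>w. indicator (Q z0 \<rho>) w * g w powr (2 + \<epsilon>)) \<and>
  mean (Q z0 \<rho>) (\<lambda>w. g w powr (2 + \<epsilon>)) \<le>
   c * ((mean (Q z0 (2 * \<rho>)) (\<lambda>w. (g w)^2)) powr (1 + \<epsilon> / 2) + mean (Q z0 (2 * \<rho>)) (\<lambda>w. f w powr (2 + \<epsilon>)))"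
  if \<rho>: "0 < \<rho>" and \<epsilon>: "0 < \<epsilon>" "\<epsilon> < \<epsilon>0" and g: "L2b g" "\<And>w. 0 \<le> g w" and f: "L2b f" "\<And>w. 0 \<le> f w"
   and g_out: "\<And>w. w \<notin> Q z0 (2 * \<rho>) ==> g w = 0" and f_out: "\<And>w. w \<notin> Q z0 (2 * \<rho>) ==> f w = 0"
   and RH: "\<And>z r. 0 < r ==> Q z (2 * r) \<subseteq> Q z0 (2 * \<rho>) ==> mean (Q z r) (\<lambda>w. (g w)^2) \<le>
    C * ((mean (Q z (2 * r)) (\<lambda>w. g w powr q)) powr \<beta> + mean (Q z (2 * r)) (\<lambda>w. (f w)^2))"
   and fi: "integrable lborel (\<lambda>w. f w powr (2 + \<epsilon>))"
  for z0 :: "(real ^ 'n) \<times> real" and \<rho> g f \<epsilon>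
 proof -
  define P where "P = Q z0 (2 * \<rho>)"
  define d where "d z = pdist z0 (2 * \<rho>) z" for z
  define p where "p = 1 + \<epsilon> / 2"
  have p: "1 < p" "p \<le> 2" using \<epsilon> \<epsilon>0 by (auto simp: p_def)
  have \<rho>2: "2 * \<rho> > 0" using \<rho> by simp
  have d: "0 < d z" "d z \<le> 2 * \<rho>" if "z \<in> P" for z using pdist_bounds[OF _ \<rho>2, of z z0] that by (auto simp: d_def P_def)
  have comp: "w \<in> P" "d z \<le> 2 * d w" "d w \<le> 2 * d z" if "z \<in> P" "r > 0" "2 * r \<le> d z" "w \<in> Q z r" for z r w
   using pdist_comparable[OF _ \<rho>2, of z z0 r w] that by (auto simp: d_def P_def)
  define wt where "wt w = indicator P w * sqrt (d w ^ m)" for w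
  have wt0: "0 \<le> wt w" for w using d(1)[of w] by (cases "w \<in> P") (auto simp: wt_def)
  have wt2: "(wt w)^2 = d w ^ m" if "w \<in> P" for w using d(1)[OF that] that by (simp add: wt_def)
  have wtle: "wt w \<le> sqrt ((2 * \<rho>) ^ m)" for w
  proof (cases "w \<in> P")
   case True
   have "d w ^ m \<le> (2 * \<rho>) ^ m" using d[OF True] by (intro power_mono) auto
   then show ?thesis using True real_sqrt_le_mono by (simp add: wt_def del: power_mult_distrib)
  qed (use \<rho> in \<open>simp add: wt_def\<close>)
  have "continuous_on UNIV d" unfolding d_def[abs_def] pdist_def[abs_def] by (intro continuous_intros)
  then have [measurable]: "d \<in> borel_measurable borel" by (rule borel_measurable_continuous_onI)
  have PB [measurable]: "P \<in> sets borel" by (simp add: P_def)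
  have bwt: "bounded_borel wt" unfolding bounded_borel_def
  proof (intro conjI exI allI)
   show "wt \<in> borel_measurable borel" unfolding wt_def[abs_def] by measurable
   show "\<bar>wt w\<bar> \<le> sqrt ((2 * \<rho>) ^ m)" for w using wt0 wtle by simp
  qed
  define h where "h w = wt w * g w" for w
  define ft where "ft w = wt w * f w" for w
  have Lh: "L2b h" and Lft: "L2b ft" unfolding h_def[abs_def] ft_def[abs_def] by (intro L2b_bounded_mult bwt g f)+
  have h0: "0 \<le> h w" and ft0: "0 \<le> ft w" for w using wt0 g f by (simp_all add: h_def ft_def)
  have h_out: "h w = 0" if "w \<notin> P" for w using that by (simp add: h_def wt_def)
  have ig2: "integrable lborel (\<lambda>w. (g w)^2)" and if2: "integrable lborel (\<lambda>w. (f w)^2)"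
   and ih2: "integrable lborel (\<lambda>w. (h w)^2)" and ift2: "integrable lborel (\<lambda>w. (ft w)^2)" using g f Lh Lft by (auto simp: L2b_def)
  have igq: "integrable lborel (\<lambda>w. g w powr q)" and ihq: "integrable lborel (\<lambda>w. h w powr q)"
   by (rule L2b_powr_integrable; use g Lh h0 q in auto)+
  define G where "G = (LBINT w. (g w)^2)"
  have G0: "G \<ge> 0" by (simp add: G_def)
  \<comment> \<open>Cylinders of radius up to \<open>8 * \<delta> z = d z / 2\<close> stay where the weight is comparable to its value at \<open>z\<close>.\<close>
  define \<delta> where "\<delta> z = d z / 16" for z
  have mean_cmult: "mean S (\<lambda>w. k * u w) = k * mean S u" for S k and u :: "(real ^ 'n) \<times> real => real"
   by (simp add: mean_def SI_def mult.left_commute[of "indicator _ _"])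
  have up: "mean (Q z r) (\<lambda>w. (h w)^2) \<le> 2 ^ m * d z ^ m * mean (Q z r) (\<lambda>w. (g w)^2)" if z: "z \<in> P" "r > 0" "2 * r \<le> d z" for z r
   unfolding mean_cmult[symmetric]
  proof (rule mean_mono[OF Q_borel ih2])
   show "integrable lborel (\<lambda>w. 2 ^ m * d z ^ m * (g w)^2)" using ig2 by simp
   fix w assume w: "w \<in> Q z r"
   have "d w ^ m \<le> (2 * d z) ^ m" using comp[OF z w] d(1) by (intro power_mono) (auto simp: less_imp_le)
   then have "(wt w)^2 \<le> 2 ^ m * d z ^ m" using wt2[OF comp(1)[OF z w]] by (simp add: power_mult_distrib)
   then show "(h w)^2 \<le> 2 ^ m * d z ^ m * (g w)^2" unfolding h_def power_mult_distrib by (rule mult_right_mono) simp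
  qed
  have H1: "mean (Q z r) (\<lambda>w. (h w)^2) \<le> (C * 4 ^ m) * ((mean (Q z (2 * r)) (\<lambda>w. h w powr q)) powr \<beta> + mean (Q z (2 * r)) (\<lambda>w. (ft w)^2))"
   if z: "z \<in> P" and r: "0 < r" "r \<le> \<delta> z" for z r
  proof -
   have r2: "2 * r > 0" "2 * (2 * r) \<le> d z" "2 * r \<le> d z" using r d(1)[OF z] by (auto simp: \<delta>_def)
   have sub: "Q z (2 * r) \<subseteq> Q z0 (2 * \<rho>)" using comp(1)[OF z r2(1,2)] by (auto simp: P_def)
   define k where "k = d z ^ m / 2 ^ m"
   have k: "k > 0" using d(1)[OF z] by (simp add: k_def)
   have wk: "sqrt k \<le> wt w" "k \<le> (wt w)^2" if w: "w \<in> Q z (2 * r)" for w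
   proof -
    have "(d z) ^ m \<le> (2 * d w) ^ m" using comp[OF z r2(1,2) w] d(1)[OF z] by (intro power_mono) auto
    then have "k \<le> d w ^ m" by (simp add: k_def power_mult_distrib divide_le_eq mult.commute)
    then show "k \<le> (wt w)^2" using wt2[OF comp(1)[OF z r2(1,2) w]] by simp
    then have "sqrt k \<le> sqrt ((wt w)^2)" by (rule real_sqrt_le_mono)
    then show "sqrt k \<le> wt w" using wt0[of w] by simp
   qed
   define X where "X = mean (Q z (2 * r)) (\<lambda>w. g w powr q)"
   have X0: "X \<ge> 0" unfolding X_def by (rule mean_nonneg) simp
   have "sqrt k powr q * X \<le> mean (Q z (2 * r)) (\<lambda>w. h w powr q)"
    unfolding X_def mean_cmult[symmetric]
   proof (rule mean_mono[OF Q_borel _ ihq])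
    show "integrable lborel (\<lambda>w. sqrt k powr q * g w powr q)" using igq by simp
    fix w assume w: "w \<in> Q z (2 * r)"
    have "(sqrt k * g w) powr q \<le> h w powr q"
     unfolding h_def using wk(1)[OF w] g(2)[of w] k q by (intro powr_mono2 mult_right_mono) auto
    then show "sqrt k powr q * g w powr q \<le> h w powr q" by (simp only: powr_mult)
   qed
   then have "(sqrt k powr q * X) powr \<beta> \<le> (mean (Q z (2 * r)) (\<lambda>w. h w powr q)) powr \<beta>"
    using \<beta> X0 by (intro powr_mono2) auto
   moreover have "(sqrt k powr q * X) powr \<beta> = k * X powr \<beta>"
    using k q\<beta> by (simp add: powr_mult powr_powr powr_numeral)
   ultimately have A: "k * X powr \<beta> \<le> (mean (Q z (2 * r)) (\<lambda>w. h w powr q)) powr \<beta>" by simp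
   have B: "k * mean (Q z (2 * r)) (\<lambda>w. (f w)^2) \<le> mean (Q z (2 * r)) (\<lambda>w. (ft w)^2)"
    unfolding mean_cmult[symmetric]
   proof (rule mean_mono[OF Q_borel _ ift2])
    show "integrable lborel (\<lambda>w. k * (f w)^2)" using if2 by simp
    show "k * (f w)^2 \<le> (ft w)^2" if "w \<in> Q z (2 * r)" for w
     unfolding ft_def power_mult_distrib using wk(2)[OF that] by (rule mult_right_mono) simp
   qed
   have "mean (Q z r) (\<lambda>w. (h w)^2) \<le> 2 ^ m * d z ^ m * mean (Q z r) (\<lambda>w. (g w)^2)"
    by (rule up[OF z r(1) r2(3)])
   also have "\<dots> \<le> 2 ^ m * d z ^ m * (C * (X powr \<beta> + mean (Q z (2 * r)) (\<lambda>w. (f w)^2)))"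
    unfolding X_def using d(1)[OF z] by (intro mult_left_mono RH[OF r(1) sub]) auto
   also have "\<dots> = (C * 4 ^ m) * (k * X powr \<beta> + k * mean (Q z (2 * r)) (\<lambda>w. (f w)^2))"
   proof -
    have "(4::real) ^ m = 2 ^ m * 2 ^ m" by (simp flip: power_mult_distrib)
    then have "2 ^ m * d z ^ m = 4 ^ m * k" by (simp add: k_def)
    then show ?thesis by (simp add: algebra_simps)
   qed
   also have "\<dots> \<le> (C * 4 ^ m) * ((mean (Q z (2 * r)) (\<lambda>w. h w powr q)) powr \<beta> + mean (Q z (2 * r)) (\<lambda>w. (ft w)^2))"
    using C by (intro mult_left_mono add_mono A B) auto
   finally show ?thesis .
  qed
  have H2: "mean (Q z r) (\<lambda>w. (h w)^2) \<le> T0 * G" if z: "z \<in> P" and r: "\<delta> z \<le> r" "r \<le> 8 * \<delta> z" for z r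
  proof -
   have dz: "d z > 0" by (rule d(1)[OF z])
   have r0: "r > 0" "2 * r \<le> d z" using r dz by (auto simp: \<delta>_def)
   have "(d z) ^ m \<le> (16 * r) ^ m" using r dz by (intro power_mono) (auto simp: \<delta>_def)
   then have dr: "d z ^ m \<le> 16 ^ m * r ^ m" by (simp add: power_mult_distrib)
   have Sg: "SI (Q z r) (\<lambda>w. (g w)^2) \<le> G" unfolding G_def by (rule SI_le_integral[OF Q_borel ig2]) simp
   have "mean (Q z r) (\<lambda>w. (h w)^2) \<le> 2 ^ m * d z ^ m * mean (Q z r) (\<lambda>w. (g w)^2)" by (rule up[OF z r0])
   also have "\<dots> \<le> 2 ^ m * (16 ^ m * r ^ m) * (G / (\<omega> * r ^ m))"
   proof (intro mult_mono mult_left_mono dr)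
    show "mean (Q z r) (\<lambda>w. (g w)^2) \<le> G / (\<omega> * r ^ m)"
     unfolding mean_def measure_Q(1)[OF r0(1)] \<omega>_def m_def using Sg r0 omega_pos[where 'n='n] by (intro divide_right_mono) auto
    show "0 \<le> mean (Q z r) (\<lambda>w. (g w)^2)" by (rule mean_nonneg) simp
   qed (use r0 in auto)
   also have "\<dots> = T0 * G"
   proof -
    have "(32::real) ^ m = 2 ^ m * 16 ^ m" by (simp flip: power_mult_distrib)
    then show ?thesis using r0 \<omega> by (simp add: T0_def)
   qed
   finally show ?thesis .
  qed
  define R where "R = \<rho> ^ m"
  have R: "R > 0" using \<rho> by (simp add: R_def)
  define V1 where "V1 = \<omega> * R"
  have V1: "V1 > 0" using \<omega> R by (simp add: V1_def)
  have mV1: "measure lborel (Q z0 \<rho>) = V1" unfolding measure_Q(1)[OF \<rho>] by (simp add: V1_def \<omega>_def R_def m_def)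
  have mV2: "measure lborel (Q z0 (2 * \<rho>)) = 2 ^ m * V1" unfolding measure_Q(1)[OF \<rho>2] V1_def \<omega>_def R_def m_def by (simp add: power_mult_distrib)
  define F where "F = (LBINT w. f w powr (2 + \<epsilon>))"
  have F0: "F \<ge> 0" by (simp add: F_def)
  have ift: "integrable lborel (\<lambda>w. ft w powr (2 + \<epsilon>))" "(LBINT w. ft w powr (2 + \<epsilon>)) \<le> (2 ^ m * R) powr p * F"
  proof -
   note [measurable] = L2b_measurable[OF Lft]
   have le: "ft w powr (2 + \<epsilon>) \<le> (2 ^ m * R) powr p * f w powr (2 + \<epsilon>)" for w
   proof -
    have "ft w powr (2 + \<epsilon>) \<le> (sqrt ((2 * \<rho>) ^ m) * f w) powr (2 + \<epsilon>)"
     unfolding ft_def using wtle[of w] wt0[of w] f(2)[of w] \<epsilon> by (intro powr_mono2 mult_right_mono) auto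
    also have "\<dots> = sqrt ((2 * \<rho>) ^ m) powr (2 + \<epsilon>) * f w powr (2 + \<epsilon>)" by (rule powr_mult)
    also have "sqrt ((2 * \<rho>) ^ m) powr (2 + \<epsilon>) = (2 ^ m * R) powr p"
     using sqrt_powr[of "(2 * \<rho>) ^ m" \<epsilon>] \<rho> by (simp add: p_def R_def power_mult_distrib)
    finally show ?thesis .
   qed
   have i: "integrable lborel (\<lambda>w. (2 ^ m * R) powr p * f w powr (2 + \<epsilon>))" using fi by simp
   show 1: "integrable lborel (\<lambda>w. ft w powr (2 + \<epsilon>))"
    by (rule Bochner_Integration.integrable_bound[OF i]) (use le in auto)
   have "(LBINT w. ft w powr (2 + \<epsilon>)) \<le> (LBINT w. (2 ^ m * R) powr p * f w powr (2 + \<epsilon>))"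
    by (rule integral_mono[OF 1 i le])
   then show "(LBINT w. ft w powr (2 + \<epsilon>)) \<le> (2 ^ m * R) powr p * F" by (simp add: F_def)
  qed
  have h2G: "(LBINT w. (h w)^2) \<le> 2 ^ m * R * G"
  proof -
   have "(LBINT w. (h w)^2) \<le> (LBINT w. 2 ^ m * R * (g w)^2)"
   proof (rule integral_mono[OF ih2])
    show "(h w)^2 \<le> 2 ^ m * R * (g w)^2" for w
    proof -
     have "(wt w)^2 \<le> (sqrt ((2 * \<rho>) ^ m))^2" using wtle wt0 by (intro power_mono)
     then have "(wt w)^2 \<le> 2 ^ m * R" using \<rho> by (simp add: R_def power_mult_distrib)
     then show ?thesis unfolding h_def power_mult_distrib by (rule mult_right_mono) simp
    qed
   qed (use ig2 in simp)
   then show ?thesis by (simp add: G_def)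
  qed
  have low: "indicator (Q z0 \<rho>) w * g w powr (2 + \<epsilon>) \<le> R powr (- p) * h w powr (2 + \<epsilon>)" for w
  proof (cases "w \<in> Q z0 \<rho>")
   case True
   have dr: "\<rho> \<le> d w" unfolding d_def by (rule pdist_half[OF \<rho> True])
   have wP: "w \<in> P"
   proof -
    have "\<rho>^2 \<le> (2 * \<rho>)^2" using \<rho> by (intro power_mono) auto
    then show ?thesis using True \<rho> unfolding P_def mem_Q by (auto intro: less_le_trans)
   qed
   have "sqrt R \<le> wt w" using dr wP \<rho> by (simp add: wt_def R_def power_mono)
   then have "(sqrt R * g w) powr (2 + \<epsilon>) \<le> h w powr (2 + \<epsilon>)"
    unfolding h_def using g(2)[of w] R \<epsilon> by (intro powr_mono2 mult_right_mono) auto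
   then have "R powr p * g w powr (2 + \<epsilon>) \<le> h w powr (2 + \<epsilon>)" using R by (simp add: powr_mult sqrt_powr p_def)
   then have "R powr (- p) * (R powr p * g w powr (2 + \<epsilon>)) \<le> R powr (- p) * h w powr (2 + \<epsilon>)" by (intro mult_left_mono) auto
   moreover have "R powr (- p) * R powr p = 1" using R by (simp flip: powr_add)
   ultimately show ?thesis using True by (simp add: mult.assoc[symmetric])
  qed simp
  have Mg: "mean (Q z0 (2 * \<rho>)) (\<lambda>w. (g w)^2) = G / (2 ^ m * V1)"
  proof -
   have "SI (Q z0 (2 * \<rho>)) (\<lambda>w. (g w)^2) = G" unfolding SI_def G_def
    by (intro Bochner_Integration.integral_cong refl) (use g_out in \<open>auto simp: indicator_def\<close>)
   then show ?thesis by (simp add: mean_def mV2)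
  qed
  have Mf: "mean (Q z0 (2 * \<rho>)) (\<lambda>w. f w powr (2 + \<epsilon>)) = F / (2 ^ m * V1)"
  proof -
   have "SI (Q z0 (2 * \<rho>)) (\<lambda>w. f w powr (2 + \<epsilon>)) = F" unfolding SI_def F_def
    by (intro Bochner_Integration.integral_cong refl) (use f_out \<epsilon> in \<open>auto simp: indicator_def\<close>)
   then show ?thesis by (simp add: mean_def mV2)
  qed
  have "integrable lborel (\<lambda>w. h w powr (2 + \<epsilon>)) \<and>
   (LBINT w. h w powr (2 + \<epsilon>)) \<le> C2 * ((T0 powr (\<epsilon> / 2) * G powr (\<epsilon> / 2)) * (2 ^ m * R * G) + (2 ^ m * R) powr p * F)"
  proof (cases "G = 0")
   case True
   have "AE w in lborel. (g w)^2 = 0"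
    using True integral_nonneg_eq_0_iff_AE[OF ig2] by (simp add: G_def)
   then have z: "AE w in lborel. h w powr (2 + \<epsilon>) = 0" by eventually_elim (simp add: h_def)
   note [measurable] = L2b_measurable[OF Lh]
   have "integrable lborel (\<lambda>w. h w powr (2 + \<epsilon>)) \<longleftrightarrow> integrable lborel (\<lambda>w::(real ^ 'n) \<times> real. 0::real)"
    by (rule integrable_cong_AE) (use z in auto)
   moreover have "(LBINT w. h w powr (2 + \<epsilon>)) = (\<integral>w. 0 \<partial>(lborel :: ((real ^ 'n) \<times> real) measure))"
    by (rule integral_cong_AE) (use z in auto)
   ultimately show ?thesis using True C2 F0 by simp
  next
   case False
   then have G: "G > 0" using G0 by simp
   define t where "t = sqrt (T0 * G)"
   have t: "t > 0" "t^2 = T0 * G" using T0 G by (auto simp: t_def)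
   have L: "integral\<^sup>L lborel (trunc_pow 2 (\<kappa> * lam) h) \<le>
    C' * (lam powr (2 - q) * integral\<^sup>L lborel (trunc_pow q (\<eta> * lam) h) + integral\<^sup>L lborel (trunc_pow 2 (\<eta> * lam) ft))"
    if lam: "lam \<ge> t" for lam
   proof -
    have l0: "lam > 0" using lam t by linarith
    have "t^2 \<le> lam^2" by (rule power_mono[OF lam]) (use t in simp)
    then have H2': "\<forall>z\<in>P. \<forall>r. \<delta> z \<le> r --> r \<le> 8 * \<delta> z --> mean (Q z r) (\<lambda>w. (h w)^2) \<le> lam^2"
     using H2 unfolding t(2)[symmetric] by (blast intro: order_trans)
    have \<delta>0: "\<forall>z\<in>P. \<delta> z > 0" using d(1) by (simp add: \<delta>_def)
    have h0': "\<forall>w. 0 \<le> h w" and ft0': "\<forall>w. 0 \<le> ft w" and ho: "\<forall>w. w \<notin> P --> h w = 0" using h0 ft0 h_out by blast+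
    have H1': "\<forall>z\<in>P. \<forall>r. 0 < r --> r \<le> \<delta> z --> mean (Q z r) (\<lambda>w. (h w)^2) \<le>
     (C * 4 ^ m) * ((mean (Q z (2 * r)) (\<lambda>w. h w powr qexp TYPE('n))) powr bexp TYPE('n) + mean (Q z (2 * r)) (\<lambda>w. (ft w)^2))"
     using H1 unfolding q_def \<beta>_def by blast
    show ?thesis
     using lev[THEN spec, of h, THEN spec, of ft, THEN spec, of P, THEN spec, of \<delta>, THEN spec, of lam] Lh h0' Lft ft0' ho \<delta>0 l0 H1' H2'
     unfolding q_def by blast
   qed
   have "\<forall>w. 0 \<le> h w" "\<forall>w. 0 \<le> ft w" using h0 ft0 by blast+
   then have "integrable lborel (\<lambda>w. h w powr (2 + \<epsilon>)) \<and>
    (LBINT w. h w powr (2 + \<epsilon>)) \<le> C2 * (t powr \<epsilon> * (LBINT w. (h w)^2) + (LBINT w. ft w powr (2 + \<epsilon>)))"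
    using hi[THEN spec, of \<epsilon>, THEN spec, of h, THEN spec, of ft, THEN spec, of t] \<epsilon> Lh Lft t(1) L ift(1) by blast
   moreover have "C2 * (t powr \<epsilon> * (LBINT w. (h w)^2) + (LBINT w. ft w powr (2 + \<epsilon>))) \<le> C2 * (t powr \<epsilon> * (2 ^ m * R * G) + (2 ^ m * R) powr p * F)"
    using C2 by (intro mult_left_mono add_mono h2G ift(2)) auto
   moreover have "t powr \<epsilon> = T0 powr (\<epsilon> / 2) * G powr (\<epsilon> / 2)"
    using T0 G by (simp add: t_def powr_half_sqrt[symmetric] powr_powr powr_mult)
   ultimately show ?thesis by (auto intro: order_trans)
  qed
  then have ih: "integrable lborel (\<lambda>w. h w powr (2 + \<epsilon>))"
   and hb: "(LBINT w. h w powr (2 + \<epsilon>)) \<le> C2 * ((T0 powr (\<epsilon> / 2) * G powr (\<epsilon> / 2)) * (2 ^ m * R * G) + (2 ^ m * R) powr p * F)" by auto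
  have irh: "integrable lborel (\<lambda>w. R powr (- p) * h w powr (2 + \<epsilon>))" using ih by simp
  have 1: "integrable lborel (\<lambda>w. indicator (Q z0 \<rho>) w * g w powr (2 + \<epsilon>))"
  proof (rule Bochner_Integration.integrable_bound[OF irh])
   note [measurable] = L2b_measurable[OF g(1)]
   show "(\<lambda>w. indicator (Q z0 \<rho>) w * g w powr (2 + \<epsilon>)) \<in> borel_measurable lborel" by measurable
   show "AE w in lborel. norm (indicator (Q z0 \<rho>) w * g w powr (2 + \<epsilon>)) \<le> norm (R powr (- p) * h w powr (2 + \<epsilon>))"
    by (rule AE_I2) (use low in auto)
  qed
  define M where "M = G / (2 ^ m * V1)"
  define Mf' where "Mf' = F / (2 ^ m * V1)"
  have M0: "M \<ge> 0" "Mf' \<ge> 0" using G0 F0 V1 by (auto simp: M_def Mf'_def)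
  have GM: "G = (2 ^ m * \<omega>) * R * M" using \<omega> R by (simp add: M_def V1_def)
  have FM: "F = 2 ^ m * V1 * Mf'" using V1 by (simp add: Mf'_def)
  have Gp: "G powr (\<epsilon> / 2) * G = (2 ^ m * \<omega>) powr p * R powr p * M powr p"
  proof -
   have "G powr (\<epsilon> / 2) * G = G powr p" using G0 powr_mult_base[of G "\<epsilon> / 2"] by (simp add: p_def mult.commute)
   then show ?thesis by (simp only: GM powr_mult)
  qed
  have "SI (Q z0 \<rho>) (\<lambda>w. g w powr (2 + \<epsilon>)) \<le> R powr (- p) * (LBINT w. h w powr (2 + \<epsilon>))"
   unfolding SI_def using integral_mono[OF 1 irh low] by simp
  also have "\<dots> \<le> R powr (- p) * (C2 * ((T0 powr (\<epsilon> / 2) * G powr (\<epsilon> / 2)) * (2 ^ m * R * G) + (2 ^ m * R) powr p * F))"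
   by (rule mult_left_mono[OF hb]) simp
  also have "\<dots> = (R powr (- p) * R powr p) * (C2 * (T0 powr (\<epsilon> / 2) * (2 ^ m * R) * ((2 ^ m * \<omega>) powr p * M powr p) + (2 ^ m) powr p * F))"
  proof -
   have a: "(T0 powr (\<epsilon> / 2) * G powr (\<epsilon> / 2)) * (2 ^ m * R * G) = T0 powr (\<epsilon> / 2) * (2 ^ m * R) * (G powr (\<epsilon> / 2) * G)" by (simp only: mult_ac)
   show ?thesis unfolding a Gp powr_mult[of "2 ^ m" R] by (simp only: distrib_left mult_ac)
  qed
  also have "R powr (- p) * R powr p = 1" using R by (simp flip: powr_add)
  finally have S: "SI (Q z0 \<rho>) (\<lambda>w. g w powr (2 + \<epsilon>)) \<le> C2 * (T0 powr (\<epsilon> / 2) * (2 ^ m * R) * ((2 ^ m * \<omega>) powr p * M powr p) + (2 ^ m) powr p * F)" by simp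
  have "mean (Q z0 \<rho>) (\<lambda>w. g w powr (2 + \<epsilon>)) \<le> C2 * (T0 powr (\<epsilon> / 2) * (2 ^ m * R) * ((2 ^ m * \<omega>) powr p * M powr p) + (2 ^ m) powr p * F) / V1"
   unfolding mean_def mV1 using S V1 by (intro divide_right_mono) auto
  also have "\<dots> = (C2 * T0 powr (\<epsilon> / 2) * 2 ^ m * (2 ^ m * \<omega>) powr p / \<omega>) * M powr p + (C2 * (2 ^ m) powr p * 2 ^ m) * Mf'"
   unfolding FM using V1 R \<omega> by (simp add: V1_def field_simps)
  also have "\<dots> \<le> c1 * M powr p + c2 * Mf'"
  proof (intro add_mono mult_right_mono)
   have T: "T0 powr (\<epsilon> / 2) \<le> 1 + T0" by (rule powr_le_one_plus) (use \<epsilon> \<epsilon>0 T0 in auto)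
   have "(2 ^ m * \<omega>) powr p \<le> (1 + 2 ^ m * \<omega>) powr p" using \<omega> p by (intro powr_mono2) auto
   also have "\<dots> \<le> (1 + 2 ^ m * \<omega>) powr 2" using \<omega> p by (intro powr_mono) auto
   also have "\<dots> = (1 + 2 ^ m * \<omega>)^2" using \<omega> by (simp add: powr_numeral)
   finally have W: "(2 ^ m * \<omega>) powr p \<le> (1 + 2 ^ m * \<omega>)^2" .
   show "C2 * T0 powr (\<epsilon> / 2) * 2 ^ m * (2 ^ m * \<omega>) powr p / \<omega> \<le> c1"
    unfolding c1_def using T W C2 \<omega> T0 by (intro divide_right_mono mult_mono) auto
   have "(2 ^ m) powr p \<le> (2 ^ m :: real) powr 2" using p by (intro powr_mono) auto
   also have "\<dots> = (2 ^ m)^2" by (simp add: powr_numeral)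
   finally show "C2 * (2 ^ m) powr p * 2 ^ m \<le> c2" unfolding c2_def using C2 by (intro mult_right_mono mult_left_mono) auto
  qed (use M0 in auto)
  also have "\<dots> \<le> c * (M powr p + Mf')" using c12 M0 by (simp add: c_def distrib_left distrib_right)
  finally show ?thesis using 1 unfolding Mg Mf M_def[symmetric] Mf'_def[symmetric] p_def by blast
 qed
 show ?thesis
 proof (rule exI[of _ \<epsilon>0], rule exI[of _ c], rule conjI[OF \<epsilon>0(1)], rule conjI[OF \<epsilon>0(2)], rule conjI[OF c], intro allI impI)
  fix z0 :: "(real ^ 'n) \<times> real" and \<rho> g f \<epsilon>
  assume a: "0 < \<rho>" "0 < \<epsilon>" "\<epsilon> < \<epsilon>0" "L2b g" and g: "\<forall>w. 0 \<le> g w" and f: "L2b f" "\<forall>w. 0 \<le> f w"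
   and o: "\<forall>w. w \<notin> Q z0 (2 * \<rho>) --> g w = 0" "\<forall>w. w \<notin> Q z0 (2 * \<rho>) --> f w = 0"
   and RH: "\<forall>z r. 0 < r --> Q z (2 * r) \<subseteq> Q z0 (2 * \<rho>) --> mean (Q z r) (\<lambda>w. (g w)^2) \<le>
    C * ((mean (Q z (2 * r)) (\<lambda>w. g w powr qexp TYPE('n))) powr bexp TYPE('n) + mean (Q z (2 * r)) (\<lambda>w. (f w)^2))"
   and i: "integrable lborel (\<lambda>w. f w powr (2 + \<epsilon>))"
  show "integrable lborel (\<lambda>w. indicator (Q z0 \<rho>) w * g w powr (2 + \<epsilon>)) \<and>
  mean (Q z0 \<rho>) (\<lambda>w. g w powr (2 + \<epsilon>)) \<le>
   c * ((mean (Q z0 (2 * \<rho>)) (\<lambda>w. (g w)^2)) powr (1 + \<epsilon> / 2) + mean (Q z0 (2 * \<rho>)) (\<lambda>w. f w powr (2 + \<epsilon>)))"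
   by (rule main[OF a g[rule_format] f(1) f(2)[rule_format] o(1)[rule_format] o(2)[rule_format] _ i])
     (use RH in \<open>simp_all add: q_def \<beta>_def\<close>)
 qed
qed

section \<open>Restriction to subcylinders and Borel representatives\<close>

text \<open>
  Needed because Gehring's lemma uses the reverse Hoelder inequality on all subcylinders, whereas a
  system is required to vanish outside its own cylinder.
\<close>

lemma structured_system_restrict:
 assumes S: "structured_system N \<nu> L P u D A F" and P': "P' \<subseteq> P" "P' \<in> sets borel"
 shows "structured_system N \<nu> L P' u (\<lambda>i j w. indicator P' w * D i j w) (\<lambda>i j w. indicator P' w * A i j w)
  (\<lambda>i j w. indicator P' w * F i j w)"
proof -
 note sd = structured_systemD[OF S]
 have bP: "bounded_borel (indicator P' :: _ => real)"
  using P' by (auto simp: bounded_borel_def indicator_def intro!: exI[of _ 1])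
 have flux: "flux_solution P' (u i) (\<lambda>j w. indicator P' w * D i j w) (\<lambda>j w. indicator P' w * A i j w - indicator P' w * F i j w)"
  if i: "i < N" for i
 proof -
  have f: "flux_solution P (u i) (D i) (\<lambda>j w. A i j w - F i j w)" by (rule sd(1)[OF i])
  have LG: "L2b (\<lambda>w. indicator P' w * A i j w - indicator P' w * F i j w)" for j
   by (intro L2b_diff L2b_bounded_mult sd(3,4)[OF i] bP)
  have LD: "L2b (\<lambda>w. indicator P' w * D i j w)" for j by (intro L2b_bounded_mult sd(2)[OF i] bP)
  have eqs: "(\<forall>j. (LBINT w. u i w * frechet_derivative \<psi> (at w) (dx j)) = - (LBINT w. (indicator P' w * D i j w) * \<psi> w)) \<and>
    (LBINT w. u i w * frechet_derivative \<psi> (at w) dt) =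
     (\<Sum>j\<in>UNIV. \<integral>w. (indicator P' w * A i j w - indicator P' w * F i j w) * frechet_derivative \<psi> (at w) (dx j) \<partial>lborel)"
   if \<psi>: "test_function P' \<psi>" for \<psi>
  proof -
   have \<psi>P: "test_function P \<psi>" using P'(1) \<psi> by (auto simp: test_function_def compactly_contained_def)
   have cl: "closure {x. \<psi> x \<noteq> 0} \<subseteq> P'" using \<psi> by (simp add: test_function_def compactly_contained_def)
   have \<psi>0: "\<psi> w = 0" if "w \<notin> P'" for w using cl closure_subset[of "{x. \<psi> x \<noteq> 0}"] that by blast
   have d0: "frechet_derivative \<psi> (at w) b = 0" if "w \<notin> P'" for w b
    by (rule derivative_zero_outside_closure) (use cl that in blast)
   have e1: "(indicator P' w * D i j w) * \<psi> w = D i j w * \<psi> w" for j w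
    by (cases "w \<in> P'") (simp_all add: \<psi>0)
   have e2: "(indicator P' w * A i j w - indicator P' w * F i j w) * frechet_derivative \<psi> (at w) b
    = (A i j w - F i j w) * frechet_derivative \<psi> (at w) b" for j w b
    by (cases "w \<in> P'") (simp_all add: d0)
   show ?thesis unfolding e1 e2 using f \<psi>P unfolding flux_solution_def by blast
  qed
  have "L2b (u i)" using f by (simp add: flux_solution_def)
  then show ?thesis using LG LD eqs unfolding flux_solution_def by blast
 qed
 have st: "\<nu> * sqsum N (\<lambda>i j w. indicator P' w * D i j w) w \<le> (\<Sum>i<N. \<Sum>j\<in>UNIV. (indicator P' w * A i j w) * (indicator P' w * D i j w)) \<and>
  sqsum N (\<lambda>i j w. indicator P' w * A i j w) w \<le> L^2 * sqsum N (\<lambda>i j w. indicator P' w * D i j w) w" for w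
  using sd(7)[of w] sd(8)[of w] by (cases "w \<in> P'") (simp_all add: sqsum_def)
 have L: "L2b (\<lambda>w. indicator P' w * D i j w) \<and> L2b (\<lambda>w. indicator P' w * A i j w) \<and> L2b (\<lambda>w. indicator P' w * F i j w)"
  if "i < N" for i j using that by (intro conjI L2b_bounded_mult sd bP)
 show ?thesis unfolding structured_system_def using flux L st by simp
qed

lemma AE_lebesgue_on_iff:
 "S \<in> sets borel ==> (AE z in lebesgue_on S. \<Phi> z) \<longleftrightarrow> (AE z in lborel. z \<in> S --> \<Phi> z)"
 by (subst AE_restrict_space_iff) (auto simp: AE_completion_iff)

lemma borel_representative:
 fixes f :: "'a::euclidean_space => real"
 assumes f: "f \<in> borel_measurable (lebesgue_on S)" and S: "S \<in> sets borel"
 shows "\<exists>f'. f' \<in> borel_measurable borel \<and> (\<forall>z. z \<notin> S --> f' z = 0) \<and> (AE z in lborel. z \<in> S --> f' z = f z)"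
proof -
 have "(\<lambda>z. indicator S z *\<^sub>R f z) \<in> borel_measurable lebesgue"
  using f S by (subst borel_measurable_restrict_space_iff[symmetric]) auto
 from completion_ex_borel_measurable_real[OF this]
 obtain g where g: "g \<in> borel_measurable lborel" "AE z in lborel. indicator S z *\<^sub>R f z = g z" by blast
 have [measurable]: "g \<in> borel_measurable borel" using g(1) by simp
 note [measurable] = S
 have "(\<lambda>z. indicator S z * g z) \<in> borel_measurable borel" by measurable
 moreover have "AE z in lborel. z \<in> S --> indicator S z * g z = f z" using g(2) by eventually_elim auto
 ultimately show ?thesis by (intro exI[of _ "\<lambda>z. indicator S z * g z"]) auto
qed

lemma lebesgue_integral_representative:
 fixes f h :: "'a::euclidean_space => real"
 assumes h: "h \<in> borel_measurable borel" and ae: "AE z in lborel. indicator S z *\<^sub>R f z = h z"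
 shows "(LINT z:S|lebesgue. f z) = integral\<^sup>L lborel h" "set_integrable lebesgue S f \<longleftrightarrow> integrable lborel h"
proof -
 have hm: "h \<in> borel_measurable lborel" using h by simp
 have hm': "h \<in> borel_measurable lebesgue" by (rule measurable_completion[OF hm])
 have ae': "AE z in lebesgue. h z = indicator S z *\<^sub>R f z" unfolding AE_completion_iff using ae by eventually_elim simp
 have fm: "(\<lambda>z. indicator S z *\<^sub>R f z) \<in> borel_measurable lebesgue" by (rule borel_measurable_AE[OF hm' ae'])
 have "(LINT z:S|lebesgue. f z) = integral\<^sup>L lebesgue h" unfolding set_lebesgue_integral_def
  by (rule integral_cong_AE[OF fm hm']) (use ae' in eventually_elim, simp)
 then show "(LINT z:S|lebesgue. f z) = integral\<^sup>L lborel h" using integral_completion[OF hm] by simp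
 have "set_integrable lebesgue S f \<longleftrightarrow> integrable lebesgue h" unfolding set_integrable_def
  by (rule integrable_cong_AE[OF fm hm']) (use ae' in eventually_elim, simp)
 then show "set_integrable lebesgue S f \<longleftrightarrow> integrable lborel h" using integrable_completion[OF hm] by simp
qed

text \<open>
  Completeness of Lebesgue measure allows the limit to be prescribed only almost everywhere.
\<close>

lemma borel_measurable_lebesgue_limit_AE:
 fixes f :: "nat => 'a::euclidean_space => real"
 assumes S: "S \<in> sets borel" and f: "\<And>m. f m \<in> borel_measurable (lebesgue_on S)"
  and lim: "AE z in lebesgue_on S. (\<lambda>m. f m z) \<longlonglongrightarrow> g z"
 shows "g \<in> borel_measurable (lebesgue_on S)"
proof -
 have "AE z in lborel. z \<in> S --> (\<lambda>m. f m z) \<longlonglongrightarrow> g z" using lim unfolding AE_lebesgue_on_iff[OF S] .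
 then obtain Z where Z: "\<And>z. z \<in> space lborel - Z ==> z \<in> S --> (\<lambda>m. f m z) \<longlonglongrightarrow> g z" "Z \<in> null_sets lborel"
  by (rule AE_E3) blast
 have ZS: "S - Z \<in> sets borel" using S Z(2) by (auto simp: null_sets_def)
 have ZL: "S - Z \<in> sets lebesgue" using ZS by simp
 have "(\<lambda>z. indicator S z *\<^sub>R f m z) \<in> borel_measurable lebesgue" for m
  using f[of m] S by (subst borel_measurable_restrict_space_iff[symmetric]) auto
 then have "(\<lambda>z. indicator (S - Z) z * (indicator S z *\<^sub>R f m z)) \<in> borel_measurable lebesgue" for m
  using ZL by (intro borel_measurable_times borel_measurable_indicator)
 moreover have "(\<lambda>m. indicator (S - Z) z * (indicator S z *\<^sub>R f m z)) \<longlonglongrightarrow> indicator (S - Z) z * g z" for z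
  using Z(1)[of z] by (cases "z \<in> S - Z") auto
 ultimately have gm: "(\<lambda>z. indicator (S - Z) z * g z) \<in> borel_measurable lebesgue"
  by (rule borel_measurable_LIMSEQ_real[rotated])
 have "AE z in lborel. z \<notin> Z" by (rule AE_not_in[OF Z(2)])
 then have ae: "AE z in lebesgue. indicator (S - Z) z * g z = indicator S z *\<^sub>R g z"
  unfolding AE_completion_iff by eventually_elim (auto simp: indicator_def)
 show ?thesis using borel_measurable_AE[OF gm ae] S by (subst borel_measurable_restrict_space_iff) auto
qed

lemma dyadic_floor_tendsto: "(\<lambda>m. real_of_int \<lfloor>x * 2 ^ m\<rfloor> / 2 ^ m) \<longlonglongrightarrow> x"
proof (rule tendsto_sandwich[of "\<lambda>m. x - (1/2) ^ m" _ _ "\<lambda>_. x"])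
 show "\<forall>\<^sub>F m in sequentially. x - (1/2) ^ m \<le> real_of_int \<lfloor>x * 2 ^ m\<rfloor> / 2 ^ m"
 proof (rule always_eventually, rule allI)
  fix m :: nat
  have "x * 2 ^ m - 1 \<le> real_of_int \<lfloor>x * 2 ^ m\<rfloor>" by linarith
  then have "(x * 2 ^ m - 1) / 2 ^ m \<le> real_of_int \<lfloor>x * 2 ^ m\<rfloor> / 2 ^ m" by (intro divide_right_mono) auto
  then show "x - (1/2) ^ m \<le> real_of_int \<lfloor>x * 2 ^ m\<rfloor> / 2 ^ m" by (simp add: diff_divide_distrib power_one_over)
 qed
 show "\<forall>\<^sub>F m in sequentially. real_of_int \<lfloor>x * 2 ^ m\<rfloor> / 2 ^ m \<le> x"
  by (rule always_eventually, rule allI) (simp add: divide_le_eq)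
 have "(\<lambda>m. (1/2::real) ^ m) \<longlonglongrightarrow> 0" by (rule LIMSEQ_power_zero) simp
 from tendsto_diff[OF tendsto_const[of x] this] show "(\<lambda>m. x - (1/2) ^ m) \<longlonglongrightarrow> x" by simp
qed simp

lemma tendsto_coordinatewise:
 fixes X :: "nat => nat => 'b::topological_space"
 assumes "\<And>i. (\<lambda>m. X m i) \<longlonglongrightarrow> x i" shows "X \<longlonglongrightarrow> x"
proof -
 have "limitin (product_topology (\<lambda>i. euclidean) UNIV) X x sequentially"
  unfolding limitin_componentwise using assms by auto
 then show ?thesis unfolding euclidean_product_topology by simp
qed

lemma measurable_matrix_entry:
 assumes "f \<in> borel_measurable M"
 shows "(\<lambda>z. (f z :: nat => real ^ 'n) k $ l) \<in> borel_measurable M"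
proof -
 have "(\<lambda>v :: nat => real ^ 'n. v k $ l) \<in> borel_measurable borel"
  by (intro borel_measurable_continuous_onI continuous_on_component continuous_on_product_coordinates)
 from measurable_compose[OF assms this] show ?thesis .
qed

text \<open>
  Round the entries of the matrix down to multiples of \<open>2^(-m)\<close>.  The rounded matrix takes countably many
  values, for each of which \<open>A\<close> is measurable in \<open>z\<close>; continuity in the second argument gives the limit at almost every
  \<open>z\<close>.
\<close>

lemma caratheodory_composition:
 fixes A :: "'a::euclidean_space => (nat => real ^ 'n) => nat => real ^ 'n"
 assumes A: "caratheodory N S A" and S: "S \<in> sets borel" and D: "\<And>i j. D i j \<in> borel_measurable borel"
 shows "(\<lambda>z. A z (\<lambda>i. if i < N then \<chi> j. D i j z else 0) k $ l) \<in> borel_measurable (lebesgue_on S)"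
proof -
 \<comment> \<open>Integer matrices are encoded as extensional functions on a finite index set, which are countable.\<close>
 define J where "J = {..<N} \<times> (UNIV :: 'n set)"
 define I where "I = PiE J (\<lambda>_. UNIV :: int set)"
 have cI: "countable I" unfolding I_def J_def by (rule countable_PiE) auto
 define X :: "nat => (nat \<times> 'n => int) => nat => real ^ 'n"
  where "X m a = (\<lambda>i. if i < N then (\<chi> j. real_of_int (a (i, j)) / 2 ^ m) else 0)" for m a
 define g where "g m z = restrict (\<lambda>p. \<lfloor>D (fst p) (snd p) z * 2 ^ m\<rfloor>) J" for m :: nat and z
 define Xi :: "'a => nat => real ^ 'n" where "Xi z = (\<lambda>i. if i < N then (\<chi> j. D i j z) else 0)" for z
 have Xc: "X m a \<in> coord_space N" "Xi z \<in> coord_space N" for m a z by (auto simp: X_def Xi_def coord_space_def)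
 have fm: "(\<lambda>z. A z (X m a) k $ l) \<in> borel_measurable (lebesgue_on S)" for m a
  by (rule measurable_matrix_entry) (use A Xc in \<open>simp add: caratheodory_def\<close>)
 have gm: "g m \<in> measurable (lebesgue_on S) (count_space I)" for m
  unfolding measurable_count_space_eq_countable[OF cI]
 proof (intro conjI ballI)
  show "g m \<in> space (lebesgue_on S) \<rightarrow> I" by (auto simp: g_def I_def)
  fix a assume a: "a \<in> I"
  have one: "{z. \<lfloor>D (fst p) (snd p) z * 2 ^ m\<rfloor> = a p} \<in> sets borel" for p
  proof -
   note [measurable] = D[of "fst p" "snd p"]
   have "{z \<in> space borel. real_of_int (a p) \<le> D (fst p) (snd p) z * 2 ^ m \<and> D (fst p) (snd p) z * 2 ^ m < real_of_int (a p) + 1} \<in> sets borel"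
    by measurable
   then show ?thesis by (simp add: floor_eq_iff)
  qed
  have ga: "g m z = a \<longleftrightarrow> (\<forall>p\<in>J. \<lfloor>D (fst p) (snd p) z * 2 ^ m\<rfloor> = a p)" for z
   using a by (auto simp: g_def I_def PiE_iff restrict_def extensional_def fun_eq_iff)
  have B: "S \<inter> (\<Inter>p\<in>J. {z. \<lfloor>D (fst p) (snd p) z * 2 ^ m\<rfloor> = a p}) \<in> sets borel"
  proof (cases "J = {}")
   case True
   then show ?thesis using S by simp
  next
   case False
   then show ?thesis using one S by (intro sets.Int sets.finite_INT) (auto simp: J_def)
  qed
  have eq: "g m -` {a} \<inter> space (lebesgue_on S) = S \<inter> (S \<inter> (\<Inter>p\<in>J. {z. \<lfloor>D (fst p) (snd p) z * 2 ^ m\<rfloor> = a p}))"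
   by (rule set_eqI) (simp add: ga; blast)
  show "g m -` {a} \<inter> space (lebesgue_on S) \<in> sets (lebesgue_on S)"
   unfolding eq sets_restrict_space by (rule imageI) (use B in simp)
 qed
 have m: "(\<lambda>z. A z (X m (g m z)) k $ l) \<in> borel_measurable (lebesgue_on S)" for m
  by (rule measurable_compose_countable'[where f="\<lambda>a z. A z (X m a) k $ l", OF fm gm cI])
 have Xlim: "(\<lambda>m. X m (g m z)) \<longlonglongrightarrow> Xi z" for z
 proof (rule tendsto_coordinatewise)
  fix i
  show "(\<lambda>m. X m (g m z) i) \<longlonglongrightarrow> Xi z i"
  proof (cases "i < N")
   case True
   have "X m (g m z) i = (\<chi> j. real_of_int \<lfloor>D i j z * 2 ^ m\<rfloor> / 2 ^ m)" for m
    using True by (simp add: X_def g_def J_def)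
   moreover have "(\<lambda>m. \<chi> j. real_of_int \<lfloor>D i j z * 2 ^ m\<rfloor> / 2 ^ m) \<longlonglongrightarrow> (\<chi> j. D i j z)"
    by (intro tendsto_vec_lambda dyadic_floor_tendsto)
   ultimately show ?thesis using True by (simp add: Xi_def)
  qed (simp add: X_def Xi_def)
 qed
 have "AE z in lebesgue_on S. continuous_on (coord_space N) (A z)" using A by (simp add: caratheodory_def)
 then have "AE z in lebesgue_on S. (\<lambda>m. A z (X m (g m z)) k $ l) \<longlonglongrightarrow> A z (Xi z) k $ l"
 proof eventually_elim
  case (elim z)
  have "(\<lambda>m. A z (X m (g m z))) \<longlonglongrightarrow> A z (Xi z)"
   by (rule continuous_on_tendsto_compose[OF elim Xlim]) (use Xc in auto)
  from continuous_on_tendsto_compose[of UNIV "\<lambda>v. v k $ l", OF continuous_on_component[OF continuous_on_product_coordinates] this]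
  show ?case by simp
 qed
 from borel_measurable_lebesgue_limit_AE[OF S m this] show ?thesis unfolding Xi_def .
qed

section \<open>Slices of test functions\<close>

lemma test_function_smooth_kernel: "test_function P \<psi> ==> smooth_kernel \<psi>"
 unfolding smooth_kernel_def test_function_def compactly_contained_def
 by (blast intro: bounded_subset[OF compact_imp_bounded closure_subset])

lemma test_function_zero_outside:
 assumes "test_function P \<psi>" "w \<notin> P"
 shows "\<psi> w = 0" "frechet_derivative \<psi> (at w) b = 0"
proof -
 have cl: "closure {x. \<psi> x \<noteq> 0} \<subseteq> P" using assms by (simp add: test_function_def compactly_contained_def)
 show "\<psi> w = 0" using cl closure_subset[of "{x. \<psi> x \<noteq> 0}"] assms(2) by blast
 show "frechet_derivative \<psi> (at w) b = 0"
  by (rule derivative_zero_outside_closure) (use cl assms(2) in blast)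
qed

lemma slice_has_derivative:
 fixes \<psi> :: "'a::euclidean_space \<times> real => real"
 assumes "(\<psi> has_derivative \<psi>') (at (x, t))"
 shows "((\<lambda>y. \<psi> (y, t)) has_derivative (\<lambda>h. \<psi>' (h, 0))) (at x)"
  "((\<lambda>s. \<psi> (x, s)) has_derivative (\<lambda>h. \<psi>' (0, h))) (at t)"
proof -
 have "((\<lambda>y. (y, t)) has_derivative (\<lambda>h. (h, 0))) (at x)"
  by (rule has_derivative_Pair[OF has_derivative_ident has_derivative_const])
 from has_derivative_compose[OF this, of \<psi> \<psi>'] assms
 show "((\<lambda>y. \<psi> (y, t)) has_derivative (\<lambda>h. \<psi>' (h, 0))) (at x)" by simp
 have "((\<lambda>s. (x, s)) has_derivative (\<lambda>h. (0, h))) (at t)"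
  by (rule has_derivative_Pair[OF has_derivative_const has_derivative_ident])
 from has_derivative_compose[OF this, of \<psi> \<psi>'] assms
 show "((\<lambda>s. \<psi> (x, s)) has_derivative (\<lambda>h. \<psi>' (0, h))) (at t)" by simp
qed

lemma test_function_differentiable:
 assumes "test_function P \<psi>" shows "(\<psi> has_derivative frechet_derivative \<psi> (at z)) (at z)"
proof -
 have "C_k (Suc 0) \<psi>" using assms by (simp add: test_function_def del: C_k.simps)
 then show ?thesis by (rule C_k_has_derivative)
qed

lemma grad_slice:
 assumes "test_function P \<psi>"
 shows "grad (\<lambda>y. \<psi> (y, t)) x $ j = frechet_derivative \<psi> (at (x, t)) (dx j)"
 unfolding grad_def
 using frechet_derivative_eqI[OF slice_has_derivative(1)[OF test_function_differentiable[OF assms, of "(x, t)"]]] by simp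

lemma deriv_slice:
 fixes \<psi> :: "(real ^ 'n) \<times> real => real"
 assumes "test_function P \<psi>"
 shows "deriv (\<lambda>s. \<psi> (x, s)) t = frechet_derivative \<psi> (at (x, t)) dt"
proof (rule DERIV_imp_deriv)
 let ?d = "frechet_derivative \<psi> (at (x, t))"
 have D: "(\<psi> has_derivative ?d) (at (x, t))" by (rule test_function_differentiable[OF assms])
 have l: "?d (0, h) = h * ?d dt" for h
  using linear_scale[OF has_derivative_linear[OF D], of h "(0, 1)"] by simp
 have e: "(\<lambda>h. ?d (0, h)) = (*) (?d dt)" by (rule ext, rule trans[OF l mult.commute])
 show "((\<lambda>s. \<psi> (x, s)) has_field_derivative ?d dt) (at t)"
  unfolding has_field_derivative_def using slice_has_derivative(2)[OF D] unfolding e .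
qed

text \<open>
  A derivative of the slice in direction \<open>b\<close> is a slice of the derivative in direction \<open>(b, 0)\<close>.
\<close>

lemma C_k_slice:
 fixes \<psi> :: "'a::euclidean_space \<times> real => real"
 shows "C_k k \<psi> ==> C_k k (\<lambda>y. \<psi> (y, t))"
proof (induction k arbitrary: \<psi>)
 case 0
 then have "continuous_on UNIV \<psi>" by simp
 then have "continuous_on UNIV (\<lambda>y. \<psi> (y, t))"
  by (rule continuous_on_compose2) (auto intro!: continuous_intros)
 then show ?case by simp
next
 case (Suc k)
 have d: "((\<lambda>y. \<psi> (y, t)) has_derivative (\<lambda>h. frechet_derivative \<psi> (at (x, t)) (h, 0))) (at x)" for x
  by (rule slice_has_derivative(1)[OF C_k_has_derivative[OF Suc.prems]])
 show ?case unfolding C_k.simps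
 proof (intro conjI allI ballI)
  show "(\<lambda>y. \<psi> (y, t)) differentiable at x" for x using d[of x] by (auto simp: differentiable_def)
  fix b :: 'a assume "b \<in> Basis"
  then have "(b, 0) \<in> (Basis :: ('a \<times> real) set)" by (auto simp: Basis_prod_def)
  then have "C_k k (\<lambda>z. frechet_derivative \<psi> (at z) (b, 0))" using Suc.prems unfolding C_k.simps by blast
  from Suc.IH[OF this] show "C_k k (\<lambda>x. frechet_derivative (\<lambda>y. \<psi> (y, t)) (at x) b)"
   unfolding frechet_derivative_eqI[OF d] .
 qed
qed

lemma test_function_slice:
 fixes \<psi> :: "'a::euclidean_space \<times> real => real"
 assumes "test_function (U \<times> V) \<psi>"
 shows "test_function U (\<lambda>y. \<psi> (y, t))"
 unfolding test_function_def compactly_contained_def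
proof (intro conjI allI)
 let ?S = "closure {z. \<psi> z \<noteq> 0}" and ?T = "closure {y. \<psi> (y, t) \<noteq> 0}"
 have S: "compact ?S" "?S \<subseteq> U \<times> V" using assms by (auto simp: test_function_def compactly_contained_def)
 show "C_k k (\<lambda>y. \<psi> (y, t))" for k using assms by (intro C_k_slice) (simp add: test_function_def)
 have "closed ((\<lambda>y. (y, t)) -` ?S)" by (intro closed_vimage closed_closure continuous_intros)
 moreover have "{y. \<psi> (y, t) \<noteq> 0} \<subseteq> (\<lambda>y. (y, t)) -` ?S" using closure_subset[of "{z. \<psi> z \<noteq> 0}"] by auto
 ultimately have T: "?T \<subseteq> (\<lambda>y. (y, t)) -` ?S" by (rule closure_minimal[rotated])
 then show "?T \<subseteq> U" using S(2) by auto
 have "?T \<subseteq> fst ` ?S" using T by force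
 moreover have "compact (fst ` ?S)" by (intro compact_continuous_image S continuous_intros)
 ultimately have "bounded ?T" using compact_imp_bounded bounded_subset by blast
 then show "compact ?T" by (simp add: compact_eq_bounded_closed)
qed

text \<open>
  Fubini's theorem: almost every time slice of the representatives agrees almost everywhere with the
  corresponding slice of the given functions, and the slice of a test function is a test function.
\<close>

lemma gradient_identity_from_slices:
 fixes U :: "(real ^ 'n) set" and u D u' D' :: "(real ^ 'n) \<times> real => real"
 assumes L: "L2b u'" "L2b D'"
  and eq: "AE z in lborel. z \<in> U \<times> V --> u' z = u z \<and> D' z = D z"
  and W: "AE t in lborel. t \<in> V --> (\<forall>\<phi>. test_function U \<phi> -->
   (LINT x:U|lebesgue. u (x, t) * grad \<phi> x $ j) = - (LINT x:U|lebesgue. D (x, t) * \<phi> x))"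
  and \<psi>: "test_function (U \<times> V) \<psi>"
 shows "(LBINT w. u' w * frechet_derivative \<psi> (at w) (dx j)) = - (LBINT w. D' w * \<psi> w)"
proof -
 have sk: "smooth_kernel \<psi>" by (rule test_function_smooth_kernel[OF \<psi>])
 define h1 where "h1 w = u' w * frechet_derivative \<psi> (at w) (dx j)" for w
 define h2 where "h2 w = D' w * \<psi> w" for w
 have bb: "bounded_borel \<psi>" "bounded_borel (\<lambda>w. frechet_derivative \<psi> (at w) (dx j))"
  by (rule smooth_kernel_bounded_borel[OF sk], rule smooth_kernel_bounded_borel[OF smooth_kernel_derivative[OF sk dx_Basis]])
 have Lh: "L2b h1" "L2b h2" unfolding h1_def[abs_def] h2_def[abs_def]
  using L2b_bounded_mult[OF L(1) bb(2)] L2b_bounded_mult[OF L(2) bb(1)] by (simp_all add: mult.commute)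
 have slice: "(LBINT w. h w) = (LBINT t. (LBINT x. h (x, t)))" "(\<lambda>t. \<integral>x. h (x, t) \<partial>lborel) \<in> borel_measurable lborel"
  and sm: "(\<lambda>x. h (x, t)) \<in> borel_measurable borel" if "L2b h" for h :: "(real ^ 'n) \<times> real => real" and t
 proof -
  have i: "integrable (lborel \<Otimes>\<^sub>M lborel) (case_prod (\<lambda>x t. h (x, t)))"
   using L2b_integrable[OF that] by (simp add: lborel_prod)
  show "(LBINT w. h w) = (LBINT t. (LBINT x. h (x, t)))"
   using lborel_pair.integral_snd[OF i] by (simp add: lborel_prod)
  show "(\<lambda>t. \<integral>x. h (x, t) \<partial>lborel) \<in> borel_measurable lborel"
   using lborel_pair.integrable_snd[OF i] by simp
  have "(\<lambda>x. (x, t)) \<in> borel_measurable borel" by (intro borel_measurable_continuous_onI continuous_intros)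
  from measurable_compose[OF this L2b_measurable[OF that]] show "(\<lambda>x. h (x, t)) \<in> borel_measurable borel" .
 qed
 obtain Z where Z: "\<And>z. z \<in> space lborel - Z ==> z \<in> U \<times> V --> u' z = u z \<and> D' z = D z" "Z \<in> null_sets lborel"
  using AE_E3[OF eq] by blast
 have "AE z in lborel \<Otimes>\<^sub>M lborel. z \<notin> Z" unfolding lborel_prod by (rule AE_not_in[OF Z(2)])
 from lborel_pair.AE_pair[OF this] have "AE x in lborel. AE t in lborel. (x, t) \<notin> Z" .
 moreover have "{z \<in> space (lborel \<Otimes>\<^sub>M lborel). (fst z, snd z) \<notin> Z} \<in> sets (lborel \<Otimes>\<^sub>M lborel)"
 proof -
  have "Z \<in> sets lborel" using Z(2) by (simp add: null_sets_def)
  then have "- Z \<in> sets borel" by (simp add: borel_comp)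
  then show ?thesis unfolding lborel_prod by (simp add: Compl_eq[symmetric])
 qed
 ultimately have AEt: "AE t in lborel. AE x in lborel. (x, t) \<notin> Z"
  using lborel_pair.AE_commute[of "\<lambda>x t. (x, t) \<notin> Z"] by blast
 have "AE t in lborel. (LBINT x. h1 (x, t)) = - (LBINT x. h2 (x, t))"
  using AEt W
 proof eventually_elim
  case (elim t)
  show ?case
  proof (cases "t \<in> V")
   case False
   then have "h1 (x, t) = 0" "h2 (x, t) = 0" for x
    using test_function_zero_outside[OF \<psi>, of "(x, t)"] by (auto simp: h1_def h2_def)
   then show ?thesis by simp
  next
   case True
   have ts: "test_function U (\<lambda>y. \<psi> (y, t))" by (rule test_function_slice[OF \<psi>])
   have g: "grad (\<lambda>y. \<psi> (y, t)) x $ j = frechet_derivative \<psi> (at (x, t)) (dx j)" for x by (rule grad_slice[OF \<psi>])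
   have a1: "AE x in lborel. indicator U x *\<^sub>R (u (x, t) * grad (\<lambda>y. \<psi> (y, t)) x $ j) = h1 (x, t)"
    using elim(1)
   proof eventually_elim
    case (elim x)
    show ?case
    proof (cases "x \<in> U")
     case True
     then show ?thesis using Z(1)[of "(x, t)"] elim \<open>t \<in> V\<close> by (simp add: h1_def g)
    next
     case False
     then show ?thesis using test_function_zero_outside[OF \<psi>, of "(x, t)"] by (simp add: h1_def)
    qed
   qed
   have a2: "AE x in lborel. indicator U x *\<^sub>R (D (x, t) * \<psi> (x, t)) = h2 (x, t)"
    using elim(1)
   proof eventually_elim
    case (elim x)
    show ?case
    proof (cases "x \<in> U")
     case True
     then show ?thesis using Z(1)[of "(x, t)"] elim \<open>t \<in> V\<close> by (simp add: h2_def)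
    next
     case False
     then show ?thesis using test_function_zero_outside[OF \<psi>, of "(x, t)"] by (simp add: h2_def)
    qed
   qed
   have "(LINT x:U|lebesgue. u (x, t) * grad (\<lambda>y. \<psi> (y, t)) x $ j) = - (LINT x:U|lebesgue. D (x, t) * \<psi> (x, t))"
    using elim(2) True ts by blast
   then show ?thesis
    unfolding lebesgue_integral_representative(1)[OF sm[OF Lh(1)] a1] lebesgue_integral_representative(1)[OF sm[OF Lh(2)] a2] .
  qed
 qed
 then have "(LBINT t. (LBINT x. h1 (x, t))) = (LBINT t. - (LBINT x. h2 (x, t)))"
  by (rule integral_cong_AE[rotated 2]) (use slice(2)[OF Lh(1)] slice(2)[OF Lh(2)] in simp_all)
 then show ?thesis using slice(1)[OF Lh(1)] slice(1)[OF Lh(2)] by (simp add: h1_def h2_def)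
qed

section \<open>From weak solutions to Borel systems\<close>

lemma enorm_square: "(enorm N v)^2 = (\<Sum>i<N. (norm (v i))^2)"
 by (simp add: enorm_def L2_set_def sum_nonneg)

lemma enorm_nonneg: "0 \<le> enorm N v" by (simp add: enorm_def L2_set_nonneg)

lemma enorm_powr_2: "enorm N v powr 2 = (enorm N v)^2"
 using enorm_nonneg[of N v] by (simp add: powr_numeral)

lemma norm_vec_square: "(norm (x :: real ^ 'n))^2 = (\<Sum>j\<in>UNIV. (x $ j)^2)"
 unfolding power2_norm_eq_inner inner_vec_def by (simp add: power2_eq_square)

lemma norm_entry_le_enorm: "i < N ==> (norm (v i))^2 \<le> (enorm N v)^2"
 unfolding enorm_square by (rule member_le_sum[of i "{..<N}" "\<lambda>i. (norm (v i))^2"]) auto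

lemma matrix_entry_le_enorm: "i < N ==> (v i $ j :: real)^2 \<le> (enorm N v)^2"
proof -
 assume i: "i < N"
 have "(v i $ j)^2 \<le> (norm (v i))^2" using component_le_norm_cart[of "v i" j] abs_le_square_iff[of "v i $ j" "norm (v i)"] by simp
 then show ?thesis using norm_entry_le_enorm[OF i, of v] by linarith
qed

text \<open>
  A Lebesgue measurable function agrees almost everywhere with a Borel function; the dominating function
  \<open>e\<close> provides square integrability.
\<close>

lemma L2b_representative:
 fixes g e :: "'a::euclidean_space => real"
 assumes g: "g \<in> borel_measurable (lebesgue_on K)" and P: "P \<subseteq> K" "P \<in> sets borel" "bounded P"
  and e: "set_integrable lebesgue K e" and le: "AE z in lborel. z \<in> P --> (g z)^2 \<le> e z"
 shows "\<exists>g'. L2b g' \<and> (\<forall>z. z \<notin> P --> g' z = 0) \<and> (AE z in lborel. z \<in> P --> g' z = g z)"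
proof -
 have "g \<in> borel_measurable (lebesgue_on P)" by (rule measurable_restrict_mono[OF g P(1)])
 from borel_representative[OF this P(2)]
 obtain g' where g': "g' \<in> borel_measurable borel" "\<forall>z. z \<notin> P --> g' z = 0" "AE z in lborel. z \<in> P --> g' z = g z" by (elim exE conjE) (rule that)
 have "set_integrable lebesgue P e" by (rule set_integrable_subset[OF e]) (use P in auto)
 then have ie: "integrable lebesgue (\<lambda>z. indicator P z *\<^sub>R e z)" by (simp add: set_integrable_def)
 have m: "(\<lambda>z. (g' z)^2) \<in> borel_measurable lborel" using g'(1) by simp
 have "integrable lebesgue (\<lambda>z. (g' z)^2)"
 proof (rule Bochner_Integration.integrable_bound[OF ie])
  show "(\<lambda>z. (g' z)^2) \<in> borel_measurable lebesgue" by (rule measurable_completion[OF m])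
  show "AE z in lebesgue. norm ((g' z)^2) \<le> norm (indicator P z *\<^sub>R e z)"
   unfolding AE_completion_iff using g'(3) le
  proof eventually_elim
   case (elim z)
   then show ?case using g'(2) by (cases "z \<in> P") auto
  qed
 qed
 then have "integrable lborel (\<lambda>z. (g' z)^2)" unfolding integrable_completion[OF m] .
 moreover have "bounded {z. g' z \<noteq> 0}" by (rule bounded_subset[OF P(3)]) (use g'(2) in auto)
 ultimately have "L2b g'" using g'(1) by (simp add: L2b_def)
 then show ?thesis using g'(2,3) by blast
qed

text \<open>
  Choose Borel representatives of \<open>u\<close>, \<open>Du\<close>, \<open>F\<close> and \<open>A(z, Du)\<close>, collect the countably many exceptional
  null sets in one Borel null set, and let all functions vanish there.  The structure conditions then hold at
  every point: off the null set by hypothesis, on it because all terms are zero.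
\<close>

lemma structured_system_of_weak_solution:
 fixes \<Omega> :: "(real ^ 'n) set" and A :: "(real ^ 'n) \<times> real => (nat => real ^ 'n) => (nat => real ^ 'n)"
  and F Du :: "(real ^ 'n) \<times> real => nat => real ^ 'n" and L :: real
 assumes R: "0 < R" and L: "0 < L" and \<Omega>: "open \<Omega>"
  and car: "caratheodory N (\<Omega> \<times> {0<..<T}) A" and gr: "growth_conditions N \<nu> L (\<Omega> \<times> {0<..<T}) A"
  and Floc: "in_Lp_loc 2 N (\<Omega> \<times> {0<..<T}) F" and ws: "weak_solution N \<Omega> T A F u Du"
  and cc: "cylinder x0 t0 R \<Subset> \<Omega> \<times> {0<..<T}"
 shows "in_Lp 2 N (cylinder x0 t0 R) Du \<and> (\<exists>u' D A' F'. structured_system N \<nu> L (cylinder x0 t0 R) u' D A' F' \<and>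
  (AE z in lborel. z \<in> cylinder x0 t0 R --> (\<forall>i<N. \<forall>j. D i j z = Du z i $ j \<and> F' i j z = F z i $ j)))"
proof -
 define U where "U = ball x0 R"
 define V where "V = {t0 - R^2<..<t0 + R^2}"
 define P where "P = cylinder x0 t0 R"
 define S where "S = \<Omega> \<times> {0<..<T}"
 have PUV: "P = U \<times> V" by (simp add: P_def U_def V_def cylinder_def)
 have "open P" unfolding PUV U_def V_def by (intro open_Times) auto
 then have Pb: "P \<in> sets borel" by simp
 have bdP: "bounded P" unfolding PUV U_def V_def by (intro bounded_Times) auto
 have "open S" unfolding S_def by (intro open_Times \<Omega>) auto
 then have Sb: "S \<in> sets borel" by simp
 have R2: "t0 - R^2 < t0 + R^2" using R by simp
 have clP: "closure P = cball x0 R \<times> {t0 - R^2..t0 + R^2}"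
  unfolding PUV U_def V_def closure_Times using R R2 by simp
 have clS: "cball x0 R \<times> {t0 - R^2..t0 + R^2} \<subseteq> S" and ccl: "compact (closure P)"
  using cc unfolding P_def[symmetric] S_def[symmetric] compactly_contained_def clP by auto
 have PS: "P \<subseteq> S" using clS closure_subset[of P] unfolding clP by blast
 have UO: "open U" "U \<Subset> \<Omega>"
 proof -
  have "cball x0 R \<subseteq> \<Omega>"
  proof
   fix x assume "x \<in> cball x0 R"
   then have "(x, t0) \<in> cball x0 R \<times> {t0 - R^2..t0 + R^2}" using R by simp
   from subsetD[OF clS this] show "x \<in> \<Omega>" by (simp add: S_def)
  qed
  then show "U \<Subset> \<Omega>" using R by (simp add: U_def compactly_contained_def)
 qed (simp add: U_def)
 have "(x0, t0 - R^2) \<in> S" "(x0, t0 + R^2) \<in> S" using clS R R2 by auto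
 then have tt: "0 < t0 - R^2" "t0 + R^2 < T" by (auto simp: S_def)
 have W: "AE t in lebesgue_on V. W12 N U (\<lambda>x. u (x, t)) (\<lambda>x. Du (x, t))"
  and u2: "in_Lp 2 N P u" and D2: "in_Lp 2 N P Du"
 proof -
  have "L2loc_W12loc N \<Omega> T u Du" using ws by (simp add: weak_solution_def)
  then have "(AE t in lebesgue_on V. W12 N U (\<lambda>x. u (x, t)) (\<lambda>x. Du (x, t))) \<and> in_Lp 2 N P u \<and> in_Lp 2 N P Du"
   unfolding L2loc_W12loc_def PUV V_def using UO tt R2 by blast
  then show "AE t in lebesgue_on V. W12 N U (\<lambda>x. u (x, t)) (\<lambda>x. Du (x, t))" "in_Lp 2 N P u" "in_Lp 2 N P Du" by auto
 qed
 have F2: "in_Lp 2 N (closure P) F" using Floc ccl clS unfolding in_Lp_loc_def S_def clP by blast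
 have Duc: "Du z \<in> coord_space N" if "z \<in> P" for z using D2 that by (auto simp: in_Lp_def)
 have iDu: "set_integrable lebesgue P (\<lambda>z. (enorm N (Du z))^2)" using D2 by (simp add: in_Lp_def enorm_powr_2)

 have "\<forall>i. \<exists>g. i < N --> L2b g \<and> (\<forall>z. z \<notin> P --> g z = 0) \<and> (AE z in lborel. z \<in> P --> g z = u z i)"
 proof
  fix i
  have 1: "(\<lambda>z. u z i) \<in> borel_measurable (lebesgue_on P)"
   by (rule measurable_compose[where g="\<lambda>v. v i", OF _ borel_measurable_continuous_onI[OF continuous_on_product_coordinates]])
    (use u2 in \<open>simp add: in_Lp_def\<close>)
  have 2: "set_integrable lebesgue P (\<lambda>z. (enorm N (u z))^2)" using u2 by (simp add: in_Lp_def enorm_powr_2)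
  show "\<exists>g. i < N --> L2b g \<and> (\<forall>z. z \<notin> P --> g z = 0) \<and> (AE z in lborel. z \<in> P --> g z = u z i)"
  proof (cases "i < N")
   case True
   have "(u z i)^2 \<le> (enorm N (u z))^2" for z using norm_entry_le_enorm[OF True, of "u z"] by simp
   then have 3: "AE z in lborel. z \<in> P --> (u z i)^2 \<le> (enorm N (u z))^2" by simp
   show ?thesis using L2b_representative[OF 1 order_refl Pb bdP 2 3] by blast
  qed simp
 qed
 from choice[OF this] obtain u' where u': "\<forall>i. i < N --> L2b (u' i) \<and> (\<forall>z. z \<notin> P --> u' i z = 0) \<and> (AE z in lborel. z \<in> P --> u' i z = u z i)" ..
 have rep: "\<exists>d. \<forall>i j. (i < N --> L2b (d i j) \<and> (AE z in lborel. z \<in> P --> d i j z = f z i $ j)) \<and> (\<not> i < N --> d i j = (\<lambda>_. 0))"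
  if m: "\<And>i j. (\<lambda>z. f z i $ j) \<in> borel_measurable (lebesgue_on K)" and K: "P \<subseteq> K"
   and e: "set_integrable lebesgue K e" and le: "AE z in lborel. z \<in> P --> (enorm N (f z))^2 \<le> e z"
  for f :: "(real ^ 'n) \<times> real => nat => real ^ 'n" and e K
 proof -
  have "\<forall>p. \<exists>d. (fst p < N --> L2b d \<and> (AE z in lborel. z \<in> P --> d z = f z (fst p) $ (snd p))) \<and> (\<not> fst p < N --> d = (\<lambda>_. 0))"
  proof
   fix p :: "nat \<times> 'n"
   show "\<exists>d. (fst p < N --> L2b d \<and> (AE z in lborel. z \<in> P --> d z = f z (fst p) $ (snd p))) \<and> (\<not> fst p < N --> d = (\<lambda>_. 0))"
   proof (cases "fst p < N")
    case True
    have "AE z in lborel. z \<in> P --> (f z (fst p) $ (snd p))^2 \<le> e z"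
     using le by eventually_elim (use matrix_entry_le_enorm[OF True] order_trans in blast)
    from L2b_representative[OF m K Pb bdP e this] show ?thesis using True by blast
   qed blast
  qed
  from choice[OF this] obtain d where "\<forall>p. (fst p < N --> L2b (d p) \<and> (AE z in lborel. z \<in> P --> d p z = f z (fst p) $ (snd p))) \<and> (\<not> fst p < N --> d p = (\<lambda>_. 0))" ..
  then show ?thesis by (intro exI[of _ "\<lambda>i j. d (i, j)"]) auto
 qed
 have mDu: "(\<lambda>z. Du z i $ j) \<in> borel_measurable (lebesgue_on P)" for i j
  by (rule measurable_matrix_entry) (use D2 in \<open>simp add: in_Lp_def\<close>)
 have "AE z in lborel. z \<in> P --> (enorm N (Du z))^2 \<le> (enorm N (Du z))^2" by simp
 from rep[OF mDu order_refl iDu this] obtain d where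
  d: "\<forall>i j. (i < N --> L2b (d i j) \<and> (AE z in lborel. z \<in> P --> d i j z = Du z i $ j)) \<and> (\<not> i < N --> d i j = (\<lambda>_. 0))" ..
 have mF: "(\<lambda>z. F z i $ j) \<in> borel_measurable (lebesgue_on (closure P))" for i j
  by (rule measurable_matrix_entry) (use F2 in \<open>simp add: in_Lp_def\<close>)
 have iF: "set_integrable lebesgue (closure P) (\<lambda>z. (enorm N (F z))^2)" using F2 by (simp add: in_Lp_def enorm_powr_2)
 have "AE z in lborel. z \<in> P --> (enorm N (F z))^2 \<le> (enorm N (F z))^2" by simp
 from rep[OF mF closure_subset iF this] obtain f where
  f: "\<forall>i j. (i < N --> L2b (f i j) \<and> (AE z in lborel. z \<in> P --> f i j z = F z i $ j)) \<and> (\<not> i < N --> f i j = (\<lambda>_. 0))" ..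
 have dm: "d i j \<in> borel_measurable borel" for i j
  using d by (cases "i < N") (auto dest: L2b_measurable)
 define Xi :: "(real ^ 'n) \<times> real => nat => real ^ 'n" where "Xi z = (\<lambda>i. if i < N then \<chi> j. d i j z else 0)" for z
 have AE_entries: "AE z in lborel. \<forall>i j. z \<in> P --> i < N --> \<Phi> i j z"
  if "\<And>i j. i < N ==> AE z in lborel. z \<in> P --> \<Phi> i j z" for \<Phi> :: "nat => 'n => (real ^ 'n) \<times> real => bool"
  unfolding AE_all_countable
 proof (intro allI)
  fix i j
  show "AE z in lborel. z \<in> P --> i < N --> \<Phi> i j z"
  proof (cases "i < N")
   case True
   from that[OF this, of j] show ?thesis by eventually_elim blast
  qed simp
 qed
 have dAE: "AE z in lborel. \<forall>i j. z \<in> P --> i < N --> d i j z = Du z i $ j"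
  by (rule AE_entries) (use d in blast)
 have Xi: "AE z in lborel. z \<in> P --> Xi z = Du z"
  using dAE
 proof eventually_elim
  case (elim z)
  show ?case
  proof
   assume z: "z \<in> P"
   show "Xi z = Du z"
   proof
    fix i
    show "Xi z i = Du z i"
    proof (cases "i < N")
     case True
     then show ?thesis using elim z by (simp add: Xi_def vec_eq_iff)
    next
     case False
     then show ?thesis using Duc[OF z] by (simp add: Xi_def coord_space_def)
    qed
   qed
  qed
 qed
 have gAE: "AE z in lborel. z \<in> P --> \<nu> * (enorm N (Du z))^2 \<le> edot N (A z (Du z)) (Du z) \<and> enorm N (A z (Du z)) \<le> L * enorm N (Du z)"
 proof -
  have "AE z in lborel. z \<in> S --> (\<forall>\<xi>\<in>coord_space N. \<nu> * (enorm N \<xi>)^2 \<le> edot N (A z \<xi>) \<xi> \<and> enorm N (A z \<xi>) \<le> L * enorm N \<xi>)"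
   using gr Sb unfolding growth_conditions_def S_def[symmetric] by (simp add: AE_lebesgue_on_iff)
  then show ?thesis
  proof eventually_elim
   case (elim z)
   then show ?case using PS Duc[of z] by blast
  qed
 qed
 have mA: "(\<lambda>z. A z (Xi z) k $ l) \<in> borel_measurable (lebesgue_on P)" for k l
  using measurable_restrict_mono[OF caratheodory_composition[OF car[folded S_def] Sb dm] PS] unfolding Xi_def .
 have iA: "set_integrable lebesgue P (\<lambda>z. L^2 * (enorm N (Du z))^2)" using iDu by (intro set_integrable_mult_right) auto
 have "AE z in lborel. z \<in> P --> (enorm N (A z (Xi z)))^2 \<le> L^2 * (enorm N (Du z))^2"
  using Xi gAE
 proof eventually_elim
  case (elim z)
  show ?case
  proof
   assume "z \<in> P"
   with elim have "enorm N (A z (Xi z)) \<le> L * enorm N (Du z)" by simp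
   from power_mono[OF this enorm_nonneg, of 2] show "(enorm N (A z (Xi z)))^2 \<le> L^2 * (enorm N (Du z))^2"
    by (simp add: power_mult_distrib)
  qed
 qed
 from rep[OF mA order_refl iA this] obtain a where
  a: "\<forall>i j. (i < N --> L2b (a i j) \<and> (AE z in lborel. z \<in> P --> a i j z = A z (Xi z) i $ j)) \<and> (\<not> i < N --> a i j = (\<lambda>_. 0))" ..
 have fAE: "AE z in lborel. \<forall>i j. z \<in> P --> i < N --> f i j z = F z i $ j"
  by (rule AE_entries) (use f in blast)
 have aAE: "AE z in lborel. \<forall>i j. z \<in> P --> i < N --> a i j z = A z (Xi z) i $ j"
  by (rule AE_entries) (use a in blast)
 define good where "good z \<longleftrightarrow> (\<forall>i<N. \<forall>j. d i j z = Du z i $ j \<and> f i j z = F z i $ j \<and> a i j z = A z (Du z) i $ j) \<and>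
  \<nu> * (enorm N (Du z))^2 \<le> edot N (A z (Du z)) (Du z) \<and> enorm N (A z (Du z)) \<le> L * enorm N (Du z)" for z
 have "AE z in lborel. z \<in> P --> good z"
  using dAE fAE aAE Xi gAE by eventually_elim (auto simp: good_def)
 then obtain Z where Z: "\<And>z. z \<in> space lborel - Z ==> z \<in> P --> good z" "Z \<in> null_sets lborel"
  by (rule AE_E3) blast
 have Zb: "P - Z \<in> sets borel" using Pb Z(2) by (auto simp: null_sets_def)
 have AEZ: "AE z in lborel. z \<notin> Z" by (rule AE_not_in[OF Z(2)])
 define X :: "(real ^ 'n) \<times> real => real" where "X = indicator (P - Z)"
 have bX: "bounded_borel X" using Zb by (auto simp: X_def bounded_borel_def indicator_def intro!: exI[of _ 1])
 define D' where "D' i j w = X w * d i j w" for i j w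
 define A' where "A' i j w = X w * a i j w" for i j w
 define F' where "F' i j w = X w * f i j w" for i j w
 have LL: "L2b (D' i j)" "L2b (A' i j)" "L2b (F' i j)" if "i < N" for i j
  unfolding D'_def[abs_def] A'_def[abs_def] F'_def[abs_def] using d a f that by (intro L2b_bounded_mult bX; blast)+
 have on: "D' i j w = Du w i $ j" "A' i j w = A w (Du w) i $ j" "F' i j w = F w i $ j" if "w \<in> P" "w \<notin> Z" "i < N" for i j w
  using Z(1)[of w] that by (auto simp: D'_def A'_def F'_def X_def good_def)
 have off: "D' i j w = 0" "A' i j w = 0" "F' i j w = 0" if "w \<notin> P \<or> w \<in> Z" for i j w
  using that by (auto simp: D'_def A'_def F'_def X_def)
 have st: "\<nu> * sqsum N D' w \<le> (\<Sum>i<N. \<Sum>j\<in>UNIV. A' i j w * D' i j w) \<and> sqsum N A' w \<le> L^2 * sqsum N D' w" for w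
 proof (cases "w \<in> P \<and> w \<notin> Z")
  case True
  then have gw: "good w" using Z(1)[of w] by simp
  have 1: "sqsum N D' w = (enorm N (Du w))^2" "sqsum N A' w = (enorm N (A w (Du w)))^2"
   unfolding sqsum_def enorm_square norm_vec_square using on True by simp_all
  have 2: "(\<Sum>i<N. \<Sum>j\<in>UNIV. A' i j w * D' i j w) = edot N (A w (Du w)) (Du w)"
   unfolding edot_def inner_vec_def using on True by simp
  have "enorm N (A w (Du w)) \<le> L * enorm N (Du w)" using gw by (simp add: good_def)
  from power_mono[OF this enorm_nonneg, of 2] show ?thesis using gw unfolding 1 2 good_def by (simp add: power_mult_distrib)
 qed (use off in \<open>simp add: sqsum_def\<close>)
 have flux: "flux_solution P (u' i) (D' i) (\<lambda>j w. A' i j w - F' i j w)" if i: "i < N" for i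
 proof -
  have Lu: "L2b (u' i)" and uAE: "AE z in lborel. z \<in> P --> u' i z = u z i" using u' i by blast+
  have LG: "L2b (\<lambda>w. A' i j w - F' i j w)" for j by (intro L2b_diff LL i)
  have eq1: "(LBINT w. u' i w * frechet_derivative \<psi> (at w) (dx j)) = - (LBINT w. D' i j w * \<psi> w)"
   if \<psi>: "test_function P \<psi>" for \<psi> j
  proof (rule gradient_identity_from_slices[where U=U and V=V and u="\<lambda>z. u z i" and D="\<lambda>z. Du z i $ j", OF Lu LL(1)[OF i]])
   show "AE z in lborel. z \<in> U \<times> V --> u' i z = u z i \<and> D' i j z = Du z i $ j"
    using uAE AEZ unfolding PUV[symmetric] by eventually_elim (use on i in blast)
   have "AE t in lborel. t \<in> V --> W12 N U (\<lambda>x. u (x, t)) (\<lambda>x. Du (x, t))"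
    using W by (subst (asm) AE_lebesgue_on_iff) (simp_all add: V_def)
   then show "AE t in lborel. t \<in> V --> (\<forall>\<phi>. test_function U \<phi> -->
    (LINT x:U|lebesgue. u (x, t) i * grad \<phi> x $ j) = - (LINT x:U|lebesgue. Du (x, t) i $ j * \<phi> x))"
    by eventually_elim (use i in \<open>auto simp: W12_def\<close>)
   show "test_function (U \<times> V) \<psi>" using \<psi> by (simp add: PUV)
  qed
  have eq2: "(LBINT w. u' i w * frechet_derivative \<psi> (at w) dt) =
    (\<Sum>j\<in>UNIV. \<integral>w. (A' i j w - F' i j w) * frechet_derivative \<psi> (at w) (dx j) \<partial>lborel)"
   if \<psi>: "test_function P \<psi>" for \<psi>
  proof -
   \<comment> \<open>Test only the \<open>i\<close>-th equation.\<close>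
   define \<phi> where "\<phi> z k = (if k = i then \<psi> z else 0)" for z k
   have \<psi>S: "test_function S \<psi>" using \<psi> PS by (auto simp: test_function_def compactly_contained_def)
   have "test_function S (\<lambda>z. \<phi> z k)" for k
    using \<psi>S by (cases "k = i") (auto simp: \<phi>_def test_function_def compactly_contained_def C_k_const)
   then have E: "(LINT z:S|lebesgue. - edot N (u z) (time_deriv \<phi> z) + edot N (A z (Du z)) (spatial_grad \<phi> z)) =
    (LINT z:S|lebesgue. edot N (F z) (spatial_grad \<phi> z))"
    using ws unfolding weak_solution_def S_def by blast
   have td: "time_deriv \<phi> z = (\<lambda>k. if k = i then frechet_derivative \<psi> (at z) dt else 0)" for z
    using deriv_slice[OF \<psi>, of "fst z" "snd z"] by (auto simp: fun_eq_iff time_deriv_def \<phi>_def)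
   have sg: "spatial_grad \<phi> z = (\<lambda>k. if k = i then (\<chi> j. frechet_derivative \<psi> (at z) (dx j)) else 0)" for z
    using grad_slice[OF \<psi>, of "snd z" "fst z"]
    by (auto simp: fun_eq_iff spatial_grad_def \<phi>_def vec_eq_iff) (simp add: grad_def)
   have e1: "edot N v (time_deriv \<phi> z) = v i * frechet_derivative \<psi> (at z) dt" for v z
    unfolding edot_def td using i by (simp add: if_distrib[of "\<lambda>x. _ * x"] sum.delta cong: if_cong)
   have e2: "edot N v (spatial_grad \<phi> z) = (\<Sum>j\<in>UNIV. v i $ j * frechet_derivative \<psi> (at z) (dx j))" for v z
   proof -
    have "edot N v (spatial_grad \<phi> z) = (\<Sum>k<N. if k = i then v i \<bullet> (\<chi> j. frechet_derivative \<psi> (at z) (dx j)) else 0)"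
     unfolding edot_def sg by (rule sum.cong) auto
    then show ?thesis using i by (simp add: inner_vec_def)
   qed
   have sk: "smooth_kernel \<psi>" by (rule test_function_smooth_kernel[OF \<psi>])
   have bd: "bounded_borel (\<lambda>w. frechet_derivative \<psi> (at w) b)" if "b \<in> Basis" for b
    by (rule smooth_kernel_bounded_borel[OF smooth_kernel_derivative[OF sk that]])
   have Lm: "L2b (\<lambda>w. g w * frechet_derivative \<psi> (at w) b)" if "L2b g" "b \<in> Basis" for g b
    using L2b_bounded_mult[OF that(1) bd[OF that(2)]] by (simp add: mult.commute)
   have iu: "integrable lborel (\<lambda>w. u' i w * frechet_derivative \<psi> (at w) dt)"
    by (rule L2b_integrable[OF Lm[OF Lu dt_Basis]])
   have iAj: "integrable lborel (\<lambda>w. A' i j w * frechet_derivative \<psi> (at w) (dx j))" for j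
    by (rule L2b_integrable[OF Lm[OF LL(2)[OF i] dx_Basis]])
   have iFj: "integrable lborel (\<lambda>w. F' i j w * frechet_derivative \<psi> (at w) (dx j))" for j
    by (rule L2b_integrable[OF Lm[OF LL(3)[OF i] dx_Basis]])
   define h1 where "h1 z = - (u' i z * frechet_derivative \<psi> (at z) dt) + (\<Sum>j\<in>UNIV. A' i j z * frechet_derivative \<psi> (at z) (dx j))" for z
   define h2 where "h2 z = (\<Sum>j\<in>UNIV. F' i j z * frechet_derivative \<psi> (at z) (dx j))" for z
   have ih: "integrable lborel h1" "integrable lborel h2"
    unfolding h1_def[abs_def] h2_def[abs_def] using iu iAj iFj by auto
   have hm: "h1 \<in> borel_measurable borel" "h2 \<in> borel_measurable borel"
    using borel_measurable_integrable[OF ih(1)] borel_measurable_integrable[OF ih(2)] by simp_all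
   have a1: "AE z in lborel. indicator S z *\<^sub>R (- edot N (u z) (time_deriv \<phi> z) + edot N (A z (Du z)) (spatial_grad \<phi> z)) = h1 z"
    using uAE AEZ
   proof eventually_elim
    case (elim z)
    show ?case
    proof (cases "z \<in> P")
     case True
     then have "z \<in> S" using PS by blast
     then show ?thesis unfolding e1 e2 h1_def using True elim on(2)[OF True _ i] by simp
    next
     case False
     then show ?thesis unfolding e1 e2 h1_def using test_function_zero_outside(2)[OF \<psi> False] by simp
    qed
   qed
   have a2: "AE z in lborel. indicator S z *\<^sub>R edot N (F z) (spatial_grad \<phi> z) = h2 z"
    using AEZ
   proof eventually_elim
    case (elim z)
    show ?case
    proof (cases "z \<in> P")
     case True
     then have "z \<in> S" using PS by blast
     then show ?thesis unfolding e2 h2_def using True elim on(3)[OF True _ i] by simp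
    next
     case False
     then show ?thesis unfolding e2 h2_def using test_function_zero_outside(2)[OF \<psi> False] by simp
    qed
   qed
   have "integral\<^sup>L lborel h1 = integral\<^sup>L lborel h2"
    using E unfolding lebesgue_integral_representative(1)[OF hm(1) a1] lebesgue_integral_representative(1)[OF hm(2) a2] .
   moreover have "integral\<^sup>L lborel h1 = - (LBINT w. u' i w * frechet_derivative \<psi> (at w) dt) + (\<Sum>j\<in>UNIV. \<integral>w. A' i j w * frechet_derivative \<psi> (at w) (dx j) \<partial>lborel)"
    unfolding h1_def[abs_def] using iu iAj by (subst Bochner_Integration.integral_add) (auto simp: Bochner_Integration.integral_sum)
   moreover have "integral\<^sup>L lborel h2 = (\<Sum>j\<in>UNIV. \<integral>w. F' i j w * frechet_derivative \<psi> (at w) (dx j) \<partial>lborel)"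
    unfolding h2_def[abs_def] using iFj by (intro Bochner_Integration.integral_sum) auto
   moreover have "(\<Sum>j\<in>UNIV. \<integral>w. (A' i j w - F' i j w) * frechet_derivative \<psi> (at w) (dx j) \<partial>lborel) =
    (\<Sum>j\<in>UNIV. \<integral>w. A' i j w * frechet_derivative \<psi> (at w) (dx j) \<partial>lborel) - (\<Sum>j\<in>UNIV. \<integral>w. F' i j w * frechet_derivative \<psi> (at w) (dx j) \<partial>lborel)"
    unfolding sum_subtractf[symmetric] left_diff_distrib using iAj iFj by (intro sum.cong refl Bochner_Integration.integral_diff)
   ultimately show ?thesis by linarith
  qed
  show ?thesis unfolding flux_solution_def using Lu LL(1)[OF i] LG eq1 eq2 by blast
 qed
 have "structured_system N \<nu> L P u' D' A' F'"
  unfolding structured_system_def using flux LL off st by blast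
 moreover have "AE z in lborel. z \<in> P --> (\<forall>i<N. \<forall>j. D' i j z = Du z i $ j \<and> F' i j z = F z i $ j)"
  using AEZ by eventually_elim (use on in blast)
 ultimately show ?thesis using D2 unfolding P_def by blast
qed

section \<open>The interior estimates\<close>

lemma mean_cong: "(\<And>w. w \<in> S ==> f w = g w) ==> mean S f = mean S g"
 unfolding mean_def SI_def by (rule arg_cong[where f="\<lambda>x. x / _"], rule Bochner_Integration.integral_cong) (auto simp: indicator_def)

lemma sqrt_powr_2: "0 \<le> (x::real) ==> sqrt x powr 2 = x"
 by (simp add: powr_numeral)

lemma Lp_mean_representative:
 fixes f :: "(real ^ 'n) \<times> real => nat => real ^ 'n"
 assumes S: "S \<in> sets borel" "S \<subseteq> P" and D: "\<And>i j. i < N ==> L2b (D i j)"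
  and eq: "AE z in lborel. z \<in> P --> (\<forall>i<N. \<forall>j. D i j z = f z i $ j)"
 shows "Lp_mean p N S f = (mean S (\<lambda>w. sqrt (sqsum N D w) powr p)) powr (1 / p)"
  "set_integrable lebesgue S (\<lambda>z. enorm N (f z) powr p) \<longleftrightarrow> integrable lborel (\<lambda>w. indicator S w * sqrt (sqsum N D w) powr p)"
proof -
 note [measurable] = S(1) L2b_measurable[OF L2b_sqrt_sqsum(1)[OF D]]
 have m: "(\<lambda>w. indicator S w * sqrt (sqsum N D w) powr p) \<in> borel_measurable borel" by measurable
 have ae: "AE z in lborel. indicator S z *\<^sub>R (enorm N (f z) powr p) = indicator S z * sqrt (sqsum N D z) powr p"
  using eq
 proof eventually_elim
  case (elim z)
  show ?case
  proof (cases "z \<in> S")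
   case True
   then have "\<forall>i<N. \<forall>j. D i j z = f z i $ j" using elim S(2) by blast
   then have "sqsum N D z = (enorm N (f z))^2" unfolding sqsum_def enorm_square norm_vec_square by simp
   then have "sqrt (sqsum N D z) = enorm N (f z)" using enorm_nonneg[of N "f z"] by simp
   then show ?thesis by simp
  qed simp
 qed
 show "Lp_mean p N S f = (mean S (\<lambda>w. sqrt (sqsum N D w) powr p)) powr (1 / p)"
  unfolding Lp_mean_def lebesgue_integral_representative(1)[OF m ae] mean_def SI_def using S(1) by simp
 show "set_integrable lebesgue S (\<lambda>z. enorm N (f z) powr p) \<longleftrightarrow> integrable lborel (\<lambda>w. indicator S w * sqrt (sqsum N D w) powr p)"
  by (rule lebesgue_integral_representative(2)[OF m ae])
qed

text \<open>
  For \<open>x\<close> between \<open>0\<close> and \<open>a + b\<close> the fraction \<open>x / (a + b)\<close> is at most its own \<open>s\<close>-th power; add this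
  for \<open>x = a\<close> and \<open>x = b\<close>.
\<close>

lemma powr_subadditive:
 assumes "0 \<le> a" "0 \<le> b" "0 < s" "s \<le> 1"
 shows "(a + b) powr s \<le> a powr s + (b::real) powr s"
proof (cases "a + b = 0")
 case True
 then show ?thesis using assms by simp
next
 case False
 then have ab: "a + b > 0" using assms by simp
 have frac: "(a + b) powr s * (x / (a + b)) \<le> x powr s" if "0 \<le> x" "x \<le> a + b" for x
 proof -
  have "(x / (a + b)) powr 1 \<le> (x / (a + b)) powr s" using that ab assms by (intro powr_mono') auto
  then have "x / (a + b) \<le> (x / (a + b)) powr s" using that ab by simp
  then have "(a + b) powr s * (x / (a + b)) \<le> (a + b) powr s * (x / (a + b)) powr s" by (rule mult_left_mono) simp
  also have "\<dots> = ((a + b) * (x / (a + b))) powr s" by (rule powr_mult[symmetric])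
  also have "(a + b) * (x / (a + b)) = x" using ab by simp
  finally show ?thesis .
 qed
 have "(a + b) powr s = (a + b) powr s * (a / (a + b)) + (a + b) powr s * (b / (a + b))"
  using ab by (simp add: distrib_left[symmetric] add_divide_distrib[symmetric])
 also have "\<dots> \<le> a powr s + b powr s" using assms by (intro add_mono frac) auto
 finally show ?thesis .
qed

lemma root_of_sum_bound:
 assumes "0 \<le> a" "a \<le> C * (X + Y)" "0 < C" "0 \<le> X" "0 \<le> Y" "0 < s" "s \<le> 1"
 shows "a powr s \<le> (1 + C) * X powr s + (1 + C) * (Y::real) powr s"
proof -
 have "a powr s \<le> (C * (X + Y)) powr s" using assms by (intro powr_mono2) auto
 also have "\<dots> = C powr s * (X + Y) powr s" by (rule powr_mult)
 also have "\<dots> \<le> (1 + C) * (X powr s + Y powr s)"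
  using assms by (intro mult_mono powr_subadditive powr_le_one_plus) auto
 finally show ?thesis by (simp add: distrib_left)
qed

text \<open>
  The two inequalities for the Borel system, with roots taken.
\<close>

theorem theorem4p4:
  fixes L :: real
  assumes "0 < L"
  shows "\<exists>q. 1 < q \<and> q < 2 \<and>
    (\<forall>(N::nat) \<nu>. 1 \<le> N \<and> 0 < \<nu> \<and> \<nu> < L \<longrightarrow>
      (\<exists>c>0. \<exists>c'>0. \<exists>\<epsilon>\<^sub>0. 0 < \<epsilon>\<^sub>0 \<and> \<epsilon>\<^sub>0 < 1 \<and>
        (\<forall>(\<Omega> :: (real ^ 'n) set) T A F u Du.
          open \<Omega> \<and> connected \<Omega> \<and> bounded \<Omega> \<and> \<Omega> \<noteq> {} \<and> 0 < T \<and>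
          caratheodory N (\<Omega> \<times> {0<..<T}) A \<and>
          growth_conditions N \<nu> L (\<Omega> \<times> {0<..<T}) A \<and>
          F \<in> borel_measurable (lebesgue_on (\<Omega> \<times> {0<..<T})) \<and>
          in_Lp_loc 2 N (\<Omega> \<times> {0<..<T}) F \<and>
          weak_solution N \<Omega> T A F u Du \<longrightarrow>
            (\<forall>x0 t0 \<rho>. 0 < \<rho> \<and> cylinder x0 t0 (2 * \<rho>) \<Subset> \<Omega> \<times> {0<..<T} \<longrightarrow>
              Lp_mean 2 N (cylinder x0 t0 \<rho>) Du
                \<le> c * Lp_mean q N (cylinder x0 t0 (2 * \<rho>)) Du
                  + c * Lp_mean 2 N (cylinder x0 t0 (2 * \<rho>)) F) \<and>
            (\<forall>\<epsilon>. 0 < \<epsilon> \<and> \<epsilon> < \<epsilon>\<^sub>0 \<longrightarrow>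
              (\<forall>x0 t0 \<rho>. 0 < \<rho> \<and> cylinder x0 t0 (2 * \<rho>) \<Subset> \<Omega> \<times> {0<..<T} \<and>
                in_Lp (2 + \<epsilon>) N (cylinder x0 t0 (2 * \<rho>)) F \<longrightarrow>
                  in_Lp (2 + \<epsilon>) N (cylinder x0 t0 \<rho>) Du \<and>
                  Lp_mean (2 + \<epsilon>) N (cylinder x0 t0 \<rho>) Du
                    \<le> c' * Lp_mean 2 N (cylinder x0 t0 (2 * \<rho>)) Du
                      + c' * Lp_mean (2 + \<epsilon>) N (cylinder x0 t0 (2 * \<rho>)) F)))))"
proof (rule exI[of _ "qexp TYPE('n)"], intro conjI allI impI)
 show "1 < qexp TYPE('n)" "qexp TYPE('n) < 2" using qexp_bounds by auto
 fix N :: nat and \<nu> :: real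
 assume N\<nu>: "1 \<le> N \<and> 0 < \<nu> \<and> \<nu> < L"
 have \<nu>: "\<nu> > 0" using N\<nu> by simp
 obtain C where C: "C > 0" and RH: "\<forall>(z0 :: (real ^ 'n) \<times> real) \<rho> u D A F. 0 < \<rho> --> structured_system N \<nu> L (Q z0 (2 * \<rho>)) u D A F -->
  mean (Q z0 \<rho>) (sqsum N D) \<le>
   C * ((mean (Q z0 (2 * \<rho>)) (\<lambda>w. sqrt (sqsum N D w) powr qexp TYPE('n))) powr bexp TYPE('n) + mean (Q z0 (2 * \<rho>)) (sqsum N F))"
  using reverse_hoelder_system[OF \<nu> assms, where 'n='n and N=N] by (elim exE conjE) (rule that)
 obtain e0 cG :: real where e0: "0 < e0" "e0 < 1" and cG: "cG > 0" and GE: "\<forall>(z0 :: (real ^ 'n) \<times> real) \<rho> g f \<epsilon>.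
  0 < \<rho> --> 0 < \<epsilon> --> \<epsilon> < e0 --> L2b g --> (\<forall>w. 0 \<le> g w) --> L2b f --> (\<forall>w. 0 \<le> f w) -->
  (\<forall>w. w \<notin> Q z0 (2 * \<rho>) --> g w = 0) --> (\<forall>w. w \<notin> Q z0 (2 * \<rho>) --> f w = 0) -->
  (\<forall>z r. 0 < r --> Q z (2 * r) \<subseteq> Q z0 (2 * \<rho>) --> mean (Q z r) (\<lambda>w. (g w)^2) \<le>
    C * ((mean (Q z (2 * r)) (\<lambda>w. g w powr qexp TYPE('n))) powr bexp TYPE('n) + mean (Q z (2 * r)) (\<lambda>w. (f w)^2))) -->
  integrable lborel (\<lambda>w. f w powr (2 + \<epsilon>)) -->
  integrable lborel (\<lambda>w. indicator (Q z0 \<rho>) w * g w powr (2 + \<epsilon>)) \<and>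
  mean (Q z0 \<rho>) (\<lambda>w. g w powr (2 + \<epsilon>)) \<le>
   cG * ((mean (Q z0 (2 * \<rho>)) (\<lambda>w. (g w)^2)) powr (1 + \<epsilon> / 2) + mean (Q z0 (2 * \<rho>)) (\<lambda>w. f w powr (2 + \<epsilon>)))"
  using parabolic_gehring[OF C, where 'n='n] by (elim exE conjE) (rule that)
 have main: "Lp_mean 2 N (cylinder x0 t0 \<rho>) Du
   \<le> (1 + C) * Lp_mean (qexp TYPE('n)) N (cylinder x0 t0 (2 * \<rho>)) Du + (1 + C) * Lp_mean 2 N (cylinder x0 t0 (2 * \<rho>)) F"
  "0 < \<epsilon> ==> \<epsilon> < e0 ==> in_Lp (2 + \<epsilon>) N (cylinder x0 t0 (2 * \<rho>)) F ==>
   in_Lp (2 + \<epsilon>) N (cylinder x0 t0 \<rho>) Du \<and>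
   Lp_mean (2 + \<epsilon>) N (cylinder x0 t0 \<rho>) Du
    \<le> (1 + cG) * Lp_mean 2 N (cylinder x0 t0 (2 * \<rho>)) Du + (1 + cG) * Lp_mean (2 + \<epsilon>) N (cylinder x0 t0 (2 * \<rho>)) F"
  if \<Omega>: "open \<Omega>" and car: "caratheodory N (\<Omega> \<times> {0<..<T}) A" and gr: "growth_conditions N \<nu> L (\<Omega> \<times> {0<..<T}) A"
   and Fl: "in_Lp_loc 2 N (\<Omega> \<times> {0<..<T}) F" and ws: "weak_solution N \<Omega> T A F u Du"
   and \<rho>: "0 < \<rho>" and cc: "cylinder x0 t0 (2 * \<rho>) \<Subset> \<Omega> \<times> {0<..<T}"
  for \<Omega> :: "(real ^ 'n) set" and T A F u Du x0 t0 \<rho> \<epsilon>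
 proof -
  define z0 where "z0 = (x0, t0)"
  have cyl: "cylinder x0 t0 r = Q z0 r" for r by (simp add: z0_def)
  define P where "P = Q z0 (2 * \<rho>)"
  have \<rho>2: "2 * \<rho> > 0" using \<rho> by simp
  have QP: "Q z0 \<rho> \<subseteq> P"
  proof -
   have "\<rho>^2 \<le> (2 * \<rho>)^2" using \<rho> by (intro power_mono) auto
   then show ?thesis using \<rho> unfolding P_def subset_iff mem_Q by auto
  qed
  have Pb: "P \<in> sets borel" and Qb: "Q z0 \<rho> \<in> sets borel" by (simp_all add: P_def)
  have Du2: "in_Lp 2 N P Du"
   and ex: "\<exists>u' D A' F'. structured_system N \<nu> L P u' D A' F' \<and>
    (AE z in lborel. z \<in> P --> (\<forall>i<N. \<forall>j. D i j z = Du z i $ j \<and> F' i j z = F z i $ j))"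
   using structured_system_of_weak_solution[OF \<rho>2 assms \<Omega> car gr Fl ws cc] unfolding cyl P_def by auto
  obtain u' D A' F' where sys: "structured_system N \<nu> L P u' D A' F'"
   and ae: "AE z in lborel. z \<in> P --> (\<forall>i<N. \<forall>j. D i j z = Du z i $ j \<and> F' i j z = F z i $ j)"
   using ex by (elim exE conjE) (rule that)
  note sd = structured_systemD[OF sys]
  define g where "g w = sqrt (sqsum N D w)" for w
  define f where "f w = sqrt (sqsum N F' w)" for w
  have g2: "(g w)^2 = sqsum N D w" and f2: "(f w)^2 = sqsum N F' w" for w
   by (simp_all add: g_def f_def sqsum_nonneg)
  have gp2: "g w powr 2 = sqsum N D w" and fp2: "f w powr 2 = sqsum N F' w" for w
   by (simp_all add: g_def f_def sqsum_nonneg sqrt_powr_2)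
  have g0: "0 \<le> g w" and f0: "0 \<le> f w" for w by (simp_all add: g_def f_def sqsum_nonneg)
  have Lg: "L2b g" and Lf: "L2b f" unfolding g_def[abs_def] f_def[abs_def] by (rule L2b_sqrt_sqsum(1), rule sd, assumption)+
  have go: "g w = 0" and fo: "f w = 0" if "w \<notin> P" for w
   using sd(5,6)[OF _ that] by (simp_all add: g_def f_def sqsum_def)
  have aeD: "AE z in lborel. z \<in> P --> (\<forall>i<N. \<forall>j. D i j z = Du z i $ j)"
   and aeF: "AE z in lborel. z \<in> P --> (\<forall>i<N. \<forall>j. F' i j z = F z i $ j)"
   using ae by (eventually_elim, blast)+
  have lpDQ: "Lp_mean p N (Q z0 \<rho>) Du = (mean (Q z0 \<rho>) (\<lambda>w. g w powr p)) powr (1 / p)" for p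
   unfolding g_def by (rule Lp_mean_representative(1)[OF Qb QP sd(2) aeD])
  have lpDP: "Lp_mean p N P Du = (mean P (\<lambda>w. g w powr p)) powr (1 / p)" for p
   unfolding g_def by (rule Lp_mean_representative(1)[OF Pb order_refl sd(2) aeD])
  have lpFP: "Lp_mean p N P F = (mean P (\<lambda>w. f w powr p)) powr (1 / p)" for p
   unfolding f_def by (rule Lp_mean_representative(1)[OF Pb order_refl sd(4) aeF])
  have RHg: "mean (Q z r) (\<lambda>w. (g w)^2) \<le>
    C * ((mean (Q z (2 * r)) (\<lambda>w. g w powr qexp TYPE('n))) powr bexp TYPE('n) + mean (Q z (2 * r)) (\<lambda>w. (f w)^2))"
   if r: "0 < r" and sub: "Q z (2 * r) \<subseteq> P" for z r
  proof -
   let ?X = "\<lambda>D i j w. indicator (Q z (2 * r)) w * D i j w"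
   have "structured_system N \<nu> L (Q z (2 * r)) u' (?X D) (?X A') (?X F')"
    by (rule structured_system_restrict[OF sys sub Q_borel])
   then have "mean (Q z r) (sqsum N (?X D)) \<le>
    C * ((mean (Q z (2 * r)) (\<lambda>w. sqrt (sqsum N (?X D) w) powr qexp TYPE('n))) powr bexp TYPE('n) + mean (Q z (2 * r)) (sqsum N (?X F')))"
    using RH r by blast
   moreover have in_X: "sqsum N (?X E) w = sqsum N E w" if "w \<in> Q z (2 * r)" for E :: "nat => 'n => (real ^ 'n) \<times> real => real" and w
    using that by (simp add: sqsum_def)
   have "Q z r \<subseteq> Q z (2 * r)"
   proof -
    have "r^2 \<le> (2 * r)^2" using r by (intro power_mono) auto
    then show ?thesis using r unfolding subset_iff mem_Q by auto
   qed
   then have "mean (Q z r) (sqsum N (?X D)) = mean (Q z r) (\<lambda>w. (g w)^2)"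
    unfolding g2 by (intro mean_cong in_X) blast
   moreover have "mean (Q z (2 * r)) (\<lambda>w. sqrt (sqsum N (?X D) w) powr qexp TYPE('n)) = mean (Q z (2 * r)) (\<lambda>w. g w powr qexp TYPE('n))"
    unfolding g_def by (intro mean_cong) (simp only: in_X)
   moreover have "mean (Q z (2 * r)) (sqsum N (?X F')) = mean (Q z (2 * r)) (\<lambda>w. (f w)^2)"
    unfolding f2 by (intro mean_cong in_X)
   ultimately show ?thesis by simp
  qed
  have qb: "1 < qexp TYPE('n)" "qexp TYPE('n) < 2" "qexp TYPE('n) * bexp TYPE('n) = 2" using qexp_bounds qexp_bexp by auto
  then have bq: "bexp TYPE('n) * (1/2) = 1 / qexp TYPE('n)" by (simp add: field_simps)
  have est1: "(mean (Q z0 \<rho>) (\<lambda>w. (g w)^2)) powr (1/2) \<le>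
   (1 + C) * ((mean P (\<lambda>w. g w powr qexp TYPE('n))) powr bexp TYPE('n)) powr (1/2) + (1 + C) * (mean P (\<lambda>w. (f w)^2)) powr (1/2)"
   by (rule root_of_sum_bound[OF _ RHg[OF \<rho>, of z0, folded P_def] C]) (auto intro!: mean_nonneg)
  show "Lp_mean 2 N (cylinder x0 t0 \<rho>) Du
   \<le> (1 + C) * Lp_mean (qexp TYPE('n)) N (cylinder x0 t0 (2 * \<rho>)) Du + (1 + C) * Lp_mean 2 N (cylinder x0 t0 (2 * \<rho>)) F"
   using est1 unfolding cyl P_def[symmetric] lpDQ lpDP lpFP gp2 fp2 g2 f2 powr_powr bq .
  assume \<epsilon>: "0 < \<epsilon>" "\<epsilon> < e0" and FL: "in_Lp (2 + \<epsilon>) N (cylinder x0 t0 (2 * \<rho>)) F"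
  have FLP: "in_Lp (2 + \<epsilon>) N P F" using FL unfolding cyl P_def .
  have "set_integrable lebesgue P (\<lambda>z. enorm N (F z) powr (2 + \<epsilon>))" using FLP by (simp add: in_Lp_def)
  then have "integrable lborel (\<lambda>w. indicator P w * f w powr (2 + \<epsilon>))"
   unfolding f_def using Lp_mean_representative(2)[OF Pb order_refl sd(4) aeF] by blast
  moreover have "indicator P w * f w powr (2 + \<epsilon>) = f w powr (2 + \<epsilon>)" for w
   using fo[of w] by (cases "w \<in> P") simp_all
  ultimately have fi: "integrable lborel (\<lambda>w. f w powr (2 + \<epsilon>))" by simp
  have "integrable lborel (\<lambda>w. indicator (Q z0 \<rho>) w * g w powr (2 + \<epsilon>)) \<and>
   mean (Q z0 \<rho>) (\<lambda>w. g w powr (2 + \<epsilon>)) \<le>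
   cG * ((mean (Q z0 (2 * \<rho>)) (\<lambda>w. (g w)^2)) powr (1 + \<epsilon> / 2) + mean (Q z0 (2 * \<rho>)) (\<lambda>w. f w powr (2 + \<epsilon>)))"
   by (rule GE[rule_format, OF \<rho> \<epsilon> Lg g0 Lf f0 go[unfolded P_def] fo[unfolded P_def] RHg[unfolded P_def] fi])
  then have gi: "integrable lborel (\<lambda>w. indicator (Q z0 \<rho>) w * g w powr (2 + \<epsilon>))"
   and gm: "mean (Q z0 \<rho>) (\<lambda>w. g w powr (2 + \<epsilon>)) \<le>
   cG * ((mean P (\<lambda>w. (g w)^2)) powr (1 + \<epsilon> / 2) + mean P (\<lambda>w. f w powr (2 + \<epsilon>)))" by (auto simp: P_def)
  have "set_integrable lebesgue (Q z0 \<rho>) (\<lambda>z. enorm N (Du z) powr (2 + \<epsilon>))"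
   using gi unfolding g_def using Lp_mean_representative(2)[OF Qb QP sd(2) aeD] by blast
  moreover have "Du \<in> Q z0 \<rho> \<rightarrow> coord_space N" using Du2 QP by (auto simp: in_Lp_def)
  moreover have "Du \<in> borel_measurable (lebesgue_on (Q z0 \<rho>))"
   by (rule measurable_restrict_mono[OF _ QP]) (use Du2 in \<open>simp add: in_Lp_def\<close>)
  ultimately have inl: "in_Lp (2 + \<epsilon>) N (Q z0 \<rho>) Du" by (simp add: in_Lp_def)
  have ex2: "(1 + \<epsilon> / 2) * (1 / (2 + \<epsilon>)) = 1 / 2" using \<epsilon> by (simp add: field_simps)
  have est2: "(mean (Q z0 \<rho>) (\<lambda>w. g w powr (2 + \<epsilon>))) powr (1 / (2 + \<epsilon>)) \<le>
   (1 + cG) * ((mean P (\<lambda>w. (g w)^2)) powr (1 + \<epsilon> / 2)) powr (1 / (2 + \<epsilon>)) + (1 + cG) * (mean P (\<lambda>w. f w powr (2 + \<epsilon>))) powr (1 / (2 + \<epsilon>))"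
   by (rule root_of_sum_bound[OF _ gm cG]) (use \<epsilon> in \<open>auto intro!: mean_nonneg\<close>)
  have "Lp_mean (2 + \<epsilon>) N (cylinder x0 t0 \<rho>) Du
    \<le> (1 + cG) * Lp_mean 2 N (cylinder x0 t0 (2 * \<rho>)) Du + (1 + cG) * Lp_mean (2 + \<epsilon>) N (cylinder x0 t0 (2 * \<rho>)) F"
   using est2 unfolding cyl P_def[symmetric] lpDQ lpDP lpFP gp2 g2 powr_powr ex2 .
  with inl show "in_Lp (2 + \<epsilon>) N (cylinder x0 t0 \<rho>) Du \<and>
   Lp_mean (2 + \<epsilon>) N (cylinder x0 t0 \<rho>) Du
    \<le> (1 + cG) * Lp_mean 2 N (cylinder x0 t0 (2 * \<rho>)) Du + (1 + cG) * Lp_mean (2 + \<epsilon>) N (cylinder x0 t0 (2 * \<rho>)) F"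
   unfolding cyl by blast
 qed
 have pos: "0 < 1 + C" "0 < 1 + cG" using C cG by auto
 show "\<exists>c>0. \<exists>c'>0. \<exists>\<epsilon>\<^sub>0. 0 < \<epsilon>\<^sub>0 \<and> \<epsilon>\<^sub>0 < 1 \<and>
    (\<forall>(\<Omega> :: (real ^ 'n) set) T A F u Du.
     open \<Omega> \<and> connected \<Omega> \<and> bounded \<Omega> \<and> \<Omega> \<noteq> {} \<and> 0 < T \<and>
     caratheodory N (\<Omega> \<times> {0<..<T}) A \<and>
     growth_conditions N \<nu> L (\<Omega> \<times> {0<..<T}) A \<and>
     F \<in> borel_measurable (lebesgue_on (\<Omega> \<times> {0<..<T})) \<and>
     in_Lp_loc 2 N (\<Omega> \<times> {0<..<T}) F \<and>
     weak_solution N \<Omega> T A F u Du -->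
      (\<forall>x0 t0 \<rho>. 0 < \<rho> \<and> cylinder x0 t0 (2 * \<rho>) \<Subset> \<Omega> \<times> {0<..<T} -->
       Lp_mean 2 N (cylinder x0 t0 \<rho>) Du
        \<le> c * Lp_mean (qexp TYPE('n)) N (cylinder x0 t0 (2 * \<rho>)) Du
         + c * Lp_mean 2 N (cylinder x0 t0 (2 * \<rho>)) F) \<and>
      (\<forall>\<epsilon>. 0 < \<epsilon> \<and> \<epsilon> < \<epsilon>\<^sub>0 -->
       (\<forall>x0 t0 \<rho>. 0 < \<rho> \<and> cylinder x0 t0 (2 * \<rho>) \<Subset> \<Omega> \<times> {0<..<T} \<and>
        in_Lp (2 + \<epsilon>) N (cylinder x0 t0 (2 * \<rho>)) F -->
         in_Lp (2 + \<epsilon>) N (cylinder x0 t0 \<rho>) Du \<and>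
         Lp_mean (2 + \<epsilon>) N (cylinder x0 t0 \<rho>) Du
          \<le> c' * Lp_mean 2 N (cylinder x0 t0 (2 * \<rho>)) Du
           + c' * Lp_mean (2 + \<epsilon>) N (cylinder x0 t0 (2 * \<rho>)) F)))"
 proof (rule exI[of _ "1 + C"], rule conjI[OF pos(1)], rule exI[of _ "1 + cG"], rule conjI[OF pos(2)],
   rule exI[of _ e0], rule conjI[OF e0(1)], rule conjI[OF e0(2)], intro allI impI)
  fix \<Omega> :: "(real ^ 'n) set" and T A F u Du
  assume H: "open \<Omega> \<and> connected \<Omega> \<and> bounded \<Omega> \<and> \<Omega> \<noteq> {} \<and> 0 < T \<and>
     caratheodory N (\<Omega> \<times> {0<..<T}) A \<and>
     growth_conditions N \<nu> L (\<Omega> \<times> {0<..<T}) A \<and>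
     F \<in> borel_measurable (lebesgue_on (\<Omega> \<times> {0<..<T})) \<and>
     in_Lp_loc 2 N (\<Omega> \<times> {0<..<T}) F \<and>
     weak_solution N \<Omega> T A F u Du"
  then have m: "open \<Omega>" "caratheodory N (\<Omega> \<times> {0<..<T}) A" "growth_conditions N \<nu> L (\<Omega> \<times> {0<..<T}) A"
   "in_Lp_loc 2 N (\<Omega> \<times> {0<..<T}) F" "weak_solution N \<Omega> T A F u Du" by simp_all
  show "(\<forall>x0 t0 \<rho>. 0 < \<rho> \<and> cylinder x0 t0 (2 * \<rho>) \<Subset> \<Omega> \<times> {0<..<T} -->
       Lp_mean 2 N (cylinder x0 t0 \<rho>) Du
        \<le> (1 + C) * Lp_mean (qexp TYPE('n)) N (cylinder x0 t0 (2 * \<rho>)) Du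
         + (1 + C) * Lp_mean 2 N (cylinder x0 t0 (2 * \<rho>)) F) \<and>
      (\<forall>\<epsilon>. 0 < \<epsilon> \<and> \<epsilon> < e0 -->
       (\<forall>x0 t0 \<rho>. 0 < \<rho> \<and> cylinder x0 t0 (2 * \<rho>) \<Subset> \<Omega> \<times> {0<..<T} \<and>
        in_Lp (2 + \<epsilon>) N (cylinder x0 t0 (2 * \<rho>)) F -->
         in_Lp (2 + \<epsilon>) N (cylinder x0 t0 \<rho>) Du \<and>
         Lp_mean (2 + \<epsilon>) N (cylinder x0 t0 \<rho>) Du
          \<le> (1 + cG) * Lp_mean 2 N (cylinder x0 t0 (2 * \<rho>)) Du
           + (1 + cG) * Lp_mean (2 + \<epsilon>) N (cylinder x0 t0 (2 * \<rho>)) F))"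
   by (rule conjI; intro allI impI; elim conjE; (rule main(1)[OF m] | rule main(2)[OF m]); assumption)
 qed
qed

end
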